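(* Let $\mathcal{X}_{+},\mathcal{X}_{-}$ be real normed spaces and $\theta_{\pm}:\mathcal{M}(S)\to\mathcal{X}_{\pm}$ two linear $\sigma$-normal maps. Let $g_{-}:\mathcal{X}_{-}\to\mathbb{R}$ be continuous and convex, such that there is $R_{0}\in\mathbb{R}^{+}$ for which $\{x\in\mathcal{X}_{-}^{\ast}:\Vert x\Vert_{\mathrm{op}}\le R,\ g_{-}^{\ast}(x)<\infty\}$ is nonempty and weak$^{\ast}$-closed for all $R\in[R_{0},\infty)$, and such that $g_{-}^{\ast}$ has minimal linear growth $\Vert\theta_{-}\Vert_{\mathrm{op}}$. Let $g_{+}:\mathcal{X}_{+}\to\mathbb{R}$ be continuous, convex and bounded on bounded sets, such that $g_{+}^{\ast}(\mathcal{X}_{+}^{\ast})\subseteq\mathbb{R}$ and $g_{+}^{\ast}$ has minimal linear growth $\Vert\theta_{+}\Vert_{\mathrm{op}}$. Let $\tau_{\pm}(\mu):=\theta_{\pm}(\mu_{S})$ for $\mu\in\mathcal{P}(T)$. Then: (i) $$\sup\mathfrak{F}^{\flat}(\mathcal{P}(T))=\mathrm{P}^{\flat}=\sup_{y_{+}\in\mathcal{X}_{+}^{\ast}}\inf_{y_{-}\in\mathcal{X}_{-}^{\ast}}\{P_{\mathrm{L}}(y_{+},y_{-})+g_{-}^{\ast}(y_{-})-g_{+}^{\ast}(y_{+})\},$$ $$\sup\mathfrak{F}^{\sharp}(\mathcal{P}(T))=\mathrm{P}^{\sharp}=\inf_{y_{-}\in\mathcal{X}_{-}^{\ast}}\sup_{y_{+}\in\mathcal{X}_{+}^{\ast}}\{P_{\mathrm{L}}(y_{+},y_{-})+g_{-}^{\ast}(y_{-})-g_{+}^{\ast}(y_{+})\}.$$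 (ii) $$E_{\mathfrak{F}^{\flat}}=\overline{\mathrm{co}}(E_{P}),$$ $$E_{\mathfrak{F}^{\sharp}}=\{\mu\in\overline{\mathrm{co}}(E_{\mathrm{NL}}(x_{-})):x_{-}\in\mathrm{M}^{\sharp}\cap\partial g_{-}(\tau_{-}(\mu))\}$$ (the set of all $\mu\in\mathcal{P}(T)$ for which there is $x_{-}\in\mathrm{M}^{\sharp}\cap\partial g_{-}(\tau_{-}(\mu))$ with $\mu\in\overline{\mathrm{co}}(E_{\mathrm{NL}}(x_{-}))$), where $E_{\mathrm{NL}}(x_{-}):=\bigcup_{x_{+}\in M^{\sharp}(x_{-})}E_{\mathrm{L}}(x_{+},x_{-})$.
   Context: Symbolic setting: $(\Omega,d)$ is a compact metric space with $\max d(\Omega\times\Omega)=1$; $\mathrm{m}$ is a fixed Borel probability measure on $\Omega$ with support $\Omega$; $\Sigma=\Omega^{\mathbb{N}}$ with the product topology; $C(\Sigma)$ is the Banach space of real continuous functions with the sup norm; $T$ is the shift $T(\omega_{1},\omega_{2},\dots)=(\omega_{2},\omega_{3},\dots)$. $\mathcal{P}(T)\subseteq C(\Sigma)^{\ast}$ is the convex weak$^{\ast}$-compact metrizable set of $T$-invariant Borel probability measures on $\Sigma$, $\mathcal{P}_{\mathrm{erg}}(T)$ the ergodic ones (the extreme points of $\mathcal{P}(T)$); $\overline{\mathrm{co}}$ is the weak$^{\ast}$-closed convex hull. Each $\mu\in\mathcal{P}(T)$ has a unique Choquet measure $\xi_{\mu}$: the Borel probability measure on $\mathcal{P}(T)$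 with $\xi_{\mu}(\mathcal{P}_{\mathrm{erg}}(T))=1$ and barycenter $\mu$. $S=\{\varphi\in C(\Sigma):\Vert\varphi\Vert_{\infty}\le1\}$ with the sup-norm metric; $\mathcal{M}(S)$ is the Banach space of bounded real Borel-measurable functions on $S$ with the sup norm; $\mu_{S}\in\mathcal{M}(S)$ is $\mu_{S}(\varphi)=\int\varphi\,\mathrm{d}\mu$. A map $\theta$ from $\mathcal{M}(S)$ into a normed space is $\sigma$-normal if $\theta(f_{n})\to\theta(f)$ in norm for every bounded sequence $(f_{n})\subseteq\mathcal{M}(S)$ converging point-wise to $f\in\mathcal{M}(S)$. Entropy: for $\varphi\in C(\Sigma)$, $\mathcal{L}_{0}^{\mathrm{m}}\varphi(\sigma)=\int_{\Omega}\varphi(\omega_{0}\sigma)\,\mathrm{m}(\mathrm{d}\omega_{0})$, where $\omega_{0}\sigma=(\omega_{0},\omega_{1},\dots)$ for $\sigma=(\omega_{1},\omega_{2},\dots)$; for $\mu\in\mathcal{P}(T)$, $h(\mu)=\inf_{\varphi}\int_{\Sigma}\ln(\mathcal{L}_{0}^{\mathrm{m}}\varphi(\sigma)/\varphi(\sigma))\,\mu(\mathrm{d}\sigma)\in[-\infty,0]$, infimum over strictly positive $\varphi\in C(\Sigma)$. Functionals on $\mathcal{P}(T)$: $\Delta^{g_{\pm}\circ\theta_{\pm}}(\mu)=\int_{\mathcal{P}_{\mathrm{erg}}(T)}g_{\pm}(\theta_{\pm}(\nu_{S}))\,\xi_{\mu}(\mathrm{d}\nu)$; $P(\mu)=h(\mu)-g_{-}(\theta_{-}(\mu_{S}))+g_{+}(\theta_{+}(\mu_{S}))$;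 $\mathfrak{F}^{\sharp}(\mu)=\Delta^{g_{+}\circ\theta_{+}}(\mu)-g_{-}(\theta_{-}(\mu_{S}))+h(\mu)$; $\mathfrak{F}^{\flat}(\mu)=\Delta^{g_{+}\circ\theta_{+}}(\mu)-\Delta^{g_{-}\circ\theta_{-}}(\mu)+h(\mu)$. For a functional $\Phi\in\{P,\mathfrak{F}^{\flat}\}$, $E_{\Phi}=\{\mu\in\mathcal{P}(T):\exists(\mu_{n})\subseteq\mathcal{P}(T)$ with $\mu_{n}\to\mu$ weak$^{\ast}$ and $\Phi(\mu_{n})\to\sup\Phi(\mathcal{P}(T))\}$ ($E_{P}$ equals the set of maximizers of $P$); $E_{\mathfrak{F}^{\sharp}}=\{\mu\in\mathcal{P}(T):\mathfrak{F}^{\sharp}(\mu)=\sup\mathfrak{F}^{\sharp}(\mathcal{P}(T))\}$. Convex analysis: $\mathbb{R}^{+}=(0,\infty)$. Duals carry the weak$^{\ast}$ topology; $\Vert\cdot\Vert_{\mathrm{op}}$ is the operator norm; $B(0,R)=\{y\in\mathcal{X}^{\ast}:\Vert y\Vert_{\mathrm{op}}\le R\}$. $g^{\ast}(x)=\sup_{y\in\mathcal{X}}\{x(y)-g(y)\}$ for $x\in\mathcal{X}^{\ast}$; $g^{\ast}$ has minimal linear growth $\lambda$ if $\lim_{R\to\infty}\sup_{y\in\mathcal{X}^{\ast}\setminus B(0,R)}\{\lambda\Vert y\Vert_{\mathrm{op}}-g^{\ast}(y)\}=-\infty$; $\partial g(z)=\{x\in\mathcal{X}^{\ast}:x(y-z)\le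 g(y)-g(z)\ \forall y\in\mathcal{X}\}$. For $y_{\pm}\in\mathcal{X}_{\pm}^{\ast}$, $\mu\in\mathcal{P}(T)$: $\mathrm{P}(y_{+},y_{-},\mu)=h(\mu)-y_{-}(\theta_{-}(\mu_{S}))+y_{+}(\theta_{+}(\mu_{S}))$; $P_{\mathrm{L}}(y_{+},y_{-})=\sup_{\mu\in\mathcal{P}(T)}\mathrm{P}(y_{+},y_{-},\mu)$; $E_{\mathrm{L}}(y_{+},y_{-})$ is the set of $\nu\in\mathcal{P}(T)$ with $\mathrm{P}(y_{+},y_{-},\nu)=P_{\mathrm{L}}(y_{+},y_{-})$; $P_{\mathrm{NL}}(y_{+},y_{-})=P_{\mathrm{L}}(y_{+},y_{-})+g_{-}^{\ast}(y_{-})-g_{+}^{\ast}(y_{+})$; $P^{\sharp}(y_{-})=\sup P_{\mathrm{NL}}(\mathcal{X}_{+}^{\ast},y_{-})$; $M^{\sharp}(y_{-})=\{x_{+}\in\mathcal{X}_{+}^{\ast}:P_{\mathrm{NL}}(x_{+},y_{-})=P^{\sharp}(y_{-})\}$; $\mathrm{P}^{\sharp}=\inf P^{\sharp}(\mathcal{X}_{-}^{\ast})$; $\mathrm{M}^{\sharp}=\{x_{-}\in\mathcal{X}_{-}^{\ast}:P^{\sharp}(x_{-})=\mathrm{P}^{\sharp}\}$. *)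

theory Defs
  imports "HOL-Probability.Probability"
begin

section \<open>The closed unit ball and bounded Borel functions\<close>

text \<open>With \<open>'a\<close> the space of continuous functions on the sequence space, \<open>'a unit_ball\<close> is
  the metric space $S$ and \<open>'a unit_ball bborel\<close> is the space $\mathcal{M}(S)$.\<close>

typedef (overloaded) 'a unit_ball = "cball 0 1 :: 'a::real_normed_vector set"
  morphisms ball_val Abs_unit_ball
  by (rule exI[of _ 0]) simp

instantiation unit_ball :: (real_normed_vector) metric_space
begin

definition dist_unit_ball :: "'a unit_ball \<Rightarrow> 'a unit_ball \<Rightarrow> real"
  where "dist_unit_ball x y = dist (ball_val x) (ball_val y)"

definition uniformity_unit_ball :: "('a unit_ball \<times> 'a unit_ball) filter"
  where "uniformity_unit_ball = (INF e\<in>{0 <..}. principal {(x, y). dist x y < e})"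

definition open_unit_ball :: "'a unit_ball set \<Rightarrow> bool"
  where "open_unit_ball U = (\<forall>x\<in>U. \<forall>\<^sub>F (x', y) in uniformity. x' = x \<longrightarrow> y \<in> U)"

instance
proof
  fix x y z :: "'a unit_ball"
  show "dist x y = 0 \<longleftrightarrow> x = y"
    by (simp add: dist_unit_ball_def ball_val_inject)
  show "dist x y \<le> dist x z + dist y z"
    unfolding dist_unit_ball_def by (rule dist_triangle2)
qed (rule uniformity_unit_ball_def open_unit_ball_def)+

end

text \<open>Bounded real Borel functions on a topological space, with the sup norm.\<close>

typedef (overloaded) 'a bborel =
    "{f :: 'a::topological_space \<Rightarrow> real. f \<in> borel_measurable borel \<and> bounded (range f)}"
  morphisms apply_bborel Bborel
  by (rule exI[of _ "\<lambda>_. 0"]) (auto simp: image_def)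

setup_lifting type_definition_bborel

lemma bborel_eqI: "(\<And>x. apply_bborel f x = apply_bborel g x) \<Longrightarrow> f = g"
  by transfer auto

lemma bdd_above_bborel: "bdd_above (range (\<lambda>x. \<bar>apply_bborel f x\<bar>))"
proof -
  have "bounded (range (apply_bborel f))" using apply_bborel[of f] by simp
  then obtain B where "\<And>x. \<bar>apply_bborel f x\<bar> \<le> B" by (auto simp: bounded_iff)
  then show ?thesis by (intro bdd_aboveI2[where M=B])
qed

instantiation bborel :: (topological_space) real_vector
begin

lift_definition zero_bborel :: "'a bborel" is "\<lambda>_. 0"
  by (auto simp: image_def)

lift_definition uminus_bborel :: "'a bborel \<Rightarrow> 'a bborel" is "\<lambda>f x. - f x"
  by (auto simp: bounded_iff)

lift_definition plus_bborel :: "'a bborel \<Rightarrow> 'a bborel \<Rightarrow> 'a bborel" is "\<lambda>f g x. f x + g x"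
  by (auto intro!: bounded_plus_comp)

lift_definition minus_bborel :: "'a bborel \<Rightarrow> 'a bborel \<Rightarrow> 'a bborel" is "\<lambda>f g x. f x - g x"
  by (auto intro!: bounded_minus_comp)

lift_definition scaleR_bborel :: "real \<Rightarrow> 'a bborel \<Rightarrow> 'a bborel" is "\<lambda>c f x. c * f x"
  by (auto dest: bounded_scaleR_comp)

instance
proof
  fix f g h :: "'a bborel" and a b :: real
  show "f + g + h = f + (g + h)" "f + g = g + f" "0 + f = f" "- f + f = 0" "f - g = f + - g"
    by (transfer; auto)+
  show "a *\<^sub>R (f + g) = a *\<^sub>R f + a *\<^sub>R g" "(a + b) *\<^sub>R f = a *\<^sub>R f + b *\<^sub>R f"
    "a *\<^sub>R b *\<^sub>R f = (a * b) *\<^sub>R f" "1 *\<^sub>R f = f"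
    by (transfer; auto simp: algebra_simps)+
qed

end

instantiation bborel :: (topological_space) real_normed_vector
begin

definition norm_bborel :: "'a bborel \<Rightarrow> real"
  where "norm_bborel f = (SUP x. \<bar>apply_bborel f x\<bar>)"

definition dist_bborel :: "'a bborel \<Rightarrow> 'a bborel \<Rightarrow> real"
  where "dist_bborel f g = norm (f - g)"

definition sgn_bborel :: "'a bborel \<Rightarrow> 'a bborel"
  where "sgn_bborel f = f /\<^sub>R norm f"

definition uniformity_bborel :: "('a bborel \<times> 'a bborel) filter"
  where "uniformity_bborel = (INF e\<in>{0 <..}. principal {(x, y). dist x y < e})"

definition open_bborel :: "'a bborel set \<Rightarrow> bool"
  where "open_bborel U = (\<forall>x\<in>U. \<forall>\<^sub>F (x', y) in uniformity. x' = x \<longrightarrow> y \<in> U)"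

lemma abs_bborel_le_norm: "\<bar>apply_bborel f x\<bar> \<le> norm f"
  unfolding norm_bborel_def by (rule cSUP_upper[OF _ bdd_above_bborel]) simp

lemma norm_bborel_le: "(\<And>x. \<bar>apply_bborel f x\<bar> \<le> B) \<Longrightarrow> norm f \<le> B"
  unfolding norm_bborel_def by (rule cSUP_least) auto

instance
proof
  fix f g :: "'a bborel" and a :: real
  show "dist f g = norm (f - g)" by (rule dist_bborel_def)
  show "sgn f = f /\<^sub>R norm f" by (rule sgn_bborel_def)
  show "uniformity = (INF e\<in>{0 <..}. principal {(x, y :: 'a bborel). dist x y < e})"
    by (rule uniformity_bborel_def)
  show "open U = (\<forall>x\<in>U. \<forall>\<^sub>F (x', y) in uniformity. x' = x \<longrightarrow> y \<in> U)" for U :: "'a bborel set"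
    by (rule open_bborel_def)
  show "norm f = 0 \<longleftrightarrow> f = 0"
  proof
    assume "norm f = 0"
    then have "apply_bborel f x = 0" for x using abs_bborel_le_norm[of f x] by simp
    then show "f = 0" by (intro bborel_eqI) (simp add: zero_bborel.rep_eq)
  next
    assume "f = 0"
    then show "norm f = 0" by (simp add: norm_bborel_def zero_bborel.rep_eq)
  qed
  show "norm (f + g) \<le> norm f + norm g"
  proof (rule norm_bborel_le)
    fix x
    show "\<bar>apply_bborel (f + g) x\<bar> \<le> norm f + norm g"
      using abs_bborel_le_norm[of f x] abs_bborel_le_norm[of g x]
      by (simp add: plus_bborel.rep_eq)
  qed
  have le: "norm (c *\<^sub>R k) \<le> \<bar>c\<bar> * norm k" for c and k :: "'a bborel"
    by (rule norm_bborel_le)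
       (simp add: scaleR_bborel.rep_eq abs_mult mult_left_mono abs_bborel_le_norm)
  show "norm (a *\<^sub>R f) = \<bar>a\<bar> * norm f"
  proof (cases "a = 0")
    case True
    have "a *\<^sub>R f = 0" using True by (transfer; auto)
    then show ?thesis using True by (simp add: norm_bborel_def zero_bborel.rep_eq)
  next
    case False
    have "inverse a *\<^sub>R (a *\<^sub>R f) = f"
      using False by (transfer; auto)
    then have "norm f \<le> \<bar>inverse a\<bar> * norm (a *\<^sub>R f)"
      using le[of "inverse a" "a *\<^sub>R f"] by simp
    then have "\<bar>a\<bar> * norm f \<le> norm (a *\<^sub>R f)"
      using False by (simp add: field_simps abs_inverse)
    then show ?thesis using le[of a f] by (rule antisym[rotated])
  qed
qed

end

definition sigma_normal :: "('a::topological_space bborel \<Rightarrow> 'x::real_normed_vector) \<Rightarrow> bool"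
  where "sigma_normal \<theta> \<longleftrightarrow>
    (\<forall>F f. bounded (range F) \<and> (\<forall>x. (\<lambda>n::nat. apply_bborel (F n) x) \<longlonglongrightarrow> apply_bborel f x)
       \<longrightarrow> (\<lambda>n. \<theta> (F n)) \<longlonglongrightarrow> \<theta> f)"

section \<open>Convex analysis on normed spaces\<close>

text \<open>The dual of \<open>'x\<close> is the type \<open>'x \<Rightarrow>\<^sub>L real\<close>, whose norm is the operator norm. On functionals the
  library's strong operator topology is the topology of pointwise convergence.\<close>

abbreviation weak_star :: "('x::real_normed_vector \<Rightarrow>\<^sub>L real) topology"
  where "weak_star \<equiv> strong_operator_topology"

definition conjugate :: "('x::real_normed_vector \<Rightarrow> real) \<Rightarrow> ('x \<Rightarrow>\<^sub>L real) \<Rightarrow> ereal"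
  where "conjugate g x = (SUP y. ereal (blinfun_apply x y - g y))"

definition minimal_linear_growth ::
    "('x::real_normed_vector \<Rightarrow> real) \<Rightarrow> real \<Rightarrow> bool"
  \<comment> \<open>the growth is that of \<open>conjugate g\<close>; the supremum over an empty set is \<open>- \<infinity>\<close>\<close>
  where "minimal_linear_growth g l \<longleftrightarrow>
    ((\<lambda>R. SUP y\<in>- cball 0 R. ereal (l * norm y) - conjugate g y) \<longlongrightarrow> - \<infinity>) at_top"

definition subdifferential :: "('x::real_normed_vector \<Rightarrow> real) \<Rightarrow> 'x \<Rightarrow> ('x \<Rightarrow>\<^sub>L real) set"
  where "subdifferential g z = {x. \<forall>y. blinfun_apply x (y - z) \<le> g y - g z}"

section \<open>Invariant measures of the full shift\<close>

text \<open>Sequences are indexed from \<open>0\<close>. Since the sequence space is compact in the application,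
  the type \<open>(nat \<Rightarrow> 'w) \<Rightarrow>\<^sub>C real\<close> consists of all continuous functions there. Every compact
  metric space is Polish, so taking \<open>'w\<close> in class \<open>polish_space\<close> loses nothing.\<close>

definition shift :: "(nat \<Rightarrow> 'w) \<Rightarrow> nat \<Rightarrow> 'w"
  where "shift \<sigma> = (\<lambda>n. \<sigma> (Suc n))"

definition inv_measures :: "(nat \<Rightarrow> 'w::topological_space) measure set"
  where "inv_measures = {\<mu>. prob_space \<mu> \<and> sets \<mu> = sets borel \<and> distr \<mu> borel shift = \<mu>}"

definition ergodic_measures :: "(nat \<Rightarrow> 'w::topological_space) measure set"
  where "ergodic_measures = {\<mu> \<in> inv_measures.
    \<forall>A\<in>sets borel. shift -` A = A \<longrightarrow> measure \<mu> A = 0 \<or> measure \<mu> A = 1}"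

definition measure_functional ::
    "(nat \<Rightarrow> 'w::topological_space) measure \<Rightarrow> ((nat \<Rightarrow> 'w) \<Rightarrow>\<^sub>C real) \<Rightarrow>\<^sub>L real"
  where "measure_functional \<mu> = Blinfun (\<lambda>\<phi>. \<integral>\<sigma>. apply_bcontfun \<phi> \<sigma> \<partial>\<mu>)"

definition inv_topology :: "(nat \<Rightarrow> 'w::topological_space) measure topology"
  where "inv_topology = pullback_topology inv_measures measure_functional weak_star"

definition closed_hull ::
    "(nat \<Rightarrow> 'w::topological_space) measure set \<Rightarrow> (nat \<Rightarrow> 'w) measure set"
  \<comment> \<open>weak* closed convex hull, taken in the dual of the space of continuous functions\<close>
  where "closed_hull E = {\<mu> \<in> inv_measures.
    measure_functional \<mu> \<in> weak_star closure_of (convex hull (measure_functional ` E))}"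

definition is_choquet_measure ::
    "(nat \<Rightarrow> 'w::topological_space) measure \<Rightarrow> (nat \<Rightarrow> 'w) measure measure \<Rightarrow> bool"
  \<comment> \<open>The last clause is the barycenter condition. The weak* continuous linear functionals on
     the dual space are the evaluations at continuous functions.\<close>
  where "is_choquet_measure \<mu> \<xi> \<longleftrightarrow>
    prob_space \<xi> \<and> sets \<xi> = sigma_sets inv_measures {U. openin inv_topology U} \<and>
    emeasure \<xi> ergodic_measures = 1 \<and>
    (\<forall>\<phi> :: (nat \<Rightarrow> 'w) \<Rightarrow>\<^sub>C real.
       (\<integral>\<nu>. (\<integral>\<sigma>. apply_bcontfun \<phi> \<sigma> \<partial>\<nu>) \<partial>\<xi>) = (\<integral>\<sigma>. apply_bcontfun \<phi> \<sigma> \<partial>\<mu>))"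

definition choquet_measure ::
    "(nat \<Rightarrow> 'w::topological_space) measure \<Rightarrow> (nat \<Rightarrow> 'w) measure measure"
  where "choquet_measure \<mu> = (THE \<xi>. is_choquet_measure \<mu> \<xi>)"

type_synonym 'w test_fun = "((nat \<Rightarrow> 'w) \<Rightarrow>\<^sub>C real) unit_ball"

definition eval_S :: "(nat \<Rightarrow> 'w::topological_space) measure \<Rightarrow> 'w test_fun bborel"
  where "eval_S \<mu> = Bborel (\<lambda>\<phi>. \<integral>\<sigma>. apply_bcontfun (ball_val \<phi>) \<sigma> \<partial>\<mu>)"

section \<open>Entropy and pressure functionals\<close>

definition transfer_op ::
    "'w::topological_space measure \<Rightarrow> ((nat \<Rightarrow> 'w) \<Rightarrow>\<^sub>C real) \<Rightarrow> (nat \<Rightarrow> 'w) \<Rightarrow> real"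
  where "transfer_op m \<phi> \<sigma> = (\<integral>\<omega>. apply_bcontfun \<phi> (case_nat \<omega> \<sigma>) \<partial>m)"

definition entropy :: "'w::topological_space measure \<Rightarrow> (nat \<Rightarrow> 'w) measure \<Rightarrow> ereal"
  where "entropy m \<mu> = (INF \<phi>\<in>{\<phi> :: (nat \<Rightarrow> 'w) \<Rightarrow>\<^sub>C real. \<forall>\<sigma>. apply_bcontfun \<phi> \<sigma> > 0}.
    ereal (\<integral>\<sigma>. ln (transfer_op m \<phi> \<sigma> / apply_bcontfun \<phi> \<sigma>) \<partial>\<mu>))"

definition Delta ::
    "('w::topological_space test_fun bborel \<Rightarrow> 'x) \<Rightarrow> ('x \<Rightarrow> real) \<Rightarrow> (nat \<Rightarrow> 'w) measure \<Rightarrow> real"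
  where "Delta \<theta> g \<mu> = (LINT \<nu>:ergodic_measures|choquet_measure \<mu>. g (\<theta> (eval_S \<nu>)))"

text \<open>The maps below take the data \<open>m \<theta>\<^sub>+ \<theta>\<^sub>- g\<^sub>+ g\<^sub>-\<close> in this order, omitting what is not used.\<close>

definition pressure_fun ::
    "'w::topological_space measure \<Rightarrow>
     ('w test_fun bborel \<Rightarrow> 'x) \<Rightarrow> ('w test_fun bborel \<Rightarrow> 'y) \<Rightarrow>
     ('x \<Rightarrow> real) \<Rightarrow> ('y \<Rightarrow> real) \<Rightarrow> (nat \<Rightarrow> 'w) measure \<Rightarrow> ereal"
  where "pressure_fun m \<theta>p \<theta>m gp gm \<mu> =
    entropy m \<mu> - ereal (gm (\<theta>m (eval_S \<mu>))) + ereal (gp (\<theta>p (eval_S \<mu>)))"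

definition F_sharp ::
    "'w::topological_space measure \<Rightarrow>
     ('w test_fun bborel \<Rightarrow> 'x) \<Rightarrow> ('w test_fun bborel \<Rightarrow> 'y) \<Rightarrow>
     ('x \<Rightarrow> real) \<Rightarrow> ('y \<Rightarrow> real) \<Rightarrow> (nat \<Rightarrow> 'w) measure \<Rightarrow> ereal"
  where "F_sharp m \<theta>p \<theta>m gp gm \<mu> =
    ereal (Delta \<theta>p gp \<mu>) - ereal (gm (\<theta>m (eval_S \<mu>))) + entropy m \<mu>"

definition F_flat ::
    "'w::topological_space measure \<Rightarrow>
     ('w test_fun bborel \<Rightarrow> 'x) \<Rightarrow> ('w test_fun bborel \<Rightarrow> 'y) \<Rightarrow>
     ('x \<Rightarrow> real) \<Rightarrow> ('y \<Rightarrow> real) \<Rightarrow> (nat \<Rightarrow> 'w) measure \<Rightarrow> ereal"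
  where "F_flat m \<theta>p \<theta>m gp gm \<mu> =
    ereal (Delta \<theta>p gp \<mu>) - ereal (Delta \<theta>m gm \<mu>) + entropy m \<mu>"

definition generalized_equilibria ::
    "((nat \<Rightarrow> 'w::topological_space) measure \<Rightarrow> ereal) \<Rightarrow> (nat \<Rightarrow> 'w) measure set"
  where "generalized_equilibria \<Phi> = {\<mu> \<in> inv_measures. \<exists>M :: nat \<Rightarrow> (nat \<Rightarrow> 'w) measure.
    range M \<subseteq> inv_measures \<and> limitin inv_topology M \<mu> sequentially \<and>
    (\<lambda>n. \<Phi> (M n)) \<longlonglongrightarrow> (SUP \<nu>\<in>inv_measures. \<Phi> \<nu>)}"

definition equilibria ::
    "((nat \<Rightarrow> 'w::topological_space) measure \<Rightarrow> ereal) \<Rightarrow> (nat \<Rightarrow> 'w) measure set"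
  where "equilibria \<Phi> = {\<mu> \<in> inv_measures. \<Phi> \<mu> = (SUP \<nu>\<in>inv_measures. \<Phi> \<nu>)}"

section \<open>Linearized pressures and the thermodynamic game\<close>

definition lin_pressure_fun ::
    "'w::topological_space measure \<Rightarrow>
     ('w test_fun bborel \<Rightarrow> 'x::real_normed_vector) \<Rightarrow>
     ('w test_fun bborel \<Rightarrow> 'y::real_normed_vector) \<Rightarrow>
     ('x \<Rightarrow>\<^sub>L real) \<Rightarrow> ('y \<Rightarrow>\<^sub>L real) \<Rightarrow> (nat \<Rightarrow> 'w) measure \<Rightarrow> ereal"
  where "lin_pressure_fun m \<theta>p \<theta>m yp ym \<mu> =
    entropy m \<mu> - ereal (blinfun_apply ym (\<theta>m (eval_S \<mu>)))
      + ereal (blinfun_apply yp (\<theta>p (eval_S \<mu>)))"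

definition P_L ::
    "'w::topological_space measure \<Rightarrow>
     ('w test_fun bborel \<Rightarrow> 'x::real_normed_vector) \<Rightarrow>
     ('w test_fun bborel \<Rightarrow> 'y::real_normed_vector) \<Rightarrow>
     ('x \<Rightarrow>\<^sub>L real) \<Rightarrow> ('y \<Rightarrow>\<^sub>L real) \<Rightarrow> ereal"
  where "P_L m \<theta>p \<theta>m yp ym = (SUP \<mu>\<in>inv_measures. lin_pressure_fun m \<theta>p \<theta>m yp ym \<mu>)"

definition E_L ::
    "'w::topological_space measure \<Rightarrow>
     ('w test_fun bborel \<Rightarrow> 'x::real_normed_vector) \<Rightarrow>
     ('w test_fun bborel \<Rightarrow> 'y::real_normed_vector) \<Rightarrow>
     ('x \<Rightarrow>\<^sub>L real) \<Rightarrow> ('y \<Rightarrow>\<^sub>L real) \<Rightarrow> (nat \<Rightarrow> 'w) measure set"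
  where "E_L m \<theta>p \<theta>m yp ym =
    {\<nu> \<in> inv_measures. lin_pressure_fun m \<theta>p \<theta>m yp ym \<nu> = P_L m \<theta>p \<theta>m yp ym}"

definition P_NL ::
    "'w::topological_space measure \<Rightarrow>
     ('w test_fun bborel \<Rightarrow> 'x::real_normed_vector) \<Rightarrow>
     ('w test_fun bborel \<Rightarrow> 'y::real_normed_vector) \<Rightarrow>
     ('x \<Rightarrow> real) \<Rightarrow> ('y \<Rightarrow> real) \<Rightarrow>
     ('x \<Rightarrow>\<^sub>L real) \<Rightarrow> ('y \<Rightarrow>\<^sub>L real) \<Rightarrow> ereal"
  where "P_NL m \<theta>p \<theta>m gp gm yp ym =
    P_L m \<theta>p \<theta>m yp ym + conjugate gm ym - conjugate gp yp"

definition P_flat ::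
    "'w::topological_space measure \<Rightarrow>
     ('w test_fun bborel \<Rightarrow> 'x::real_normed_vector) \<Rightarrow>
     ('w test_fun bborel \<Rightarrow> 'y::real_normed_vector) \<Rightarrow>
     ('x \<Rightarrow> real) \<Rightarrow> ('y \<Rightarrow> real) \<Rightarrow> ereal"
  where "P_flat m \<theta>p \<theta>m gp gm = (SUP yp. INF ym. P_NL m \<theta>p \<theta>m gp gm yp ym)"

definition P_sharp_at ::
    "'w::topological_space measure \<Rightarrow>
     ('w test_fun bborel \<Rightarrow> 'x::real_normed_vector) \<Rightarrow>
     ('w test_fun bborel \<Rightarrow> 'y::real_normed_vector) \<Rightarrow>
     ('x \<Rightarrow> real) \<Rightarrow> ('y \<Rightarrow> real) \<Rightarrow> ('y \<Rightarrow>\<^sub>L real) \<Rightarrow> ereal"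
  where "P_sharp_at m \<theta>p \<theta>m gp gm ym = (SUP yp. P_NL m \<theta>p \<theta>m gp gm yp ym)"

definition M_sharp_at ::
    "'w::topological_space measure \<Rightarrow>
     ('w test_fun bborel \<Rightarrow> 'x::real_normed_vector) \<Rightarrow>
     ('w test_fun bborel \<Rightarrow> 'y::real_normed_vector) \<Rightarrow>
     ('x \<Rightarrow> real) \<Rightarrow> ('y \<Rightarrow> real) \<Rightarrow> ('y \<Rightarrow>\<^sub>L real) \<Rightarrow> ('x \<Rightarrow>\<^sub>L real) set"
  where "M_sharp_at m \<theta>p \<theta>m gp gm ym =
    {xp. P_NL m \<theta>p \<theta>m gp gm xp ym = P_sharp_at m \<theta>p \<theta>m gp gm ym}"

definition P_sharp ::
    "'w::topological_space measure \<Rightarrow>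
     ('w test_fun bborel \<Rightarrow> 'x::real_normed_vector) \<Rightarrow>
     ('w test_fun bborel \<Rightarrow> 'y::real_normed_vector) \<Rightarrow>
     ('x \<Rightarrow> real) \<Rightarrow> ('y \<Rightarrow> real) \<Rightarrow> ereal"
  where "P_sharp m \<theta>p \<theta>m gp gm = (INF ym. P_sharp_at m \<theta>p \<theta>m gp gm ym)"

definition M_sharp ::
    "'w::topological_space measure \<Rightarrow>
     ('w test_fun bborel \<Rightarrow> 'x::real_normed_vector) \<Rightarrow>
     ('w test_fun bborel \<Rightarrow> 'y::real_normed_vector) \<Rightarrow>
     ('x \<Rightarrow> real) \<Rightarrow> ('y \<Rightarrow> real) \<Rightarrow> ('y \<Rightarrow>\<^sub>L real) set"
  where "M_sharp m \<theta>p \<theta>m gp gm =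
    {xm. P_sharp_at m \<theta>p \<theta>m gp gm xm = P_sharp m \<theta>p \<theta>m gp gm}"

definition E_NL ::
    "'w::topological_space measure \<Rightarrow>
     ('w test_fun bborel \<Rightarrow> 'x::real_normed_vector) \<Rightarrow>
     ('w test_fun bborel \<Rightarrow> 'y::real_normed_vector) \<Rightarrow>
     ('x \<Rightarrow> real) \<Rightarrow> ('y \<Rightarrow> real) \<Rightarrow> ('y \<Rightarrow>\<^sub>L real) \<Rightarrow> (nat \<Rightarrow> 'w) measure set"
  where "E_NL m \<theta>p \<theta>m gp gm xm =
    (\<Union>xp\<in>M_sharp_at m \<theta>p \<theta>m gp gm xm. E_L m \<theta>p \<theta>m xp xm)"

section \<open>The defining formulas hold for probability measures\<close>

lemma integrable_bcontfun:
  fixes \<phi> :: "'a::topological_space \<Rightarrow>\<^sub>C real"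
  assumes "prob_space \<mu>" "sets \<mu> = sets borel"
  shows "integrable \<mu> (apply_bcontfun \<phi>)"
proof -
  interpret prob_space \<mu> by fact
  have "apply_bcontfun \<phi> \<in> borel_measurable borel"
    by (rule borel_measurable_continuous_onI) simp
  then have "apply_bcontfun \<phi> \<in> borel_measurable \<mu>"
    using assms(2) measurable_cong_sets by blast
  then show ?thesis
    by (intro integrable_const_bound[where B="norm \<phi>"]) (simp_all only: norm_bounded always_eventually simp_thms)
qed

lemma apply_measure_functional:
  fixes \<mu> :: "(nat \<Rightarrow> 'w::topological_space) measure"
  assumes "prob_space \<mu>" "sets \<mu> = sets borel"
  shows "blinfun_apply (measure_functional \<mu>) \<phi> = (\<integral>\<sigma>. apply_bcontfun \<phi> \<sigma> \<partial>\<mu>)"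
proof -
  interpret prob_space \<mu> by fact
  have "bounded_linear (\<lambda>\<phi> :: (nat \<Rightarrow> 'w) \<Rightarrow>\<^sub>C real. \<integral>\<sigma>. apply_bcontfun \<phi> \<sigma> \<partial>\<mu>)"
  proof (rule bounded_linear_intro[where K=1])
    fix \<phi> \<psi> :: "(nat \<Rightarrow> 'w) \<Rightarrow>\<^sub>C real" and r :: real
    show "(\<integral>\<sigma>. apply_bcontfun (\<phi> + \<psi>) \<sigma> \<partial>\<mu>) =
        (\<integral>\<sigma>. apply_bcontfun \<phi> \<sigma> \<partial>\<mu>) + (\<integral>\<sigma>. apply_bcontfun \<psi> \<sigma> \<partial>\<mu>)"
      using assms by (simp add: integrable_bcontfun)
    show "(\<integral>\<sigma>. apply_bcontfun (r *\<^sub>R \<phi>) \<sigma> \<partial>\<mu>) = r *\<^sub>R (\<integral>\<sigma>. apply_bcontfun \<phi> \<sigma> \<partial>\<mu>)"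
      by simp
    have "norm (\<integral>\<sigma>. apply_bcontfun \<phi> \<sigma> \<partial>\<mu>) \<le> (\<integral>\<sigma>. norm (apply_bcontfun \<phi> \<sigma>) \<partial>\<mu>)"
      by (rule Bochner_Integration.integral_norm_bound)
    also have "\<dots> \<le> (\<integral>\<sigma>. norm \<phi> \<partial>\<mu>)"
      by (rule integral_mono[OF integrable_norm[OF integrable_bcontfun[OF assms]] integrable_const])
         (rule norm_bounded)
    finally show "norm (\<integral>\<sigma>. apply_bcontfun \<phi> \<sigma> \<partial>\<mu>) \<le> norm \<phi> * 1"
      by (simp add: prob_space)
  qed
  then show ?thesis
    unfolding measure_functional_def by (simp add: bounded_linear_Blinfun_apply)
qed

lemma apply_eval_S:
  fixes \<mu> :: "(nat \<Rightarrow> 'w::topological_space) measure"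
  assumes "prob_space \<mu>" "sets \<mu> = sets borel"
  shows "apply_bborel (eval_S \<mu>) \<phi> = (\<integral>\<sigma>. apply_bcontfun (ball_val \<phi>) \<sigma> \<partial>\<mu>)"
proof -
  let ?L = "blinfun_apply (measure_functional \<mu>)"
  have eq: "(\<lambda>\<phi>. \<integral>\<sigma>. apply_bcontfun (ball_val \<phi>) \<sigma> \<partial>\<mu>) = (\<lambda>\<phi>. ?L (ball_val \<phi>))"
    using assms by (simp add: apply_measure_functional)
  have "continuous_on UNIV (ball_val :: 'w test_fun \<Rightarrow> _)"
    unfolding continuous_on_iff by (auto simp: dist_unit_ball_def)
  then have "continuous_on UNIV (\<lambda>\<phi>::'w test_fun. ?L (ball_val \<phi>))"
    by (intro continuous_intros)
  then have meas: "(\<lambda>\<phi>::'w test_fun. ?L (ball_val \<phi>)) \<in> borel_measurable borel"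
    by (rule borel_measurable_continuous_onI)
  have "norm (?L (ball_val \<phi>)) \<le> norm (measure_functional \<mu>)" for \<phi> :: "'w test_fun"
  proof -
    have "norm (ball_val \<phi>) \<le> 1" using ball_val[of \<phi>] by simp
    then show ?thesis
      using norm_blinfun[of "measure_functional \<mu>" "ball_val \<phi>"]
        mult_left_mono[of "norm (ball_val \<phi>)" 1 "norm (measure_functional \<mu>)"] by simp
  qed
  then have bdd: "bounded (range (\<lambda>\<phi>::'w test_fun. ?L (ball_val \<phi>)))"
    by (auto simp: bounded_iff)
  show ?thesis
    unfolding eval_S_def eq using meas bdd
    by (subst Bborel_inverse) (simp_all only: mem_Collect_eq fun_cong[OF eq, symmetric] simp_thms)
qed

lemma topspace_inv_topology: "topspace inv_topology = inv_measures"
  by (simp add: inv_topology_def topspace_pullback_topology strong_operator_topology_topspace)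

end

theory Submission
  imports Defs
begin

text \<open>
  All functionals in question are the entropy plus a functional $f$ of the measure. Every invariant
  measure is a weak* limit of ergodic measures, obtained by independent concatenation of blocks, along
  which the entropy does not drop. On ergodic measures a weak* continuous $f$ agrees with its mean over
  ergodic components, and the entropy of a measure is at most the mean entropy of its components. So
  replacing $f$ by its mean does not change the supremum, and almost maximality of the mean forces
  almost all ergodic components to be close to maximizers for $f$; this is where the closed convex
  hulls come from.

  The entropy is concave and $\Delta^{g_+ \circ \theta_+}$ is affine. Therefore Fenchel duality, that is
  a Hahn-Banach separation, replaces $g_-$ by an infimum over affine functionals, and this infimum is
  attained. For a maximizer of $\mathfrak{F}^\sharp$ an optimal functional is a subgradient of $g_-$.
  The functional $g_+$ is a supremum of affine functionals, so that the two suprema commute.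
\<close>

section \<open>Fenchel duality\<close>

text \<open>The Choquet measure is made concrete: \<open>component \<sigma>\<close> is the weak*
  limit of the empirical measures of \<sigma>, and the Choquet measure of \<mu> is the law of
  \<open>component\<close> under \<mu>. Integrals over the decomposition become integrals against
  \<mu>, whose affine dependence on \<mu> is evident. As \<open>component\<close> is shift invariant
  at every point, whatever depends on it alone passes through the transfer operator. The obstacle is
  that the mean over components is in general not weak* continuous and, for a difference of convex
  functionals, not even semicontinuous. For a single convex functional, doubling the length of the
  empirical averages exhibits the mean as an infimum of continuous functionals. This semicontinuity
  turns limits of almost maximizers into maximizers in the sharp case, whereas the flat case has to
  work with generalized equilibria. Duality needs an affine functional where g_+ composed with
  \<theta>_+ is merely convex; hence the mean over components is substituted before the
  separation.\<close>

lemma hahn_banach_sublinear: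
  fixes p :: "'a::real_vector \<Rightarrow> real"
  assumes sub: "\<And>x y. p (x + y) \<le> p x + p y"
    and hom: "\<And>t x. t \<ge> 0 \<Longrightarrow> p (t *\<^sub>R x) = t * p x"
  shows "\<exists>L. linear L \<and> (\<forall>x. L x \<le> p x)"
proof -
  define SL where "SL = {q :: 'a \<Rightarrow> real. (\<forall>x y. q (x + y) \<le> q x + q y) \<and>
      (\<forall>t\<ge>0. \<forall>x. q (t *\<^sub>R x) = t * q x) \<and> (\<forall>x. q x \<le> p x)}"
  have SL0: "q 0 = 0" if "q \<in> SL" for q
  proof -
    have "q (0 *\<^sub>R 0) = 0 * q 0" using that unfolding SL_def by blast
    then show ?thesis by simp
  qed
  have SLneg: "- q (- x) \<le> q x" if "q \<in> SL" for q x
  proof -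
    have "q (x + - x) \<le> q x + q (- x)" using that unfolding SL_def by blast
    then show ?thesis using SL0[OF that] by simp
  qed
  \<comment> \<open>A bound that does not depend on \<open>q\<close>; it keeps the pointwise infimum
    of a chain finite.\<close>
  have lower: "- p (- x) \<le> q x" if "q \<in> SL" for q x
  proof -
    have "q (- x) \<le> p (- x)" using that unfolding SL_def by blast
    then show ?thesis using SLneg[OF that, of x] by linarith
  qed
  \<comment> \<open>Zorn's lemma for the reversed pointwise order on the sublinear functionals below
    \<open>p\<close>; a minimal one will turn out to be additive.\<close>
  have "\<exists>m\<in>SL. \<forall>a\<in>SL. a \<le> m \<longrightarrow> a = m"
  proof (rule predicate_Zorn)
    show "partial_order_on SL (relation_of (\<lambda>m a. a \<le> m) SL)"
      by (rule partial_order_on_relation_ofI) auto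
    fix C assume C: "C \<in> Chains (relation_of (\<lambda>m a. a \<le> m) SL)"
    then have CS: "C \<subseteq> SL" and ch: "\<And>a b. a \<in> C \<Longrightarrow> b \<in> C \<Longrightarrow> a \<le> b \<or> b \<le> a"
      unfolding Chains_def relation_of_def by blast+
    show "\<exists>u\<in>SL. \<forall>a\<in>C. u \<le> a"
    proof (cases "C = {}")
      case True
      have "p \<in> SL" using sub hom by (auto simp: SL_def)
      then show ?thesis using True by auto
    next
      case False
      define u where "u x = (INF q\<in>C. q x)" for x
      have bdd: "bdd_below ((\<lambda>q. q x) ` C)" for x
        by (rule bdd_belowI2[where m="- p (- x)"]) (use lower CS in blast)
      have ule: "u x \<le> q x" if "q \<in> C" for q x
        unfolding u_def by (rule cINF_lower[OF bdd that])
      have "u \<in> SL" unfolding SL_def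
      proof (intro CollectI conjI allI impI)
        fix x y
        \<comment> \<open>In a chain one of \<open>q1\<close>, \<open>q2\<close> is the smaller, and
          its subadditivity bounds \<open>u (x + y)\<close> by \<open>q1 x + q2 y\<close>; the two
          infima can then be taken separately.\<close>
        have "u (x + y) - q2 y \<le> q1 x" if q12: "q1 \<in> C" "q2 \<in> C" for q1 q2
        proof -
          obtain q where q: "q \<in> C" "q \<le> q1" "q \<le> q2"
            using ch[OF q12] q12 by auto
          have "u (x + y) \<le> q (x + y)" by (rule ule[OF q(1)])
          also have "\<dots> \<le> q x + q y" using q(1) CS by (auto simp: SL_def)
          also have "\<dots> \<le> q1 x + q2 y" using q by (intro add_mono) (auto simp: le_fun_def)
          finally show ?thesis by simp
        qed
        then have "u (x + y) - q2 y \<le> u x" if "q2 \<in> C" for q2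
          unfolding u_def[of x] using False that by (intro cINF_greatest) auto
        then have "u (x + y) - u x \<le> q2 y" if "q2 \<in> C" for q2
          using that by (auto simp: algebra_simps)
        then have "u (x + y) - u x \<le> u y"
          unfolding u_def[of y] using False by (intro cINF_greatest) auto
        then show "u (x + y) \<le> u x + u y" by simp
      next
        fix t :: real and x assume t: "t \<ge> 0"
        have q: "q (t *\<^sub>R x) = t * q x" if "q \<in> C" for q
          using that CS t by (auto simp: SL_def)
        show "u (t *\<^sub>R x) = t * u x"
        proof (rule antisym)
          show "u (t *\<^sub>R x) \<le> t * u x"
          proof (cases "t = 0")
            case True
            obtain q where "q \<in> C" using False by auto
            then show ?thesis using ule[of q "t *\<^sub>R x"] q[of q] True by simp
          next
            case f: False
            have "u (t *\<^sub>R x) / t \<le> q x" if "q \<in> C" for q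
              using ule[OF that, of "t *\<^sub>R x"] q[OF that] f t by (simp add: field_simps)
            then have "u (t *\<^sub>R x) / t \<le> u x"
              unfolding u_def[of x] using False by (intro cINF_greatest) auto
            then show ?thesis using f t by (simp add: field_simps)
          qed
          show "t * u x \<le> u (t *\<^sub>R x)"
            unfolding u_def[of "t *\<^sub>R x"]
            by (intro cINF_greatest[OF False]) (simp only: q mult_left_mono[OF ule t])
        qed
      next
        fix x
        obtain q where "q \<in> C" using False by auto
        moreover from this CS have "q x \<le> p x" unfolding SL_def by blast
        ultimately show "u x \<le> p x" using ule[of q x] by linarith
      qed
      then show ?thesis using ule by (auto simp: le_fun_def)
    qed
  qed
  then obtain q where q: "q \<in> SL" and qmin: "\<And>a. a \<in> SL \<Longrightarrow> a \<le> q \<Longrightarrow> a = q" by auto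
  have qsub: "q (x + y) \<le> q x + q y" and qp: "q x \<le> p x" for x y
    using q by (auto simp: SL_def)
  have qhom: "q (t *\<^sub>R x) = t * q x" if "t \<ge> 0" for t x
    using q that by (auto simp: SL_def)
  have super: "q x + q y \<le> q (x + y)" for x y
  proof -
    \<comment> \<open>\<open>r\<close> lowers \<open>q\<close> as far as its slope along
      \<open>y\<close> allows. It is sublinear and at most \<open>q\<close>, so minimality gives
      \<open>r = q\<close>, and \<open>t = 1\<close> in the infimum yields superadditivity.\<close>
    define r where "r z = (INF t\<in>{0..}. q (z + t *\<^sub>R y) - t * q y)" for z
    have bdd: "bdd_below ((\<lambda>t. q (z + t *\<^sub>R y) - t * q y) ` {0..})" for z
    proof (rule bdd_belowI2[where m="- q (- z)"])
      fix t :: real assume "t \<in> {0..}"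
      then have "t * q y = q (t *\<^sub>R y)" using qhom by simp
      also have "\<dots> \<le> q (z + t *\<^sub>R y) + q (- z)"
        using qsub[of "z + t *\<^sub>R y" "- z"] by simp
      finally show "- q (- z) \<le> q (z + t *\<^sub>R y) - t * q y" by simp
    qed
    have rle: "r z \<le> q (z + t *\<^sub>R y) - t * q y" if "t \<ge> 0" for t z
      unfolding r_def using that by (intro cINF_lower[OF bdd]) simp
    have rq: "r z \<le> q z" for z using rle[of 0 z] by simp
    have "r \<in> SL" unfolding SL_def
    proof (intro CollectI conjI allI impI)
      fix z w
      have "r (z + w) - (q (w + t *\<^sub>R y) - t * q y) \<le> q (z + s *\<^sub>R y) - s * q y"
        if "s \<ge> 0" "t \<ge> 0" for s t
      proof -
        have "r (z + w) \<le> q (z + w + (s + t) *\<^sub>R y) - (s + t) * q y"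
          using that by (intro rle) simp
        also have "z + w + (s + t) *\<^sub>R y = (z + s *\<^sub>R y) + (w + t *\<^sub>R y)"
          by (simp add: algebra_simps)
        finally show ?thesis
          using qsub[of "z + s *\<^sub>R y" "w + t *\<^sub>R y"] by (simp add: algebra_simps)
      qed
      then have "r (z + w) - (q (w + t *\<^sub>R y) - t * q y) \<le> r z" if "t \<ge> 0" for t
        unfolding r_def[of z] using that by (intro cINF_greatest) auto
      then have "r (z + w) - r z \<le> q (w + t *\<^sub>R y) - t * q y" if "t \<ge> 0" for t
        using that by (auto simp: algebra_simps)
      then have "r (z + w) - r z \<le> r w"
        unfolding r_def[of w] by (intro cINF_greatest) auto
      then show "r (z + w) \<le> r z + r w" by simp
    next
      fix t :: real and z assume t: "t \<ge> 0"
      have up: "r (t *\<^sub>R z) \<le> t * r z" if t: "t > 0" for t z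
      proof -
        have "r (t *\<^sub>R z) / t \<le> q (z + s *\<^sub>R y) - s * q y" if "s \<ge> 0" for s
        proof -
          have "r (t *\<^sub>R z) \<le> q (t *\<^sub>R z + (t * s) *\<^sub>R y) - (t * s) * q y"
            using that t by (intro rle) simp
          also have "t *\<^sub>R z + (t * s) *\<^sub>R y = t *\<^sub>R (z + s *\<^sub>R y)"
            by (simp add: algebra_simps)
          finally have "r (t *\<^sub>R z) \<le> t * (q (z + s *\<^sub>R y) - s * q y)"
            using qhom[of t "z + s *\<^sub>R y"] t by (simp add: right_diff_distrib mult.assoc)
          then show ?thesis using t by (simp add: field_simps)
        qed
        then have "r (t *\<^sub>R z) / t \<le> r z"
          unfolding r_def[of z] by (intro cINF_greatest) auto
        then show ?thesis using t by (simp add: field_simps)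
      qed
      show "r (t *\<^sub>R z) = t * r z"
      proof (cases "t = 0")
        case True
        have "q 0 = 0" by (rule SL0[OF q])
        have "r 0 = 0"
        proof (rule antisym)
          show "r 0 \<le> 0" using rq[of 0] \<open>q 0 = 0\<close> by simp
          show "0 \<le> r 0" unfolding r_def using qhom by (intro cINF_greatest) auto
        qed
        then show ?thesis using True by simp
      next
        case False
        have "r ((1 / t) *\<^sub>R (t *\<^sub>R z)) \<le> (1 / t) * r (t *\<^sub>R z)"
          using t False by (intro up) auto
        then have "t * r z \<le> r (t *\<^sub>R z)" using t False by (simp add: field_simps)
        then show ?thesis using up[of t z] t False by simp
      qed
    next
      fix z show "r z \<le> p z" using rq[of z] qp[of z] by linarith
    qed
    then have "r = q" using rq by (intro qmin) (auto simp: le_fun_def)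
    then show ?thesis using rle[of 1 x] by simp
  qed
  have add: "q (x + y) = q x + q y" for x y using super[of x y] qsub[of x y] by linarith
  have neg: "q (- x) = - q x" for x using add[of x "- x"] SL0[OF q] by simp
  have "linear q"
  proof (rule linearI)
    fix t :: real and x
    show "q (t *\<^sub>R x) = t *\<^sub>R q x"
    proof (cases "t \<ge> 0")
      case True then show ?thesis using qhom by simp
    next
      case False
      then have "q (- ((- t) *\<^sub>R x)) = - ((- t) * q x)" using qhom[of "- t" x] by (simp only: neg)
      then show ?thesis by simp
    qed
  qed (rule add)
  then show ?thesis using qp by auto
qed

text \<open>A hyperplane is put between the hypograph of \<open>a\<close> over the points
  \<open>\<tau> i\<close> and the graph of \<open>g + c\<close>. The index set has no linear
  structure; \<open>mix\<close> expresses the concavity of \<open>a\<close> along \<tau>. The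
  sublinear functional \<open>s\<close> is the infimum of the quotients \<open>v i t x\<close>. A
  linear functional below it gives the claim through \<open>t = 1\<close>, and continuity of
  \<open>g\<close> at one point makes it bounded.\<close>

lemma fenchel_sandwich:
  fixes g :: "'x::real_normed_vector \<Rightarrow> real" and \<tau> :: "'i \<Rightarrow> 'x" and a :: "'i \<Rightarrow> real"
  assumes cvx: "convex_on UNIV g" and cont: "continuous_on UNIV g" and ne: "I \<noteq> {}"
    and mix: "\<And>i j t. i \<in> I \<Longrightarrow> j \<in> I \<Longrightarrow> 0 < t \<Longrightarrow> t < 1 \<Longrightarrow>
      \<exists>k\<in>I. \<tau> k = (1 - t) *\<^sub>R \<tau> i + t *\<^sub>R \<tau> j \<and> (1 - t) * a i + t * a j \<le> a k"
    and le: "\<And>i. i \<in> I \<Longrightarrow> a i \<le> g (\<tau> i) + c"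
  shows "\<exists>L. \<forall>i\<in>I. \<forall>x. a i - blinfun_apply L (\<tau> i) + (blinfun_apply L x - g x) \<le> c"
proof -
  define v where "v i t x = (g (\<tau> i + t *\<^sub>R x) - a i + c) / t" for i t x
  define s where "s x = Inf {v i t x |i t. i \<in> I \<and> t > 0}" for x
  obtain i0 where i0: "i0 \<in> I" using ne by auto
  have key: "\<exists>k\<in>I. \<exists>w>0. v k w (x + y) \<le> v i t x + v j u y"
    if ij: "i \<in> I" "j \<in> I" and tu: "t > 0" "u > 0" for i j t u x y
  proof -
    \<comment> \<open>Weights with \<open>\<alpha> * t = \<beta> * u = w\<close>: in the mixture of
      the points displaced by \<open>t\<close> along \<open>x\<close> and by \<open>u\<close> along
      \<open>y\<close> both displacements become \<open>w\<close>, and division by \<open>w\<close>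
      turns the weights \<alpha> and \<beta> into 1/t and 1/u.\<close>
    define \<alpha> \<beta> w where "\<alpha> = u / (t + u)" and "\<beta> = t / (t + u)" and "w = t * u / (t + u)"
    have pos: "\<alpha> > 0" "\<beta> > 0" "w > 0" "\<alpha> = 1 - \<beta>" "\<beta> < 1"
      using tu by (auto simp: \<alpha>_def \<beta>_def w_def divide_simps)
    obtain k where k: "k \<in> I" "\<tau> k = (1 - \<beta>) *\<^sub>R \<tau> i + \<beta> *\<^sub>R \<tau> j"
      "(1 - \<beta>) * a i + \<beta> * a j \<le> a k" using mix[OF ij, of \<beta>] pos by auto
    have w: "\<alpha> * t = w" "\<beta> * u = w" by (auto simp: \<alpha>_def \<beta>_def w_def)
    have "\<tau> k + w *\<^sub>R (x + y) = (1 - \<beta>) *\<^sub>R (\<tau> i + t *\<^sub>R x) + \<beta> *\<^sub>R (\<tau> j + u *\<^sub>R y)"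
      using k(2) w pos(4) by (simp add: scaleR_add_right)
    then have "g (\<tau> k + w *\<^sub>R (x + y)) \<le> (1 - \<beta>) * g (\<tau> i + t *\<^sub>R x) + \<beta> * g (\<tau> j + u *\<^sub>R y)"
      using convex_onD[OF cvx, of \<beta>] pos by simp
    then have "g (\<tau> k + w *\<^sub>R (x + y)) - a k + c \<le>
        (1 - \<beta>) * (g (\<tau> i + t *\<^sub>R x) - a i + c) + \<beta> * (g (\<tau> j + u *\<^sub>R y) - a j + c)"
      using k(3) by (simp add: algebra_simps)
    also have "\<dots> = w * (v i t x + v j u y)"
    proof -
      have "w * v i t x = (1 - \<beta>) * (g (\<tau> i + t *\<^sub>R x) - a i + c)"
        using tu by (simp add: v_def pos(4) flip: w(1))
      moreover have "w * v j u y = \<beta> * (g (\<tau> j + u *\<^sub>R y) - a j + c)"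
        using tu by (simp add: v_def flip: w(2))
      ultimately show ?thesis by (simp add: distrib_left)
    qed
    finally have "v k w (x + y) \<le> v i t x + v j u y"
      using pos by (simp add: v_def[of k] field_simps)
    then show ?thesis using k(1) pos by auto
  qed
  \<comment> \<open>The opposite direction \<open>- x\<close> at the reference index cancels the
    displacement, and at displacement 0 the quotient is nonnegative by \<open>le\<close>; hence the
    infimum \<open>s\<close> is finite.\<close>
  have low: "- v i0 1 (- x) \<le> v i t x" if it: "i \<in> I" "t > 0" for i t x
  proof -
    obtain k w where k: "k \<in> I" "w > 0" "v k w (x + - x) \<le> v i t x + v i0 1 (- x)"
      using key[OF it(1) i0 it(2), of 1 x "- x"] by auto
    have "0 \<le> v k w (x + - x)" using le[OF k(1)] k(2) by (simp add: v_def)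
    then show ?thesis using k(3) by linarith
  qed
  have bdd: "bdd_below {v i t x |i t. i \<in> I \<and> t > 0}" for x
    by (rule bdd_belowI[where m="- v i0 1 (- x)"]) (use low in blast)
  have sle: "s x \<le> v i t x" if "i \<in> I" "t > 0" for i t x
    unfolding s_def using that by (intro cInf_lower[OF _ bdd]) auto
  have sge: "b \<le> s x" if "\<And>i t. i \<in> I \<Longrightarrow> t > 0 \<Longrightarrow> b \<le> v i t x" for b x
    unfolding s_def using that i0 zero_less_one by (intro cInf_greatest) blast+
  have "\<exists>L. linear L \<and> (\<forall>x. L x \<le> s x)"
  proof (rule hahn_banach_sublinear)
    fix x y
    have "s (x + y) - v j u y \<le> v i t x" if "i \<in> I" "j \<in> I" "t > 0" "u > 0" for i j t u
      using key[OF that, of x y] sle[of _ _ "x + y"] by force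
    then have "s (x + y) - v j u y \<le> s x" if "j \<in> I" "u > 0" for j u
      using that by (intro sge) auto
    then have "s (x + y) - s x \<le> s y"
      by (intro sge) (auto simp: algebra_simps)
    then show "s (x + y) \<le> s x + s y" by simp
  next
    have up: "t * s x \<le> s (t *\<^sub>R x)" if "t > 0" for t x
    proof (rule sge)
      fix i u assume i: "i \<in> I" "(u::real) > 0"
      have "s x \<le> v i (u * t) x" using i that by (intro sle) auto
      then have "t * s x \<le> t * v i (u * t) x" using that by simp
      also have "\<dots> = v i u (t *\<^sub>R x)" using that i by (simp add: v_def field_simps)
      finally show "t * s x \<le> v i u (t *\<^sub>R x)" .
    qed
    fix t :: real and x assume t: "t \<ge> 0"
    show "s (t *\<^sub>R x) = t * s x"
    proof (cases "t = 0")
      case True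
      have "0 \<le> s 0"
      proof (rule sge)
        fix i u assume "i \<in> I" "(u::real) > 0"
        then show "0 \<le> v i u 0" using le[of i] by (simp add: v_def)
      qed
      moreover have "s 0 \<le> 0"
      proof (rule ccontr)
        assume "\<not> s 0 \<le> 0"
        moreover define B where "B = v i0 1 0"
        \<comment> \<open>At displacement 0 the quotient is \<open>B / u\<close>, which falls below
          a positive \<open>s 0\<close> once \<open>u\<close> exceeds
          \<open>B / s 0\<close>.\<close>
        moreover define u where "u = (B + 1) / s 0"
        ultimately have pos: "s 0 > 0" by simp
        have "B \<ge> 0" using le[OF i0] by (simp add: B_def v_def)
        then have u: "u > 0" using pos by (simp add: u_def)
        have "s 0 \<le> v i0 u 0" by (rule sle[OF i0 u])
        also have "\<dots> = B / u" by (simp add: v_def B_def)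
        also have "\<dots> = s 0 * (B / (B + 1))" by (simp add: u_def)
        also have "\<dots> < s 0 * 1" using pos \<open>B \<ge> 0\<close> by (intro mult_strict_left_mono) auto
        finally show False by simp
      qed
      ultimately show ?thesis using True by simp
    next
      case False
      have "(1 / t) * s (t *\<^sub>R x) \<le> s ((1 / t) *\<^sub>R (t *\<^sub>R x))" using t False by (intro up) auto
      then have "s (t *\<^sub>R x) \<le> t * s x" using t False by (simp add: field_simps)
      then show ?thesis using up[of t x] t False by simp
    qed
  qed
  then obtain L where L: "linear L" "\<And>x. L x \<le> s x" by auto
  have Lle: "L x \<le> g (\<tau> i + x) - a i + c" if "i \<in> I" for i x
    using L(2)[of x] sle[OF that zero_less_one, of x] by (simp add: v_def)
  have "isCont g (\<tau> i0)" using cont by (simp add: continuous_on_eq_continuous_at)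
  then obtain d where d: "d > 0" "\<And>y. dist y (\<tau> i0) < d \<Longrightarrow> dist (g y) (g (\<tau> i0)) < 1"
    unfolding continuous_at_eps_delta using zero_less_one by blast
  define C where "C = g (\<tau> i0) + 1 - a i0 + c"
  have C: "L x \<le> C" if "norm x < d" for x
    using Lle[OF i0, of x] d(2)[of "\<tau> i0 + x"] that
    by (auto simp: C_def dist_norm)
  \<comment> \<open>Scaling \<open>x\<close> to norm \<open>d / 2\<close> moves it into the ball
    where \<open>L\<close> is at most \<open>C\<close>; used for \<open>x\<close> and
    \<open>- x\<close>, the estimate bounds the absolute value.\<close>
  have bound: "L x \<le> 2 * C / d * norm x" for x
  proof (cases "x = 0")
    case True then show ?thesis using L(1) by (simp add: linear_0)
  next
    case False
    define t where "t = d / (2 * norm x)"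
    have t: "t > 0" using d False by (simp add: t_def)
    have "norm (t *\<^sub>R x) < d" using d False by (simp add: t_def)
    then have "L (t *\<^sub>R x) \<le> C" by (rule C)
    then have "t * L x \<le> C" using linear_scale[OF L(1)] by simp
    then have "L x \<le> C / t" using t by (simp add: field_simps)
    also have "C / t = 2 * C / d * norm x" by (simp add: t_def)
    finally show ?thesis .
  qed
  have "bounded_linear L"
  proof (rule bounded_linear_intro[where K="2 * C / d"])
    show "L (x + y) = L x + L y" for x y by (rule linear_add[OF L(1)])
    show "L (r *\<^sub>R x) = r *\<^sub>R L x" for r x by (rule linear_scale[OF L(1)])
    show "norm (L x) \<le> norm x * (2 * C / d)" for x
      using bound[of x] bound[of "- x"] by (simp add: linear_neg[OF L(1)] abs_le_iff mult.commute)
  qed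
  then have app: "blinfun_apply (Blinfun L) = L" by (rule bounded_linear_Blinfun_apply)
  have "a i - L (\<tau> i) + (L x - g x) \<le> c" if "i \<in> I" for i x
    using Lle[OF that, of "x - \<tau> i"] by (simp add: linear_diff[OF L(1)])
  then show ?thesis by (intro exI[of _ "Blinfun L"]) (simp add: app)
qed

section \<open>Conjugates, subgradients and attained duality\<close>

lemma conjugate_ge: "ereal (blinfun_apply L z - g z) \<le> conjugate g L"
  unfolding conjugate_def by (rule SUP_upper) simp

lemma conjugate_gt_MInf: "- \<infinity> < conjugate g L"
  using conjugate_ge[of L 0 g] by (cases "conjugate g L") auto

text \<open>The equality case of the Fenchel-Young inequality. It recognises subgradients by
  comparing values, which is how optimal functionals of the game are identified.\<close>

lemma subdifferential_iff_conjugate: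
  "L \<in> subdifferential g z \<longleftrightarrow> conjugate g L = ereal (blinfun_apply L z - g z)"
proof
  assume "L \<in> subdifferential g z"
  then have "conjugate g L \<le> ereal (blinfun_apply L z - g z)"
    unfolding conjugate_def subdifferential_def
    by (intro SUP_least) (auto simp: blinfun.diff_right algebra_simps)
  then show "conjugate g L = ereal (blinfun_apply L z - g z)"
    using conjugate_ge by (rule antisym)
next
  assume eq: "conjugate g L = ereal (blinfun_apply L z - g z)"
  have "blinfun_apply L y - g y \<le> blinfun_apply L z - g z" for y
    using conjugate_ge[of L y g] by (simp add: eq)
  then show "L \<in> subdifferential g z"
    unfolding subdifferential_def by (auto simp: blinfun.diff_right algebra_simps)
qed

text \<open>The sandwich lemma with the single point \<open>z\<close>, where mixing is trivial and
  the affine function in between supports \<open>g\<close> at \<open>z\<close>.\<close>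

lemma subdifferential_nonempty:
  assumes "convex_on UNIV g" "continuous_on UNIV g"
  shows "\<exists>L. L \<in> subdifferential g z"
proof -
  have "\<exists>L. \<forall>i\<in>{()}. \<forall>x. g z - blinfun_apply L z + (blinfun_apply L x - g x) \<le> 0"
    by (rule fenchel_sandwich[OF assms]) (simp_all add: scaleR_diff_left left_diff_distrib)
  then show ?thesis
    unfolding subdifferential_def by (auto simp: blinfun.diff_right algebra_simps)
qed

lemma fenchel_weak_duality:
  "(SUP i\<in>I. a i - ereal (g (\<tau> i))) \<le> (SUP i\<in>I. a i - ereal (blinfun_apply y (\<tau> i))) + conjugate g y"
proof (rule SUP_least)
  fix i assume "i \<in> I"
  have "a i - ereal (g (\<tau> i)) = (a i - ereal (blinfun_apply y (\<tau> i)))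
      + ereal (blinfun_apply y (\<tau> i) - g (\<tau> i))"
    by (cases "a i") auto
  also have "\<dots> \<le> (SUP i\<in>I. a i - ereal (blinfun_apply y (\<tau> i))) + conjugate g y"
    by (intro add_mono conjugate_ge SUP_upper \<open>i \<in> I\<close>)
  finally show "a i - ereal (g (\<tau> i)) \<le>
    (SUP i\<in>I. a i - ereal (blinfun_apply y (\<tau> i))) + conjugate g y" .
qed

text \<open>The sandwich lemma with \<open>c = s\<close>: its bound holds for \<open>i\<close> and
  \<open>x\<close> independently, so the supremum over \<open>i\<close> and the conjugate can be
  taken separately and add up to at most \<open>s\<close>. The converse is weak duality.\<close>

lemma fenchel_duality_attained:
  fixes g :: "'x::real_normed_vector \<Rightarrow> real" and \<tau> :: "'i \<Rightarrow> 'x" and a :: "'i \<Rightarrow> ereal"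
  assumes cvx: "convex_on UNIV g" and cont: "continuous_on UNIV g"
    and mix: "\<And>i j t. i \<in> I \<Longrightarrow> j \<in> I \<Longrightarrow> 0 < t \<Longrightarrow> t < 1 \<Longrightarrow>
      \<exists>k\<in>I. \<tau> k = (1 - t) *\<^sub>R \<tau> i + t *\<^sub>R \<tau> j \<and> ereal (1 - t) * a i + ereal t * a j \<le> a k"
    and s: "(SUP i\<in>I. a i - ereal (g (\<tau> i))) = ereal s"
  shows "\<exists>y. (SUP i\<in>I. a i - ereal (blinfun_apply y (\<tau> i))) + conjugate g y = ereal s"
proof -
  have up: "a i - ereal (g (\<tau> i)) \<le> ereal s" if "i \<in> I" for i
    unfolding s[symmetric] using that by (rule SUP_upper)
  \<comment> \<open>Indices with value \<open>- \<infinity>\<close> do not influence the supremum;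
    on the others \<open>a\<close> is real, because \<open>s\<close> bounds it from above.\<close>
  define J where "J = {i\<in>I. a i \<noteq> - \<infinity>}"
  define b where "b i = real_of_ereal (a i)" for i
  have ab: "a i = ereal (b i)" if "i \<in> J" for i
    using that up[of i] by (cases "a i") (auto simp: J_def b_def)
  have "J \<noteq> {}"
  proof
    assume "J = {}"
    then have "(SUP i\<in>I. a i - ereal (g (\<tau> i))) \<le> - \<infinity>"
      by (intro SUP_least) (auto simp: J_def)
    then show False by (simp add: s)
  qed
  have "\<exists>L. \<forall>i\<in>J. \<forall>x. b i - blinfun_apply L (\<tau> i) + (blinfun_apply L x - g x) \<le> s"
  proof (rule fenchel_sandwich[OF cvx cont \<open>J \<noteq> {}\<close>])
    fix i j and t :: real assume ij: "i \<in> J" "j \<in> J" "0 < t" "t < 1"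
    then obtain k where k: "k \<in> I" "\<tau> k = (1 - t) *\<^sub>R \<tau> i + t *\<^sub>R \<tau> j"
      "ereal (1 - t) * a i + ereal t * a j \<le> a k"
      using mix[of i j t] by (auto simp: J_def)
    then have *: "ereal ((1 - t) * b i + t * b j) \<le> a k" using ab ij by simp
    then have "k \<in> J" using k(1) by (auto simp: J_def)
    then show "\<exists>k\<in>J. \<tau> k = (1 - t) *\<^sub>R \<tau> i + t *\<^sub>R \<tau> j \<and> (1 - t) * b i + t * b j \<le> b k"
      using k(2) * ab by auto
  next
    fix i assume i: "i \<in> J"
    then have "i \<in> I" by (simp add: J_def)
    then show "b i \<le> g (\<tau> i) + s" using up[of i] ab[OF i] by simp
  qed
  then obtain L where L: "\<And>i x. i \<in> J \<Longrightarrow> b i - blinfun_apply L (\<tau> i) + (blinfun_apply L x - g x) \<le> s"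
    by blast
  have conj: "conjugate g L \<le> ereal (s - (b i - blinfun_apply L (\<tau> i)))" if "i \<in> J" for i
    unfolding conjugate_def using L[OF that] by (intro SUP_least) (simp add: algebra_simps)
  obtain i0 where "i0 \<in> J" using \<open>J \<noteq> {}\<close> by auto
  then obtain c where c: "conjugate g L = ereal c"
    using conj[of i0] conjugate_gt_MInf[of g L] by (cases "conjugate g L") auto
  have "(SUP i\<in>I. a i - ereal (blinfun_apply L (\<tau> i))) \<le> ereal (s - c)"
  proof (rule SUP_least)
    fix i assume i: "i \<in> I"
    show "a i - ereal (blinfun_apply L (\<tau> i)) \<le> ereal (s - c)"
    proof (cases "i \<in> J")
      case True then show ?thesis using conj[OF True] ab[OF True] by (simp add: c)
    next
      case False then show ?thesis using i by (simp add: J_def)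
    qed
  qed
  then have "(SUP i\<in>I. a i - ereal (blinfun_apply L (\<tau> i))) + conjugate g L \<le> ereal (s - c) + ereal c"
    unfolding c by (rule add_right_mono)
  then show ?thesis
    using fenchel_weak_duality[of a g \<tau> I L] by (intro exI[of _ L] antisym) (simp_all add: s)
qed

section \<open>Sequential weak compactness\<close>

lemma integral_infdist_tendsto_measure_closed:
  fixes C :: "'a::metric_space set"
  assumes "finite_measure M" and M: "sets M = sets borel" and C: "closed C" "C \<noteq> {}"
  shows "(\<lambda>k. \<integral>x. max 0 (1 - real k * infdist x C) \<partial>M) \<longlonglongrightarrow> measure M C"
    and "(\<lambda>k. \<integral>x. \<bar>indicator C x - max 0 (1 - real k * infdist x C)\<bar> \<partial>M) \<longlonglongrightarrow> 0"
proof -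
  interpret finite_measure M by fact
  define f where "f k x = max 0 (1 - real k * infdist x C)" for k x
  have cont: "continuous_on UNIV (f k)" for k unfolding f_def by (intro continuous_intros)
  have [measurable]: "f k \<in> borel_measurable M" for k
    using borel_measurable_continuous_onI[OF cont] measurable_cong_sets[OF M refl] by blast
  have [measurable]: "C \<in> sets M" using C(1) M by simp
  have lim: "(\<lambda>k. f k x) \<longlonglongrightarrow> indicator C x" for x
  proof (cases "x \<in> C")
    case True then show ?thesis by (simp add: f_def)
  next
    case False
    then have pos: "infdist x C > 0" using C by (simp add: infdist_pos_not_in_closed)
    have "eventually (\<lambda>k. f k x = 0) sequentially"
      using eventually_ge_at_top[of "nat \<lceil>1 / infdist x C\<rceil>"]
    proof eventually_elim
      case (elim k)
      then have "1 / infdist x C \<le> real k" by linarith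
      then show ?case using pos by (simp add: f_def field_simps)
    qed
    then show ?thesis using False by (simp add: tendsto_eventually)
  qed
  have bd: "norm (f k x) \<le> 1" for k x by (simp add: f_def infdist_nonneg)
  have "(\<lambda>k. \<integral>x. f k x \<partial>M) \<longlonglongrightarrow> (\<integral>x. indicator C x \<partial>M)"
    by (rule integral_dominated_convergence[where w="\<lambda>_. 1"]) (use lim bd in auto)
  then show "(\<lambda>k. \<integral>x. max 0 (1 - real k * infdist x C) \<partial>M) \<longlonglongrightarrow> measure M C"
    by (simp add: f_def)
  have "(\<lambda>k. \<integral>x. \<bar>indicator C x - f k x\<bar> \<partial>M) \<longlonglongrightarrow> (\<integral>x. 0 \<partial>M)"
  proof (rule integral_dominated_convergence[where w="\<lambda>_. 1"])
    show "AE x in M. (\<lambda>k. \<bar>indicator C x - f k x\<bar>) \<longlonglongrightarrow> 0"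
    proof (rule AE_I2)
      fix x
      have "(\<lambda>k. indicator C x - f k x) \<longlonglongrightarrow> indicator C x - indicator C x"
        by (intro tendsto_intros lim)
      then show "(\<lambda>k. \<bar>indicator C x - f k x\<bar>) \<longlonglongrightarrow> 0" by (simp add: tendsto_rabs_zero_iff)
    qed
    show "AE x in M. norm \<bar>indicator C x - f k x\<bar> \<le> 1" for k
      by (auto simp: f_def indicator_def infdist_nonneg)
  qed auto
  then show "(\<lambda>k. \<integral>x. \<bar>indicator C x - max 0 (1 - real k * infdist x C)\<bar> \<partial>M) \<longlonglongrightarrow> 0"
    by (simp add: f_def)
qed

text \<open>Closed sets form an intersection-stable generator of the Borel sets, and their
  indicators are limits of the continuous functions
  \<open>max 0 (1 - real k * infdist x X)\<close>.\<close>

lemma measure_eqI_continuous: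
  fixes M N :: "'a::metric_space measure"
  assumes "finite_measure M" "finite_measure N" and M: "sets M = sets borel" and N: "sets N = sets borel"
    and eq: "\<And>f :: 'a \<Rightarrow> real. continuous_on UNIV f \<Longrightarrow> (\<And>x. 0 \<le> f x) \<Longrightarrow> (\<And>x. f x \<le> 1) \<Longrightarrow>
      (\<integral>x. f x \<partial>M) = (\<integral>x. f x \<partial>N)"
  shows "M = N"
proof (rule measure_eqI_generator_eq[where E="Collect closed" and \<Omega>=UNIV and A="\<lambda>_. UNIV"])
  interpret M: finite_measure M by fact
  interpret N: finite_measure N by fact
  show "Int_stable (Collect closed)" by (auto simp: Int_stable_def)
  show "sets M = sigma_sets UNIV (Collect closed)" "sets N = sigma_sets UNIV (Collect closed)"
    unfolding M N by (simp_all add: borel_eq_closed)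
  fix X :: "'a set" assume "X \<in> Collect closed"
  then have X: "closed X" by simp
  show "emeasure M X = emeasure N X"
  proof (cases "X = {}")
    case False
    have "(\<integral>x. max 0 (1 - real k * infdist x X) \<partial>M) = (\<integral>x. max 0 (1 - real k * infdist x X) \<partial>N)" for k
      by (rule eq) (auto intro!: continuous_intros simp: infdist_nonneg)
    then have "measure M X = measure N X"
      using integral_infdist_tendsto_measure_closed(1)[OF assms(1) M X False]
        integral_infdist_tendsto_measure_closed(1)[OF assms(2) N X False]
      by (simp add: LIMSEQ_unique)
    then show ?thesis by (simp add: M.emeasure_eq_measure N.emeasure_eq_measure)
  qed simp
qed (auto simp: finite_measure.emeasure_finite[OF assms(1)])

text \<open>The functions approximable in mean, collected in \<open>P\<close>, contain indicators of
  closed sets and are stable under sums, multiples and dominated limits. Dynkin's argument extends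
  this to indicators of Borel sets, and induction over integrable functions to all of them.\<close>

lemma continuous_L1_dense:
  fixes f :: "'a::metric_space \<Rightarrow> real"
  assumes "finite_measure M" and M: "sets M = sets borel" and f: "integrable M f" and "e > 0"
  shows "\<exists>\<psi>. continuous_on UNIV \<psi> \<and> bounded (range \<psi>) \<and> (\<integral>x. \<bar>f x - \<psi> x\<bar> \<partial>M) < e"
proof -
  interpret finite_measure M by fact
  define P where "P f \<longleftrightarrow> (\<forall>e>0. \<exists>\<psi>. continuous_on UNIV \<psi> \<and> bounded (range \<psi>) \<and>
    (\<integral>x. \<bar>f x - \<psi> x\<bar> \<partial>M) < e)" for f :: "'a \<Rightarrow> real"
  have int: "integrable M \<psi>" if c: "continuous_on UNIV \<psi>" and b: "bounded (range \<psi>)" for \<psi> :: "'a \<Rightarrow> real"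
  proof -
    obtain B where "\<And>x. norm (\<psi> x) \<le> B" using b by (auto simp: bounded_iff)
    moreover have "\<psi> \<in> borel_measurable M"
      using borel_measurable_continuous_onI[OF c] measurable_cong_sets[OF M refl] by blast
    ultimately show ?thesis by (intro integrable_const_bound[of _ B]) auto
  qed
  have Padd: "P (\<lambda>x. f x + g x)" if fg: "integrable M f" "P f" "integrable M g" "P g" for f g
    unfolding P_def
  proof (intro allI impI)
    fix e :: real assume "e > 0"
    then have "e / 2 > 0" by simp
    obtain \<psi> where 1: "continuous_on UNIV \<psi>" "bounded (range \<psi>)" "(\<integral>x. \<bar>f x - \<psi> x\<bar> \<partial>M) < e / 2"
      using fg(2) \<open>e / 2 > 0\<close> unfolding P_def by blast
    obtain \<eta> where 2: "continuous_on UNIV \<eta>" "bounded (range \<eta>)" "(\<integral>x. \<bar>g x - \<eta> x\<bar> \<partial>M) < e / 2"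
      using fg(4) \<open>e / 2 > 0\<close> unfolding P_def by blast
    have "(\<integral>x. \<bar>f x + g x - (\<psi> x + \<eta> x)\<bar> \<partial>M) \<le> (\<integral>x. \<bar>f x - \<psi> x\<bar> + \<bar>g x - \<eta> x\<bar> \<partial>M)"
      using fg(1,3) int[OF 1(1,2)] int[OF 2(1,2)] by (intro integral_mono) auto
    also have "\<dots> = (\<integral>x. \<bar>f x - \<psi> x\<bar> \<partial>M) + (\<integral>x. \<bar>g x - \<eta> x\<bar> \<partial>M)"
      using fg(1,3) int[OF 1(1,2)] int[OF 2(1,2)] by (intro Bochner_Integration.integral_add) auto
    also have "\<dots> < e" using 1(3) 2(3) by simp
    finally show "\<exists>\<psi>. continuous_on UNIV \<psi> \<and> bounded (range \<psi>) \<and> (\<integral>x. \<bar>f x + g x - \<psi> x\<bar> \<partial>M) < e"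
      using 1 2 by (intro exI[of _ "\<lambda>x. \<psi> x + \<eta> x"]) (auto intro!: continuous_intros bounded_plus_comp)
  qed
  have Plim: "P g" if s: "\<And>i. integrable M (s i)" "\<And>i. P (s i)"
    and lim: "\<And>x. x \<in> space M \<Longrightarrow> (\<lambda>i. s i x) \<longlonglongrightarrow> g x" and w: "integrable M w" and g: "integrable M g"
    and bd: "\<And>i x. x \<in> space M \<Longrightarrow> norm (s i x) \<le> w x" for s g and w :: "'a \<Rightarrow> real"
    unfolding P_def
  proof (intro allI impI)
    fix e :: real assume "e > 0"
    have "(\<lambda>i. \<integral>x. \<bar>g x - s i x\<bar> \<partial>M) \<longlonglongrightarrow> (\<integral>x. 0 \<partial>M)"
    proof (rule integral_dominated_convergence[where w="\<lambda>x. \<bar>g x\<bar> + w x"])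
      show "AE x in M. (\<lambda>i. \<bar>g x - s i x\<bar>) \<longlonglongrightarrow> 0"
      proof (rule AE_I2)
        fix x assume "x \<in> space M"
        then have "(\<lambda>i. g x - s i x) \<longlonglongrightarrow> g x - g x" by (intro tendsto_intros lim)
        then show "(\<lambda>i. \<bar>g x - s i x\<bar>) \<longlonglongrightarrow> 0" by (simp add: tendsto_rabs_zero_iff)
      qed
      show "AE x in M. norm \<bar>g x - s i x\<bar> \<le> \<bar>g x\<bar> + w x" for i
        using bd by (intro AE_I2) (smt (verit) real_norm_def)
    qed (use w g s(1) in \<open>auto intro: borel_measurable_integrable\<close>)
    then have "eventually (\<lambda>i. (\<integral>x. \<bar>g x - s i x\<bar> \<partial>M) < e / 2) sequentially"
      by (rule order_tendstoD(2)) (use \<open>e > 0\<close> in simp)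
    then obtain i where i: "(\<integral>x. \<bar>g x - s i x\<bar> \<partial>M) < e / 2"
      unfolding eventually_sequentially by blast
    obtain \<psi> where 1: "continuous_on UNIV \<psi>" "bounded (range \<psi>)" "(\<integral>x. \<bar>s i x - \<psi> x\<bar> \<partial>M) < e / 2"
      using s(2)[of i] \<open>e > 0\<close> half_gt_zero unfolding P_def by blast
    have "(\<integral>x. \<bar>g x - \<psi> x\<bar> \<partial>M) \<le> (\<integral>x. \<bar>g x - s i x\<bar> + \<bar>s i x - \<psi> x\<bar> \<partial>M)"
      using g s(1)[of i] int[OF 1(1,2)] by (intro integral_mono) auto
    also have "\<dots> = (\<integral>x. \<bar>g x - s i x\<bar> \<partial>M) + (\<integral>x. \<bar>s i x - \<psi> x\<bar> \<partial>M)"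
      using g s(1)[of i] int[OF 1(1,2)] by (intro Bochner_Integration.integral_add) auto
    also have "\<dots> < e" using 1(3) i by simp
    finally show "\<exists>\<psi>. continuous_on UNIV \<psi> \<and> bounded (range \<psi>) \<and> (\<integral>x. \<bar>g x - \<psi> x\<bar> \<partial>M) < e"
      using 1 by blast
  qed
  have Pscale: "P (\<lambda>x. f x * c)" if f: "integrable M f" "P f" for f and c :: real
    unfolding P_def
  proof (intro allI impI)
    fix e :: real assume "e > 0"
    then have "e / (\<bar>c\<bar> + 1) > 0" by (simp add: add_nonneg_pos)
    then obtain \<psi> where 1: "continuous_on UNIV \<psi>" "bounded (range \<psi>)" "(\<integral>x. \<bar>f x - \<psi> x\<bar> \<partial>M) < e / (\<bar>c\<bar> + 1)"
      using f(2) unfolding P_def by blast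
    have "(\<integral>x. \<bar>f x * c - \<psi> x * c\<bar> \<partial>M) = (\<integral>x. \<bar>f x - \<psi> x\<bar> * \<bar>c\<bar> \<partial>M)"
      by (intro Bochner_Integration.integral_cong) (simp_all flip: abs_mult add: left_diff_distrib)
    also have "\<dots> = (\<integral>x. \<bar>f x - \<psi> x\<bar> \<partial>M) * \<bar>c\<bar>" by simp
    also have "\<dots> \<le> (\<integral>x. \<bar>f x - \<psi> x\<bar> \<partial>M) * (\<bar>c\<bar> + 1)" by (intro mult_left_mono) auto
    also have "\<dots> < e" using 1(3) by (simp add: field_simps)
    finally have "(\<integral>x. \<bar>f x * c - \<psi> x * c\<bar> \<partial>M) < e" .
    moreover have "bounded (range (\<lambda>x. \<psi> x * c))"
      using bounded_scaleR_comp[OF 1(2), of c] by (simp add: mult.commute)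
    ultimately show "\<exists>\<psi>. continuous_on UNIV \<psi> \<and> bounded (range \<psi>) \<and> (\<integral>x. \<bar>f x * c - \<psi> x\<bar> \<partial>M) < e"
      using 1(1) by (intro exI[of _ "\<lambda>x. \<psi> x * c"]) (auto intro!: continuous_intros)
  qed
  have P0: "P (\<lambda>x. c)" for c unfolding P_def by (auto intro!: exI[of _ "\<lambda>_. c"] simp: image_def)
  have ind: "P (indicator A)" if "A \<in> sets M" for A
  proof -
    have SM: "sigma_sets UNIV (Collect closed) = sets M" unfolding M by (simp add: borel_eq_closed)
    have "Int_stable (Collect closed :: 'a set set)" "Collect closed \<subseteq> Pow (UNIV :: 'a set)"
      "A \<in> sigma_sets UNIV (Collect closed)"
      using that by (auto simp: Int_stable_def SM)
    then show ?thesis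
    proof (induction rule: sigma_sets_induct_disjoint)
      case (basic C)
      then have C: "closed C" by simp
      show ?case
      proof (cases "C = {}")
        case True then show ?thesis using P0[of 0] by simp
      next
        case False
        show ?thesis unfolding P_def
        proof (intro allI impI)
          fix e :: real assume "e > 0"
          have "eventually (\<lambda>k. (\<integral>x. \<bar>indicator C x - max 0 (1 - real k * infdist x C)\<bar> \<partial>M) < e) sequentially"
            by (rule order_tendstoD(2)[OF integral_infdist_tendsto_measure_closed(2)[OF assms(1) M C False] \<open>e > 0\<close>])
          then obtain k where "(\<integral>x. \<bar>indicator C x - max 0 (1 - real k * infdist x C)\<bar> \<partial>M) < e"
            unfolding eventually_sequentially by blast
          then show "\<exists>\<psi>. continuous_on UNIV \<psi> \<and> bounded (range \<psi>) \<and> (\<integral>x. \<bar>indicator C x - \<psi> x\<bar> \<partial>M) < e"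
            by (intro exI[of _ "\<lambda>x. max 0 (1 - real k * infdist x C)"])
              (auto intro!: continuous_intros simp: bounded_iff infdist_nonneg intro!: exI[of _ 1])
        qed
      qed
    next
      case empty
      then show ?case using P0[of 0] by simp
    next
      case (compl A)
      then have [measurable]: "A \<in> sets M" by (simp add: SM)
      have "P (\<lambda>x. 1 + indicator A x * (-1))"
        by (intro Padd Pscale P0 compl.IH) (simp_all add: less_top[symmetric])
      moreover have "(\<lambda>x. 1 + indicator A x * (-1)) = (indicator (UNIV - A) :: 'a \<Rightarrow> real)"
        by (auto simp: indicator_def)
      ultimately show ?case by simp
    next
      case (union A)
      then have [measurable]: "A i \<in> sets M" for i by (auto simp: SM)
      have fin: "P (\<lambda>x. \<Sum>i<n. indicator (A i) x)" for n
        by (induction n) (auto intro!: Padd P0 union.IH Bochner_Integration.integrable_sum simp: less_top[symmetric])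
      show ?case
      proof (rule Plim[where w="\<lambda>_. 1" and s="\<lambda>n x. \<Sum>i<n. indicator (A i) x"])
        have *: "(\<Sum>i<n. indicator (A i) x) = (indicator (\<Union>i<n. A i) x :: real)" for n x
          by (intro indicator_UN_disjoint[symmetric]) (use union(1) in \<open>auto intro: disjoint_family_on_mono\<close>)
        show "(\<lambda>n. \<Sum>i<n. indicator (A i) x) \<longlonglongrightarrow> (indicator (\<Union> (range A)) x :: real)" for x
          unfolding * by (rule LIMSEQ_indicator_UN)
        show "norm (\<Sum>i<n. indicator (A i) x :: real) \<le> 1" for n x by (simp add: *)
      qed (use fin in \<open>auto simp: less_top[symmetric]\<close>)
    qed
  qed
  from f have "P f"
  proof (induction rule: integrable_induct)
    case (base A c)
    then show ?case using Pscale[OF _ ind[OF base(1)], of c] by simp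
  next
    case (add f g) then show ?case by (intro Padd)
  next
    case (lim f s)
    show ?case by (rule Plim[of s f "\<lambda>x. 2 * norm (f x)"]) (use lim in auto)
  qed
  then show ?thesis using \<open>e > 0\<close> by (simp add: P_def)
qed

text \<open>Basis sets whose points are pairwise closer than \<open>e\<close> cover the space, and
  finitely many of them suffice; \<open>N\<close> bounds their indices. Points with equal membership
  below \<open>N\<close> lie in a common small set.\<close>

lemma separating_open_sequence:
  assumes "compact (UNIV :: 'a::polish_space set)"
  obtains B :: "nat \<Rightarrow> 'a::polish_space set" where "\<And>k. open (B k)"
    "\<And>e. e > 0 \<Longrightarrow> \<exists>N. \<forall>x y. (\<forall>k<N. x \<in> B k \<longleftrightarrow> y \<in> B k) \<longrightarrow> dist x y < e"
proof -
  obtain \<B> :: "'a set set" where \<B>: "countable \<B>" "topological_basis \<B>"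
    using ex_countable_basis by auto
  have "\<B> \<noteq> {}" using topological_basisE[OF \<B>(2) open_UNIV, of undefined] by auto
  define B where "B = from_nat_into \<B>"
  have rB: "range B = \<B>" unfolding B_def by (rule range_from_nat_into[OF \<open>\<B> \<noteq> {}\<close> \<B>(1)])
  show ?thesis
  proof
    show "open (B k)" for k using rB \<B>(2) topological_basis_open by blast
    fix e :: real assume e: "e > 0"
    define I where "I = {k. \<forall>x\<in>B k. \<forall>y\<in>B k. dist x y < e}"
    have cov: "UNIV \<subseteq> (\<Union>k\<in>I. B k)"
    proof
      fix x :: 'a
      have "open (ball x (e/2))" "x \<in> ball x (e/2)" using e by auto
      then obtain b where b: "b \<in> \<B>" "x \<in> b" "b \<subseteq> ball x (e/2)"
        using topological_basisE[OF \<B>(2)] by metis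
      then obtain k where "b = B k" using rB by auto
      moreover have "dist y z < e" if "y \<in> b" "z \<in> b" for y z
      proof -
        have "dist x y < e/2" "dist x z < e/2" using that b(3) by auto
        then show ?thesis using dist_triangle2[of y z x] by (simp add: dist_commute)
      qed
      ultimately show "x \<in> (\<Union>k\<in>I. B k)" using b(2) by (auto simp: I_def)
    qed
    obtain J where J: "J \<subseteq> I" "finite J" "UNIV \<subseteq> (\<Union>k\<in>J. B k)"
      using compactE_image[OF assms _ cov] \<open>\<And>k. open (B k)\<close> by metis
    obtain N where N: "\<forall>k\<in>J. k < N" using finite_nat_set_iff_bounded J(2) by auto
    have "dist x y < e" if "\<forall>k<N. x \<in> B k \<longleftrightarrow> y \<in> B k" for x y
    proof -
      obtain k where "k \<in> J" "x \<in> B k" using J(3) by auto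
      moreover then have "y \<in> B k" using that N by auto
      ultimately show ?thesis using J(1) by (auto simp: I_def)
    qed
    then show "\<exists>N. \<forall>x y. (\<forall>k<N. x \<in> B k \<longleftrightarrow> y \<in> B k) \<longrightarrow> dist x y < e" by auto
  qed
qed

text \<open>The space is coded into the Cantor set: membership of a point in the sets of a separating
  sequence gives its ternary digits, which continuous functions of a real number read off. Helly's
  theorem on the line then yields the limit, which is decoded along the digits.\<close>

primrec digit_tail :: "nat \<Rightarrow> real \<Rightarrow> real" where
  "digit_tail 0 t = t"
| "digit_tail (Suc k) t = 3 * digit_tail k t - 2 * max 0 (min 1 (3 * digit_tail k t - 1))"

text \<open>A continuous reading of the leading ternary digit of the tail: 0 up to 1/3, 1 from 2/3
  on, linear in the removed middle third. On Cantor points it takes only the values 0 and 1.\<close>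

definition digit :: "nat \<Rightarrow> real \<Rightarrow> real"
  where "digit k t = max 0 (min 1 (3 * digit_tail k t - 1))"

text \<open>Multilinear interpolation in the digits: the mean of \<open>F\<close> over a random set
  that contains each \<open>k < n\<close> independently with probability \<open>digit k t\<close>.
  It is continuous in \<open>t\<close> and reads off \<open>F\<close> exactly when all these digits
  are 0 or 1.\<close>

primrec digit_interp :: "nat \<Rightarrow> (nat set \<Rightarrow> real) \<Rightarrow> real \<Rightarrow> real" where
  "digit_interp 0 F t = F {}"
| "digit_interp (Suc n) F t = digit n t * digit_interp n (\<lambda>p. F (insert n p)) t
    + (1 - digit n t) * digit_interp n F t"

lemma continuous_digit: "continuous_on UNIV (digit k)"
proof -
  have "continuous_on UNIV (digit_tail k)" for k
    by (induction k) (auto intro!: continuous_intros)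
  then show ?thesis unfolding digit_def by (intro continuous_intros)
qed

lemma continuous_digit_interp: "continuous_on UNIV (digit_interp n F)"
  by (induction n arbitrary: F) (auto intro!: continuous_intros continuous_digit)

lemma digit_bounds: "0 \<le> digit k t" "digit k t \<le> 1"
  by (auto simp: digit_def)

lemma digit_interp_bounded:
  assumes "\<And>p. \<bar>F p\<bar> \<le> b"
  shows "\<bar>digit_interp n F t\<bar> \<le> b"
  using assms
proof (induction n arbitrary: F)
  case (Suc n)
  have "\<bar>digit_interp (Suc n) F t\<bar> \<le> digit n t * \<bar>digit_interp n (\<lambda>p. F (insert n p)) t\<bar>
      + (1 - digit n t) * \<bar>digit_interp n F t\<bar>"
    using digit_bounds[of n t] by (simp add: order_trans[OF abs_triangle_ineq] abs_mult)
  also have "\<dots> \<le> digit n t * b + (1 - digit n t) * b"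
    using digit_bounds[of n t] by (intro add_mono mult_left_mono Suc) auto
  finally show ?case by (simp add: algebra_simps)
qed simp

lemma digit_interp_eq:
  assumes "\<And>k. k < n \<Longrightarrow> digit k t = 0 \<or> digit k t = 1"
  shows "digit_interp n F t = F {k. k < n \<and> digit k t = 1}"
  using assms
proof (induction n arbitrary: F)
  case (Suc n)
  have 01: "digit n t = 0 \<or> digit n t = 1" using Suc.prems by simp
  have "{k. k < Suc n \<and> digit k t = 1} =
      (if digit n t = 1 then insert n {k. k < n \<and> digit k t = 1} else {k. k < n \<and> digit k t = 1})"
    by (auto simp: less_Suc_eq)
  then show ?case using Suc.IH[of F] Suc.IH[of "\<lambda>p. F (insert n p)"] Suc.prems 01
    by (cases "digit n t = 1") simp_all
qed simp

text \<open>\<open>S j x\<close> is the real number whose ternary digits are twice the indicators of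
  \<open>B j\<close>, \<open>B (j + 1)\<close>, ... at \<open>x\<close>. The recursion for
  \<open>S j\<close> shows that removing the leading digit leads from \<open>S j\<close> to
  \<open>S (Suc j)\<close>, so the digits of \<open>S 0\<close> are the indicators.\<close>

lemma cantor_code:
  fixes B :: "nat \<Rightarrow> 'a set"
  obtains s :: "'a \<Rightarrow> real" where "\<And>x k. digit k (s x) = indicator (B k) x" "\<And>x. 0 \<le> s x" "\<And>x. s x \<le> 1"
    "\<And>M. (\<And>k. B k \<in> sets M) \<Longrightarrow> s \<in> borel_measurable M"
proof
  define S where "S j x = (\<Sum>k. (2/3) * indicator (B (k + j)) x * (1/3)^k :: real)" for j and x :: 'a
  have g: "(\<lambda>k. (2/3) * (1/3)^k) sums (1::real)"
    using sums_mult[OF geometric_sums[of "1/3::real"], of "2/3"] by simp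
  have sm: "summable (\<lambda>k. (2/3) * indicator (B (k + j)) x * (1/3)^k :: real)" for j x
    by (rule summable_comparison_test[OF _ sums_summable[OF g]]) (auto simp: indicator_def)
  have S01: "0 \<le> S j x" "S j x \<le> 1" for j x
  proof -
    show "0 \<le> S j x" unfolding S_def by (intro suminf_nonneg sm) auto
    have "S j x \<le> (\<Sum>k. (2/3) * (1/3)^k)" unfolding S_def
      by (intro suminf_le sm sums_summable[OF g]) (auto simp: indicator_def)
    then show "S j x \<le> 1" using sums_unique[OF g] by simp
  qed
  have Srec: "S j x = (2/3) * indicator (B j) x + (1/3) * S (Suc j) x" for j x
  proof -
    have "S j x = (\<Sum>k. (2/3) * indicator (B (Suc k + j)) x * (1/3)^Suc k) + (2/3) * indicator (B (0 + j)) x * (1/3)^0"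
      unfolding S_def using suminf_split_head[OF sm[of j x]] by simp
    also have "(\<Sum>k. (2/3) * indicator (B (Suc k + j)) x * (1/3)^Suc k) = (1/3) * S (Suc j) x"
      unfolding S_def by (subst suminf_mult[OF sm, symmetric]) (simp add: mult_ac)
    finally show ?thesis by simp
  qed
  have ind: "max 0 (min 1 (3 * S j x - 1)) = indicator (B j) x" for j x
    using Srec[of j x] S01[of "Suc j" x] by (cases "x \<in> B j") auto
  have tail: "digit_tail k (S 0 x) = S k x" for k x
  proof (induction k)
    case (Suc k)
    then show ?case using Srec[of k x] ind[of k x] by simp
  qed simp
  show "digit k (S 0 x) = indicator (B k) x" for k x by (simp add: digit_def tail ind)
  show "0 \<le> S 0 x" "S 0 x \<le> 1" for x by (rule S01)+
  fix M :: "'a measure" assume [measurable]: "\<And>k. B k \<in> sets M"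
  show "S 0 \<in> borel_measurable M" unfolding S_def by measurable
qed

theorem weak_seq_compact:
  fixes M :: "nat \<Rightarrow> 'a::polish_space measure"
  assumes K: "compact (UNIV :: 'a set)" and prob: "\<And>n. prob_space (M n)"
    and sets: "\<And>n. sets (M n) = sets borel"
  obtains r N where "strict_mono (r :: nat \<Rightarrow> nat)" "prob_space N" "sets N = sets borel"
    "\<And>f :: 'a \<Rightarrow> real. continuous_on UNIV f \<Longrightarrow> (\<lambda>n. \<integral>x. f x \<partial>M (r n)) \<longlonglongrightarrow> (\<integral>x. f x \<partial>N)"
proof -
  obtain B :: "nat \<Rightarrow> 'a set" where B: "\<And>k. open (B k)" and
    sep: "\<And>e. e > 0 \<Longrightarrow> \<exists>N. \<forall>x y. (\<forall>k<N. x \<in> B k \<longleftrightarrow> y \<in> B k) \<longrightarrow> dist x y < e"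
    using separating_open_sequence[OF K] by blast
  obtain s :: "'a \<Rightarrow> real" where s: "\<And>x k. digit k (s x) = indicator (B k) x" "\<And>x. 0 \<le> s x" "\<And>x. s x \<le> 1"
    and smeas: "\<And>M. (\<And>k. B k \<in> sets M) \<Longrightarrow> s \<in> borel_measurable M"
    using cantor_code[of B] by blast
  interpret M: prob_space "M n" for n by (rule prob)
  have [measurable]: "s \<in> borel_measurable (M n)" for n
    using B sets by (intro smeas) auto
  \<comment> \<open>The code takes values in [0, 1], so one interval carries all image measures and
    Helly's theorem applies.\<close>
  have tight: "tight (\<lambda>n. distr (M n) borel s)"
    unfolding tight_def
  proof (intro conjI allI impI)
    show "real_distribution (distr (M n) borel s)" for n
      by (intro M.real_distribution_distr) measurable
    fix e :: real assume "e > 0"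
    have "measure (distr (M n) borel s) {-1<..1} = 1" for n
    proof -
      have "s -` {-1<..1} \<inter> space (M n) = space (M n)"
      proof -
        have "-1 < s x" for x using s(2)[of x] by linarith
        then show ?thesis using s(3) by auto
      qed
      then show ?thesis by (simp add: measure_distr M.prob_space)
    qed
    then show "\<exists>a b. a < b \<and> (\<forall>n. 1 - e < measure (distr (M n) borel s) {a<..b})"
      using \<open>e > 0\<close> by (intro exI[of _ "-1"] exI[of _ 1]) auto
  qed
  obtain r L where r: "strict_mono (r :: nat \<Rightarrow> nat)" and L: "real_distribution L"
    and wc: "weak_conv_m (\<lambda>n. distr (M (r n)) borel s) L"
    using tight_imp_convergent_subsubsequence[OF tight strict_mono_id] by (auto simp: comp_def id_def)
  interpret L: real_distribution L by fact
  have conv: "(\<lambda>n. \<integral>x. h (s x) \<partial>M (r n)) \<longlonglongrightarrow> (\<integral>t. h t \<partial>L)"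
    if h: "continuous_on UNIV h" "\<And>t. \<bar>h t\<bar> \<le> b" for h :: "real \<Rightarrow> real" and b
  proof -
    have rd: "real_distribution (distr (M (r n)) borel s)" for n
      using tight by (simp add: tight_def)
    have "(\<lambda>n. \<integral>t. h t \<partial>distr (M (r n)) borel s) \<longlonglongrightarrow> (\<integral>t. h t \<partial>L)"
      using rd L wc
      by (rule weak_conv_imp_integral_bdd_continuous_conv[where B=b])
        (use h in \<open>auto simp: continuous_on_eq_continuous_at\<close>)
    moreover have "h \<in> borel_measurable borel" by (rule borel_measurable_continuous_onI[OF h(1)])
    ultimately show ?thesis by (simp add: integral_distr)
  qed
  \<comment> \<open>The range of \<open>s\<close> need not be closed, and \<open>L\<close> need not
    be carried by it. A nonnegative bounded continuous function vanishing on the range still has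
    integral zero under \<open>L\<close>; in this way closed conditions satisfied by all codes pass
    to almost all \<open>t\<close>.\<close>
  have AEzero: "AE t in L. h t = 0"
    if h: "continuous_on UNIV h" "\<And>t. \<bar>h t\<bar> \<le> b" "\<And>t. 0 \<le> h t" "\<And>x. h (s x) = 0" for h :: "real \<Rightarrow> real" and b
  proof -
    have "(\<integral>t. h t \<partial>L) = 0" using conv[OF h(1,2)] h(4) by (simp add: LIMSEQ_const_iff)
    moreover have "h \<in> borel_measurable borel" by (rule borel_measurable_continuous_onI[OF h(1)])
    then have "integrable L h" using h(2) by (intro L.integrable_const_bound[of _ b]) auto
    ultimately show ?thesis using integral_nonneg_eq_0_iff_AE[of L h] h(3) by simp
  qed
  have AEd: "AE t in L. \<forall>k. digit k t = 0 \<or> digit k t = 1"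
  proof -
    have "AE t in L. digit k t * (1 - digit k t) = 0" for k
    proof (rule AEzero[of _ 1])
      show "continuous_on UNIV (\<lambda>t. digit k t * (1 - digit k t))" by (intro continuous_intros continuous_digit)
      show "\<bar>digit k t * (1 - digit k t)\<bar> \<le> 1" for t
        using digit_bounds[of k t] by (auto simp: abs_mult intro!: mult_le_one)
    qed (use digit_bounds s(1) in \<open>auto simp: indicator_def\<close>)
    then show ?thesis unfolding AE_all_countable by (simp add: disj_commute)
  qed
  \<comment> \<open>\<open>pat n t\<close> is the digit pattern of \<open>t\<close> below
    \<open>n\<close>, \<open>cell n p\<close> the set of points with pattern \<open>p\<close>, and
    \<open>pt n p\<close> a chosen point of the cell; for an empty cell the choice is
    arbitrary.\<close>
  define pat where "pat n t = {k. k < n \<and> digit k t = 1}" for n t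
  define cell where "cell n p = {x. \<forall>k<n. x \<in> B k \<longleftrightarrow> k \<in> p}" for n p
  define pt where "pt n p = (SOME x. x \<in> cell n p)" for n p
  have pt: "pt n p \<in> cell n p" if "cell n p \<noteq> {}" for n p
    unfolding pt_def using that some_in_eq[of "cell n p"] by simp
  have pats: "pat n (s x) = {k. k < n \<and> x \<in> B k}" for n x
    by (auto simp: pat_def s(1) indicator_def)
  have cellx: "x \<in> cell n (pat n (s x))" for n x by (auto simp: cell_def pats)
  have ds: "digit k (s x) = 0 \<or> digit k (s x) = 1" for k x by (auto simp: s(1) indicator_def)
  have AEc: "AE t in L. \<forall>n. cell n (pat n t) \<noteq> {}"
  proof -
    have "AE t in L. cell n (pat n t) \<noteq> {}" for n
    proof -
      \<comment> \<open>Interpolating the indicator of the patterns with empty cell gives a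
        continuous function that vanishes on all codes.\<close>
      define F where "F p = (if cell n p = {} then 1 else 0 :: real)" for p
      have "digit_interp n F (s x) = 0" for x
        using cellx[of x n] ds by (subst digit_interp_eq) (auto simp: F_def pat_def)
      then have "AE t in L. \<bar>digit_interp n F t\<bar> = 0"
        by (intro AEzero[of _ 1] continuous_intros continuous_digit_interp)
          (auto intro!: digit_interp_bounded simp: F_def)
      with AEd show ?thesis
      proof eventually_elim
        case (elim t)
        then show ?case by (auto simp: digit_interp_eq F_def pat_def split: if_splits)
      qed
    qed
    then show ?thesis unfolding AE_all_countable by simp
  qed
  define c where "c n t = pt n (pat n t)" for n t
  have cmeas: "c n \<in> borel_measurable borel" for n
  proof -
    have "pat n \<in> measurable borel (count_space UNIV)" for n
    proof (induction n)
      case 0 then show ?case by (simp add: pat_def)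
    next
      case (Suc n)
      have *: "pat (Suc n) t = (if digit n t = 1 then insert n (pat n t) else pat n t)" for t
        by (auto simp: pat_def less_Suc_eq)
      have [measurable]: "digit n \<in> borel_measurable borel"
        by (rule borel_measurable_continuous_onI[OF continuous_digit])
      have "(\<lambda>t. insert n (pat n t)) \<in> measurable borel (count_space UNIV)"
        by (rule measurable_compose[OF Suc]) simp
      moreover have "{t \<in> space borel. digit n t = 1} \<in> sets borel" by measurable
      ultimately show ?case unfolding * [abs_def] by (intro measurable_If Suc)
    qed
    then show ?thesis unfolding c_def by (rule measurable_compose) simp
  qed
  \<comment> \<open>Cells of long patterns are small by the separation property, so for almost all
    \<open>t\<close> the chosen points of the successive cells form a Cauchy sequence.\<close>
  have close: "\<exists>N. \<forall>n\<ge>N. \<forall>x y. x \<in> cell N (pat N t) \<longrightarrow> y \<in> cell n (pat n t) \<longrightarrow> dist x y < e" if e: "e > 0" for e t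
  proof -
    obtain N where N: "\<And>x y. (\<forall>k<N. x \<in> B k \<longleftrightarrow> y \<in> B k) \<Longrightarrow> dist x y < e"
      using sep[OF e] by blast
    have "dist x y < e" if "n \<ge> N" "x \<in> cell N (pat N t)" "y \<in> cell n (pat n t)" for n x y
    proof (rule N, intro allI impI)
      fix k assume "k < N"
      then have "x \<in> B k \<longleftrightarrow> k \<in> pat N t" "y \<in> B k \<longleftrightarrow> k \<in> pat n t"
        using that unfolding cell_def by auto
      then show "x \<in> B k \<longleftrightarrow> y \<in> B k" using \<open>k < N\<close> that(1) by (simp add: pat_def)
    qed
    then show ?thesis by blast
  qed
  have AEg: "AE t in L. convergent (\<lambda>n. c n t)"
    using AEc
  proof eventually_elim
    case (elim t)
    have "Cauchy (\<lambda>n. c n t)"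
    proof (rule metric_CauchyI)
      fix e :: real assume "e > 0"
      then obtain N where N: "\<And>n x y. n \<ge> N \<Longrightarrow> x \<in> cell N (pat N t) \<Longrightarrow> y \<in> cell n (pat n t) \<Longrightarrow> dist x y < e/2"
        using close[of "e/2" t] by auto
      have *: "dist (c N t) (c n t) < e/2" if "n \<ge> N" for n
        using that elim by (intro N) (auto simp: c_def intro: pt)
      have "dist (c m t) (c n t) < e" if "m \<ge> N" "n \<ge> N" for m n
        using *[OF that(1)] *[OF that(2)] dist_triangle2[of "c m t" "c n t" "c N t"] by (simp add: dist_commute)
      then show "\<exists>N. \<forall>m\<ge>N. \<forall>n\<ge>N. dist (c m t) (c n t) < e" by auto
    qed
    then show ?case by (rule Cauchy_convergent)
  qed
  obtain Z where Z: "{t \<in> space L. \<not> convergent (\<lambda>n. c n t)} \<subseteq> Z" "Z \<in> null_sets L"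
    using AEg by (auto elim!: AE_E simp: null_sets_def)
  \<comment> \<open>On the null set \<open>Z\<close> the limit is replaced by a constant, which
    makes \<open>cc\<close> an everywhere limit of measurable functions.\<close>
  define cc where "cc t = (if t \<in> Z then undefined else lim (\<lambda>n. c n t))" for t
  have Zb: "Z \<in> sets borel" using Z(2) by auto
  have cclim: "(\<lambda>n. if t \<in> Z then undefined else c n t) \<longlonglongrightarrow> cc t" for t
    using Z(1) by (auto simp: cc_def convergent_LIMSEQ_iff)
  have [measurable]: "cc \<in> borel_measurable borel"
    by (rule borel_measurable_LIMSEQ_metric[OF _ cclim])
      (use cmeas Zb in \<open>auto intro!: measurable_If_set\<close>)
  define N where "N = distr L borel cc"
  have "prob_space N" unfolding N_def by (rule L.prob_space_distr) measurable
  moreover have "sets N = sets borel" by (simp add: N_def)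
  moreover have "(\<lambda>n. \<integral>x. f x \<partial>M (r n)) \<longlonglongrightarrow> (\<integral>x. f x \<partial>N)" if f: "continuous_on UNIV f" for f :: "'a \<Rightarrow> real"
  proof (rule LIMSEQ_I)
    fix e :: real assume e: "e > 0"
    have [measurable]: "f \<in> borel_measurable borel" by (rule borel_measurable_continuous_onI[OF f])
    have "bounded (range f)" using compact_continuous_image[OF f K] by (rule compact_imp_bounded)
    then obtain b where b: "\<And>x. \<bar>f x\<bar> \<le> b" by (auto simp: bounded_iff)
    have "uniformly_continuous_on UNIV f" by (rule compact_uniformly_continuous[OF f K])
    then obtain d where d: "d > 0" "\<And>x y. dist x y < d \<Longrightarrow> dist (f x) (f y) < e/4"
      using e unfolding uniformly_continuous_on_def by (metis UNIV_I divide_pos_pos zero_less_numeral)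
    \<comment> \<open>\<open>h n\<close> evaluates \<open>f\<close> at the chosen point of the cell
      of \<open>t\<close>, interpolated to a continuous function of the code. Composed with
      \<open>s\<close> it is uniformly close to \<open>f\<close> for large \<open>n\<close>, and it
      tends to \<open>f (cc t)\<close> for almost all \<open>t\<close>.\<close>
    define h where "h n = digit_interp n (\<lambda>p. f (pt n p))" for n
    have hc: "continuous_on UNIV (h n)" for n unfolding h_def by (rule continuous_digit_interp)
    have hb: "\<bar>h n t\<bar> \<le> b" for n t unfolding h_def by (rule digit_interp_bounded[OF b])
    have [measurable]: "h n \<in> borel_measurable borel" for n by (rule borel_measurable_continuous_onI[OF hc])
    have intf: "integrable M' f" if "prob_space M'" "sets M' = sets borel" for M'
    proof -
      interpret M': prob_space M' by fact
      have "f \<in> borel_measurable M'" using measurable_cong_sets[OF that(2) refl] borel_measurable_continuous_onI[OF f] by blast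
      then show ?thesis using b by (intro M'.integrable_const_bound[of _ b]) auto
    qed
    have inth: "integrable M' (\<lambda>x. h n (g x))" if "prob_space M'" "g \<in> borel_measurable M'" for M' :: "'z measure" and g n
    proof -
      interpret M': prob_space M' by fact
      have [measurable]: "g \<in> borel_measurable M'" by fact
      show ?thesis using hb by (intro M'.integrable_const_bound[of _ b]) auto
    qed
    have hs: "\<exists>n0. \<forall>n\<ge>n0. \<forall>x. \<bar>h n (s x) - f x\<bar> \<le> e/4"
    proof -
      obtain N where N: "\<And>x y. (\<forall>k<N. x \<in> B k \<longleftrightarrow> y \<in> B k) \<Longrightarrow> dist x y < d"
        using sep[OF d(1)] by blast
      have "\<bar>h n (s x) - f x\<bar> \<le> e/4" if "n \<ge> N" for n x
      proof -
        have "h n (s x) = f (pt n (pat n (s x)))"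
          unfolding h_def pat_def using ds by (intro digit_interp_eq)
        moreover have "pt n (pat n (s x)) \<in> cell n (pat n (s x))" using cellx by (intro pt) auto
        then have "dist (pt n (pat n (s x))) x < d"
          using that by (intro N) (auto simp: cell_def pats)
        ultimately show ?thesis using d(2) by (force simp: dist_real_def)
      qed
      then show ?thesis by auto
    qed
    have hl: "(\<lambda>n. \<integral>t. h n t \<partial>L) \<longlonglongrightarrow> (\<integral>x. f x \<partial>N)"
    proof -
      have "(\<lambda>n. \<integral>t. h n t \<partial>L) \<longlonglongrightarrow> (\<integral>t. f (cc t) \<partial>L)"
      proof (rule integral_dominated_convergence[where w="\<lambda>_. b"])
        have "AE t in L. t \<notin> Z" by (rule AE_not_in[OF Z(2)])
        with AEd show "AE t in L. (\<lambda>n. h n t) \<longlonglongrightarrow> f (cc t)"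
        proof eventually_elim
          case (elim t)
          have "(\<lambda>n. c n t) \<longlonglongrightarrow> cc t" using cclim[of t] elim(2) by simp
          moreover have "isCont f (cc t)" using f by (simp add: continuous_on_eq_continuous_at)
          ultimately have "(\<lambda>n. f (c n t)) \<longlonglongrightarrow> f (cc t)" by (rule isCont_tendsto_compose[rotated])
          moreover have "h n t = f (c n t)" for n
            unfolding h_def c_def pat_def using elim(1) by (intro digit_interp_eq) auto
          ultimately show ?case by simp
        qed
      qed (use hb in auto)
      then show ?thesis by (simp add: N_def integral_distr)
    qed
    obtain n0 where n0: "\<And>n x. n \<ge> n0 \<Longrightarrow> \<bar>h n (s x) - f x\<bar> \<le> e/4" using hs by blast
    obtain n1 where n1: "\<And>n. n \<ge> n1 \<Longrightarrow> \<bar>(\<integral>t. h n t \<partial>L) - (\<integral>x. f x \<partial>N)\<bar> < e/4"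
      using LIMSEQ_D[OF hl, of "e/4"] e by auto
    define n where "n = max n0 n1"
    obtain k0 where k0: "\<And>k. k \<ge> k0 \<Longrightarrow> \<bar>(\<integral>x. h n (s x) \<partial>M (r k)) - (\<integral>t. h n t \<partial>L)\<bar> < e/4"
      using LIMSEQ_D[OF conv[OF hc hb], of "e/4" n] e by auto
    have "norm ((\<integral>x. f x \<partial>M (r k)) - (\<integral>x. f x \<partial>N)) < e" if "k \<ge> k0" for k
    proof -
      have "\<bar>(\<integral>x. h n (s x) \<partial>M (r k)) - (\<integral>x. f x \<partial>M (r k))\<bar> = \<bar>\<integral>x. h n (s x) - f x \<partial>M (r k)\<bar>"
        by (subst Bochner_Integration.integral_diff) (auto intro!: inth intf prob sets)
      also have "\<dots> \<le> (\<integral>x. e/4 \<partial>M (r k))"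
        by (rule integral_abs_bound[THEN order_trans], rule integral_mono)
          (use n0[of n] in \<open>auto intro!: integrable_abs Bochner_Integration.integrable_diff inth intf prob sets simp: n_def\<close>)
      also have "\<dots> = e/4" by (simp add: M.prob_space)
      finally show ?thesis using k0[OF that] n1[of n] e unfolding real_norm_def n_def by linarith
    qed
    then show "\<exists>no. \<forall>n\<ge>no. norm ((\<integral>x. f x \<partial>M (r n)) - (\<integral>x. f x \<partial>N)) < e" by blast
  qed
  ultimately show ?thesis using r by (intro that)
qed

text \<open>Partitions of unity: hat functions of radius \<open>r n\<close> around finitely many
  centres, normalised by their sum \<open>U\<close>, with rational coefficients. Uniform continuity
  makes such combinations dense, and extensional coefficient families keep them countable.\<close>

lemma separable_bcontfun:
  assumes K: "compact (UNIV :: 'a::metric_space set)"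
  obtains \<Phi> :: "nat \<Rightarrow> ('a::metric_space \<Rightarrow>\<^sub>C real)" where "\<And>f e. e > 0 \<Longrightarrow> \<exists>k. dist f (\<Phi> k) < e"
proof -
  define r where "r n = 1 / real (Suc n)" for n
  have "\<exists>F. finite F \<and> (UNIV :: 'a set) = (\<Union>x\<in>F. ball x (r n))" for n
  proof -
    have "UNIV \<subseteq> (\<Union>x\<in>(UNIV :: 'a set). ball x (r n))" by (auto simp: r_def)
    then obtain F where "finite F" "(UNIV :: 'a set) \<subseteq> (\<Union>x\<in>F. ball x (r n))"
      by (rule compactE_image[OF K, rotated]) auto
    then show ?thesis by blast
  qed
  then obtain F where F: "\<And>n. finite (F n)" "\<And>n. (UNIV :: 'a set) = (\<Union>x\<in>F n. ball x (r n))" by metis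
  define u where "u n x y = max 0 (r n - dist x y)" for n and x y :: 'a
  define U where "U n y = (\<Sum>x\<in>F n. u n x y)" for n y
  define G where "G n q y = (\<Sum>x\<in>F n. q x * u n x y) / U n y" for n q y
  have u0: "u n x y \<ge> 0" for n x y by (simp add: u_def)
  have U0: "U n y > 0" for n y
  proof -
    obtain x where "x \<in> F n" "y \<in> ball x (r n)" using F(2)[of n] by blast
    then show ?thesis unfolding U_def using F(1) u0
      by (intro sum_pos2[of _ x]) (auto simp: u_def)
  qed
  have "continuous_on UNIV (G n q)" for n q
  proof -
    have "continuous_on UNIV (u n x)" for x unfolding u_def by (intro continuous_intros)
    then show ?thesis using U0 unfolding G_def U_def
      by (intro continuous_intros) (auto simp: less_imp_neq[symmetric])
  qed
  then have GB: "apply_bcontfun (Bcontfun (G n q)) = G n q" for n q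
    using compact_imp_bounded[OF compact_continuous_image[OF _ K]]
    by (intro Bcontfun_inverse) (auto simp: bcontfun_def)
  define D where "D = (\<Union>n. (\<lambda>q. Bcontfun (G n q)) ` (F n \<rightarrow>\<^sub>E \<rat>))"
  have "countable D" unfolding D_def using F(1) countable_rat by (auto intro!: countable_PiE)
  moreover have dense: "\<exists>g\<in>D. dist f g < e" if e: "e > 0" for f :: "'a \<Rightarrow>\<^sub>C real" and e
  proof -
    have "uniformly_continuous_on UNIV (apply_bcontfun f)"
      by (rule compact_uniformly_continuous[OF _ K]) simp
    then obtain d where d: "d > 0" "\<And>x y. dist x y < d \<Longrightarrow> \<bar>apply_bcontfun f x - apply_bcontfun f y\<bar> < e/4"
      using e unfolding uniformly_continuous_on_def dist_real_def by (metis UNIV_I divide_pos_pos zero_less_numeral)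
    obtain n where n: "r n < d" using d(1) nat_approx_posE unfolding r_def by blast
    have "\<exists>q\<in>\<rat>. \<bar>q - apply_bcontfun f x\<bar> < e/4" for x
    proof -
      obtain q where "q \<in> \<rat>" "apply_bcontfun f x < q" "q < apply_bcontfun f x + e/4"
        using Rats_dense_in_real[of "apply_bcontfun f x" "apply_bcontfun f x + e/4"] e by auto
      then show ?thesis by (intro bexI[of _ q]) auto
    qed
    then obtain q0 where q0: "\<And>x. q0 x \<in> \<rat>" "\<And>x. \<bar>q0 x - apply_bcontfun f x\<bar> < e/4" by metis
    define q where "q = restrict q0 (F n)"
    have "\<bar>apply_bcontfun f y - G n q y\<bar> \<le> e/2" for y
    proof -
      have "apply_bcontfun f y - G n q y = (\<Sum>x\<in>F n. (apply_bcontfun f y - q x) * u n x y) / U n y"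
        using U0[of n y] by (simp add: G_def field_simps left_diff_distrib sum_subtractf sum_distrib_left[symmetric] U_def)
      moreover have "\<bar>\<Sum>x\<in>F n. (apply_bcontfun f y - q x) * u n x y\<bar> \<le> (\<Sum>x\<in>F n. (e/2) * u n x y)"
      proof (rule order_trans[OF sum_abs], rule sum_mono)
        fix x assume x: "x \<in> F n"
        show "\<bar>(apply_bcontfun f y - q x) * u n x y\<bar> \<le> (e/2) * u n x y"
        proof (cases "dist x y < r n")
          case True
          then have "\<bar>apply_bcontfun f x - apply_bcontfun f y\<bar> < e/4" using n by (intro d(2)) simp
          moreover have "q x = q0 x" using x by (simp add: q_def)
          ultimately have "\<bar>apply_bcontfun f y - q x\<bar> \<le> e/2" using q0(2)[of x] by linarith
          then show ?thesis
            unfolding abs_mult abs_of_nonneg[OF u0] by (rule mult_right_mono[OF _ u0])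
        next
          case False then show ?thesis by (simp add: u_def)
        qed
      qed
      moreover have "(\<Sum>x\<in>F n. (e/2) * u n x y) = (e/2) * U n y" by (simp add: U_def sum_distrib_left)
      ultimately have "\<bar>apply_bcontfun f y - G n q y\<bar> \<le> (e/2) * U n y / U n y"
        using U0[of n y] by (simp only: abs_divide abs_of_pos divide_right_mono less_imp_le)
      then show ?thesis using U0[of n y] by simp
    qed
    then have "dist f (Bcontfun (G n q)) \<le> e/2"
      by (intro dist_bound) (simp add: GB dist_real_def)
    moreover have "q \<in> F n \<rightarrow>\<^sub>E \<rat>" using q0(1) by (auto simp: q_def)
    then have "Bcontfun (G n q) \<in> D" unfolding D_def by blast
    ultimately show ?thesis using e by (intro bexI[of _ "Bcontfun (G n q)"]) auto
  qed
  have "D \<noteq> {}" using dense[of 1 0] by auto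
  then have "range (from_nat_into D) = D" using \<open>countable D\<close> by (rule range_from_nat_into)
  then show ?thesis using dense by (intro that[of "from_nat_into D"]) (metis rangeE)
qed

section \<open>Birkhoff averages\<close>

definition birkhoff :: "('a \<Rightarrow> 'a) \<Rightarrow> ('a \<Rightarrow> real) \<Rightarrow> nat \<Rightarrow> 'a \<Rightarrow> real"
  where "birkhoff T f n x = (\<Sum>k<n. f ((T ^^ k) x)) / real n"

lemma birkhoff_bound:
  assumes "\<And>x. \<bar>f x\<bar> \<le> B" "B \<ge> 0"
  shows "\<bar>birkhoff T f n x\<bar> \<le> B"
proof (cases "n = 0")
  case False
  have "\<bar>\<Sum>k<n. f ((T ^^ k) x)\<bar> \<le> (\<Sum>k<n. B)"
    by (rule order_trans[OF sum_abs sum_mono]) (rule assms)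
  then show ?thesis using False by (simp add: birkhoff_def field_simps)
qed (use assms in \<open>simp add: birkhoff_def\<close>)

lemma birkhoff_shift_diff:
  assumes "n > 0"
  shows "birkhoff T f n (T x) - birkhoff T f n x = (f ((T ^^ n) x) - f x) / real n"
proof -
  have "(\<Sum>k<n. f ((T ^^ k) (T x))) = (\<Sum>k<n. f ((T ^^ Suc k) x))"
    by (simp add: funpow_swap1)
  also have "\<dots> = (\<Sum>k<Suc n. f ((T ^^ k) x)) - f ((T ^^ 0) x)"
    by (subst sum.lessThan_Suc_shift) simp
  also have "\<dots> = (\<Sum>k<n. f ((T ^^ k) x)) + f ((T ^^ n) x) - f x" by simp
  finally have e: "(\<Sum>k<n. f ((T ^^ k) (T x))) = (\<Sum>k<n. f ((T ^^ k) x)) + f ((T ^^ n) x) - f x" .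
  show ?thesis unfolding birkhoff_def e using assms by (simp add: diff_divide_distrib[symmetric])
qed

lemma birkhoff_shift_tendsto:
  assumes "\<And>x. \<bar>f x\<bar> \<le> B"
  shows "(\<lambda>n. birkhoff T f n (T x) - birkhoff T f n x) \<longlonglongrightarrow> 0"
proof (rule Lim_null_comparison)
  show "eventually (\<lambda>n. norm (birkhoff T f n (T x) - birkhoff T f n x) \<le> 2 * B / real n) sequentially"
    using eventually_gt_at_top[of 0]
  proof eventually_elim
    case (elim n)
    have "\<bar>f ((T ^^ n) x) - f x\<bar> \<le> 2 * B" using assms[of "(T ^^ n) x"] assms[of x] by linarith
    then show ?case using elim by (simp add: birkhoff_shift_diff divide_right_mono)
  qed
  show "(\<lambda>n. 2 * B / real n) \<longlonglongrightarrow> 0" by (rule lim_const_over_n)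
qed

locale measure_preserving = prob_space M for M :: "'a measure" +
  fixes T :: "'a \<Rightarrow> 'a"
  assumes T [measurable]: "T \<in> measurable M M" and distr_T: "distr M M T = M"
begin

lemma measurable_funpow [measurable]: "(T ^^ n) \<in> measurable M M"
  by (induction n) (auto intro: measurable_comp[of _ M M _ M])

lemma integral_T:
  fixes f :: "'a \<Rightarrow> real"
  assumes [measurable]: "f \<in> borel_measurable M"
  shows "(\<integral>x. f (T x) \<partial>M) = (\<integral>x. f x \<partial>M)"
  by (subst (2) distr_T[symmetric], subst integral_distr) simp_all

lemma integral_funpow:
  fixes f :: "'a \<Rightarrow> real"
  assumes [measurable]: "f \<in> borel_measurable M"
  shows "(\<integral>x. f ((T ^^ n) x) \<partial>M) = (\<integral>x. f x \<partial>M)"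
proof (induction n)
  case (Suc n)
  have "(\<integral>x. f ((T ^^ Suc n) x) \<partial>M) = (\<integral>x. f ((T ^^ n) (T x)) \<partial>M)"
    by (simp only: funpow_Suc_right comp_def)
  then show ?case using Suc integral_T[of "\<lambda>x. f ((T ^^ n) x)"] by simp
qed simp

lemma measurable_birkhoff [measurable]:
  assumes [measurable]: "f \<in> borel_measurable M"
  shows "birkhoff T f n \<in> borel_measurable M"
  unfolding birkhoff_def by measurable

lemma integral_birkhoff:
  assumes [measurable]: "f \<in> borel_measurable M" and f: "\<And>x. \<bar>f x\<bar> \<le> B" and n: "n > 0"
  shows "(\<integral>x. birkhoff T f n x \<partial>M) = (\<integral>x. f x \<partial>M)"
proof -
  have "(\<integral>x. birkhoff T f n x \<partial>M) = (\<Sum>k<n. \<integral>x. f ((T ^^ k) x) \<partial>M) / real n"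
    unfolding birkhoff_def using f
    by (simp add: Bochner_Integration.integral_sum integrable_const_bound[where B=B])
  then show ?thesis using n by (simp add: integral_funpow)
qed

text \<open>The maximum of the partial sums of \<open>F\<close> along the orbit over at most
  \<open>n\<close> steps, the empty sum included; the recursion splits off the initial step.\<close>

primrec max_sum :: "('a \<Rightarrow> real) \<Rightarrow> nat \<Rightarrow> 'a \<Rightarrow> real" where
  "max_sum F 0 x = 0"
| "max_sum F (Suc n) x = max 0 (F x + max_sum F n (T x))"

text \<open>Garsia's argument: where \<open>max_sum F n x\<close> is positive it equals
  \<open>F x + max_sum F (n - 1) (T x)\<close>, which is at most
  \<open>F x + max_sum F n (T x)\<close>, and elsewhere it is zero. By invariance the integral of
  \<open>F\<close> over \<open>E n\<close> is nonnegative, and by \<open>pos\<close> the sets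
  \<open>E n\<close> exhaust the space.\<close>

lemma maximal_ergodic:
  fixes F :: "'a \<Rightarrow> real"
  assumes F [measurable]: "F \<in> borel_measurable M" and B: "\<And>x. \<bar>F x\<bar> \<le> B"
    and pos: "\<And>x. x \<in> space M \<Longrightarrow> \<exists>n. (\<Sum>k<n. F ((T ^^ k) x)) > 0"
  shows "(\<integral>x. F x \<partial>M) \<ge> 0"
proof -
  have [measurable]: "max_sum F n \<in> borel_measurable M" for n
    by (induction n) simp_all
  have nn: "max_sum F n x \<ge> 0" for n x by (cases n) auto
  have mono: "max_sum F n x \<le> max_sum F (Suc n) x" for n x
  proof (induction n arbitrary: x)
    case (Suc n)
    show ?case using Suc[of "T x"] by simp
  qed simp
  have mb: "\<bar>max_sum F n x\<bar> \<le> real n * B" for n x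
  proof (induction n arbitrary: x)
    case (Suc n)
    show ?case using Suc[of "T x"] B[of x] by (simp add: algebra_simps abs_le_iff max_def)
  qed simp
  have sums: "(\<Sum>k<n. F ((T ^^ k) x)) \<le> max_sum F n x" for n x
  proof (induction n arbitrary: x)
    case (Suc n)
    have "(\<Sum>k<Suc n. F ((T ^^ k) x)) = F x + (\<Sum>k<n. F ((T ^^ k) (T x)))"
      by (subst sum.lessThan_Suc_shift) (simp add: funpow_swap1)
    then show ?case using Suc[of "T x"] by simp
  qed simp
  define E where "E n = {x \<in> space M. max_sum F n x > 0}" for n
  have [measurable]: "E n \<in> sets M" for n unfolding E_def by measurable
  have ge: "(\<integral>x. F x * indicator (E n) x \<partial>M) \<ge> 0" for n
  proof -
    have int: "integrable M (\<lambda>x. max_sum F n x)" "integrable M (\<lambda>x. max_sum F n (T x))"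
      using mb by (auto intro!: integrable_const_bound[of _ "real n * B"])
    have "0 = (\<integral>x. max_sum F n x - max_sum F n (T x) \<partial>M)"
      using integral_T[of "max_sum F n"] int by simp
    also have "\<dots> \<le> (\<integral>x. F x * indicator (E n) x \<partial>M)"
    proof (rule integral_mono)
      show "integrable M (\<lambda>x. F x * indicator (E n) x)"
        using B order_trans[OF abs_ge_zero B]
        by (intro integrable_const_bound[of _ B]) (auto simp: indicator_def abs_mult)
      fix x assume x: "x \<in> space M"
      show "max_sum F n x - max_sum F n (T x) \<le> F x * indicator (E n) x"
      proof (cases "x \<in> E n")
        case True
        then obtain k where k: "n = Suc k" by (cases n) (auto simp: E_def)
        show ?thesis using True mono[of k "T x"] by (auto simp: E_def k max_def split: if_splits)
      next
        case False
        then have "max_sum F n x = 0" using x nn[of n x] by (auto simp: E_def)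
        then show ?thesis using nn[of n "T x"] False by simp
      qed
    qed (use int in auto)
    finally show ?thesis .
  qed
  have "(\<lambda>n. \<integral>x. F x * indicator (E n) x \<partial>M) \<longlonglongrightarrow> (\<integral>x. F x \<partial>M)"
  proof (rule integral_dominated_convergence[where w="\<lambda>_. B"])
    show "AE x in M. (\<lambda>n. F x * indicator (E n) x) \<longlonglongrightarrow> F x"
    proof (rule AE_I2)
      fix x assume x: "x \<in> space M"
      obtain n where "(\<Sum>k<n. F ((T ^^ k) x)) > 0" using pos[OF x] by auto
      then have "max_sum F n x > 0" using sums[of x n] by linarith
      moreover have "max_sum F n x \<le> max_sum F m x" if "m \<ge> n" for m
        using that lift_Suc_mono_le[of "\<lambda>n. max_sum F n x"] mono by blast
      ultimately have "eventually (\<lambda>m. F x * indicator (E m) x = F x) sequentially"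
        using x unfolding eventually_sequentially E_def
        by (intro exI[of _ n]) (force simp: indicator_def)
      then show "(\<lambda>n. F x * indicator (E n) x) \<longlonglongrightarrow> F x" by (rule tendsto_eventually)
    qed
    show "AE x in M. norm (F x * indicator (E n) x) \<le> B" for n
      using B order_trans[OF abs_ge_zero B] by (auto simp: indicator_def abs_mult)
  qed auto
  then show ?thesis by (rule LIMSEQ_le_const) (use ge in auto)
qed

text \<open>The limit superior \<open>u\<close> is invariant under \<open>T\<close>, so the sums of
  \<open>f - u + e\<close> along an orbit are \<open>n\<close> times
  \<open>birkhoff T f n x - u x + e\<close>. One of them is positive by the choice of
  \<open>u\<close>, and the maximal ergodic inequality compares the integrals.\<close>

lemma integral_limsup_birkhoff_le:
  assumes [measurable]: "f \<in> borel_measurable M" and f: "\<And>x. \<bar>f x\<bar> \<le> B"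
    and u: "\<And>x. limsup (\<lambda>n. ereal (birkhoff T f n x)) = ereal (u x)"
  shows "(\<integral>x. u x \<partial>M) \<le> (\<integral>x. f x \<partial>M)" "u \<in> borel_measurable M" "\<And>x. \<bar>u x\<bar> \<le> B"
proof -
  have B0: "B \<ge> 0" using f[of undefined] by linarith
  have bb: "\<bar>birkhoff T f n x\<bar> \<le> B" for n x by (rule birkhoff_bound[OF f B0])
  have "(\<lambda>x. limsup (\<lambda>n. ereal (birkhoff T f n x))) \<in> borel_measurable M" by measurable
  then show [measurable]: "u \<in> borel_measurable M" by (simp add: u)
  show uB: "\<bar>u x\<bar> \<le> B" for x
  proof -
    have "ereal (u x) \<le> ereal B" unfolding u[symmetric]
      using bb by (intro Limsup_bounded) (auto simp: abs_le_iff)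
    moreover have "ereal (- B) \<le> liminf (\<lambda>n. ereal (birkhoff T f n x))"
      using bb by (intro Liminf_bounded) (auto simp: abs_le_iff minus_le_iff)
    then have "ereal (- B) \<le> ereal (u x)" unfolding u[symmetric]
      by (rule order_trans) (simp add: Liminf_le_Limsup)
    ultimately show ?thesis by (simp add: abs_le_iff)
  qed
  have uT: "u (T x) = u x" for x
  proof -
    have "(\<lambda>n. ereal (birkhoff T f n (T x) - birkhoff T f n x)) \<longlonglongrightarrow> ereal 0"
      using birkhoff_shift_tendsto[OF f] by (simp add: lim_ereal)
    then have "limsup (\<lambda>n. ereal (birkhoff T f n (T x) - birkhoff T f n x) + ereal (birkhoff T f n x))
        = ereal 0 + limsup (\<lambda>n. ereal (birkhoff T f n x))"
      by (rule ereal_limsup_lim_add) simp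
    then show ?thesis by (simp add: u zero_ereal_def[symmetric])
  qed
  have uTn: "u ((T ^^ n) x) = u x" for n x by (induction n) (simp_all add: uT)
  have int: "integrable M f" "integrable M u"
    using f uB by (auto intro!: integrable_const_bound[of _ B])
  show "(\<integral>x. u x \<partial>M) \<le> (\<integral>x. f x \<partial>M)"
  proof (rule field_le_epsilon)
    fix e :: real assume e: "e > 0"
    have "(\<integral>x. f x - u x + e \<partial>M) \<ge> 0"
    proof (rule maximal_ergodic[where B="2 * B + e"])
      show "\<bar>f x - u x + e\<bar> \<le> 2 * B + e" for x using f[of x] uB[of x] e by linarith
      fix x assume "x \<in> space M"
      have "\<exists>n>0. u x - e < birkhoff T f n x"
      proof (rule ccontr)
        assume "\<not> ?thesis"
        then have "eventually (\<lambda>n. ereal (birkhoff T f n x) \<le> ereal (u x - e)) sequentially"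
          by (intro eventually_mono[OF eventually_gt_at_top[of 0]]) (metis ereal_less_eq(3) not_less)
        then have "limsup (\<lambda>n. ereal (birkhoff T f n x)) \<le> ereal (u x - e)"
          by (rule Limsup_bounded)
        then show False using e by (simp add: u)
      qed
      then obtain n where n: "n > 0" "u x - e < birkhoff T f n x" by auto
      have "(\<Sum>k<n. f ((T ^^ k) x) - u ((T ^^ k) x) + e) = real n * (birkhoff T f n x - u x + e)"
        using n(1) by (simp add: uTn sum.distrib sum_subtractf birkhoff_def field_simps)
      also have "\<dots> > 0" using n by simp
      finally show "\<exists>n. (\<Sum>k<n. f ((T ^^ k) x) - u ((T ^^ k) x) + e) > 0" by blast
    qed simp
    then show "(\<integral>x. u x \<partial>M) \<le> (\<integral>x. f x \<partial>M) + e" using int by (simp add: prob_space)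
  qed
qed

text \<open>The preceding estimate for \<open>f\<close> and for \<open>- f\<close>: the integral of
  the limit superior is at most that of \<open>f\<close>, which is at most that of the limit
  inferior. Hence the two limits agree almost everywhere.\<close>

theorem birkhoff_convergent:
  assumes [measurable]: "f \<in> borel_measurable M" and f: "\<And>x. \<bar>f x\<bar> \<le> B"
  shows "AE x in M. convergent (\<lambda>n. birkhoff T f n x)"
proof -
  have B0: "B \<ge> 0" using f[of undefined] by linarith
  have fin: "\<exists>u. limsup (\<lambda>n. ereal (birkhoff T g n x)) = ereal u" if g: "\<And>x. \<bar>g x\<bar> \<le> B" for g x
  proof -
    have bb: "\<bar>birkhoff T g n x\<bar> \<le> B" for n x by (rule birkhoff_bound[OF g B0])
    have "limsup (\<lambda>n. ereal (birkhoff T g n x)) \<le> ereal B"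
      using bb by (intro Limsup_bounded) (auto simp: abs_le_iff)
    moreover have "ereal (- B) \<le> liminf (\<lambda>n. ereal (birkhoff T g n x))"
      using bb by (intro Liminf_bounded) (auto simp: abs_le_iff minus_le_iff)
    then have "ereal (- B) \<le> limsup (\<lambda>n. ereal (birkhoff T g n x))"
      by (rule order_trans) (simp add: Liminf_le_Limsup)
    ultimately show ?thesis by (cases "limsup (\<lambda>n. ereal (birkhoff T g n x))") auto
  qed
  obtain u where u: "\<And>x. limsup (\<lambda>n. ereal (birkhoff T f n x)) = ereal (u x)"
    using fin[of f] f by metis
  have "\<And>x. \<bar>- f x\<bar> \<le> B" using f by simp
  then obtain w where w: "\<And>x. limsup (\<lambda>n. ereal (birkhoff T (\<lambda>x. - f x) n x)) = ereal (w x)"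
    using fin[of "\<lambda>x. - f x"] by metis
  have "birkhoff T (\<lambda>x. - f x) n x = - birkhoff T f n x" for n x
    by (simp add: birkhoff_def sum_negf)
  then have l: "liminf (\<lambda>n. ereal (birkhoff T f n x)) = ereal (- w x)" for x
    using w[of x] ereal_Limsup_uminus[of sequentially "\<lambda>n. ereal (birkhoff T f n x)"]
    by (simp add: uminus_ereal.simps(1)[symmetric] ereal_uminus_eq_reorder del: uminus_ereal.simps)
  have nf: "(\<lambda>x. - f x) \<in> borel_measurable M" "\<And>x. \<bar>- f x\<bar> \<le> B" using f by auto
  note U = integral_limsup_birkhoff_le[OF assms u] and W = integral_limsup_birkhoff_le[OF nf w]
  have [measurable]: "u \<in> borel_measurable M" "w \<in> borel_measurable M" by (rule U W)+
  have int: "integrable M u" "integrable M w"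
    using U(3) W(3) by (auto intro!: integrable_const_bound[of _ B])
  have uw: "0 \<le> u x + w x" for x
  proof -
    have "liminf (\<lambda>n. ereal (birkhoff T f n x)) \<le> limsup (\<lambda>n. ereal (birkhoff T f n x))"
      by (simp add: Liminf_le_Limsup)
    then show ?thesis by (simp add: u l)
  qed
  have "(\<integral>x. u x + w x \<partial>M) \<le> 0" using U(1) W(1) int by simp
  moreover have "(\<integral>x. u x + w x \<partial>M) \<ge> 0" using uw by simp
  ultimately have "AE x in M. u x + w x = 0"
    using integral_nonneg_eq_0_iff_AE[of M "\<lambda>x. u x + w x"] uw int by simp
  then show ?thesis
  proof eventually_elim
    case (elim x)
    then have "limsup (\<lambda>n. ereal (birkhoff T f n x)) = liminf (\<lambda>n. ereal (birkhoff T f n x))"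
      by (simp add: u l eq_neg_iff_add_eq_0)
    then have "(\<lambda>n. ereal (birkhoff T f n x)) \<longlonglongrightarrow> ereal (u x)"
      using u[of x] by (intro Liminf_eq_Limsup) auto
    then show ?case by (auto simp: convergent_def)
  qed
qed

end

section \<open>Measures on the full shift\<close>

abbreviation ev :: "(nat \<Rightarrow> 'w::topological_space) measure \<Rightarrow> ((nat \<Rightarrow> 'w) \<Rightarrow>\<^sub>C real) \<Rightarrow> real"
  where "ev \<mu> \<phi> \<equiv> (\<integral>\<sigma>. apply_bcontfun \<phi> \<sigma> \<partial>\<mu>)"

definition prob_borel :: "(nat \<Rightarrow> 'w::topological_space) measure set"
  where "prob_borel = {\<mu>. prob_space \<mu> \<and> sets \<mu> = sets borel}"

definition weakly :: "(nat \<Rightarrow> (nat \<Rightarrow> 'w::topological_space) measure) \<Rightarrow> (nat \<Rightarrow> 'w) measure \<Rightarrow> bool"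
  where "weakly M \<mu> \<longleftrightarrow> (\<forall>\<phi>. (\<lambda>n. ev (M n) \<phi>) \<longlonglongrightarrow> ev \<mu> \<phi>)"

lemma tendsto_fun_iff:
  fixes f :: "'a \<Rightarrow> 'b \<Rightarrow> 'c::topological_space"
  shows "(f \<longlongrightarrow> l) F \<longleftrightarrow> (\<forall>i. ((\<lambda>n. f n i) \<longlongrightarrow> l i) F)"
proof -
  have "(f \<longlongrightarrow> l) F \<longleftrightarrow> limitin (product_topology (\<lambda>i. euclidean) UNIV) f l F"
    by (simp add: euclidean_product_topology)
  then show ?thesis by (simp add: limitin_componentwise)
qed

lemma limitin_pullback:
  assumes "l \<in> A" "\<And>n. M n \<in> A"
  shows "limitin (pullback_topology A f T) M l F \<longleftrightarrow> limitin T (\<lambda>n. f (M n)) (f l) F"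
proof -
  have "(\<forall>U. (\<exists>V. openin T V \<and> U = f -` V \<inter> A) \<and> l \<in> U \<longrightarrow> (\<forall>\<^sub>F x in F. M x \<in> U)) \<longleftrightarrow>
      (\<forall>V. openin T V \<longrightarrow> l \<in> f -` V \<inter> A \<longrightarrow> (\<forall>\<^sub>F x in F. M x \<in> f -` V \<inter> A))" by blast
  then show ?thesis
    unfolding limitin_def topspace_pullback_topology openin_pullback_topology
    using assms by (simp add: imp_conjL)
qed

lemma limitin_weak_star:
  "limitin weak_star X x F \<longleftrightarrow> (\<forall>\<phi>. ((\<lambda>n. blinfun_apply (X n) \<phi>) \<longlongrightarrow> blinfun_apply x \<phi>) F)"
  unfolding strong_operator_topology_def by (subst limitin_pullback) (auto simp: tendsto_fun_iff)

lemma inv_prob_borel: "\<mu> \<in> inv_measures \<Longrightarrow> \<mu> \<in> prob_borel"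
  by (simp add: inv_measures_def prob_borel_def)

lemma prob_borelD:
  assumes "\<mu> \<in> prob_borel"
  shows "prob_space \<mu>" "sets \<mu> = sets borel" "space \<mu> = UNIV"
  using assms sets_eq_imp_space_eq[of \<mu> borel] by (auto simp: prob_borel_def)

lemma measurable_prob_borel:
  assumes "\<mu> \<in> prob_borel" "f \<in> measurable borel N"
  shows "f \<in> measurable \<mu> N"
  using measurable_cong_sets[OF prob_borelD(2)[OF assms(1)] refl] assms(2) by blast

lemma limitin_inv_topology:
  assumes "\<mu> \<in> inv_measures" "\<And>n. M n \<in> inv_measures"
  shows "limitin inv_topology M \<mu> sequentially \<longleftrightarrow> weakly M \<mu>"
proof -
  have a: "blinfun_apply (measure_functional \<nu>) \<phi> = ev \<nu> \<phi>" if "\<nu> \<in> inv_measures" for \<nu> \<phi>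
    using prob_borelD[OF inv_prob_borel[OF that]] by (intro apply_measure_functional)
  show ?thesis
    unfolding inv_topology_def limitin_pullback[OF assms] limitin_weak_star weakly_def
    using assms by (simp add: a)
qed

lemma continuous_shift: "continuous_on UNIV (shift :: (nat \<Rightarrow> 'w::topological_space) \<Rightarrow> _)"
  unfolding shift_def by (intro continuous_on_coordinatewise_then_product continuous_on_product_coordinates)

lemma shift_funpow: "(shift ^^ k) \<sigma> = (\<lambda>n. \<sigma> (n + k))"
  by (induction k) (auto simp: shift_def)

lemma continuous_shift_funpow: "continuous_on UNIV ((shift ^^ k) :: (nat \<Rightarrow> 'w::topological_space) \<Rightarrow> _)"
  unfolding shift_funpow[abs_def]
  by (intro continuous_on_coordinatewise_then_product continuous_on_product_coordinates)

lemma measurable_shift [measurable]: "shift \<in> measurable borel (borel :: (nat \<Rightarrow> 'w::topological_space) measure)"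
  by (rule borel_measurable_continuous_onI[OF continuous_shift])

lemma inv_measure_preserving:
  assumes "\<mu> \<in> inv_measures"
  shows "measure_preserving \<mu> shift"
proof -
  have \<mu>: "prob_space \<mu>" "sets \<mu> = sets borel" "distr \<mu> borel shift = \<mu>"
    using assms by (auto simp: inv_measures_def)
  then interpret prob_space \<mu> by simp
  show ?thesis
  proof
    show "shift \<in> measurable \<mu> \<mu>" using \<mu>(2) measurable_cong_sets[OF \<mu>(2) \<mu>(2)] by simp
    show "distr \<mu> \<mu> shift = \<mu>" using \<mu>(2,3) distr_cong_AE[of \<mu> \<mu> \<mu> borel shift shift] by simp
  qed
qed

lemma ev_bound:
  assumes "\<mu> \<in> prob_borel"
  shows "\<bar>ev \<mu> \<phi>\<bar> \<le> norm \<phi>"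
proof -
  interpret prob_space \<mu> using prob_borelD[OF assms] by simp
  have "\<bar>ev \<mu> \<phi>\<bar> \<le> (\<integral>\<sigma>. norm \<phi> \<partial>\<mu>)"
    using norm_bounded[of \<phi>] integrable_bcontfun[OF prob_borelD(1,2)[OF assms]]
    by (intro integral_abs_bound[THEN order_trans] integral_mono) auto
  then show ?thesis by (simp add: prob_space)
qed

lemma ev_diff:
  assumes "\<mu> \<in> prob_borel"
  shows "ev \<mu> (\<phi> - \<psi>) = ev \<mu> \<phi> - ev \<mu> \<psi>"
  using integrable_bcontfun[OF prob_borelD(1,2)[OF assms]] by simp

locale compact_alphabet =
  fixes m :: "'w::polish_space measure"
  assumes compact_UNIV: "compact (UNIV :: 'w set)"
    and m_prob: "prob_space m" and m_borel: "sets m = sets borel"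
begin

lemma compact_seq: "compact (UNIV :: (nat \<Rightarrow> 'w) set)"
proof -
  have "compactin (product_topology (\<lambda>i. euclidean) UNIV) (PiE UNIV (\<lambda>i::nat. UNIV :: 'w set))"
    using compact_UNIV by (subst compactin_PiE) simp
  then show ?thesis by (simp add: euclidean_product_topology)
qed

lemma apply_Bcontfun:
  fixes f :: "(nat \<Rightarrow> 'w) \<Rightarrow> real"
  assumes "continuous_on UNIV f"
  shows "apply_bcontfun (Bcontfun f) = f"
  using compact_imp_bounded[OF compact_continuous_image[OF assms compact_seq]] assms
  by (intro Bcontfun_inverse) (simp add: bcontfun_def)

lemma continuous_bcontfun [continuous_intros]:
  fixes \<phi> :: "(nat \<Rightarrow> 'w) \<Rightarrow>\<^sub>C real"
  shows "continuous_on S (apply_bcontfun \<phi>)"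
  by (rule continuous_on_subset[of UNIV]) auto

lemma ev_continuous:
  fixes f :: "(nat \<Rightarrow> 'w) \<Rightarrow> real"
  assumes "continuous_on UNIV f"
  shows "ev \<mu> (Bcontfun f) = (\<integral>\<sigma>. f \<sigma> \<partial>\<mu>)"
  by (simp add: apply_Bcontfun[OF assms])

lemma weaklyD:
  fixes f :: "(nat \<Rightarrow> 'w) \<Rightarrow> real"
  assumes "weakly M \<mu>" "continuous_on UNIV f"
  shows "(\<lambda>n. \<integral>\<sigma>. f \<sigma> \<partial>M n) \<longlonglongrightarrow> (\<integral>\<sigma>. f \<sigma> \<partial>\<mu>)"
  using assms(1) unfolding weakly_def ev_continuous[OF assms(2), symmetric] by blast

section \<open>Countably many coordinates for measures, and compactness\<close>

definition dense_seq :: "nat \<Rightarrow> (nat \<Rightarrow> 'w) \<Rightarrow>\<^sub>C real"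
  where "dense_seq = (SOME \<Phi>. \<forall>f e. e > 0 \<longrightarrow> (\<exists>k. dist f (\<Phi> k) < e))"

lemma dense_seq: "e > 0 \<Longrightarrow> \<exists>k. dist f (dense_seq k) < e"
proof -
  have "\<exists>\<Phi> :: nat \<Rightarrow> (nat \<Rightarrow> 'w) \<Rightarrow>\<^sub>C real. \<forall>f e. e > 0 \<longrightarrow> (\<exists>k. dist f (\<Phi> k) < e)"
    using separable_bcontfun[OF compact_seq] by metis
  from someI_ex[OF this] show "e > 0 \<Longrightarrow> \<exists>k. dist f (dense_seq k) < e"
    unfolding dense_seq_def by blast
qed

lemma ev_dist:
  fixes \<mu> :: "(nat \<Rightarrow> 'w) measure"
  assumes "\<mu> \<in> prob_borel"
  shows "\<bar>ev \<mu> \<phi> - ev \<mu> \<psi>\<bar> \<le> dist \<phi> \<psi>"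
  using ev_bound[OF assms, of "\<phi> - \<psi>"] unfolding ev_diff[OF assms] dist_norm .

lemma weakly_dense:
  fixes M :: "nat \<Rightarrow> (nat \<Rightarrow> 'w) measure"
  assumes M: "\<And>n. M n \<in> prob_borel" and \<mu>: "\<mu> \<in> prob_borel"
    and lim: "\<And>j. (\<lambda>n. ev (M n) (dense_seq j)) \<longlonglongrightarrow> ev \<mu> (dense_seq j)"
  shows "weakly M \<mu>"
  unfolding weakly_def
proof (intro allI LIMSEQ_I)
  fix \<phi> and e :: real assume e: "e > 0"
  obtain j where j: "dist \<phi> (dense_seq j) < e/3" using dense_seq[of "e/3" \<phi>] e by auto
  obtain N where N: "\<And>n. n \<ge> N \<Longrightarrow> \<bar>ev (M n) (dense_seq j) - ev \<mu> (dense_seq j)\<bar> < e/3"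
    using LIMSEQ_D[OF lim[of j], of "e/3"] e by auto
  have "norm (ev (M n) \<phi> - ev \<mu> \<phi>) < e" if "n \<ge> N" for n
    using N[OF that] ev_dist[OF M[of n], of \<phi> "dense_seq j"] ev_dist[OF \<mu>, of \<phi> "dense_seq j"] j
    unfolding real_norm_def by linarith
  then show "\<exists>no. \<forall>n\<ge>no. norm (ev (M n) \<phi> - ev \<mu> \<phi>) < e" by blast
qed

lemma prob_borel_eqI:
  fixes \<mu> \<nu> :: "(nat \<Rightarrow> 'w) measure"
  assumes \<mu>: "\<mu> \<in> prob_borel" and \<nu>: "\<nu> \<in> prob_borel" and eq: "\<And>\<phi>. ev \<mu> \<phi> = ev \<nu> \<phi>"
  shows "\<mu> = \<nu>"
proof (rule measure_eqI_continuous)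
  show "finite_measure \<mu>" "finite_measure \<nu>"
    using prob_borelD[OF \<mu>] prob_borelD[OF \<nu>] by (simp_all add: prob_space.finite_measure)
  show "(\<integral>\<sigma>. f \<sigma> \<partial>\<mu>) = (\<integral>\<sigma>. f \<sigma> \<partial>\<nu>)" if "continuous_on UNIV f" for f :: "(nat \<Rightarrow> 'w) \<Rightarrow> real"
    using eq[of "Bcontfun f"] by (simp add: apply_Bcontfun[OF that])
qed (use prob_borelD[OF \<mu>] prob_borelD[OF \<nu>] in auto)

text \<open>Coordinates in the space of real sequences. On probability measures they are injective
  and describe weak convergence, so topology, measurability and compactness of
  \<open>inv_measures\<close> are handled through them.\<close>

definition code :: "(nat \<Rightarrow> 'w) measure \<Rightarrow> nat \<Rightarrow> real"
  where "code \<mu> j = ev \<mu> (dense_seq j)"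

lemma weakly_iff_code:
  assumes "\<And>n. M n \<in> prob_borel" "\<mu> \<in> prob_borel"
  shows "weakly M \<mu> \<longleftrightarrow> (\<lambda>n. code (M n)) \<longlonglongrightarrow> code \<mu>"
  using weakly_dense[of M \<mu>, OF assms] unfolding tendsto_fun_iff code_def
  by (auto simp: weakly_def)

lemma inj_code:
  assumes "\<mu> \<in> prob_borel" "\<nu> \<in> prob_borel" "code \<mu> = code \<nu>"
  shows "\<mu> = \<nu>"
proof (rule prob_borel_eqI[OF assms(1,2)])
  have "weakly (\<lambda>n. \<mu>) \<nu>" by (subst weakly_iff_code) (use assms in auto)
  then show "ev \<mu> \<phi> = ev \<nu> \<phi>" for \<phi> by (auto simp: weakly_def LIMSEQ_const_iff)
qed

lemma prob_borel_seq_compact: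
  fixes M :: "nat \<Rightarrow> (nat \<Rightarrow> 'w) measure"
  assumes "\<And>n. M n \<in> prob_borel"
  obtains r N where "strict_mono (r :: nat \<Rightarrow> nat)" "N \<in> prob_borel" "weakly (\<lambda>n. M (r n)) N"
proof -
  obtain r N where "strict_mono (r :: nat \<Rightarrow> nat)" "prob_space N" "sets N = sets borel"
    "\<And>f :: (nat \<Rightarrow> 'w) \<Rightarrow> real. continuous_on UNIV f \<Longrightarrow> (\<lambda>n. \<integral>x. f x \<partial>M (r n)) \<longlonglongrightarrow> (\<integral>x. f x \<partial>N)"
    using weak_seq_compact[OF compact_seq, of M] prob_borelD[OF assms] by metis
  then show ?thesis by (intro that[of r N]) (auto simp: prob_borel_def weakly_def continuous_bcontfun)
qed

lemma inv_iff:
  fixes \<mu> :: "(nat \<Rightarrow> 'w) measure"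
  assumes "\<mu> \<in> prob_borel"
  shows "\<mu> \<in> inv_measures \<longleftrightarrow> (\<forall>\<phi>. (\<integral>\<sigma>. apply_bcontfun \<phi> (shift \<sigma>) \<partial>\<mu>) = ev \<mu> \<phi>)"
proof -
  note \<mu> = prob_borelD[OF assms]
  interpret prob_space \<mu> by (rule \<mu>)
  have sm: "shift \<in> measurable \<mu> borel" by (rule measurable_prob_borel[OF assms measurable_shift])
  have pd: "distr \<mu> borel shift \<in> prob_borel"
    using sm by (simp add: prob_borel_def prob_space_distr)
  have ed: "ev (distr \<mu> borel shift) \<phi> = (\<integral>\<sigma>. apply_bcontfun \<phi> (shift \<sigma>) \<partial>\<mu>)" for \<phi>
    by (rule integral_distr[OF sm]) (rule borel_measurable_continuous_onI, rule continuous_bcontfun)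
  have "\<mu> \<in> inv_measures \<longleftrightarrow> distr \<mu> borel shift = \<mu>" using \<mu> by (simp add: inv_measures_def)
  also have "\<dots> \<longleftrightarrow> (\<forall>\<phi>. ev (distr \<mu> borel shift) \<phi> = ev \<mu> \<phi>)"
    using prob_borel_eqI[OF pd assms] by auto
  finally show ?thesis by (simp add: ed)
qed

lemma continuous_bcontfun_shift:
  fixes \<phi> :: "(nat \<Rightarrow> 'w) \<Rightarrow>\<^sub>C real"
  shows "continuous_on UNIV (\<lambda>\<sigma>. apply_bcontfun \<phi> ((shift ^^ k) \<sigma>))" "continuous_on UNIV (\<lambda>\<sigma>. apply_bcontfun \<phi> (shift \<sigma>))"
  by (rule continuous_on_compose2[OF continuous_bcontfun[of UNIV] continuous_shift_funpow], simp)
    (rule continuous_on_compose2[OF continuous_bcontfun[of UNIV] continuous_shift], simp)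

lemma weakly_inv:
  fixes M :: "nat \<Rightarrow> (nat \<Rightarrow> 'w) measure"
  assumes "\<And>n. M n \<in> inv_measures" "\<mu> \<in> prob_borel" "weakly M \<mu>"
  shows "\<mu> \<in> inv_measures"
  unfolding inv_iff[OF assms(2)]
proof
  fix \<phi> :: "(nat \<Rightarrow> 'w) \<Rightarrow>\<^sub>C real"
  have "(\<lambda>n. \<integral>\<sigma>. apply_bcontfun \<phi> (shift \<sigma>) \<partial>M n) \<longlonglongrightarrow> (\<integral>\<sigma>. apply_bcontfun \<phi> (shift \<sigma>) \<partial>\<mu>)"
    by (rule weaklyD[OF assms(3) continuous_bcontfun_shift(2)])
  moreover have "(\<integral>\<sigma>. apply_bcontfun \<phi> (shift \<sigma>) \<partial>M n) = ev (M n) \<phi>" for n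
    using inv_iff[OF inv_prob_borel[OF assms(1)]] assms(1) by blast
  ultimately show "(\<integral>\<sigma>. apply_bcontfun \<phi> (shift \<sigma>) \<partial>\<mu>) = ev \<mu> \<phi>"
    using assms(3) by (auto simp: weakly_def intro: LIMSEQ_unique)
qed

lemma inv_seq_compact:
  fixes M :: "nat \<Rightarrow> (nat \<Rightarrow> 'w) measure"
  assumes "\<And>n. M n \<in> inv_measures"
  obtains r N where "strict_mono (r :: nat \<Rightarrow> nat)" "N \<in> inv_measures" "weakly (\<lambda>n. M (r n)) N"
proof -
  obtain r N where r: "strict_mono (r :: nat \<Rightarrow> nat)" "N \<in> prob_borel" "weakly (\<lambda>n. M (r n)) N"
    using prob_borel_seq_compact[of M] assms inv_prob_borel by metis
  moreover have "N \<in> inv_measures" by (rule weakly_inv[OF _ r(2,3)]) (rule assms)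
  ultimately show ?thesis by (intro that)
qed

section \<open>Topology and Borel structure of the set of invariant measures\<close>

abbreviation seq_closed :: "(nat \<Rightarrow> 'w) measure set \<Rightarrow> bool"
  where "seq_closed A \<equiv> \<forall>M \<mu>. range M \<subseteq> A \<longrightarrow> weakly M \<mu> \<longrightarrow> \<mu> \<in> inv_measures \<longrightarrow> \<mu> \<in> A"

text \<open>A limit of codes is the code of a subsequential weak limit, which exists by compactness
  and stays in \<open>A\<close>.\<close>

lemma closed_code_image:
  assumes A: "A \<subseteq> inv_measures" and cl: "seq_closed A"
  shows "closed (code ` A)"
  unfolding closed_sequential_limits
proof (intro allI impI, elim conjE)
  fix x l assume x: "\<forall>n. x n \<in> code ` A" and lim: "x \<longlonglongrightarrow> l"
  then obtain M where M: "\<And>n. M n \<in> A" "\<And>n. x n = code (M n)" unfolding image_iff by metis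
  then obtain r N where r: "strict_mono (r :: nat \<Rightarrow> nat)" "N \<in> inv_measures" "weakly (\<lambda>n. M (r n)) N"
    using inv_seq_compact[of M] A by (metis subsetD)
  have "(\<lambda>n. code (M (r n))) \<longlonglongrightarrow> code N"
    using r M(1) A inv_prob_borel by (subst weakly_iff_code[symmetric]) auto
  moreover have "(\<lambda>n. code (M (r n))) \<longlonglongrightarrow> l"
    using LIMSEQ_subseq_LIMSEQ[OF lim r(1)] M(2) by (simp add: comp_def)
  ultimately have "l = code N" by (rule LIMSEQ_unique[rotated])
  moreover have "N \<in> A"
    by (rule cl[rule_format, of "\<lambda>n. M (r n)" N]) (use r M(1) in auto)
  ultimately show "l \<in> code ` A" by simp
qed

text \<open>The complement of a weak* open set is sequentially closed, so compactness makes its code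
  image closed; conversely the coordinates are weak* continuous evaluations. The topology is
  therefore metrizable, and sequences suffice from here on.\<close>

lemma openin_inv_topology_iff:
  "openin inv_topology U \<longleftrightarrow> (\<exists>V. open V \<and> U = code -` V \<inter> inv_measures)"
proof
  assume U: "openin inv_topology U"
  then have sub: "U \<subseteq> inv_measures" using openin_subset[OF U] by (simp add: topspace_inv_topology)
  have "closed (code ` (inv_measures - U))"
  proof (rule closed_code_image)
    show "seq_closed (inv_measures - U)"
    proof (intro allI impI)
      fix M \<mu> assume M: "range M \<subseteq> inv_measures - U" "weakly M \<mu>" "\<mu> \<in> inv_measures"
      have "limitin inv_topology M \<mu> sequentially"
        by (subst limitin_inv_topology) (use M in auto)
      then show "\<mu> \<in> inv_measures - U"
        using limitinD[OF _ U, of M \<mu> sequentially] M by (auto simp: eventually_sequentially)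
    qed
  qed auto
  then have "open (- code ` (inv_measures - U))" by (simp add: open_Compl)
  moreover have "U = code -` (- code ` (inv_measures - U)) \<inter> inv_measures"
    using sub inj_code inv_prob_borel by blast
  ultimately show "\<exists>V. open V \<and> U = code -` V \<inter> inv_measures" by blast
next
  assume "\<exists>V. open V \<and> U = code -` V \<inter> inv_measures"
  then obtain V where V: "open V" "U = code -` V \<inter> inv_measures" by auto
  define W where "W = (\<lambda>L j. blinfun_apply L (dense_seq j)) -` V"
  have "continuous_map weak_star euclidean (\<lambda>L j. blinfun_apply L (dense_seq j))"
    unfolding euclidean_product_topology[symmetric] continuous_map_componentwise_UNIV
    by (auto intro: strong_operator_topology_continuous_evaluation)
  then have "openin weak_star W"
    using openin_continuous_map_preimage[of weak_star euclidean _ V] V(1)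
    by (simp add: W_def vimage_def strong_operator_topology_topspace)
  moreover have "U = measure_functional -` W \<inter> inv_measures"
  proof -
    have "(\<lambda>j. blinfun_apply (measure_functional \<nu>) (dense_seq j)) = code \<nu>" if "\<nu> \<in> inv_measures" for \<nu>
      using prob_borelD[OF inv_prob_borel[OF that]] by (simp add: code_def fun_eq_iff apply_measure_functional)
    then show ?thesis unfolding V(2) W_def by auto
  qed
  ultimately show "openin inv_topology U"
    unfolding inv_topology_def openin_pullback_topology by blast
qed

text \<open>Encoding the Borel sets of \<open>inv_topology\<close> as preimages under
  \<open>code\<close> reduces measurability of maps into this space to that of countably many real
  functions.\<close>

definition BP :: "(nat \<Rightarrow> 'w) measure measure"
  where "BP = vimage_algebra inv_measures code borel"

lemma space_BP [simp]: "space BP = inv_measures" by (simp add: BP_def)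

lemma sets_BP: "sets BP = sigma_sets inv_measures {U. openin inv_topology U}"
proof -
  have "{U. openin inv_topology U} = {code -` V \<inter> inv_measures |V. V \<in> Collect open}"
    by (auto simp: openin_inv_topology_iff)
  then show ?thesis
    unfolding BP_def using sigma_sets_vimage_commute[of code inv_measures UNIV "Collect open"]
    by (simp add: sets_vimage_algebra2 borel_def)
qed

lemma code_measurable [measurable]: "code \<in> borel_measurable BP"
  unfolding BP_def by (rule measurable_vimage_algebra1) simp

lemma seq_closed_sets:
  assumes "A \<subseteq> inv_measures" "seq_closed A"
  shows "A \<in> sets BP"
proof -
  have "A = code -` (code ` A) \<inter> inv_measures" using assms(1) inj_code inv_prob_borel by blast
  moreover have "code -` (code ` A) \<inter> space BP \<in> sets BP"
    using closed_code_image[OF assms] by (intro measurable_sets[OF code_measurable]) auto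
  ultimately show ?thesis by simp
qed

lemma measurable_BP_seq_continuous:
  fixes f :: "(nat \<Rightarrow> 'w) measure \<Rightarrow> real"
  assumes "\<And>M \<mu>. range M \<subseteq> inv_measures \<Longrightarrow> \<mu> \<in> inv_measures \<Longrightarrow> weakly M \<mu> \<Longrightarrow> (\<lambda>n. f (M n)) \<longlonglongrightarrow> f \<mu>"
  shows "f \<in> borel_measurable BP"
  unfolding borel_measurable_iff_le
proof
  fix a
  show "{w \<in> space BP. f w \<le> a} \<in> sets BP"
  proof (rule seq_closed_sets)
    show "seq_closed {w \<in> space BP. f w \<le> a}"
    proof (intro allI impI)
      fix M \<mu> assume M: "range M \<subseteq> {w \<in> space BP. f w \<le> a}" "weakly M \<mu>" "\<mu> \<in> inv_measures"
      then have "(\<lambda>n. f (M n)) \<longlonglongrightarrow> f \<mu>" by (intro assms) auto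
      then have "f \<mu> \<le> a" by (rule LIMSEQ_le_const2) (use M(1) in auto)
      then show "\<mu> \<in> {w \<in> space BP. f w \<le> a}" using M(3) by simp
    qed
  qed auto
qed

lemma bounded_seq_continuous:
  fixes f :: "(nat \<Rightarrow> 'w) measure \<Rightarrow> real"
  assumes "\<And>M \<mu>. range M \<subseteq> inv_measures \<Longrightarrow> \<mu> \<in> inv_measures \<Longrightarrow> weakly M \<mu> \<Longrightarrow> (\<lambda>n. f (M n)) \<longlonglongrightarrow> f \<mu>"
  obtains B where "\<And>\<mu>. \<mu> \<in> inv_measures \<Longrightarrow> \<bar>f \<mu>\<bar> \<le> B"
proof -
  have "\<exists>B. \<forall>\<mu>\<in>inv_measures. \<bar>f \<mu>\<bar> \<le> B"
  proof (rule ccontr)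
    assume "\<not> ?thesis"
    then have "\<forall>n::nat. \<exists>\<mu>\<in>inv_measures. \<bar>f \<mu>\<bar> > real n" by (meson not_le)
    then obtain M where M: "\<And>n. M n \<in> inv_measures" "\<And>n. \<bar>f (M n)\<bar> > real n" by metis
    obtain r N where r: "strict_mono (r :: nat \<Rightarrow> nat)" "N \<in> inv_measures" "weakly (\<lambda>n. M (r n)) N"
      using inv_seq_compact[of M] M(1) by metis
    have "(\<lambda>n. f (M (r n))) \<longlonglongrightarrow> f N" by (rule assms[OF _ r(2,3)]) (use M(1) in auto)
    then have "Bseq (\<lambda>n. f (M (r n)))" by (rule convergentI[THEN convergent_imp_Bseq])
    then obtain K where "\<And>n. \<bar>f (M (r n))\<bar> \<le> K" unfolding Bseq_def by auto
    then have "real n \<le> K" for n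
      using M(2)[of "r n"] seq_suble[OF r(1), of n] by (smt (verit) of_nat_le_iff)
    then show False using reals_Archimedean2[of K] by (meson not_le)
  qed
  then show ?thesis using that by blast
qed

lemma weakly_ev:
  "weakly M \<mu> \<Longrightarrow> (\<lambda>n. ev (M n) \<phi>) \<longlonglongrightarrow> ev \<mu> \<phi>" by (simp add: weakly_def)

lemma ev_measurable [measurable]: "(\<lambda>\<nu>. ev \<nu> \<phi>) \<in> borel_measurable BP"
  by (rule measurable_BP_seq_continuous) (rule weakly_ev)

end

section \<open>Ergodic components\<close>

context compact_alphabet
begin

text \<open>Orbit points with exponents from 0 to \<open>n\<close> are averaged,
  \<open>n + 1\<close> of them, so that \<open>n = 0\<close> is meaningful; this is why
  \<open>birkhoff\<close> appears at \<open>Suc n\<close> below.\<close>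

definition empirical :: "nat \<Rightarrow> (nat \<Rightarrow> 'w) \<Rightarrow> (nat \<Rightarrow> 'w) measure"
  where "empirical n \<sigma> = distr (measure_pmf (pmf_of_set {..n})) borel (\<lambda>k. (shift ^^ k) \<sigma>)"

lemma empirical_prob_borel: "empirical n \<sigma> \<in> prob_borel"
  unfolding prob_borel_def empirical_def by (auto intro: prob_space.prob_space_distr measure_pmf.prob_space_axioms)

lemma integral_empirical:
  fixes f :: "(nat \<Rightarrow> 'w) \<Rightarrow> real"
  assumes "f \<in> borel_measurable borel"
  shows "(\<integral>\<tau>. f \<tau> \<partial>empirical n \<sigma>) = birkhoff shift f (Suc n) \<sigma>"
proof -
  have "(\<integral>\<tau>. f \<tau> \<partial>empirical n \<sigma>) = (\<integral>k. f ((shift ^^ k) \<sigma>) \<partial>measure_pmf (pmf_of_set {..n}))"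
    unfolding empirical_def by (rule integral_distr) (use assms in auto)
  also have "\<dots> = (\<Sum>k\<in>{..n}. f ((shift ^^ k) \<sigma>)) / real (card {..n})"
    by (rule integral_pmf_of_set) auto
  finally show ?thesis by (simp add: birkhoff_def lessThan_Suc_atMost)
qed

lemma bcontfun_measurable [measurable]:
  fixes \<phi> :: "(nat \<Rightarrow> 'w) \<Rightarrow>\<^sub>C real"
  shows "apply_bcontfun \<phi> \<in> borel_measurable borel"
  by (rule borel_measurable_continuous_onI[OF continuous_bcontfun])

lemma ev_empirical: "ev (empirical n \<sigma>) \<phi> = birkhoff shift (apply_bcontfun \<phi>) (Suc n) \<sigma>"
  by (rule integral_empirical) simp

lemma bcontfun_bound: "\<bar>apply_bcontfun \<phi> x\<bar> \<le> norm \<phi>"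
  using norm_bounded[of \<phi> x] by simp

lemma birkhoff_bcontfun_bound: "\<bar>birkhoff T (apply_bcontfun \<phi>) n x\<bar> \<le> norm \<phi>"
  by (rule birkhoff_bound[OF bcontfun_bound]) simp

lemma continuous_birkhoff:
  assumes "continuous_on UNIV f"
  shows "continuous_on UNIV (birkhoff shift f n :: (nat \<Rightarrow> 'w) \<Rightarrow> real)"
  unfolding birkhoff_def divide_inverse
  by (intro continuous_intros continuous_on_compose2[OF assms continuous_shift_funpow]) auto

definition generic :: "(nat \<Rightarrow> 'w) \<Rightarrow> (nat \<Rightarrow> 'w) measure \<Rightarrow> bool"
  where "generic \<sigma> \<nu> \<longleftrightarrow> \<nu> \<in> inv_measures \<and> weakly (\<lambda>n. empirical n \<sigma>) \<nu>"

lemma genericD: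
  assumes "generic \<sigma> \<nu>"
  shows "(\<lambda>n. birkhoff shift (apply_bcontfun \<phi>) n \<sigma>) \<longlonglongrightarrow> ev \<nu> \<phi>"
  using assms unfolding generic_def weakly_def ev_empirical
  by (subst filterlim_sequentially_Suc[symmetric]) blast

lemma generic_shift: "generic (shift \<sigma>) \<nu> \<longleftrightarrow> generic \<sigma> \<nu>"
proof -
  have *: "(\<lambda>n. birkhoff shift (apply_bcontfun \<phi>) n (shift \<sigma>)) \<longlonglongrightarrow> c \<longleftrightarrow>
      (\<lambda>n. birkhoff shift (apply_bcontfun \<phi>) n \<sigma>) \<longlonglongrightarrow> c" for \<phi> c
  proof -
    have d: "(\<lambda>n. birkhoff shift (apply_bcontfun \<phi>) n (shift \<sigma>) - birkhoff shift (apply_bcontfun \<phi>) n \<sigma>) \<longlonglongrightarrow> 0"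
      by (rule birkhoff_shift_tendsto[OF bcontfun_bound])
    show ?thesis
      using tendsto_add[OF d, of "\<lambda>n. birkhoff shift (apply_bcontfun \<phi>) n \<sigma>" c]
        tendsto_diff[OF _ d, of "\<lambda>n. birkhoff shift (apply_bcontfun \<phi>) n (shift \<sigma>)" c] by auto
  qed
  show ?thesis unfolding generic_def weakly_def ev_empirical
    by (simp add: filterlim_sequentially_Suc[of "\<lambda>n. birkhoff shift (apply_bcontfun _) n _"] *)
qed

text \<open>Compactness gives a subsequential limit of the empirical measures, which is invariant
  since averages started at \<sigma> and at \<open>shift \<sigma>\<close> differ by a null sequence.
  Convergence on \<open>dense_seq\<close> promotes the subsequence to the full sequence.\<close>

lemma generic_exists:
  assumes conv: "\<And>j. convergent (\<lambda>n. birkhoff shift (apply_bcontfun (dense_seq j)) n \<sigma>)"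
  shows "\<exists>\<nu>. generic \<sigma> \<nu>"
proof -
  obtain r N where r: "strict_mono (r :: nat \<Rightarrow> nat)" "N \<in> prob_borel" "weakly (\<lambda>n. empirical (r n) \<sigma>) N"
    using prob_borel_seq_compact[of "\<lambda>n. empirical n \<sigma>"] empirical_prob_borel by metis
  have "N \<in> inv_measures"
    unfolding inv_iff[OF r(2)]
  proof
    fix \<phi> :: "(nat \<Rightarrow> 'w) \<Rightarrow>\<^sub>C real"
    let ?\<psi> = "\<lambda>\<sigma>. apply_bcontfun \<phi> (shift \<sigma>)"
    have [measurable]: "?\<psi> \<in> borel_measurable borel"
      by (rule borel_measurable_continuous_onI[OF continuous_bcontfun_shift(2)])
    have 1: "(\<lambda>n. birkhoff shift ?\<psi> (Suc (r n)) \<sigma>) \<longlonglongrightarrow> (\<integral>\<sigma>. ?\<psi> \<sigma> \<partial>N)"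
      using weaklyD[OF r(3) continuous_bcontfun_shift(2)[of \<phi>]] by (simp add: integral_empirical)
    have 2: "(\<lambda>n. birkhoff shift (apply_bcontfun \<phi>) (Suc (r n)) \<sigma>) \<longlonglongrightarrow> ev N \<phi>"
      using r(3) by (simp add: weakly_def ev_empirical)
    have eq: "birkhoff shift ?\<psi> n \<sigma> = birkhoff shift (apply_bcontfun \<phi>) n (shift \<sigma>)" for n
      unfolding birkhoff_def by (simp add: funpow_swap1)
    have "strict_mono (\<lambda>n. Suc (r n))" using r(1) by (simp add: strict_mono_def)
    then have "(\<lambda>n. birkhoff shift (apply_bcontfun \<phi>) (Suc (r n)) (shift \<sigma>) -
        birkhoff shift (apply_bcontfun \<phi>) (Suc (r n)) \<sigma>) \<longlonglongrightarrow> 0"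
      using LIMSEQ_subseq_LIMSEQ[OF birkhoff_shift_tendsto[where f="apply_bcontfun \<phi>" and T=shift and x=\<sigma>, OF bcontfun_bound]]
      by (simp add: comp_def)
    moreover have "(\<lambda>n. birkhoff shift (apply_bcontfun \<phi>) (Suc (r n)) (shift \<sigma>) -
        birkhoff shift (apply_bcontfun \<phi>) (Suc (r n)) \<sigma>) \<longlonglongrightarrow> (\<integral>\<sigma>. ?\<psi> \<sigma> \<partial>N) - ev N \<phi>"
      using tendsto_diff[OF 1 2] by (simp add: eq)
    ultimately have "(\<integral>\<sigma>. ?\<psi> \<sigma> \<partial>N) - ev N \<phi> = 0" by (rule LIMSEQ_unique[rotated])
    then show "(\<integral>\<sigma>. ?\<psi> \<sigma> \<partial>N) = ev N \<phi>" by simp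
  qed
  moreover have "weakly (\<lambda>n. empirical n \<sigma>) N"
  proof (rule weakly_dense[OF empirical_prob_borel r(2)])
    fix j
    obtain c where c: "(\<lambda>n. ev (empirical n \<sigma>) (dense_seq j)) \<longlonglongrightarrow> c"
      using conv[of j] unfolding convergent_def ev_empirical by (auto simp: filterlim_sequentially_Suc[of "\<lambda>n. birkhoff shift (apply_bcontfun _) n _"])
    have "(\<lambda>n. ev (empirical (r n) \<sigma>) (dense_seq j)) \<longlonglongrightarrow> c"
      using LIMSEQ_subseq_LIMSEQ[OF c r(1)] by (simp add: comp_def)
    then have "c = ev N (dense_seq j)" using weakly_ev[OF r(3)] LIMSEQ_unique by blast
    then show "(\<lambda>n. ev (empirical n \<sigma>) (dense_seq j)) \<longlonglongrightarrow> ev N (dense_seq j)" using c by simp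
  qed
  ultimately show ?thesis unfolding generic_def by blast
qed

text \<open>The cases are arranged so that the value is an invariant measure for every \<sigma>,
  whenever one exists, and so that shift invariance holds everywhere and not just almost everywhere.
  The transfer operator needs this, because it looks at preimages that may lie outside a given set
  of full measure.\<close>

definition component :: "(nat \<Rightarrow> 'w) \<Rightarrow> (nat \<Rightarrow> 'w) measure"
  where "component \<sigma> = (if \<exists>\<nu>. generic \<sigma> \<nu> then SOME \<nu>. generic \<sigma> \<nu> else SOME \<nu>. \<nu> \<in> inv_measures)"

lemma generic_component: "generic \<sigma> \<nu> \<Longrightarrow> generic \<sigma> (component \<sigma>)"
  unfolding component_def using someI_ex[of "generic \<sigma>"] by auto

lemma component_shift [simp]: "component (shift \<sigma>) = component \<sigma>"
  unfolding component_def generic_shift ..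

lemma component_inv:
  fixes \<mu> :: "(nat \<Rightarrow> 'w) measure"
  assumes "\<mu> \<in> inv_measures"
  shows "component \<sigma> \<in> inv_measures"
proof (cases "\<exists>\<nu>. generic \<sigma> \<nu>")
  case True then show ?thesis using generic_component by (auto simp: generic_def)
next
  case False
  then show ?thesis using someI[of "\<lambda>\<nu>. \<nu> \<in> inv_measures" \<mu>] assms by (simp add: component_def)
qed

lemma AE_generic:
  assumes "\<mu> \<in> inv_measures"
  shows "AE \<sigma> in \<mu>. generic \<sigma> (component \<sigma>)"
proof -
  interpret measure_preserving \<mu> shift by (rule inv_measure_preserving[OF assms])
  have "AE \<sigma> in \<mu>. convergent (\<lambda>n. birkhoff shift (apply_bcontfun (dense_seq j)) n \<sigma>)" for j
    by (rule birkhoff_convergent[where B="norm (dense_seq j)"])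
      (rule measurable_prob_borel[OF inv_prob_borel[OF assms] bcontfun_measurable], rule bcontfun_bound)
  then have "AE \<sigma> in \<mu>. \<forall>j. convergent (\<lambda>n. birkhoff shift (apply_bcontfun (dense_seq j)) n \<sigma>)"
    by (simp add: AE_all_countable)
  then show ?thesis
    by eventually_elim (use generic_exists generic_component in blast)
qed

lemma component_measurable:
  assumes "inv_measures \<noteq> ({} :: (nat \<Rightarrow> 'w) measure set)"
  shows "component \<in> measurable borel BP"
  unfolding BP_def
proof (rule measurable_vimage_algebra2)
  obtain \<mu> :: "(nat \<Rightarrow> 'w) measure" where \<mu>: "\<mu> \<in> inv_measures" using assms by auto
  show "component \<in> space borel \<rightarrow> inv_measures" using component_inv[OF \<mu>] by auto
  define \<mu>0 :: "(nat \<Rightarrow> 'w) measure" where "\<mu>0 = (SOME \<nu>. \<nu> \<in> inv_measures)"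
  define B where "B j n \<sigma> = birkhoff shift (apply_bcontfun (dense_seq j)) n \<sigma>" for j n and \<sigma> :: "nat \<Rightarrow> 'w"
  have [measurable]: "B j n \<in> borel_measurable borel" for j n
    unfolding B_def[abs_def] by (rule borel_measurable_continuous_onI[OF continuous_birkhoff[OF continuous_bcontfun]])
  have eq: "(\<exists>\<nu>. generic \<sigma> \<nu>) \<longleftrightarrow> (\<forall>j. convergent (\<lambda>n. B j n \<sigma>))" for \<sigma>
    using generic_exists genericD unfolding B_def convergent_def by blast
  \<comment> \<open>Having a generic measure amounts to convergence of countably many Birkhoff
    averages, a Borel condition; each coordinate is their limit there and a constant
    elsewhere.\<close>
  have "code (component \<sigma>) j = (if \<forall>j. Cauchy (\<lambda>n. B j n \<sigma>) then lim (\<lambda>n. B j n \<sigma>) else code \<mu>0 j)" for \<sigma> j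
  proof (cases "\<exists>\<nu>. generic \<sigma> \<nu>")
    case True
    then have "(\<lambda>n. B j n \<sigma>) \<longlonglongrightarrow> code (component \<sigma>) j"
      unfolding B_def code_def using generic_component genericD by blast
    then show ?thesis using True eq[of \<sigma>] by (simp add: Cauchy_convergent_iff limI)
  next
    case False
    then have "component \<sigma> = \<mu>0" by (simp add: component_def \<mu>0_def)
    moreover have "\<not> (\<forall>j. Cauchy (\<lambda>n. B j n \<sigma>))" using False eq[of \<sigma>] by (simp add: Cauchy_convergent_iff)
    ultimately show ?thesis by auto
  qed
  moreover have "{\<sigma> \<in> space borel. \<forall>j. Cauchy (\<lambda>n. B j n \<sigma>)} \<in> sets borel"
    by (intro sets.sets_Collect_countable_All sets_Collect_Cauchy) measurable
  then have "(\<lambda>\<sigma>. if \<forall>j. Cauchy (\<lambda>n. B j n \<sigma>) then lim (\<lambda>n. B j n \<sigma>) else code \<mu>0 j) \<in> borel_measurable borel" for j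
    by (intro measurable_If borel_measurable_lim_metric) simp_all
  ultimately show "(\<lambda>\<sigma>. code (component \<sigma>)) \<in> borel_measurable borel"
    by (intro measurable_coordinatewise_then_product) simp
qed

lemma component_measurable':
  assumes "\<mu> \<in> inv_measures"
  shows "component \<in> measurable \<mu> BP"
  by (rule measurable_prob_borel[OF inv_prob_borel[OF assms] component_measurable]) (use assms in auto)

text \<open>Functions of the component are invariant, so the integral does not change when the
  continuous factor is replaced by its Birkhoff averages, which tend to the component's integral.\<close>

lemma integral_component:
  fixes G :: "(nat \<Rightarrow> 'w) measure \<Rightarrow> real"
  assumes \<mu>: "\<mu> \<in> inv_measures" and G [measurable]: "G \<in> borel_measurable BP"
    and B: "\<And>\<nu>. \<nu> \<in> inv_measures \<Longrightarrow> \<bar>G \<nu>\<bar> \<le> B"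
  shows "(\<integral>\<sigma>. G (component \<sigma>) * ev (component \<sigma>) \<phi> \<partial>\<mu>) = (\<integral>\<sigma>. G (component \<sigma>) * apply_bcontfun \<phi> \<sigma> \<partial>\<mu>)"
proof -
  interpret measure_preserving \<mu> shift by (rule inv_measure_preserving[OF \<mu>])
  have [measurable]: "component \<in> measurable \<mu> BP" by (rule component_measurable'[OF \<mu>])
  have [measurable]: "apply_bcontfun \<phi> \<in> borel_measurable \<mu>"
    by (rule measurable_prob_borel[OF inv_prob_borel[OF \<mu>]]) simp
  have B0: "B \<ge> 0" using B[OF \<mu>] by linarith
  have GB: "\<bar>G (component \<sigma>)\<bar> \<le> B" for \<sigma> by (rule B[OF component_inv[OF \<mu>]])
  have comp_n: "component ((shift ^^ k) \<sigma>) = component \<sigma>" for k \<sigma> by (induction k) simp_all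
  have "(\<lambda>n. \<integral>\<sigma>. G (component \<sigma>) * birkhoff shift (apply_bcontfun \<phi>) n \<sigma> \<partial>\<mu>) \<longlonglongrightarrow>
      (\<integral>\<sigma>. G (component \<sigma>) * ev (component \<sigma>) \<phi> \<partial>\<mu>)"
  proof (rule integral_dominated_convergence[where w="\<lambda>_. B * norm \<phi>"])
    show "AE \<sigma> in \<mu>. (\<lambda>n. G (component \<sigma>) * birkhoff shift (apply_bcontfun \<phi>) n \<sigma>)
        \<longlonglongrightarrow> G (component \<sigma>) * ev (component \<sigma>) \<phi>"
      using AE_generic[OF \<mu>] by eventually_elim (intro tendsto_intros genericD)
    show "AE \<sigma> in \<mu>. norm (G (component \<sigma>) * birkhoff shift (apply_bcontfun \<phi>) n \<sigma>) \<le> B * norm \<phi>" for n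
      using GB birkhoff_bcontfun_bound B0 by (intro AE_I2) (auto simp: abs_mult intro!: mult_mono)
  qed simp_all
  moreover have "(\<integral>\<sigma>. G (component \<sigma>) * birkhoff shift (apply_bcontfun \<phi>) n \<sigma> \<partial>\<mu>) =
      (\<integral>\<sigma>. G (component \<sigma>) * apply_bcontfun \<phi> \<sigma> \<partial>\<mu>)" if "n > 0" for n
  proof -
    have "G (component \<sigma>) * birkhoff shift (apply_bcontfun \<phi>) n \<sigma> =
        birkhoff shift (\<lambda>\<sigma>. G (component \<sigma>) * apply_bcontfun \<phi> \<sigma>) n \<sigma>" for \<sigma>
      by (simp add: birkhoff_def comp_n sum_distrib_left)
    then show ?thesis
      using GB bcontfun_bound[of \<phi>] B0
      by (simp add: integral_birkhoff[where B="B * norm \<phi>"] abs_mult mult_mono that)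
  qed
  then have "eventually (\<lambda>n. (\<integral>\<sigma>. G (component \<sigma>) * birkhoff shift (apply_bcontfun \<phi>) n \<sigma> \<partial>\<mu>) =
      (\<integral>\<sigma>. G (component \<sigma>) * apply_bcontfun \<phi> \<sigma> \<partial>\<mu>)) sequentially"
    by (intro eventually_mono[OF eventually_gt_at_top[of 0]])
  then have "(\<lambda>n. \<integral>\<sigma>. G (component \<sigma>) * birkhoff shift (apply_bcontfun \<phi>) n \<sigma> \<partial>\<mu>) \<longlonglongrightarrow>
      (\<integral>\<sigma>. G (component \<sigma>) * apply_bcontfun \<phi> \<sigma> \<partial>\<mu>)" by (rule tendsto_eventually)
  ultimately show ?thesis by (rule LIMSEQ_unique)
qed

lemma integral_component_ev:
  assumes "\<mu> \<in> inv_measures"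
  shows "(\<integral>\<sigma>. ev (component \<sigma>) \<phi> \<partial>\<mu>) = ev \<mu> \<phi>"
  using integral_component[OF assms, of "\<lambda>_. 1" 1 \<phi>] by simp

text \<open>The hypothesis makes the indicator of \<open>A\<close> uncorrelated with continuous
  functions, so this indicator and the constant \<open>measure \<mu> A\<close> are densities of the
  same measure. Evaluation on \<open>A\<close> gives a number equal to its square. Besides the
  components, the block products below are treated by this criterion.\<close>

lemma zero_one_of_product:
  fixes \<mu> :: "(nat \<Rightarrow> 'w) measure"
  assumes \<mu>: "\<mu> \<in> prob_borel" and A: "A \<in> sets borel"
    and key: "\<And>\<phi>. (\<integral>\<sigma>. indicator A \<sigma> * apply_bcontfun \<phi> \<sigma> \<partial>\<mu>) = measure \<mu> A * ev \<mu> \<phi>"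
  shows "measure \<mu> A = 0 \<or> measure \<mu> A = 1"
proof -
  note \<mu>b = prob_borelD[OF \<mu>]
  interpret prob_space \<mu> by (rule \<mu>b)
  have [measurable]: "A \<in> sets \<mu>" using A \<mu>b by simp
  have fin: "finite_measure (density \<mu> (\<lambda>\<sigma>. ennreal (w \<sigma>)))"
    if [measurable]: "w \<in> borel_measurable \<mu>" and w: "\<And>\<sigma>. w \<sigma> \<le> 1" for w
  proof (rule finite_measureI)
    have "emeasure (density \<mu> (\<lambda>\<sigma>. ennreal (w \<sigma>))) (space \<mu>) \<le> (\<integral>\<^sup>+\<sigma>. 1 \<partial>\<mu>)"
    proof (subst emeasure_density)
      have "ennreal (w x) * indicator (space \<mu>) x \<le> 1" for x
        using w[of x] by (auto simp: indicator_def)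
      then show "(\<integral>\<^sup>+x. ennreal (w x) * indicator (space \<mu>) x \<partial>\<mu>) \<le> (\<integral>\<^sup>+\<sigma>. 1 \<partial>\<mu>)"
        by (intro nn_integral_mono)
    qed auto
    then show "emeasure (density \<mu> (\<lambda>\<sigma>. ennreal (w \<sigma>))) (space (density \<mu> (\<lambda>\<sigma>. ennreal (w \<sigma>)))) \<noteq> \<infinity>"
      by (auto simp: emeasure_space_1 top_unique)
  qed
  have "density \<mu> (\<lambda>\<sigma>. ennreal (indicator A \<sigma>)) = density \<mu> (\<lambda>\<sigma>. ennreal (measure \<mu> A))"
  proof (rule measure_eqI_continuous)
    show "finite_measure (density \<mu> (\<lambda>\<sigma>. ennreal (indicator A \<sigma>)))"
      "finite_measure (density \<mu> (\<lambda>\<sigma>. ennreal (measure \<mu> A)))"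
      by (intro fin; simp)+
    fix f :: "(nat \<Rightarrow> 'w) \<Rightarrow> real" assume f: "continuous_on UNIV f"
    then have "f \<in> borel_measurable \<mu>"
      by (intro measurable_prob_borel[OF \<mu>] borel_measurable_continuous_onI)
    then show "(\<integral>\<sigma>. f \<sigma> \<partial>density \<mu> (\<lambda>\<sigma>. ennreal (indicator A \<sigma>))) = (\<integral>\<sigma>. f \<sigma> \<partial>density \<mu> (\<lambda>\<sigma>. ennreal (measure \<mu> A)))"
      using key[of "Bcontfun f"] apply_Bcontfun[OF f] by (simp add: integral_density)
  qed (use \<mu>b in auto)
  then have "emeasure (density \<mu> (\<lambda>\<sigma>. ennreal (indicator A \<sigma>))) A = emeasure (density \<mu> (\<lambda>\<sigma>. ennreal (measure \<mu> A))) A"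
    by simp
  then have "ennreal (measure \<mu> A) = ennreal (measure \<mu> A * measure \<mu> A)"
    by (simp add: emeasure_density nn_integral_cmult emeasure_eq_measure ennreal_mult ennreal_indicator
      flip: indicator_inter_arith)
  then have "measure \<mu> A = measure \<mu> A * measure \<mu> A" by simp
  then show ?thesis by simp
qed

text \<open>Under an ergodic measure each coordinate of \<open>component\<close> is an invariant
  function with mean \<open>code \<mu> j\<close>, hence constant. Conversely, if the Birkhoff
  averages tend to the constant \<open>ev \<mu> \<phi>\<close>, averaging along orbits shows that an
  invariant set is uncorrelated with every \<phi>.\<close>

lemma ergodic_iff_component:
  assumes \<mu>: "\<mu> \<in> inv_measures"
  shows "\<mu> \<in> ergodic_measures \<longleftrightarrow> (AE \<sigma> in \<mu>. component \<sigma> = \<mu>)"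
proof
  assume erg: "\<mu> \<in> ergodic_measures"
  interpret measure_preserving \<mu> shift by (rule inv_measure_preserving[OF \<mu>])
  note \<mu>b = prob_borelD[OF inv_prob_borel[OF \<mu>]]
  have cmb: "component \<in> measurable borel BP" using component_measurable \<mu> by auto
  have "AE \<sigma> in \<mu>. code (component \<sigma>) j = code \<mu> j" for j
  proof -
    define g where "g \<sigma> = code (component \<sigma>) j" for \<sigma>
    define c where "c = code \<mu> j"
    have gb: "\<bar>g \<sigma>\<bar> \<le> norm (dense_seq j)" for \<sigma>
      unfolding g_def code_def by (rule ev_bound[OF inv_prob_borel[OF component_inv[OF \<mu>]]])
    have gm: "g \<in> borel_measurable borel"
      unfolding g_def
      by (rule measurable_compose[OF cmb measurable_product_then_coordinatewise[OF code_measurable]])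
    have [measurable]: "g \<in> borel_measurable \<mu>" by (rule measurable_prob_borel[OF inv_prob_borel[OF \<mu>] gm])
    have ig: "integrable \<mu> g" using gb by (intro integrable_const_bound[of _ "norm (dense_seq j)"]) auto
    have int: "(\<integral>\<sigma>. g \<sigma> \<partial>\<mu>) = c"
      unfolding g_def c_def code_def by (rule integral_component_ev[OF \<mu>])
    have zero_one: "measure \<mu> {\<sigma>. P (g \<sigma>)} = 0 \<or> measure \<mu> {\<sigma>. P (g \<sigma>)} = 1"
      if [measurable]: "Measurable.pred borel P" for P
    proof -
      have "{\<sigma>. P (g \<sigma>)} \<in> sets borel" using gm by measurable
      moreover have "shift -` {\<sigma>. P (g \<sigma>)} = {\<sigma>. P (g \<sigma>)}" by (auto simp: g_def)
      ultimately show ?thesis using erg unfolding ergodic_measures_def by blast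
    qed
    have sets_lt: "{\<sigma>. s * g \<sigma> < s * c} \<in> sets \<mu>" for s
    proof -
      have "{\<sigma> \<in> space \<mu>. s * g \<sigma> < s * c} \<in> sets \<mu>" by measurable
      then show ?thesis by (simp add: \<mu>b(3))
    qed
    \<comment> \<open>The sign \<open>s\<close> is 1 or -1 and covers both strict inequalities;
      either of them holding almost everywhere would contradict the value of the mean.\<close>
    have not_one: False if "s * s = (1::real)" "measure \<mu> {\<sigma>. s * g \<sigma> < s * c} = 1" for s
    proof -
      have AE: "AE \<sigma> in \<mu>. s * g \<sigma> < s * c"
        using that(2) prob_eq_1[OF sets_lt] by simp
      have "(\<integral>\<sigma>. s * g \<sigma> \<partial>\<mu>) < (\<integral>\<sigma>. s * c \<partial>\<mu>)"
        by (rule integral_less_AE_space) (use ig AE emeasure_space_1 in auto)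
      then show False using int by (simp add: prob_space)
    qed
    have AEn: "AE \<sigma> in \<mu>. \<not> (s * g \<sigma> < s * c)" if "s * s = (1::real)" for s
    proof -
      have "measure \<mu> {\<sigma>. s * g \<sigma> < s * c} = 0"
        using zero_one[of "\<lambda>x. s * x < s * c"] not_one[OF that] by auto
      then show ?thesis using prob_eq_0[OF sets_lt] by simp
    qed
    have "AE \<sigma> in \<mu>. \<not> g \<sigma> < c" "AE \<sigma> in \<mu>. \<not> - g \<sigma> < - c" using AEn[of 1] AEn[of "-1"] by simp_all
    then show ?thesis unfolding g_def[symmetric] c_def[symmetric] by eventually_elim linarith
  qed
  then have "AE \<sigma> in \<mu>. \<forall>j. code (component \<sigma>) j = code \<mu> j" by (simp add: AE_all_countable)
  then show "AE \<sigma> in \<mu>. component \<sigma> = \<mu>"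
    by eventually_elim (rule inj_code, use component_inv[OF \<mu>] \<mu> inv_prob_borel in auto)
next
  assume ae: "AE \<sigma> in \<mu>. component \<sigma> = \<mu>"
  interpret measure_preserving \<mu> shift by (rule inv_measure_preserving[OF \<mu>])
  note \<mu>b = prob_borelD[OF inv_prob_borel[OF \<mu>]]
  have "measure \<mu> A = 0 \<or> measure \<mu> A = 1" if A: "A \<in> sets borel" "shift -` A = A" for A
  proof -
    have [measurable]: "A \<in> sets \<mu>" using A \<mu>b by simp
    have [measurable]: "apply_bcontfun \<phi> \<in> borel_measurable \<mu>" for \<phi> :: "(nat \<Rightarrow> 'w) \<Rightarrow>\<^sub>C real"
      by (rule measurable_prob_borel[OF inv_prob_borel[OF \<mu>]]) simp
    have An: "(shift ^^ k) \<sigma> \<in> A \<longleftrightarrow> \<sigma> \<in> A" for k \<sigma>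
      by (induction k) (use A(2) in auto)
    have key: "(\<integral>\<sigma>. indicator A \<sigma> * apply_bcontfun \<phi> \<sigma> \<partial>\<mu>) = measure \<mu> A * ev \<mu> \<phi>" for \<phi>
    proof -
      have "(\<lambda>n. \<integral>\<sigma>. indicator A \<sigma> * birkhoff shift (apply_bcontfun \<phi>) n \<sigma> \<partial>\<mu>) \<longlonglongrightarrow>
          (\<integral>\<sigma>. indicator A \<sigma> * ev \<mu> \<phi> \<partial>\<mu>)"
      proof (rule integral_dominated_convergence[where w="\<lambda>_. norm \<phi>"])
        show "AE \<sigma> in \<mu>. (\<lambda>n. indicator A \<sigma> * birkhoff shift (apply_bcontfun \<phi>) n \<sigma>)
            \<longlonglongrightarrow> indicator A \<sigma> * ev \<mu> \<phi>"
          using AE_generic[OF \<mu>] ae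
          by eventually_elim (auto intro!: tendsto_intros genericD)
        show "AE \<sigma> in \<mu>. norm (indicator A \<sigma> * birkhoff shift (apply_bcontfun \<phi>) n \<sigma>) \<le> norm \<phi>" for n
          using birkhoff_bcontfun_bound[of shift \<phi> n] by (intro AE_I2) (auto simp: indicator_def)
      qed simp_all
      moreover have "(\<integral>\<sigma>. indicator A \<sigma> * birkhoff shift (apply_bcontfun \<phi>) n \<sigma> \<partial>\<mu>) =
          (\<integral>\<sigma>. indicator A \<sigma> * apply_bcontfun \<phi> \<sigma> \<partial>\<mu>)" if "n > 0" for n
      proof -
        have "indicator A \<sigma> * birkhoff shift (apply_bcontfun \<phi>) n \<sigma> =
            birkhoff shift (\<lambda>\<sigma>. indicator A \<sigma> * apply_bcontfun \<phi> \<sigma>) n \<sigma>" for \<sigma>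
          by (simp add: birkhoff_def An indicator_def sum_distrib_left)
        then show ?thesis
          using bcontfun_bound[of \<phi>] that
          by (simp add: integral_birkhoff[where B="norm \<phi>"] indicator_def abs_mult)
      qed
      then have "eventually (\<lambda>n. (\<integral>\<sigma>. indicator A \<sigma> * birkhoff shift (apply_bcontfun \<phi>) n \<sigma> \<partial>\<mu>) =
          (\<integral>\<sigma>. indicator A \<sigma> * apply_bcontfun \<phi> \<sigma> \<partial>\<mu>)) sequentially"
        by (intro eventually_mono[OF eventually_gt_at_top[of 0]])
      then have "(\<lambda>n. \<integral>\<sigma>. indicator A \<sigma> * birkhoff shift (apply_bcontfun \<phi>) n \<sigma> \<partial>\<mu>) \<longlonglongrightarrow>
          (\<integral>\<sigma>. indicator A \<sigma> * apply_bcontfun \<phi> \<sigma> \<partial>\<mu>)" by (rule tendsto_eventually)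
      ultimately show ?thesis by (simp add: LIMSEQ_unique)
    qed
    show ?thesis by (rule zero_one_of_product[OF inv_prob_borel[OF \<mu>] A(1) key])
  qed
  then show "\<mu> \<in> ergodic_measures" using \<mu> by (simp add: ergodic_measures_def)
qed

text \<open>Second moment of a coordinate of the components of \<nu>. Ergodicity means that all the
  variances vanish, which are countably many measurable conditions on \<nu>; in this way the set of
  ergodic measures is seen to be Borel.\<close>

definition square_mean :: "nat \<Rightarrow> (nat \<Rightarrow> 'w) measure \<Rightarrow> real"
  where "square_mean j \<nu> = (\<integral>\<sigma>. (code (component \<sigma>) j)\<^sup>2 \<partial>\<nu>)"

lemma code_bound: "\<mu> \<in> inv_measures \<Longrightarrow> \<bar>code \<mu> j\<bar> \<le> norm (dense_seq j)"
  unfolding code_def by (rule ev_bound[OF inv_prob_borel])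

lemma component_code_measurable:
  fixes \<mu> :: "(nat \<Rightarrow> 'w) measure"
  assumes "\<mu> \<in> inv_measures"
  shows "(\<lambda>\<sigma>. code (component \<sigma>) j) \<in> borel_measurable \<mu>"
  by (rule measurable_compose[OF component_measurable'[OF assms]
        measurable_product_then_coordinatewise[OF code_measurable]])

lemma square_mean_limit:
  assumes \<nu>: "\<nu> \<in> inv_measures"
  shows "(\<lambda>n. \<integral>\<sigma>. (birkhoff shift (apply_bcontfun (dense_seq j)) n \<sigma>)\<^sup>2 \<partial>\<nu>) \<longlonglongrightarrow> square_mean j \<nu>"
  unfolding square_mean_def
proof (rule integral_dominated_convergence[where w="\<lambda>_. (norm (dense_seq j))\<^sup>2"])
  interpret measure_preserving \<nu> shift by (rule inv_measure_preserving[OF \<nu>])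
  have [measurable]: "apply_bcontfun \<phi> \<in> borel_measurable \<nu>" for \<phi> :: "(nat \<Rightarrow> 'w) \<Rightarrow>\<^sub>C real"
    by (rule measurable_prob_borel[OF inv_prob_borel[OF \<nu>]]) simp
  have [measurable]: "(\<lambda>\<sigma>. code (component \<sigma>) j) \<in> borel_measurable \<nu>"
    by (rule component_code_measurable[OF \<nu>])
  show "(\<lambda>\<sigma>. (code (component \<sigma>) j)\<^sup>2) \<in> borel_measurable \<nu>"
    "(\<lambda>\<sigma>. (birkhoff shift (apply_bcontfun (dense_seq j)) n \<sigma>)\<^sup>2) \<in> borel_measurable \<nu>" for n
    by measurable
  show "AE \<sigma> in \<nu>. (\<lambda>n. (birkhoff shift (apply_bcontfun (dense_seq j)) n \<sigma>)\<^sup>2) \<longlonglongrightarrow> (code (component \<sigma>) j)\<^sup>2"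
    using AE_generic[OF \<nu>] by eventually_elim (auto simp: code_def intro!: tendsto_intros genericD)
  show "AE \<sigma> in \<nu>. norm ((birkhoff shift (apply_bcontfun (dense_seq j)) n \<sigma>)\<^sup>2) \<le> (norm (dense_seq j))\<^sup>2" for n
    using birkhoff_bcontfun_bound[of shift "dense_seq j" n] by (simp add: power2_le_iff_abs_le)
  show "integrable \<nu> (\<lambda>_. (norm (dense_seq j))\<^sup>2)" by simp
qed

lemma square_birkhoff_bcontfun:
  "\<exists>\<phi>. \<forall>\<sigma>. apply_bcontfun \<phi> \<sigma> = (birkhoff shift (apply_bcontfun (dense_seq j)) n \<sigma>)\<^sup>2"
proof -
  have "continuous_on UNIV (\<lambda>\<sigma>. (birkhoff shift (apply_bcontfun (dense_seq j)) n \<sigma>)\<^sup>2)"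
    by (intro continuous_intros continuous_birkhoff continuous_bcontfun)
  then show ?thesis using apply_Bcontfun by metis
qed

text \<open>A pointwise limit of integrals of squared Birkhoff averages, which are continuous
  functions of the sequence and therefore have integrals measurable in \<nu>.\<close>

lemma square_mean_measurable [measurable]: "square_mean j \<in> borel_measurable BP"
proof (rule borel_measurable_LIMSEQ_real)
  show "\<nu> \<in> space BP \<Longrightarrow> (\<lambda>n. \<integral>\<sigma>. (birkhoff shift (apply_bcontfun (dense_seq j)) n \<sigma>)\<^sup>2 \<partial>\<nu>) \<longlonglongrightarrow> square_mean j \<nu>" for \<nu>
    by (rule square_mean_limit) simp
  show "(\<lambda>\<nu>. \<integral>\<sigma>. (birkhoff shift (apply_bcontfun (dense_seq j)) n \<sigma>)\<^sup>2 \<partial>\<nu>) \<in> borel_measurable BP" for n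
  proof -
    obtain \<phi> where "\<And>\<sigma>. apply_bcontfun \<phi> \<sigma> = (birkhoff shift (apply_bcontfun (dense_seq j)) n \<sigma>)\<^sup>2"
      using square_birkhoff_bcontfun by blast
    then show ?thesis using ev_measurable[of \<phi>] by simp
  qed
qed

lemma variance_component:
  assumes \<nu>: "\<nu> \<in> inv_measures"
  shows "(\<integral>\<sigma>. (code (component \<sigma>) j - code \<nu> j)\<^sup>2 \<partial>\<nu>) = square_mean j \<nu> - (code \<nu> j)\<^sup>2"
    and "integrable \<nu> (\<lambda>\<sigma>. (code (component \<sigma>) j)\<^sup>2)"
    and "integrable \<nu> (\<lambda>\<sigma>. (code (component \<sigma>) j - code \<nu> j)\<^sup>2)"
proof -
  interpret measure_preserving \<nu> shift by (rule inv_measure_preserving[OF \<nu>])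
  have [measurable]: "(\<lambda>\<sigma>. code (component \<sigma>) j) \<in> borel_measurable \<nu>"
    by (rule component_code_measurable[OF \<nu>])
  have b: "\<bar>code (component \<sigma>) j\<bar> \<le> norm (dense_seq j)" for \<sigma>
    by (rule code_bound[OF component_inv[OF \<nu>]])
  have i1: "integrable \<nu> (\<lambda>\<sigma>. code (component \<sigma>) j)"
    using b by (intro integrable_const_bound[of _ "norm (dense_seq j)"]) auto
  show i2: "integrable \<nu> (\<lambda>\<sigma>. (code (component \<sigma>) j)\<^sup>2)"
    using b by (intro integrable_const_bound[of _ "(norm (dense_seq j))\<^sup>2"]) (auto simp: power2_le_iff_abs_le)
  have e: "(\<integral>\<sigma>. code (component \<sigma>) j \<partial>\<nu>) = code \<nu> j"
    unfolding code_def by (rule integral_component_ev[OF \<nu>])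
  have *: "(code (component \<sigma>) j - code \<nu> j)\<^sup>2 = (code (component \<sigma>) j)\<^sup>2 - 2 * code \<nu> j * code (component \<sigma>) j + (code \<nu> j)\<^sup>2" for \<sigma>
    by (simp add: power2_diff algebra_simps)
  show "integrable \<nu> (\<lambda>\<sigma>. (code (component \<sigma>) j - code \<nu> j)\<^sup>2)"
    unfolding * using i1 i2 by simp
  show "(\<integral>\<sigma>. (code (component \<sigma>) j - code \<nu> j)\<^sup>2 \<partial>\<nu>) = square_mean j \<nu> - (code \<nu> j)\<^sup>2"
    unfolding * square_mean_def using i1 i2 by (simp add: e prob_space power2_eq_square)
qed

lemma ergodic_iff_square_mean:
  assumes \<nu>: "\<nu> \<in> inv_measures"
  shows "\<nu> \<in> ergodic_measures \<longleftrightarrow> (\<forall>j. square_mean j \<nu> = (code \<nu> j)\<^sup>2)"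
proof -
  have "(AE \<sigma> in \<nu>. component \<sigma> = \<nu>) \<longleftrightarrow> (AE \<sigma> in \<nu>. \<forall>j. code (component \<sigma>) j = code \<nu> j)"
    using inj_code[OF inv_prob_borel[OF component_inv[OF \<nu>]] inv_prob_borel[OF \<nu>]]
    by (intro AE_cong) (auto simp: fun_eq_iff)
  also have "\<dots> \<longleftrightarrow> (\<forall>j. AE \<sigma> in \<nu>. (code (component \<sigma>) j - code \<nu> j)\<^sup>2 = 0)"
    by (simp add: AE_all_countable)
  also have "\<dots> \<longleftrightarrow> (\<forall>j. (\<integral>\<sigma>. (code (component \<sigma>) j - code \<nu> j)\<^sup>2 \<partial>\<nu>) = 0)"
    using variance_component(3)[OF \<nu>] by (subst integral_nonneg_eq_0_iff_AE) auto
  finally show ?thesis using variance_component(1)[OF \<nu>] ergodic_iff_component[OF \<nu>] by simp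
qed

lemma ergodic_sub_inv: "ergodic_measures \<subseteq> inv_measures"
  by (auto simp: ergodic_measures_def)

lemma ergodic_sets [measurable]: "(ergodic_measures :: (nat \<Rightarrow> 'w) measure set) \<in> sets BP"
proof -
  have "ergodic_measures = {\<nu> \<in> space BP. \<forall>j. square_mean j \<nu> = (code \<nu> j)\<^sup>2}"
    using ergodic_sub_inv ergodic_iff_square_mean by auto
  also have "\<dots> \<in> sets BP"
  proof -
    have [measurable]: "(\<lambda>\<nu>. code \<nu> j) \<in> borel_measurable BP" for j
      by (rule measurable_product_then_coordinatewise[OF code_measurable])
    show ?thesis by measurable
  qed
  finally show ?thesis .
qed

text \<open>The variance within a component is nonnegative. Its mean over \<mu> vanishes, since the
  means of the second moments of the components and of their squared coordinates both equal
  \<open>square_mean j \<mu>\<close>.\<close>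

lemma AE_component_ergodic:
  assumes \<mu>: "\<mu> \<in> inv_measures"
  shows "AE \<sigma> in \<mu>. component \<sigma> \<in> ergodic_measures"
proof -
  interpret measure_preserving \<mu> shift by (rule inv_measure_preserving[OF \<mu>])
  have [measurable]: "component \<in> measurable \<mu> BP" by (rule component_measurable'[OF \<mu>])
  have inv: "component \<sigma> \<in> inv_measures" for \<sigma> by (rule component_inv[OF \<mu>])
  have "AE \<sigma> in \<mu>. square_mean j (component \<sigma>) - (code (component \<sigma>) j)\<^sup>2 = 0" for j
  proof -
    let ?b = "(norm (dense_seq j))\<^sup>2"
    have B: "\<bar>\<integral>\<sigma>. (birkhoff shift (apply_bcontfun (dense_seq j)) n \<sigma>)\<^sup>2 \<partial>\<nu>\<bar> \<le> ?b" if "\<nu> \<in> inv_measures" for n \<nu>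
    proof -
      obtain \<phi> where \<phi>: "\<And>\<sigma>. apply_bcontfun \<phi> \<sigma> = (birkhoff shift (apply_bcontfun (dense_seq j)) n \<sigma>)\<^sup>2"
        using square_birkhoff_bcontfun by blast
      have "norm \<phi> \<le> ?b"
        using birkhoff_bcontfun_bound[of shift "dense_seq j" n]
        by (intro norm_bound) (simp add: \<phi> power2_le_iff_abs_le)
      then show ?thesis using ev_bound[OF inv_prob_borel[OF that], of \<phi>] by (simp add: \<phi>)
    qed
    have sb: "\<bar>square_mean j \<nu>\<bar> \<le> ?b" if "\<nu> \<in> inv_measures" for \<nu>
      by (rule LIMSEQ_le_const2[OF tendsto_rabs[OF square_mean_limit[OF that]]]) (use B[OF that] in auto)
    have i1: "integrable \<mu> (\<lambda>\<sigma>. square_mean j (component \<sigma>))"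
      using sb[OF inv] by (intro integrable_const_bound[of _ ?b]) auto
    note i2 = variance_component(2)[OF \<mu>, of j]
    have "(\<lambda>n. \<integral>\<sigma>. (\<integral>\<tau>. (birkhoff shift (apply_bcontfun (dense_seq j)) n \<tau>)\<^sup>2 \<partial>component \<sigma>) \<partial>\<mu>) \<longlonglongrightarrow>
        (\<integral>\<sigma>. square_mean j (component \<sigma>) \<partial>\<mu>)"
    proof (rule integral_dominated_convergence[where w="\<lambda>_. ?b"])
      show "(\<lambda>\<sigma>. \<integral>\<tau>. (birkhoff shift (apply_bcontfun (dense_seq j)) n \<tau>)\<^sup>2 \<partial>component \<sigma>) \<in> borel_measurable \<mu>" for n
      proof -
        obtain \<phi> where "\<And>\<sigma>. apply_bcontfun \<phi> \<sigma> = (birkhoff shift (apply_bcontfun (dense_seq j)) n \<sigma>)\<^sup>2"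
          using square_birkhoff_bcontfun by blast
        then show ?thesis using measurable_compose[OF component_measurable'[OF \<mu>] ev_measurable[of \<phi>]] by simp
      qed
    qed (use square_mean_limit[OF inv] B[OF inv] in auto)
    moreover have "(\<integral>\<sigma>. (\<integral>\<tau>. (birkhoff shift (apply_bcontfun (dense_seq j)) n \<tau>)\<^sup>2 \<partial>component \<sigma>) \<partial>\<mu>) =
        (\<integral>\<sigma>. (birkhoff shift (apply_bcontfun (dense_seq j)) n \<sigma>)\<^sup>2 \<partial>\<mu>)" for n
    proof -
      obtain \<phi> where "\<And>\<sigma>. apply_bcontfun \<phi> \<sigma> = (birkhoff shift (apply_bcontfun (dense_seq j)) n \<sigma>)\<^sup>2"
        using square_birkhoff_bcontfun by blast
      then show ?thesis using integral_component_ev[OF \<mu>, of \<phi>] by simp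
    qed
    ultimately have "(\<integral>\<sigma>. square_mean j (component \<sigma>) \<partial>\<mu>) = square_mean j \<mu>"
      using LIMSEQ_unique[OF _ square_mean_limit[OF \<mu>, of j]] by simp
    then have "(\<integral>\<sigma>. square_mean j (component \<sigma>) - (code (component \<sigma>) j)\<^sup>2 \<partial>\<mu>) = 0"
      using i1 i2 by (simp add: square_mean_def)
    moreover have "0 \<le> square_mean j (component \<sigma>) - (code (component \<sigma>) j)\<^sup>2" for \<sigma>
      unfolding variance_component(1)[OF inv, symmetric] by simp
    ultimately show ?thesis
      using i1 i2 by (subst (asm) integral_nonneg_eq_0_iff_AE) auto
  qed
  then have "AE \<sigma> in \<mu>. \<forall>j. square_mean j (component \<sigma>) - (code (component \<sigma>) j)\<^sup>2 = 0"
    by (simp add: AE_all_countable)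
  then show ?thesis
    by eventually_elim (use ergodic_iff_square_mean[OF inv] in auto)
qed

section \<open>Existence and uniqueness of the Choquet measure\<close>

lemma is_choquet_component:
  assumes \<mu>: "\<mu> \<in> inv_measures"
  shows "is_choquet_measure \<mu> (distr \<mu> BP component)"
  unfolding is_choquet_measure_def
proof (intro conjI allI)
  interpret measure_preserving \<mu> shift by (rule inv_measure_preserving[OF \<mu>])
  have cm [measurable]: "component \<in> measurable \<mu> BP" by (rule component_measurable'[OF \<mu>])
  show ps: "prob_space (distr \<mu> BP component)" by (rule prob_space_distr[OF cm])
  show "sets (distr \<mu> BP component) = sigma_sets inv_measures {U. openin inv_topology U}"
    by (simp add: sets_BP)
  show "emeasure (distr \<mu> BP component) ergodic_measures = 1"
  proof -
    interpret d: prob_space "distr \<mu> BP component" by (rule ps)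
    have "AE \<nu> in distr \<mu> BP component. \<nu> \<in> ergodic_measures"
    proof (subst AE_distr_iff[OF cm])
      have "{x \<in> space BP. x \<in> ergodic_measures} = ergodic_measures" using ergodic_sub_inv by auto
      then show "{x \<in> space BP. x \<in> ergodic_measures} \<in> sets BP" using ergodic_sets by simp
    qed (rule AE_component_ergodic[OF \<mu>])
    then show ?thesis by (subst d.emeasure_eq_1_AE) auto
  qed
  show "(\<integral>\<nu>. ev \<nu> \<phi> \<partial>distr \<mu> BP component) = ev \<mu> \<phi>" for \<phi>
    by (subst integral_distr) (simp_all add: integral_component_ev[OF \<mu>])
qed

text \<open>A continuous \<open>G\<close> applied to the Birkhoff averages of
  \<open>dense_seq\<close> is continuous on the sequence space and tends to
  \<open>G (code \<nu>)\<close> almost everywhere under an ergodic \<nu>. The barycenter condition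
  turns its mean over the decomposition into an integral against \<mu>, so the law of
  \<open>code\<close>, and with it the decomposition, depends on \<mu> alone.\<close>

lemma choquet_unique:
  fixes \<mu> :: "(nat \<Rightarrow> 'w) measure"
  assumes \<mu>: "\<mu> \<in> inv_measures" and X: "is_choquet_measure \<mu> \<xi>" and Y: "is_choquet_measure \<mu> \<eta>"
  shows "\<xi> = \<eta>"
proof -
  have lim: "(\<lambda>n. \<integral>\<sigma>. G (\<lambda>j. birkhoff shift (apply_bcontfun (dense_seq j)) n \<sigma>) \<partial>\<mu>) \<longlonglongrightarrow> (\<integral>\<nu>. G (code \<nu>) \<partial>\<xi>)"
    if G: "continuous_on UNIV G" "\<And>x. 0 \<le> G x" "\<And>x. G x \<le> 1" and X: "is_choquet_measure \<mu> \<xi>" for G :: "(nat \<Rightarrow> real) \<Rightarrow> real" and \<xi>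
  proof -
    interpret \<xi>: prob_space \<xi> using X by (simp add: is_choquet_measure_def)
    have s: "sets \<xi> = sets BP" using X by (simp add: is_choquet_measure_def sets_BP)
    have sp: "space \<xi> = inv_measures" using sets_eq_imp_space_eq[OF s] by simp
    have mb: "f \<in> borel_measurable \<xi>" if "f \<in> borel_measurable BP" for f :: "_ \<Rightarrow> real"
      using that measurable_cong_sets[OF s refl] by blast
    have Gm: "G \<in> borel_measurable borel" by (rule borel_measurable_continuous_onI[OF G(1)])
    define \<psi> where "\<psi> n \<sigma> = G (\<lambda>j. birkhoff shift (apply_bcontfun (dense_seq j)) n \<sigma>)" for n and \<sigma> :: "nat \<Rightarrow> 'w"
    have \<psi>c: "continuous_on UNIV (\<psi> n)" for n
    proof -
      have "continuous_on UNIV (\<lambda>\<sigma> j. birkhoff shift (apply_bcontfun (dense_seq j)) n \<sigma>)"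
        by (intro continuous_on_coordinatewise_then_product continuous_birkhoff continuous_bcontfun)
      then show ?thesis unfolding \<psi>_def by (rule continuous_on_compose2[OF G(1)]) simp
    qed
    have \<psi>b: "0 \<le> \<psi> n \<sigma>" "\<psi> n \<sigma> \<le> 1" for n \<sigma> using G by (auto simp: \<psi>_def)
    have e: "ev \<nu> (Bcontfun (\<psi> n)) = (\<integral>\<sigma>. \<psi> n \<sigma> \<partial>\<nu>)" for \<nu> :: "(nat \<Rightarrow> 'w) measure" and n by (rule ev_continuous[OF \<psi>c])
    have lim_erg: "(\<lambda>n. \<integral>\<sigma>. \<psi> n \<sigma> \<partial>\<nu>) \<longlonglongrightarrow> G (code \<nu>)" if "\<nu> \<in> ergodic_measures" for \<nu>
    proof -
      have \<nu>: "\<nu> \<in> inv_measures" using that ergodic_sub_inv by auto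
      interpret \<nu>: prob_space \<nu> using prob_borelD[OF inv_prob_borel[OF \<nu>]] by simp
      have "(\<lambda>n. \<integral>\<sigma>. \<psi> n \<sigma> \<partial>\<nu>) \<longlonglongrightarrow> (\<integral>\<sigma>. G (code \<nu>) \<partial>\<nu>)"
      proof (rule integral_dominated_convergence[where w="\<lambda>_. 1"])
        have "AE \<sigma> in \<nu>. component \<sigma> = \<nu>" using that ergodic_iff_component[OF \<nu>] by simp
        with AE_generic[OF \<nu>] show "AE \<sigma> in \<nu>. (\<lambda>n. \<psi> n \<sigma>) \<longlonglongrightarrow> G (code \<nu>)"
        proof eventually_elim
          case (elim \<sigma>)
          have "(\<lambda>n j. birkhoff shift (apply_bcontfun (dense_seq j)) n \<sigma>) \<longlonglongrightarrow> code \<nu>"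
            unfolding tendsto_fun_iff code_def using genericD[OF elim(1)] elim(2) by simp
          moreover have "isCont G (code \<nu>)" using G(1) by (simp add: continuous_on_eq_continuous_at)
          ultimately show ?case unfolding \<psi>_def by (rule isCont_tendsto_compose[rotated])
        qed
        show "\<psi> n \<in> borel_measurable \<nu>" for n
          by (rule measurable_prob_borel[OF inv_prob_borel[OF \<nu>] borel_measurable_continuous_onI[OF \<psi>c]])
      qed (use \<psi>b in auto)
      then show ?thesis by (simp add: \<nu>.prob_space)
    qed
    have "(\<lambda>n. \<integral>\<nu>. (\<integral>\<sigma>. \<psi> n \<sigma> \<partial>\<nu>) \<partial>\<xi>) \<longlonglongrightarrow> (\<integral>\<nu>. G (code \<nu>) \<partial>\<xi>)"
    proof (rule integral_dominated_convergence[where w="\<lambda>_. 1"])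
      show "(\<lambda>\<nu>. G (code \<nu>)) \<in> borel_measurable \<xi>"
        by (rule mb[OF measurable_compose[OF code_measurable Gm]])
      show "(\<lambda>\<nu>. \<integral>\<sigma>. \<psi> n \<sigma> \<partial>\<nu>) \<in> borel_measurable \<xi>" for n
        using mb[OF ev_measurable[of "Bcontfun (\<psi> n)"]] by (simp add: e)
      have "emeasure \<xi> ergodic_measures = 1" using X by (simp add: is_choquet_measure_def)
      moreover have "ergodic_measures \<in> sets \<xi>" using s by simp
      ultimately have "AE \<nu> in \<xi>. \<nu> \<in> ergodic_measures" 
        using \<xi>.prob_eq_1[of ergodic_measures] by (simp add: \<xi>.emeasure_eq_measure)
      then show "AE \<nu> in \<xi>. (\<lambda>n. \<integral>\<sigma>. \<psi> n \<sigma> \<partial>\<nu>) \<longlonglongrightarrow> G (code \<nu>)"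
        by eventually_elim (rule lim_erg)
      have "\<bar>\<integral>\<sigma>. \<psi> n \<sigma> \<partial>\<nu>\<bar> \<le> 1" if "\<nu> \<in> inv_measures" for n and \<nu> :: "(nat \<Rightarrow> 'w) measure"
      proof -
        have "norm (Bcontfun (\<psi> n)) \<le> 1" using \<psi>b by (intro norm_bound) (simp add: apply_Bcontfun[OF \<psi>c])
        then show ?thesis using ev_bound[OF inv_prob_borel[OF that], of "Bcontfun (\<psi> n)"] by (simp add: e)
      qed
      then show "AE \<nu> in \<xi>. norm (\<integral>\<sigma>. \<psi> n \<sigma> \<partial>\<nu>) \<le> 1" for n by (intro AE_I2) (simp add: sp)
    qed simp
    moreover have "(\<integral>\<nu>. (\<integral>\<sigma>. \<psi> n \<sigma> \<partial>\<nu>) \<partial>\<xi>) = (\<integral>\<sigma>. \<psi> n \<sigma> \<partial>\<mu>)" for n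
      using X unfolding is_choquet_measure_def e[symmetric] by blast
    ultimately show ?thesis by (simp add: \<psi>_def)
  qed
  have s: "sets \<xi> = sets BP" "sets \<eta> = sets BP" using X Y by (simp_all add: is_choquet_measure_def sets_BP)
  have p: "prob_space \<xi>" "prob_space \<eta>" using X Y by (simp_all add: is_choquet_measure_def)
  have cm: "code \<in> borel_measurable \<xi>" "code \<in> borel_measurable \<eta>"
    using code_measurable measurable_cong_sets[OF s(1) refl] measurable_cong_sets[OF s(2) refl] by blast+
  have d: "distr \<xi> borel code = distr \<eta> borel code"
  proof (rule measure_eqI_continuous)
    show "finite_measure (distr \<xi> borel code)" "finite_measure (distr \<eta> borel code)"
      using p cm by (auto intro!: prob_space.finite_measure prob_space.prob_space_distr)
    fix G :: "(nat \<Rightarrow> real) \<Rightarrow> real" assume G: "continuous_on UNIV G" "\<And>x. 0 \<le> G x" "\<And>x. G x \<le> 1"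
    show "(\<integral>x. G x \<partial>distr \<xi> borel code) = (\<integral>x. G x \<partial>distr \<eta> borel code)"
      using LIMSEQ_unique[OF lim[OF G X] lim[OF G Y]] borel_measurable_continuous_onI[OF G(1)] cm
      by (simp add: integral_distr)
  qed auto
  show ?thesis
  proof (rule measure_eqI)
    show "sets \<xi> = sets \<eta>" using s by simp
    fix A assume "A \<in> sets \<xi>"
    then obtain V where V: "V \<in> sets borel" "A = code -` V \<inter> inv_measures"
      unfolding s BP_def by (auto simp: sets_vimage_algebra2)
    have "space \<xi> = inv_measures" "space \<eta> = inv_measures"
      using sets_eq_imp_space_eq[OF s(1)] sets_eq_imp_space_eq[OF s(2)] by simp_all
    then show "emeasure \<xi> A = emeasure \<eta> A"
      using arg_cong[OF d, of "\<lambda>M. emeasure M V"] V cm by (simp add: emeasure_distr)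
  qed
qed

theorem choquet_measure_eq:
  fixes \<mu> :: "(nat \<Rightarrow> 'w) measure"
  assumes "\<mu> \<in> inv_measures"
  shows "choquet_measure \<mu> = distr \<mu> BP component"
  unfolding choquet_measure_def
  by (rule the_equality) (use is_choquet_component[OF assms] choquet_unique[OF assms] in auto)

end

section \<open>Mixtures and observables\<close>

definition mixture :: "'i pmf \<Rightarrow> ('i \<Rightarrow> (nat \<Rightarrow> 'w::topological_space) measure) \<Rightarrow> (nat \<Rightarrow> 'w) measure"
  where "mixture p M = measure_pmf p \<bind> M"

lemma mixture_kernel:
  shows "measure_pmf p \<in> space (prob_algebra (count_space UNIV))"
    and "(\<And>i. M i \<in> prob_borel) \<Longrightarrow> M \<in> count_space UNIV \<rightarrow>\<^sub>M prob_algebra borel"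
  by (auto simp: space_prob_algebra prob_borel_def measure_pmf.prob_space_axioms)

lemma mixture_prob_borel:
  assumes "\<And>i. M i \<in> prob_borel"
  shows "mixture p M \<in> prob_borel"
  unfolding mixture_def prob_borel_def
  using prob_space_bind'[OF mixture_kernel(1) mixture_kernel(2), of M p] sets_bind'[OF mixture_kernel(1) mixture_kernel(2), of M p] assms
  by auto

lemma integral_mixture:
  fixes f :: "(nat \<Rightarrow> 'w::topological_space) \<Rightarrow> real"
  assumes M: "\<And>i. M i \<in> prob_borel" and f: "f \<in> borel_measurable borel" "\<And>x. \<bar>f x\<bar> \<le> B"
  shows "(\<integral>x. f x \<partial>mixture p M) = (\<integral>i. (\<integral>x. f x \<partial>M i) \<partial>measure_pmf p)"
  unfolding mixture_def
proof (rule integral_bind[where K=borel and B=B and B'=1])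
  show "M \<in> measurable (measure_pmf p) (subprob_algebra borel)"
    using measurable_prob_algebraD[OF mixture_kernel(2)[where M=M]] M
      measurable_cong_sets[OF sets_measure_pmf_count_space refl] by blast
  show "f \<in> borel_measurable borel" by fact
  have "prob_space (M i)" for i using prob_borelD[OF M[of i]] by simp
  then show "AE x in measure_pmf p. emeasure (M x) (space (M x)) \<le> ennreal 1"
    by (simp add: prob_space.emeasure_space_1)
qed (use f in \<open>auto simp: measure_pmf.finite_measure_axioms\<close>)

definition mix :: "real \<Rightarrow> (nat \<Rightarrow> 'w::topological_space) measure \<Rightarrow> (nat \<Rightarrow> 'w) measure \<Rightarrow> (nat \<Rightarrow> 'w) measure"
  where "mix t \<mu> \<nu> = mixture (bernoulli_pmf t) (\<lambda>b. if b then \<nu> else \<mu>)"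

lemma mix_prob_borel: "\<mu> \<in> prob_borel \<Longrightarrow> \<nu> \<in> prob_borel \<Longrightarrow> mix t \<mu> \<nu> \<in> prob_borel"
  unfolding mix_def by (rule mixture_prob_borel) auto

lemma integral_mix:
  fixes f :: "(nat \<Rightarrow> 'w::topological_space) \<Rightarrow> real"
  assumes "\<mu> \<in> prob_borel" "\<nu> \<in> prob_borel" "f \<in> borel_measurable borel" "\<And>x. \<bar>f x\<bar> \<le> B" "0 \<le> t" "t \<le> 1"
  shows "(\<integral>x. f x \<partial>mix t \<mu> \<nu>) = (1 - t) * (\<integral>x. f x \<partial>\<mu>) + t * (\<integral>x. f x \<partial>\<nu>)"
  unfolding mix_def using assms
  by (subst integral_mixture[where B=B]) (auto simp: integral_measure_pmf[of UNIV] UNIV_bool)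

context compact_alphabet
begin

lemma ev_mix:
  fixes \<mu> \<nu> :: "(nat \<Rightarrow> 'w) measure"
  assumes "\<mu> \<in> prob_borel" "\<nu> \<in> prob_borel" "0 \<le> t" "t \<le> 1"
  shows "ev (mix t \<mu> \<nu>) \<phi> = (1 - t) * ev \<mu> \<phi> + t * ev \<nu> \<phi>"
  by (rule integral_mix[OF assms(1,2) _ bcontfun_bound assms(3,4)]) simp

lemma mix_inv:
  fixes \<mu> \<nu> :: "(nat \<Rightarrow> 'w) measure"
  assumes "\<mu> \<in> inv_measures" "\<nu> \<in> inv_measures" "0 \<le> t" "t \<le> 1"
  shows "mix t \<mu> \<nu> \<in> inv_measures"
proof -
  note b = inv_prob_borel[OF assms(1)] inv_prob_borel[OF assms(2)]
  have "(\<integral>\<sigma>. apply_bcontfun \<phi> (shift \<sigma>) \<partial>mix t \<mu> \<nu>) = ev (mix t \<mu> \<nu>) \<phi>" for \<phi> :: "(nat \<Rightarrow> 'w) \<Rightarrow>\<^sub>C real"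
  proof -
    have "(\<integral>\<sigma>. apply_bcontfun \<phi> (shift \<sigma>) \<partial>mix t \<mu> \<nu>) =
        (1 - t) * (\<integral>\<sigma>. apply_bcontfun \<phi> (shift \<sigma>) \<partial>\<mu>) + t * (\<integral>\<sigma>. apply_bcontfun \<phi> (shift \<sigma>) \<partial>\<nu>)"
      by (rule integral_mix[OF b borel_measurable_continuous_onI[OF continuous_bcontfun_shift(2)] bcontfun_bound assms(3,4)])
    also have "\<dots> = ev (mix t \<mu> \<nu>) \<phi>"
      using assms inv_iff[OF b(1)] inv_iff[OF b(2)] by (simp add: ev_mix[OF b])
    finally show ?thesis .
  qed
  then show ?thesis using inv_iff[OF mix_prob_borel[OF b]] by blast
qed

lemma eval_S_eqI:
  fixes \<mu> :: "(nat \<Rightarrow> 'w) measure"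
  assumes "\<mu> \<in> prob_borel"
  shows "apply_bborel (eval_S \<mu>) \<phi> = ev \<mu> (ball_val \<phi>)"
  using prob_borelD[OF assms] by (intro apply_eval_S)

lemma eval_S_mix:
  fixes \<mu> \<nu> :: "(nat \<Rightarrow> 'w) measure"
  assumes "\<mu> \<in> prob_borel" "\<nu> \<in> prob_borel" "0 \<le> t" "t \<le> 1"
  shows "eval_S (mix t \<mu> \<nu>) = (1 - t) *\<^sub>R eval_S \<mu> + t *\<^sub>R eval_S \<nu>"
  by (rule bborel_eqI)
    (simp add: eval_S_eqI assms mix_prob_borel ev_mix plus_bborel.rep_eq scaleR_bborel.rep_eq)

lemma tau_mix:
  fixes \<mu> \<nu> :: "(nat \<Rightarrow> 'w) measure" and \<theta> :: "'w test_fun bborel \<Rightarrow> 'x::real_normed_vector"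
  assumes "linear \<theta>" "\<mu> \<in> prob_borel" "\<nu> \<in> prob_borel" "0 \<le> t" "t \<le> 1"
  shows "\<theta> (eval_S (mix t \<mu> \<nu>)) = (1 - t) *\<^sub>R \<theta> (eval_S \<mu>) + t *\<^sub>R \<theta> (eval_S \<nu>)"
  by (simp add: eval_S_mix assms linear_add[OF assms(1)] linear_scale[OF assms(1)])

text \<open>Weak convergence is pointwise convergence of the functions \<open>eval_S (M n)\<close>,
  and these are bounded by 1, which is the situation covered by \<open>sigma_normal\<close>.\<close>

lemma tau_tendsto:
  fixes M :: "nat \<Rightarrow> (nat \<Rightarrow> 'w) measure" and \<theta> :: "'w test_fun bborel \<Rightarrow> 'x::real_normed_vector"
  assumes \<theta>: "sigma_normal \<theta>" and M: "\<And>n. M n \<in> prob_borel" and \<mu>: "\<mu> \<in> prob_borel" and w: "weakly M \<mu>"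
  shows "(\<lambda>n. \<theta> (eval_S (M n))) \<longlonglongrightarrow> \<theta> (eval_S \<mu>)"
proof -
  have "norm (eval_S (M n)) \<le> 1" for n
  proof (rule norm_bborel_le)
    fix \<phi> :: "'w test_fun"
    have "norm (ball_val \<phi>) \<le> 1" using ball_val[of \<phi>] by simp
    then show "\<bar>apply_bborel (eval_S (M n)) \<phi>\<bar> \<le> 1"
      using ev_bound[OF M[of n], of "ball_val \<phi>"] by (simp add: eval_S_eqI[OF M])
  qed
  then have "bounded (range (\<lambda>n. eval_S (M n)))" by (auto simp: bounded_iff)
  moreover have "(\<lambda>n. apply_bborel (eval_S (M n)) \<phi>) \<longlonglongrightarrow> apply_bborel (eval_S \<mu>) \<phi>" for \<phi>
    using w by (simp add: eval_S_eqI M \<mu> weakly_def)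
  ultimately show ?thesis using \<theta> unfolding sigma_normal_def by blast
qed

end

text \<open>The functional $g \circ \theta$ is considered on all Borel probability measures because it will
  be evaluated at empirical measures, which are not invariant.\<close>

locale observable = compact_alphabet m for m :: "'w::polish_space measure" +
  fixes \<theta> :: "'w test_fun bborel \<Rightarrow> 'x::real_normed_vector" and g :: "'x \<Rightarrow> real"
  assumes lin: "linear \<theta>" and normal: "sigma_normal \<theta>"
    and cvx: "convex_on UNIV g" and cont: "continuous_on UNIV g"
begin

abbreviation obs :: "(nat \<Rightarrow> 'w) measure \<Rightarrow> real" where "obs \<nu> \<equiv> g (\<theta> (eval_S \<nu>))"

lemma obs_tendsto:
  assumes "\<And>n. M n \<in> prob_borel" "\<mu> \<in> prob_borel" "weakly M \<mu>"
  shows "(\<lambda>n. obs (M n)) \<longlonglongrightarrow> obs \<mu>"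
proof -
  have "isCont g (\<theta> (eval_S \<mu>))" using cont by (simp add: continuous_on_eq_continuous_at)
  then show ?thesis by (rule isCont_tendsto_compose) (rule tau_tendsto[OF normal assms])
qed

lemma obs_tendsto_inv:
  "range M \<subseteq> inv_measures \<Longrightarrow> \<mu> \<in> inv_measures \<Longrightarrow> weakly M \<mu> \<Longrightarrow> (\<lambda>n. obs (M n)) \<longlonglongrightarrow> obs \<mu>"
  by (intro obs_tendsto) (auto intro: inv_prob_borel)

lemma obs_measurable [measurable]: "(\<lambda>\<nu>. obs \<nu>) \<in> borel_measurable BP"
  by (rule measurable_BP_seq_continuous) (rule obs_tendsto_inv)

lemma obs_bounded: "\<exists>B. \<forall>\<mu>\<in>prob_borel. \<bar>obs \<mu>\<bar> \<le> B"
proof (rule ccontr)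
  assume "\<not> ?thesis"
  then have "\<forall>n::nat. \<exists>\<mu>\<in>prob_borel. \<bar>obs \<mu>\<bar> > real n" by (meson not_le)
  then obtain M where M: "\<And>n. M n \<in> prob_borel" "\<And>n. \<bar>obs (M n)\<bar> > real n" by metis
  obtain r N where r: "strict_mono (r :: nat \<Rightarrow> nat)" "N \<in> prob_borel" "weakly (\<lambda>n. M (r n)) N"
    using prob_borel_seq_compact[of M] M(1) by metis
  have "(\<lambda>n. obs (M (r n))) \<longlonglongrightarrow> obs N" by (rule obs_tendsto[OF _ r(2,3)]) (rule M)
  then have "Bseq (\<lambda>n. obs (M (r n)))" by (rule convergentI[THEN convergent_imp_Bseq])
  then obtain K where "\<And>n. \<bar>obs (M (r n))\<bar> \<le> K" unfolding Bseq_def by auto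
  then have "real n \<le> K" for n
    using M(2)[of "r n"] seq_suble[OF r(1), of n] by (smt (verit) of_nat_le_iff)
  then show False using reals_Archimedean2[of K] by (meson not_le)
qed

text \<open>The Choquet measure is the law of \<open>component\<close>, and almost all components
  are ergodic, so the restriction to ergodic measures disappears after the change of
  variables.\<close>

lemma Delta_eq:
  assumes \<mu>: "\<mu> \<in> inv_measures"
  shows "Delta \<theta> g \<mu> = (\<integral>\<sigma>. obs (component \<sigma>) \<partial>\<mu>)"
proof -
  interpret measure_preserving \<mu> shift by (rule inv_measure_preserving[OF \<mu>])
  have [measurable]: "component \<in> measurable \<mu> BP" by (rule component_measurable'[OF \<mu>])
  have "Delta \<theta> g \<mu> = (\<integral>\<sigma>. indicator ergodic_measures (component \<sigma>) *\<^sub>R obs (component \<sigma>) \<partial>\<mu>)"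
    unfolding Delta_def choquet_measure_eq[OF \<mu>] set_lebesgue_integral_def
    by (rule integral_distr) measurable
  also have "\<dots> = (\<integral>\<sigma>. obs (component \<sigma>) \<partial>\<mu>)"
    using AE_component_ergodic[OF \<mu>] by (intro integral_cong_AE) (auto simp: indicator_def)
  finally show ?thesis .
qed

lemma Delta_ergodic:
  assumes "\<mu> \<in> ergodic_measures"
  shows "Delta \<theta> g \<mu> = obs \<mu>"
proof -
  have \<mu>: "\<mu> \<in> inv_measures" using assms ergodic_sub_inv by auto
  interpret measure_preserving \<mu> shift by (rule inv_measure_preserving[OF \<mu>])
  have [measurable]: "component \<in> measurable \<mu> BP" by (rule component_measurable'[OF \<mu>])
  have "AE \<sigma> in \<mu>. component \<sigma> = \<mu>" using ergodic_iff_component[OF \<mu>] assms by simp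
  then have "(\<integral>\<sigma>. obs (component \<sigma>) \<partial>\<mu>) = (\<integral>\<sigma>. obs \<mu> \<partial>\<mu>)"
    by (intro integral_cong_AE) auto
  then show ?thesis by (simp add: Delta_eq[OF \<mu>] prob_space)
qed

lemma obs_component_measurable:
  fixes \<mu> :: "(nat \<Rightarrow> 'w) measure"
  assumes "\<mu> \<in> inv_measures"
  shows "(\<lambda>\<sigma>. obs (component \<sigma>)) \<in> borel_measurable borel"
  by (rule measurable_compose[OF component_measurable obs_measurable]) (use assms in auto)

text \<open>The integrand \<open>obs (component \<sigma>)\<close> is the same for all measures, so
  the mean over components is affine in the measure.\<close>

lemma Delta_mix:
  assumes \<mu>: "\<mu> \<in> inv_measures" and \<nu>: "\<nu> \<in> inv_measures" and t: "0 \<le> t" "t \<le> 1"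
  shows "Delta \<theta> g (mix t \<mu> \<nu>) = (1 - t) * Delta \<theta> g \<mu> + t * Delta \<theta> g \<nu>"
proof -
  obtain B where B: "\<And>\<nu>. \<nu> \<in> prob_borel \<Longrightarrow> \<bar>obs \<nu>\<bar> \<le> B" using obs_bounded by blast
  show ?thesis
    unfolding Delta_eq[OF \<mu>] Delta_eq[OF \<nu>] Delta_eq[OF mix_inv[OF assms]]
    by (rule integral_mix[OF inv_prob_borel[OF \<mu>] inv_prob_borel[OF \<nu>] obs_component_measurable[OF \<mu>] _ t])
      (rule B[OF inv_prob_borel[OF component_inv[OF \<mu>]]])
qed

lemma continuous_obs_empirical: "continuous_on UNIV (\<lambda>\<sigma>. obs (empirical n \<sigma>))"
proof (rule continuous_at_imp_continuous_on, intro ballI)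
  fix \<sigma>
  show "isCont (\<lambda>\<sigma>. obs (empirical n \<sigma>)) \<sigma>"
    unfolding continuous_at_sequentially comp_def
  proof (intro allI impI)
    fix s assume s: "s \<longlonglongrightarrow> \<sigma>"
    have "weakly (\<lambda>k. empirical n (s k)) (empirical n \<sigma>)"
      unfolding weakly_def ev_empirical
    proof
      fix \<phi> :: "(nat \<Rightarrow> 'w) \<Rightarrow>\<^sub>C real"
      have "isCont (birkhoff shift (apply_bcontfun \<phi>) (Suc n)) \<sigma>"
        using continuous_birkhoff[OF continuous_bcontfun] by (simp add: continuous_on_eq_continuous_at)
      then show "(\<lambda>k. birkhoff shift (apply_bcontfun \<phi>) (Suc n) (s k)) \<longlonglongrightarrow> birkhoff shift (apply_bcontfun \<phi>) (Suc n) \<sigma>"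
        using s by (rule isCont_tendsto_compose)
    qed
    then show "(\<lambda>k. obs (empirical n (s k))) \<longlonglongrightarrow> obs (empirical n \<sigma>)"
      by (intro obs_tendsto empirical_prob_borel)
  qed
qed

text \<open>Index \<open>2 * n + 1\<close> means \<open>2 * n + 2\<close> orbit points, which split
  into two halves of \<open>n + 1\<close> points each; linearity of \<theta> and convexity of
  \<open>g\<close> do the rest.\<close>

lemma obs_empirical_double:
  "obs (empirical (2 * n + 1) \<sigma>) \<le> (obs (empirical n \<sigma>) + obs (empirical n ((shift ^^ Suc n) \<sigma>))) / 2"
proof -
  have sum: "(\<Sum>k<2 * n + 2. f ((shift ^^ k) \<sigma>)) = (\<Sum>k<Suc n. f ((shift ^^ k) \<sigma>)) + (\<Sum>k<Suc n. f ((shift ^^ k) ((shift ^^ Suc n) \<sigma>)))"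
    for f :: "(nat \<Rightarrow> 'w) \<Rightarrow> real"
  proof -
    have split: "(\<Sum>k<a + b. h k) = (\<Sum>k<a. h k) + (\<Sum>k<b. h (a + k))" for h :: "nat \<Rightarrow> real" and a b
      by (induction b) simp_all
    have e: "2 * n + 2 = Suc n + Suc n" by simp
    have "(shift ^^ (Suc n + k)) \<sigma> = (shift ^^ k) ((shift ^^ Suc n) \<sigma>)" for k
      by (simp only: add.commute[of "Suc n"] funpow_add comp_def)
    then show ?thesis unfolding e split by (simp only:)
  qed
  have av: "birkhoff shift f (2 * n + 2) \<sigma> =
      (1 - 1/2) * birkhoff shift f (Suc n) \<sigma> + (1/2) * birkhoff shift f (Suc n) ((shift ^^ Suc n) \<sigma>)"
    for f :: "(nat \<Rightarrow> 'w) \<Rightarrow> real"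
  proof -
    have "real (2 * n + 2) = 2 * real (Suc n)" by simp
    moreover have "(a + b) / (2 * c) = (1 - 1/2) * (a / c) + (1/2) * (b / c)" for a b c :: real
      by (cases "c = 0") (simp_all add: field_simps)
    ultimately show ?thesis unfolding birkhoff_def sum by (simp only:)
  qed
  have n2: "Suc (2 * n + 1) = 2 * n + 2" by simp
  have "eval_S (empirical (2 * n + 1) \<sigma>) =
      (1 - 1/2) *\<^sub>R eval_S (empirical n \<sigma>) + (1/2) *\<^sub>R eval_S (empirical n ((shift ^^ Suc n) \<sigma>))"
    by (rule bborel_eqI)
      (simp only: eval_S_eqI[OF empirical_prob_borel] ev_empirical n2 av plus_bborel.rep_eq scaleR_bborel.rep_eq)
  then have "\<theta> (eval_S (empirical (2 * n + 1) \<sigma>)) =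
      (1 - 1/2) *\<^sub>R \<theta> (eval_S (empirical n \<sigma>)) + (1/2) *\<^sub>R \<theta> (eval_S (empirical n ((shift ^^ Suc n) \<sigma>)))"
    by (simp only: linear_add[OF lin] linear_scale[OF lin])
  then show ?thesis
    using convex_onD[OF cvx, of "1/2" "\<theta> (eval_S (empirical n \<sigma>))" "\<theta> (eval_S (empirical n ((shift ^^ Suc n) \<sigma>)))"]
    by simp
qed

text \<open>Doubling the length of the empirical measures decreases the mean of a convex observable, so
  \<^term>\<open>Delta \<theta> g\<close> is an infimum of weak* continuous functionals.\<close>

lemma Delta_le_empirical:
  assumes \<mu>: "\<mu> \<in> inv_measures"
  shows "Delta \<theta> g \<mu> \<le> (\<integral>\<sigma>. obs (empirical (2^k - 1) \<sigma>) \<partial>\<mu>)"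
    and "(\<lambda>k. \<integral>\<sigma>. obs (empirical (2^k - 1) \<sigma>) \<partial>\<mu>) \<longlonglongrightarrow> Delta \<theta> g \<mu>"
proof -
  interpret measure_preserving \<mu> shift by (rule inv_measure_preserving[OF \<mu>])
  obtain B where B: "\<And>\<nu>. \<nu> \<in> prob_borel \<Longrightarrow> \<bar>obs \<nu>\<bar> \<le> B" using obs_bounded by blast
  have [measurable]: "(\<lambda>\<sigma>. obs (empirical n \<sigma>)) \<in> borel_measurable \<mu>" for n
    by (rule measurable_prob_borel[OF inv_prob_borel[OF \<mu>] borel_measurable_continuous_onI[OF continuous_obs_empirical]])
  have [measurable]: "(\<lambda>\<sigma>. obs (component \<sigma>)) \<in> borel_measurable \<mu>"
    by (rule measurable_prob_borel[OF inv_prob_borel[OF \<mu>] obs_component_measurable[OF \<mu>]])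
  define a where "a k = (\<integral>\<sigma>. obs (empirical (2^k - 1) \<sigma>) \<partial>\<mu>)" for k :: nat
  have int: "integrable \<mu> (\<lambda>\<sigma>. obs (empirical n ((shift ^^ k) \<sigma>)))" for n k
    using B[OF empirical_prob_borel] measurable_compose[OF measurable_funpow[of k], of "\<lambda>\<sigma>. obs (empirical n \<sigma>)"]
    by (intro integrable_const_bound[of _ B]) auto
  have int0: "integrable \<mu> (\<lambda>\<sigma>. obs (empirical n \<sigma>))" for n using int[of n 0] by simp
  \<comment> \<open>The index \<open>2^k - 1\<close> stands for \<open>2^k\<close> orbit points, so
    doubling leads to the index belonging to \<open>k + 1\<close>. By invariance the second half has
    the same mean as the other.\<close>
  have dec: "a (Suc k) \<le> a k" for k
  proof -
    have "(1::nat) \<le> 2^k" by simp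
    then have e: "2 * (2^k - 1) + 1 = 2 ^ Suc k - (1::nat)" unfolding power_Suc by arith
    have "a (Suc k) \<le> (\<integral>\<sigma>. (obs (empirical (2^k - 1) \<sigma>) + obs (empirical (2^k - 1) ((shift ^^ Suc (2^k - 1)) \<sigma>))) / 2 \<partial>\<mu>)"
      unfolding a_def e[symmetric]
    proof (rule integral_mono)
      show "integrable \<mu> (\<lambda>\<sigma>. (obs (empirical (2^k - 1) \<sigma>) + obs (empirical (2^k - 1) ((shift ^^ Suc (2^k - 1)) \<sigma>))) / 2)"
        by (intro integrable_divide Bochner_Integration.integrable_add int int0)
    qed (rule int0, rule obs_empirical_double)
    also have "\<dots> = (a k + (\<integral>\<sigma>. obs (empirical (2^k - 1) ((shift ^^ Suc (2^k - 1)) \<sigma>)) \<partial>\<mu>)) / 2"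
      unfolding a_def using int int0 by simp
    also have "(\<integral>\<sigma>. obs (empirical (2^k - 1) ((shift ^^ Suc (2^k - 1)) \<sigma>)) \<partial>\<mu>) = a k"
      unfolding a_def by (rule integral_funpow) measurable
    finally show ?thesis by simp
  qed
  have "(\<lambda>n. \<integral>\<sigma>. obs (empirical n \<sigma>) \<partial>\<mu>) \<longlonglongrightarrow> (\<integral>\<sigma>. obs (component \<sigma>) \<partial>\<mu>)"
  proof (rule integral_dominated_convergence[where w="\<lambda>_. B"])
    show "AE \<sigma> in \<mu>. (\<lambda>n. obs (empirical n \<sigma>)) \<longlonglongrightarrow> obs (component \<sigma>)"
      using AE_generic[OF \<mu>]
    proof eventually_elim
      case (elim \<sigma>)
      then show ?case unfolding generic_def
        by (intro obs_tendsto empirical_prob_borel) (auto intro: inv_prob_borel)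
    qed
  qed (use B[OF empirical_prob_borel] in auto)
  moreover have "filterlim (\<lambda>k::nat. 2^k - (1::nat)) at_top sequentially"
  proof (rule filterlim_at_top_mono[OF filterlim_ident])
    have "k \<le> 2^k - (1::nat)" for k using less_exp[of k] by linarith
    then show "eventually (\<lambda>k. k \<le> 2^k - (1::nat)) sequentially" by simp
  qed
  ultimately have "a \<longlonglongrightarrow> Delta \<theta> g \<mu>"
    unfolding a_def Delta_eq[OF \<mu>] by (rule filterlim_compose)
  then show "(\<lambda>k. \<integral>\<sigma>. obs (empirical (2^k - 1) \<sigma>) \<partial>\<mu>) \<longlonglongrightarrow> Delta \<theta> g \<mu>" unfolding a_def .
  have "decseq a" using dec by (simp add: decseq_Suc_iff)
  then have "Delta \<theta> g \<mu> \<le> a k" using \<open>a \<longlonglongrightarrow> Delta \<theta> g \<mu>\<close> by (rule decseq_ge)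
  then show "Delta \<theta> g \<mu> \<le> (\<integral>\<sigma>. obs (empirical (2^k - 1) \<sigma>) \<partial>\<mu>)" unfolding a_def .
qed

lemma Delta_usc:
  assumes M: "\<And>n. M n \<in> inv_measures" and \<mu>: "\<mu> \<in> inv_measures" and w: "weakly M \<mu>" and e: "e > 0"
  shows "eventually (\<lambda>n. Delta \<theta> g (M n) < Delta \<theta> g \<mu> + e) sequentially"
proof -
  have "eventually (\<lambda>k. (\<integral>\<sigma>. obs (empirical (2^k - 1) \<sigma>) \<partial>\<mu>) < Delta \<theta> g \<mu> + e) sequentially"
    using Delta_le_empirical(2)[OF \<mu>] e by (intro order_tendstoD) auto
  then obtain k where k: "(\<integral>\<sigma>. obs (empirical (2^k - 1) \<sigma>) \<partial>\<mu>) < Delta \<theta> g \<mu> + e"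
    by (auto simp: eventually_sequentially)
  have "(\<lambda>n. \<integral>\<sigma>. obs (empirical (2^k - 1) \<sigma>) \<partial>M n) \<longlonglongrightarrow> (\<integral>\<sigma>. obs (empirical (2^k - 1) \<sigma>) \<partial>\<mu>)"
    by (rule weaklyD[OF w continuous_obs_empirical])
  then have "eventually (\<lambda>n. (\<integral>\<sigma>. obs (empirical (2^k - 1) \<sigma>) \<partial>M n) < Delta \<theta> g \<mu> + e) sequentially"
    using k by (rule order_tendstoD)
  then show ?thesis
    by eventually_elim (use Delta_le_empirical(1)[OF M, of _ k] in \<open>auto intro: le_less_trans\<close>)
qed

end

section \<open>Entropy\<close>

lemma ln_lipschitz:
  fixes x y a :: real
  assumes "a > 0" "x \<ge> a" "y \<ge> a"
  shows "\<bar>ln x - ln y\<bar> \<le> \<bar>x - y\<bar> / a"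
proof -
  have *: "ln u - ln v \<le> \<bar>u - v\<bar> / a" if "u \<ge> a" "v \<ge> a" for u v
  proof -
    have "ln u - ln v \<le> (u - v) / v" using that assms(1) by (intro ln_diff_le) auto
    also have "\<dots> \<le> \<bar>u - v\<bar> / v" using that assms(1) by (intro divide_right_mono) auto
    also have "\<dots> \<le> \<bar>u - v\<bar> / a" using that assms(1) by (intro divide_left_mono) auto
    finally show ?thesis .
  qed
  show ?thesis using *[OF assms(2,3)] *[OF assms(3,2)] by (simp add: abs_minus_commute abs_le_iff)
qed

lemma shift_case_nat [simp]: "shift (case_nat \<omega> \<sigma>) = \<sigma>"
  by (simp add: shift_def)

lemma continuous_case_nat:
  "continuous_on UNIV (\<lambda>p :: 'w::topological_space \<times> (nat \<Rightarrow> 'w). case_nat (fst p) (snd p))"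
proof (rule continuous_on_coordinatewise_then_product)
  fix i
  show "continuous_on UNIV (\<lambda>p :: 'w \<times> (nat \<Rightarrow> 'w). case_nat (fst p) (snd p) i)"
  proof (cases i)
    case 0 then show ?thesis by (simp add: continuous_on_fst continuous_on_id)
  next
    case (Suc n)
    have "continuous_on UNIV (\<lambda>p :: 'w \<times> (nat \<Rightarrow> 'w). snd p n)"
      by (rule continuous_on_product_then_coordinatewise[OF continuous_on_snd[OF continuous_on_id]])
    then show ?thesis using Suc by simp
  qed
qed

context compact_alphabet
begin

sublocale m: prob_space m by (rule m_prob)

definition transfer :: "((nat \<Rightarrow> 'w) \<Rightarrow> real) \<Rightarrow> (nat \<Rightarrow> 'w) \<Rightarrow> real"
  where "transfer f \<sigma> = (\<integral>\<omega>. f (case_nat \<omega> \<sigma>) \<partial>m)"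

lemma transfer_op_eq: "transfer_op m \<phi> = transfer (apply_bcontfun \<phi>)"
  by (simp add: transfer_op_def transfer_def fun_eq_iff)

lemma case_nat_measurable: "(\<lambda>p. case_nat (fst p) (snd p)) \<in> measurable (borel \<Otimes>\<^sub>M borel) (borel :: (nat \<Rightarrow> 'w) measure)"
  unfolding borel_prod by (rule borel_measurable_continuous_onI[OF continuous_case_nat])

lemma case_nat_measurable':
  assumes "sets N = sets (borel :: (nat \<Rightarrow> 'w) measure)" "f \<in> measurable borel K"
  shows "(\<lambda>(\<omega>, \<sigma>). f (case_nat \<omega> \<sigma>)) \<in> measurable (m \<Otimes>\<^sub>M N) K"
proof -
  have s: "sets (m \<Otimes>\<^sub>M N) = sets (borel \<Otimes>\<^sub>M borel)" by (intro sets_pair_measure_cong m_borel assms)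
  show ?thesis unfolding measurable_cong_sets[OF s refl]
    using measurable_compose[OF case_nat_measurable assms(2)] by (simp add: case_prod_beta')
qed

lemma transfer_measurable:
  assumes f: "f \<in> borel_measurable borel"
  shows "transfer f \<in> borel_measurable borel"
proof -
  have "(\<lambda>(\<sigma>, \<omega>). f (case_nat \<omega> \<sigma>)) \<in> borel_measurable (borel \<Otimes>\<^sub>M m)"
    using measurable_compose[OF measurable_pair_swap' case_nat_measurable'[OF refl f]]
    by (simp add: case_prod_beta')
  then show ?thesis unfolding transfer_def[abs_def] by (rule m.borel_measurable_lebesgue_integral)
qed

lemma integrable_section:
  fixes f :: "(nat \<Rightarrow> 'w) \<Rightarrow> real"
  assumes f: "f \<in> borel_measurable borel" and b: "\<And>\<sigma>. \<bar>f \<sigma>\<bar> \<le> B"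
  shows "integrable m (\<lambda>\<omega>. f (case_nat \<omega> \<sigma>))"
proof -
  have "(\<lambda>\<omega>. (\<omega>, \<sigma>)) \<in> measurable m (borel \<Otimes>\<^sub>M borel)"
    by (rule measurable_Pair[OF measurable_ident_sets[OF m_borel] measurable_const]) simp
  from measurable_compose[OF this measurable_compose[OF case_nat_measurable f]]
  have "(\<lambda>\<omega>. f (case_nat \<omega> \<sigma>)) \<in> borel_measurable m" by simp
  then show ?thesis using b by (intro m.integrable_const_bound[of _ B]) auto
qed

lemma transfer_mono:
  assumes "f \<in> borel_measurable borel" "\<And>\<sigma>. \<bar>f \<sigma>\<bar> \<le> B" "g \<in> borel_measurable borel" "\<And>\<sigma>. \<bar>g \<sigma>\<bar> \<le> C"
    and "\<And>\<sigma>. f \<sigma> \<le> g \<sigma>"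
  shows "transfer f \<sigma> \<le> transfer g \<sigma>"
  unfolding transfer_def
  by (intro integral_mono integrable_section[OF assms(1,2)] integrable_section[OF assms(3,4)] assms(5))

lemma transfer_const [simp]: "transfer (\<lambda>_. c) \<sigma> = c"
  by (simp add: transfer_def m.prob_space)

lemma transfer_bounds:
  assumes f: "f \<in> borel_measurable borel" and b: "\<And>\<sigma>. a \<le> f \<sigma>" "\<And>\<sigma>. f \<sigma> \<le> b"
  shows "a \<le> transfer f \<sigma>" "transfer f \<sigma> \<le> b"
proof -
  have B: "\<bar>f \<sigma>\<bar> \<le> max \<bar>a\<bar> \<bar>b\<bar>" for \<sigma> using b[of \<sigma>] by linarith
  show "a \<le> transfer f \<sigma>" using transfer_mono[of "\<lambda>_. a" "\<bar>a\<bar>", OF _ _ f B] b(1) by simp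
  show "transfer f \<sigma> \<le> b" using transfer_mono[OF f B, of "\<lambda>_. b" "\<bar>b\<bar>"] b(2) by simp
qed

lemma transfer_diff_le:
  assumes f: "f \<in> borel_measurable borel" "\<And>\<sigma>. \<bar>f \<sigma>\<bar> \<le> B" and g: "g \<in> borel_measurable borel" "\<And>\<sigma>. \<bar>g \<sigma>\<bar> \<le> C"
  shows "\<bar>transfer f \<sigma> - transfer g \<sigma>\<bar> \<le> transfer (\<lambda>\<sigma>. \<bar>f \<sigma> - g \<sigma>\<bar>) \<sigma>"
  unfolding transfer_def
  using integral_abs_bound[of m "\<lambda>\<omega>. f (case_nat \<omega> \<sigma>) - g (case_nat \<omega> \<sigma>)"]
  by (simp add: integrable_section[OF f] integrable_section[OF g])

lemma continuous_bounded_pos: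
  fixes f :: "(nat \<Rightarrow> 'w) \<Rightarrow> real"
  assumes "continuous_on UNIV f" "\<And>\<sigma>. f \<sigma> > 0"
  obtains a b where "a > 0" "\<And>\<sigma>. a \<le> f \<sigma>" "\<And>\<sigma>. f \<sigma> \<le> b"
proof -
  obtain x where x: "\<And>y. f x \<le> f y" using continuous_attains_inf[OF compact_seq _ assms(1)] by auto
  obtain z where z: "\<And>y. f y \<le> f z" using continuous_attains_sup[OF compact_seq _ assms(1)] by auto
  show ?thesis by (rule that[of "f x" "f z"]) (use x z assms(2) in auto)
qed

lemma continuous_bounded:
  fixes f :: "(nat \<Rightarrow> 'w) \<Rightarrow> real"
  assumes "continuous_on UNIV f"
  obtains B where "\<And>\<sigma>. \<bar>f \<sigma>\<bar> \<le> B"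
  using compact_imp_bounded[OF compact_continuous_image[OF assms compact_seq]] by (auto simp: bounded_iff)

lemma continuous_transfer:
  assumes f: "continuous_on UNIV f"
  shows "continuous_on UNIV (transfer f)"
proof (rule continuous_at_imp_continuous_on, intro ballI)
  fix \<sigma>
  have fm: "f \<in> borel_measurable borel" by (rule borel_measurable_continuous_onI[OF f])
  obtain B where B: "\<And>\<sigma>. \<bar>f \<sigma>\<bar> \<le> B" using continuous_bounded[OF f] by blast
  show "isCont (transfer f) \<sigma>"
    unfolding continuous_at_sequentially comp_def transfer_def
  proof (intro allI impI)
    fix s assume s: "s \<longlonglongrightarrow> \<sigma>"
    show "(\<lambda>n. \<integral>\<omega>. f (case_nat \<omega> (s n)) \<partial>m) \<longlonglongrightarrow> (\<integral>\<omega>. f (case_nat \<omega> \<sigma>) \<partial>m)"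
    proof (rule integral_dominated_convergence[where w="\<lambda>_. B"])
      have "(\<lambda>n. f (case_nat \<omega> (s n))) \<longlonglongrightarrow> f (case_nat \<omega> \<sigma>)" for \<omega>
      proof -
        have "isCont (\<lambda>p. f (case_nat (fst p) (snd p))) (\<omega>, \<sigma>)"
          using continuous_on_compose2[OF f continuous_case_nat] by (simp add: continuous_on_eq_continuous_at)
        moreover have "(\<lambda>n. (\<omega>, s n)) \<longlonglongrightarrow> (\<omega>, \<sigma>)" by (intro tendsto_intros s)
        ultimately show ?thesis using isCont_tendsto_compose[of "(\<omega>, \<sigma>)" "\<lambda>p. f (case_nat (fst p) (snd p))"] by force
      qed
      then show "AE \<omega> in m. (\<lambda>n. f (case_nat \<omega> (s n))) \<longlonglongrightarrow> f (case_nat \<omega> \<sigma>)" by simp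
    qed (use B integrable_section[OF fm B] in \<open>auto intro: borel_measurable_integrable\<close>)
  qed
qed

text \<open>Minus the integral in the variational formula. For invariant \<mu> the term
  \<open>transfer f \<sigma>\<close> may be evaluated at \<open>shift \<sigma>\<close> instead, and
  for positive \<open>f\<close> the quotient \<open>f \<sigma> / transfer f (shift \<sigma>)\<close>
  is a conditional density of the leading coordinate with respect to \<open>m\<close> given the
  others; \<open>Jfun f \<mu>\<close> is then a mean log-density.\<close>

definition Jfun :: "((nat \<Rightarrow> 'w) \<Rightarrow> real) \<Rightarrow> (nat \<Rightarrow> 'w) measure \<Rightarrow> real"
  where "Jfun f \<mu> = (\<integral>\<sigma>. ln (f \<sigma>) - ln (transfer f \<sigma>) \<partial>\<mu>)"

lemma transfer_pos:
  assumes "continuous_on UNIV f" "\<And>\<sigma>. f \<sigma> > 0"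
  shows "transfer f \<sigma> > 0"
proof -
  obtain a b where "a > 0" "\<And>\<sigma>. a \<le> f \<sigma>" "\<And>\<sigma>. f \<sigma> \<le> b" using continuous_bounded_pos[OF assms] by blast
  then show ?thesis
    using transfer_bounds(1)[of f a b \<sigma>] borel_measurable_continuous_onI[OF assms(1)] by fastforce
qed

lemma continuous_Jfun:
  assumes "continuous_on UNIV f" "\<And>\<sigma>. f \<sigma> > 0"
  shows "continuous_on UNIV (\<lambda>\<sigma>. ln (f \<sigma>) - ln (transfer f \<sigma>))"
  using assms(2) transfer_pos[OF assms] less_imp_neq
  by (intro continuous_intros assms continuous_transfer) fastforce+

lemma entropy_eq:
  "entropy m \<mu> = (INF f\<in>{f. continuous_on UNIV f \<and> (\<forall>\<sigma>. f \<sigma> > 0)}. ereal (- Jfun f \<mu>))"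
proof -
  have *: "(\<integral>\<sigma>. ln (transfer_op m \<phi> \<sigma> / apply_bcontfun \<phi> \<sigma>) \<partial>\<mu>) = - Jfun (apply_bcontfun \<phi>) \<mu>"
    if "\<forall>\<sigma>. apply_bcontfun \<phi> \<sigma> > 0" for \<phi>
  proof -
    have "ln (transfer_op m \<phi> \<sigma> / apply_bcontfun \<phi> \<sigma>) = - (ln (apply_bcontfun \<phi> \<sigma>) - ln (transfer (apply_bcontfun \<phi>) \<sigma>))" for \<sigma>
    proof -
      have p: "apply_bcontfun \<phi> \<sigma> > 0" for \<sigma> using that by simp
      show ?thesis
        using transfer_pos[OF continuous_bcontfun p, of \<sigma>] p[of \<sigma>]
        by (simp add: transfer_op_eq ln_div less_imp_neq[symmetric])
    qed
    then show ?thesis unfolding Jfun_def by (simp only: Bochner_Integration.integral_minus)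
  qed
  have im: "{f :: (nat \<Rightarrow> 'w) \<Rightarrow> real. continuous_on UNIV f \<and> (\<forall>\<sigma>. f \<sigma> > 0)} = apply_bcontfun ` {\<phi>. \<forall>\<sigma>. apply_bcontfun \<phi> \<sigma> > 0}"
    (is "?A = ?B")
  proof
    show "?A \<subseteq> ?B"
    proof
      fix f assume "f \<in> ?A"
      then show "f \<in> ?B" using apply_Bcontfun[of f] by (intro image_eqI[of _ _ "Bcontfun f"]) auto
    qed
    show "?B \<subseteq> ?A" using continuous_bcontfun by auto
  qed
  show ?thesis unfolding entropy_def im image_image using * by (intro INF_cong) auto
qed

lemma entropy_le_Jfun:
  assumes "continuous_on UNIV f" "\<And>\<sigma>. f \<sigma> > 0"
  shows "entropy m \<mu> \<le> ereal (- Jfun f \<mu>)"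
  unfolding entropy_eq by (rule INF_lower) (use assms in auto)

lemma entropy_geI:
  assumes "\<And>f. continuous_on UNIV f \<Longrightarrow> (\<And>\<sigma>. f \<sigma> > 0) \<Longrightarrow> Jfun f \<mu> \<le> D"
  shows "ereal (- D) \<le> entropy m \<mu>"
  unfolding entropy_eq by (rule INF_greatest) (use assms in auto)

lemma entropy_nonpos: "entropy m \<mu> \<le> 0"
  using entropy_le_Jfun[of "\<lambda>_. 1" \<mu>] by (simp add: Jfun_def zero_ereal_def)

lemma Jfun_tendsto:
  assumes "continuous_on UNIV f" "\<And>\<sigma>. f \<sigma> > 0" "weakly M \<mu>"
  shows "(\<lambda>n. Jfun f (M n)) \<longlonglongrightarrow> Jfun f \<mu>"
  unfolding Jfun_def by (rule weaklyD[OF assms(3) continuous_Jfun[OF assms(1,2)]])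

text \<open>The entropy is an infimum of the weak* continuous functionals
  \<open>- Jfun f\<close>.\<close>

lemma entropy_usc:
  assumes "weakly M \<mu>" "entropy m \<mu> < c"
  shows "eventually (\<lambda>n. entropy m (M n) < c) sequentially"
proof -
  obtain f where f: "continuous_on UNIV f" "\<And>\<sigma>. f \<sigma> > 0" "ereal (- Jfun f \<mu>) < c"
    using assms(2) unfolding entropy_eq INF_less_iff by auto
  have "(\<lambda>n. ereal (- Jfun f (M n))) \<longlonglongrightarrow> ereal (- Jfun f \<mu>)"
    by (intro tendsto_intros Jfun_tendsto[OF f(1,2) assms(1)])
  then have "eventually (\<lambda>n. ereal (- Jfun f (M n)) < c) sequentially" using f(3) by (rule order_tendstoD)
  then show ?thesis by eventually_elim (use entropy_le_Jfun[OF f(1,2)] in \<open>auto intro: le_less_trans\<close>)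
qed

text \<open>Each \<open>Jfun f\<close> is affine in the measure, and an infimum of affine
  functionals is concave.\<close>

lemma entropy_mix:
  fixes \<mu> \<nu> :: "(nat \<Rightarrow> 'w) measure"
  assumes \<mu>: "\<mu> \<in> prob_borel" and \<nu>: "\<nu> \<in> prob_borel" and t: "0 \<le> t" "t \<le> 1"
  shows "ereal (1 - t) * entropy m \<mu> + ereal t * entropy m \<nu> \<le> entropy m (mix t \<mu> \<nu>)"
proof -
  have "ereal (1 - t) * entropy m \<mu> + ereal t * entropy m \<nu> \<le> ereal (- Jfun f (mix t \<mu> \<nu>))"
    if f: "continuous_on UNIV f" "\<forall>\<sigma>. f \<sigma> > 0" for f
  proof -
    have f': "\<And>\<sigma>. f \<sigma> > 0" using f(2) by blast
    have c: "continuous_on UNIV (\<lambda>\<sigma>. ln (f \<sigma>) - ln (transfer f \<sigma>))" by (rule continuous_Jfun[OF f(1) f'])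
    obtain B where B: "\<And>\<sigma>. \<bar>ln (f \<sigma>) - ln (transfer f \<sigma>)\<bar> \<le> B" using continuous_bounded[OF c] by blast
    have "Jfun f (mix t \<mu> \<nu>) = (1 - t) * Jfun f \<mu> + t * Jfun f \<nu>"
      unfolding Jfun_def by (rule integral_mix[OF \<mu> \<nu> borel_measurable_continuous_onI[OF c] B t])
    then have eq: "ereal (- Jfun f (mix t \<mu> \<nu>)) = ereal (1 - t) * ereal (- Jfun f \<mu>) + ereal t * ereal (- Jfun f \<nu>)"
      by simp
    show ?thesis unfolding eq
      using t by (intro add_mono ereal_mult_left_mono entropy_le_Jfun[OF f(1) f']) auto
  qed
  then show ?thesis unfolding entropy_eq[of "mix t \<mu> \<nu>"] by (intro INF_greatest) auto
qed

section \<open>Measurable test functions in the variational formula\<close>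

lemma prepend_prob_borel:
  assumes "\<mu> \<in> prob_borel"
  shows "distr (m \<Otimes>\<^sub>M \<mu>) borel (\<lambda>(\<omega>, \<sigma>). case_nat \<omega> \<sigma>) \<in> prob_borel"
proof -
  interpret \<mu>: prob_space \<mu> using prob_borelD[OF assms] by simp
  interpret P: pair_prob_space m \<mu> ..
  show ?thesis
    using P.prob_space_distr[OF case_nat_measurable'[OF prob_borelD(2)[OF assms], of "\<lambda>x. x" borel]]
    by (simp add: prob_borel_def)
qed

text \<open>By Fubini the dual of the transfer operator prepends an independent coordinate with law
  \<open>m\<close>; integrals of \<open>transfer f\<close> thus become integrals of \<open>f\<close>
  against another measure.\<close>

lemma integral_prepend:
  fixes f :: "(nat \<Rightarrow> 'w) \<Rightarrow> real"
  assumes \<mu>: "\<mu> \<in> prob_borel" and f: "f \<in> borel_measurable borel" and b: "\<And>\<sigma>. \<bar>f \<sigma>\<bar> \<le> B"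
  shows "(\<integral>\<sigma>. f \<sigma> \<partial>distr (m \<Otimes>\<^sub>M \<mu>) borel (\<lambda>(\<omega>, \<sigma>). case_nat \<omega> \<sigma>)) = (\<integral>\<sigma>. transfer f \<sigma> \<partial>\<mu>)"
proof -
  interpret \<mu>: prob_space \<mu> using prob_borelD[OF \<mu>] by simp
  interpret P: pair_prob_space m \<mu> ..
  note s = prob_borelD(2)[OF \<mu>]
  have fm: "(\<lambda>(\<omega>, \<sigma>). f (case_nat \<omega> \<sigma>)) \<in> borel_measurable (m \<Otimes>\<^sub>M \<mu>)" by (rule case_nat_measurable'[OF s f])
  have "(\<integral>\<sigma>. f \<sigma> \<partial>distr (m \<Otimes>\<^sub>M \<mu>) borel (\<lambda>(\<omega>, \<sigma>). case_nat \<omega> \<sigma>)) = (\<integral>p. (case p of (\<omega>, \<sigma>) \<Rightarrow> f (case_nat \<omega> \<sigma>)) \<partial>(m \<Otimes>\<^sub>M \<mu>))"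
    using case_nat_measurable'[OF s, of "\<lambda>x. x" borel] f
    by (subst integral_distr) (auto simp: case_prod_beta')
  also have "\<dots> = (\<integral>\<sigma>. (\<integral>\<omega>. f (case_nat \<omega> \<sigma>) \<partial>m) \<partial>\<mu>)"
    by (rule P.integral_snd[symmetric]) (use fm b in \<open>auto intro!: P.integrable_const_bound[of _ B]\<close>)
  finally show ?thesis by (simp add: transfer_def)
qed

text \<open>A continuous \<psi> replacing \<open>f\<close> must be close to \<open>f\<close> in mean
  under \<mu>, and \<open>transfer \<psi>\<close> close to \<open>transfer f\<close>. The second
  error is controlled by an integral against the prepended measure \<kappa>, so a single
  approximation in mean under the mixture \<Lambda> of \<mu> and \<kappa> serves both. Discontinuous
  test functions arise below when functions chosen for different components are glued.\<close>

lemma entropy_le_Jfun_measurable: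
  assumes \<mu>: "\<mu> \<in> prob_borel" and f: "f \<in> borel_measurable borel"
    and a: "a > 0" "\<And>\<sigma>. a \<le> f \<sigma>" "\<And>\<sigma>. f \<sigma> \<le> b"
  shows "entropy m \<mu> \<le> ereal (- Jfun f \<mu>)"
proof (rule ereal_le_epsilon2)
    fix e :: real assume e: "e > 0"
    interpret \<mu>: prob_space \<mu> using prob_borelD[OF \<mu>] by simp
    define \<kappa> where "\<kappa> = distr (m \<Otimes>\<^sub>M \<mu>) borel (\<lambda>(\<omega>, \<sigma>). case_nat \<omega> \<sigma>)"
    have \<kappa>: "\<kappa> \<in> prob_borel" unfolding \<kappa>_def by (rule prepend_prob_borel[OF \<mu>])
    define \<Lambda> where "\<Lambda> = mix (1/2) \<mu> \<kappa>"
    have \<Lambda>: "\<Lambda> \<in> prob_borel" unfolding \<Lambda>_def by (rule mix_prob_borel[OF \<mu> \<kappa>])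
    interpret \<Lambda>: prob_space \<Lambda> using prob_borelD[OF \<Lambda>] by simp
    have B: "\<bar>f \<sigma>\<bar> \<le> b" for \<sigma> using a(1) a(2,3)[of \<sigma>] by linarith
    have "integrable \<Lambda> f"
      by (rule \<Lambda>.integrable_const_bound[of _ b]) (use B measurable_prob_borel[OF \<Lambda> f] in auto)
    \<comment> \<open>Under \<Lambda> each of the two errors counts with weight 1/2, and
      \<open>ln\<close> is Lipschitz with constant \<open>1 / a\<close> above \<open>a\<close>: an
      error of \<open>a * e / 4\<close> in mean changes \<open>Jfun\<close> by at most
      \<open>e / 2\<close>.\<close>
    moreover have "a * e / 4 > 0" using a(1) e by simp
    ultimately obtain \<psi>0 where \<psi>0: "continuous_on UNIV \<psi>0" "bounded (range \<psi>0)" "(\<integral>x. \<bar>f x - \<psi>0 x\<bar> \<partial>\<Lambda>) < a * e / 4"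
      using continuous_L1_dense[OF \<Lambda>.finite_measure_axioms prob_borelD(2)[OF \<Lambda>]] by blast
    have ab: "a \<le> b" using a(2,3)[of undefined] by linarith
    \<comment> \<open>Clamping to the interval from \<open>a\<close> to \<open>b\<close> keeps
      \<psi> positive and does not increase the distance to \<open>f\<close>, whose values lie in
      that interval.\<close>
    define \<psi> where "\<psi> \<sigma> = max a (min b (\<psi>0 \<sigma>))" for \<sigma>
    have \<psi>: "continuous_on UNIV \<psi>" "\<And>\<sigma>. a \<le> \<psi> \<sigma>" "\<And>\<sigma>. \<psi> \<sigma> \<le> b"
      unfolding \<psi>_def using ab by (auto intro!: continuous_intros \<psi>0(1))
    then have \<psi>pos: "\<psi> \<sigma> > 0" for \<sigma> using a(1) by (meson less_le_trans)
    have \<psi>m: "\<psi> \<in> borel_measurable borel" by (rule borel_measurable_continuous_onI[OF \<psi>(1)])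
    have \<psi>B: "\<bar>\<psi> \<sigma>\<bar> \<le> b" for \<sigma> using \<psi>(2,3)[of \<sigma>] a(1) by linarith
    define d where "d \<sigma> = \<bar>f \<sigma> - \<psi> \<sigma>\<bar>" for \<sigma>
    have dm: "d \<in> borel_measurable borel" unfolding d_def using f \<psi>m by measurable
    have db: "\<bar>d \<sigma>\<bar> \<le> b" "0 \<le> d \<sigma>" for \<sigma> using a(2,3)[of \<sigma>] \<psi>(2,3)[of \<sigma>] a(1) by (auto simp: d_def)
    have d0: "d \<sigma> \<le> \<bar>f \<sigma> - \<psi>0 \<sigma>\<bar>" for \<sigma> using a(2,3)[of \<sigma>] ab by (auto simp: d_def \<psi>_def)
    have "integrable \<Lambda> d" by (rule \<Lambda>.integrable_const_bound[of _ b]) (use db measurable_prob_borel[OF \<Lambda> dm] in auto)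
    moreover have "integrable \<Lambda> (\<lambda>x. \<bar>f x - \<psi>0 x\<bar>)"
    proof -
      obtain C where C: "\<And>x. \<bar>\<psi>0 x\<bar> \<le> C" using \<psi>0(2) by (auto simp: bounded_iff)
      have "integrable \<Lambda> \<psi>0"
        by (rule \<Lambda>.integrable_const_bound[of _ C])
          (use C measurable_prob_borel[OF \<Lambda> borel_measurable_continuous_onI[OF \<psi>0(1)]] in auto)
      then show ?thesis using \<open>integrable \<Lambda> f\<close> by auto
    qed
    ultimately have "(\<integral>x. d x \<partial>\<Lambda>) \<le> (\<integral>x. \<bar>f x - \<psi>0 x\<bar> \<partial>\<Lambda>)" using d0 by (rule integral_mono)
    then have d\<Lambda>: "(\<integral>x. d x \<partial>\<Lambda>) < a * e / 4" using \<psi>0(3) by linarith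
    have "(\<integral>x. d x \<partial>\<Lambda>) = (1 - 1/2) * (\<integral>x. d x \<partial>\<mu>) + 1/2 * (\<integral>x. d x \<partial>\<kappa>)"
      unfolding \<Lambda>_def by (rule integral_mix[OF \<mu> \<kappa> dm db(1)]) auto
    moreover have "(\<integral>x. d x \<partial>\<kappa>) = (\<integral>x. transfer d x \<partial>\<mu>)"
      unfolding \<kappa>_def by (rule integral_prepend[OF \<mu> dm db(1)])
    ultimately have small: "(\<integral>x. d x \<partial>\<mu>) + (\<integral>x. transfer d x \<partial>\<mu>) < a * e / 2" using d\<Lambda> by simp
    have int: "integrable \<mu> h" if "h \<in> borel_measurable borel" "\<And>\<sigma>. c \<le> h \<sigma>" "\<And>\<sigma>. h \<sigma> \<le> C" for h :: "(nat \<Rightarrow> 'w) \<Rightarrow> real" and c C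
    proof (rule \<mu>.integrable_const_bound[of _ "max \<bar>c\<bar> \<bar>C\<bar>"])
      have "\<bar>h \<sigma>\<bar> \<le> max \<bar>c\<bar> \<bar>C\<bar>" for \<sigma> using that(2,3)[of \<sigma>] by linarith
      then show "AE \<sigma> in \<mu>. norm (h \<sigma>) \<le> max \<bar>c\<bar> \<bar>C\<bar>" by simp
    qed (rule measurable_prob_borel[OF \<mu> that(1)])
    have lnint: "integrable \<mu> (\<lambda>\<sigma>. ln (h \<sigma>))" if h: "h \<in> borel_measurable borel" "\<And>\<sigma>. a \<le> h \<sigma>" "\<And>\<sigma>. h \<sigma> \<le> b" for h :: "(nat \<Rightarrow> 'w) \<Rightarrow> real"
    proof (rule int[of _ "ln a" "ln b"])
      show "(\<lambda>\<sigma>. ln (h \<sigma>)) \<in> borel_measurable borel" using h(1) by measurable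
      have "0 < h \<sigma>" for \<sigma> using a(1) h(2)[of \<sigma>] by linarith
      then show "ln a \<le> ln (h \<sigma>)" "ln (h \<sigma>) \<le> ln b" for \<sigma>
        using a(1) h(2,3)[of \<sigma>] by (auto intro!: ln_mono)
    qed
    note tf = transfer_measurable[OF f] transfer_bounds[OF f a(2,3)]
    note t\<psi> = transfer_measurable[OF \<psi>m] transfer_bounds[OF \<psi>m \<psi>(2,3)]
    note td = transfer_measurable[OF dm] transfer_bounds[OF dm, of 0 b]
    have di: "integrable \<mu> d" "integrable \<mu> (transfer d)"
      using db(2) db(1) dm td by (auto intro!: int[of _ 0 b] simp: abs_le_iff)
    have "Jfun f \<mu> - Jfun \<psi> \<mu> = (\<integral>\<sigma>. (ln (f \<sigma>) - ln (transfer f \<sigma>)) - (ln (\<psi> \<sigma>) - ln (transfer \<psi> \<sigma>)) \<partial>\<mu>)"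
      unfolding Jfun_def
      by (rule Bochner_Integration.integral_diff[symmetric])
        (intro Bochner_Integration.integrable_diff lnint f a tf \<psi>m \<psi> t\<psi>)+
    also have "\<dots> \<le> (\<integral>\<sigma>. (d \<sigma> + transfer d \<sigma>) / a \<partial>\<mu>)"
    proof (rule integral_mono)
      show "integrable \<mu> (\<lambda>\<sigma>. (ln (f \<sigma>) - ln (transfer f \<sigma>)) - (ln (\<psi> \<sigma>) - ln (transfer \<psi> \<sigma>)))"
        by (intro Bochner_Integration.integrable_diff lnint f a tf \<psi>m \<psi> t\<psi>)
      show "integrable \<mu> (\<lambda>\<sigma>. (d \<sigma> + transfer d \<sigma>) / a)" using di by auto
      fix \<sigma>
      have "\<bar>ln (f \<sigma>) - ln (\<psi> \<sigma>)\<bar> \<le> d \<sigma> / a"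
        unfolding d_def by (rule ln_lipschitz[OF a(1) a(2) \<psi>(2)])
      moreover have "\<bar>ln (transfer f \<sigma>) - ln (transfer \<psi> \<sigma>)\<bar> \<le> \<bar>transfer f \<sigma> - transfer \<psi> \<sigma>\<bar> / a"
        by (rule ln_lipschitz[OF a(1) tf(2) t\<psi>(2)])
      moreover have "\<bar>transfer f \<sigma> - transfer \<psi> \<sigma>\<bar> / a \<le> transfer d \<sigma> / a"
        using transfer_diff_le[OF f B \<psi>m \<psi>B] a(1) by (simp add: d_def[abs_def] divide_right_mono)
      ultimately show "(ln (f \<sigma>) - ln (transfer f \<sigma>)) - (ln (\<psi> \<sigma>) - ln (transfer \<psi> \<sigma>)) \<le> (d \<sigma> + transfer d \<sigma>) / a"
        unfolding add_divide_distrib by linarith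
    qed
    also have "\<dots> = ((\<integral>\<sigma>. d \<sigma> \<partial>\<mu>) + (\<integral>\<sigma>. transfer d \<sigma> \<partial>\<mu>)) / a" using di by simp
    also have "\<dots> \<le> e" using small a(1) mult_pos_pos[OF a(1) e] by (simp add: field_simps)
    finally have "- Jfun \<psi> \<mu> \<le> - Jfun f \<mu> + e" by simp
    then show "entropy m \<mu> \<le> ereal (- Jfun f \<mu>) + ereal e"
      using entropy_le_Jfun[OF \<psi>(1) \<psi>pos, of \<mu>] by (simp add: order_trans)
qed

lemma Jfun_close:
  assumes \<nu>: "\<nu> \<in> prob_borel" and f: "continuous_on UNIV f" and g: "continuous_on UNIV g"
    and a: "a > 0" "\<And>\<sigma>. a \<le> f \<sigma>" "\<And>\<sigma>. a \<le> g \<sigma>" and d: "\<And>\<sigma>. \<bar>f \<sigma> - g \<sigma>\<bar> \<le> d"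
  shows "\<bar>Jfun f \<nu> - Jfun g \<nu>\<bar> \<le> 2 * d / a"
proof -
  interpret \<nu>: prob_space \<nu> using prob_borelD[OF \<nu>] by simp
  have pos: "f \<sigma> > 0" "g \<sigma> > 0" for \<sigma> using a(1) a(2,3)[of \<sigma>] by auto
  have int: "integrable \<nu> (\<lambda>\<sigma>. ln (h \<sigma>) - ln (transfer h \<sigma>))" if h: "continuous_on UNIV h" "\<And>\<sigma>. h \<sigma> > 0" for h
    using integrable_bcontfun[OF prob_borelD(1,2)[OF \<nu>], of "Bcontfun (\<lambda>\<sigma>. ln (h \<sigma>) - ln (transfer h \<sigma>))"]
    by (simp add: apply_Bcontfun[OF continuous_Jfun[OF h]])
  have fm: "f \<in> borel_measurable borel" "g \<in> borel_measurable borel"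
    using f g by (auto intro: borel_measurable_continuous_onI)
  obtain B where B: "\<And>\<sigma>. \<bar>f \<sigma>\<bar> \<le> B" using continuous_bounded[OF f] by blast
  obtain C where C: "\<And>\<sigma>. \<bar>g \<sigma>\<bar> \<le> C" using continuous_bounded[OF g] by blast
  have "\<bar>(ln (f \<sigma>) - ln (transfer f \<sigma>)) - (ln (g \<sigma>) - ln (transfer g \<sigma>))\<bar> \<le> 2 * d / a" for \<sigma>
  proof -
    have "\<bar>ln (f \<sigma>) - ln (g \<sigma>)\<bar> \<le> \<bar>f \<sigma> - g \<sigma>\<bar> / a" by (rule ln_lipschitz[OF a])
    also have "\<dots> \<le> d / a" using d a(1) by (simp add: divide_right_mono)
    finally have 1: "\<bar>ln (f \<sigma>) - ln (g \<sigma>)\<bar> \<le> d / a" .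
    have fb: "f \<sigma> \<le> B" "g \<sigma> \<le> C" for \<sigma> using B[of \<sigma>] C[of \<sigma>] by auto
    have "\<bar>ln (transfer f \<sigma>) - ln (transfer g \<sigma>)\<bar> \<le> \<bar>transfer f \<sigma> - transfer g \<sigma>\<bar> / a"
      by (intro ln_lipschitz a(1) transfer_bounds(1)[OF fm(1) a(2) fb(1)] transfer_bounds(1)[OF fm(2) a(3) fb(2)])
    also have "\<dots> \<le> transfer (\<lambda>\<sigma>. \<bar>f \<sigma> - g \<sigma>\<bar>) \<sigma> / a"
      using transfer_diff_le[OF fm(1) B fm(2) C, of \<sigma>] a(1) by (simp add: divide_right_mono)
    also have "\<dots> \<le> d / a"
      using transfer_bounds(2)[of "\<lambda>\<sigma>. \<bar>f \<sigma> - g \<sigma>\<bar>" 0 d \<sigma>] d fm a(1) by (simp add: divide_right_mono)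
    finally show ?thesis using 1 by simp
  qed
  then have "\<bar>\<integral>\<sigma>. (ln (f \<sigma>) - ln (transfer f \<sigma>)) - (ln (g \<sigma>) - ln (transfer g \<sigma>)) \<partial>\<nu>\<bar> \<le> (\<integral>\<sigma>. 2 * d / a \<partial>\<nu>)"
    by (intro integral_abs_bound[THEN order_trans] integral_mono)
      (use int[OF f pos(1)] int[OF g pos(2)] in auto)
  then show ?thesis
    unfolding Jfun_def using int[OF f pos(1)] int[OF g pos(2)] by (simp add: \<nu>.prob_space)
qed

text \<open>For each component, a nearly optimal function in the variational formula for the entropy can
  be chosen from a countable family. As components are shift invariant, the chosen functions glue to
  one measurable function that commutes with the transfer operator, and it is nearly optimal for the
  whole measure.\<close>

theorem entropy_le_integral_component:
  fixes k :: "(nat \<Rightarrow> 'w) measure \<Rightarrow> real"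
  assumes \<mu>: "\<mu> \<in> inv_measures" and k [measurable]: "k \<in> borel_measurable BP"
    and K: "\<And>\<nu>. \<nu> \<in> inv_measures \<Longrightarrow> \<bar>k \<nu>\<bar> \<le> K"
    and ent: "\<And>\<nu>. \<nu> \<in> inv_measures \<Longrightarrow> entropy m \<nu> \<le> ereal (- k \<nu>)"
  shows "entropy m \<mu> \<le> ereal (- (\<integral>\<sigma>. k (component \<sigma>) \<partial>\<mu>))"
proof (rule ereal_le_epsilon2)
  fix e :: real assume e: "e > 0"
  interpret measure_preserving \<mu> shift by (rule inv_measure_preserving[OF \<mu>])
  note \<mu>b = inv_prob_borel[OF \<mu>]
  have inv: "component \<sigma> \<in> inv_measures" for \<sigma> by (rule component_inv[OF \<mu>])
  have cb [measurable]: "component \<in> measurable borel BP" using component_measurable \<mu> by auto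
  have [measurable]: "component \<in> measurable \<mu> BP" by (rule component_measurable'[OF \<mu>])
  have comp_cons: "component (case_nat \<omega> \<sigma>) = component \<sigma>" for \<omega> \<sigma>
    using component_shift[of "case_nat \<omega> \<sigma>"] by simp
  define F where "F j = apply_bcontfun (dense_seq j)" for j
  define pos where "pos j \<longleftrightarrow> (\<forall>\<sigma>. F j \<sigma> > 0)" for j
  \<comment> \<open>The integrand of \<open>Jfun (F j)\<close> as a bounded continuous function. If
    \<open>F j\<close> is not everywhere positive the value is 0, and such an index is never
    selected.\<close>
  define lam where "lam j = Bcontfun (\<lambda>\<sigma>. if pos j then ln (F j \<sigma>) - ln (transfer (F j) \<sigma>) else 0)" for j
  have Fc: "continuous_on UNIV (F j)" for j unfolding F_def by (rule continuous_bcontfun)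
  have lam: "apply_bcontfun (lam j) \<sigma> = (if pos j then ln (F j \<sigma>) - ln (transfer (F j) \<sigma>) else 0)" for j \<sigma>
  proof -
    have "continuous_on UNIV (\<lambda>\<sigma>. if pos j then ln (F j \<sigma>) - ln (transfer (F j) \<sigma>) else 0)"
    proof (cases "pos j")
      case True
      then have "\<And>\<sigma>. F j \<sigma> > 0" by (simp add: pos_def)
      from continuous_Jfun[OF Fc this] show ?thesis using True by simp
    qed simp
    from apply_Bcontfun[OF this] show ?thesis by (simp add: lam_def)
  qed
  have ev_lam: "ev \<nu> (lam j) = Jfun (F j) \<nu>" if "pos j" for \<nu> j using that by (simp add: lam Jfun_def)
  define good where "good \<nu> j \<longleftrightarrow> pos j \<and> ev \<nu> (lam j) > k \<nu> - e" for \<nu> j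
  have ex: "\<exists>j. good \<nu> j" if \<nu>: "\<nu> \<in> inv_measures" for \<nu>
  proof -
    have "Defs.entropy m \<nu> < ereal (- k \<nu> + e/2)" using ent[OF \<nu>] e by (intro le_less_trans[OF ent[OF \<nu>]]) simp
    then obtain f where f: "continuous_on UNIV f" "\<And>\<sigma>. f \<sigma> > 0" "Jfun f \<nu> > k \<nu> - e/2"
      unfolding entropy_eq INF_less_iff by auto
    obtain a b where a: "a > 0" "\<And>\<sigma>. a \<le> f \<sigma>" "\<And>\<sigma>. f \<sigma> \<le> b" using continuous_bounded_pos[OF f(1,2)] by blast
    \<comment> \<open>The bound \<open>a / 2\<close> keeps \<open>F j\<close> above
      \<open>a / 2\<close>, and \<open>a * e / 8\<close> makes the Lipschitz estimate
      \<open>2 * d / (a / 2)\<close> at most \<open>e / 2\<close>.\<close>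
    define d where "d = min (a/2) (a * e / 8)"
    have "d > 0" using a(1) e by (simp add: d_def)
    then obtain j where j: "dist (Bcontfun f) (dense_seq j) < d" using dense_seq by blast
    have close: "\<bar>f \<sigma> - F j \<sigma>\<bar> \<le> d" for \<sigma>
      using dist_bounded[of "Bcontfun f" \<sigma> "dense_seq j"] j by (simp add: apply_Bcontfun[OF f(1)] F_def dist_real_def)
    have Fa: "a/2 \<le> F j \<sigma>" for \<sigma> 
    proof -
      have "\<bar>f \<sigma> - F j \<sigma>\<bar> \<le> a/2" using close[of \<sigma>] by (simp add: d_def)
      then show ?thesis using a(2)[of \<sigma>] by linarith
    qed
    have "\<bar>Jfun f \<nu> - Jfun (F j) \<nu>\<bar> \<le> 2 * d / (a/2)"
    proof (rule Jfun_close[OF inv_prob_borel[OF \<nu>] f(1) Fc _ _ Fa close])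
      show "a / 2 \<le> f \<sigma>" for \<sigma> using a(1) a(2)[of \<sigma>] by linarith
    qed (use a(1) in simp)
    also have "\<dots> \<le> e/2"
    proof -
      have "2 * d / (a/2) \<le> 2 * (a * e / 8) / (a/2)" using a(1) by (intro divide_right_mono) (auto simp: d_def)
      also have "\<dots> = e/2" using a(1) by simp
      finally show ?thesis .
    qed
    finally have "Jfun (F j) \<nu> > k \<nu> - e" using f(3) by linarith
    moreover have "pos j" unfolding pos_def using Fa a(1) by (meson half_gt_zero less_le_trans)
    ultimately show ?thesis unfolding good_def using ev_lam by auto
  qed
  \<comment> \<open>The least admissible index is a measurable choice, because
    \<open>good \<nu> j\<close> is a measurable condition on \<nu> for each
    \<open>j\<close>.\<close>
  define jj where "jj \<nu> = (LEAST j. good \<nu> j)" for \<nu>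
  have jj: "pos (jj \<nu>)" "ev \<nu> (lam (jj \<nu>)) > k \<nu> - e" if "\<nu> \<in> inv_measures" for \<nu>
    using LeastI_ex[OF ex[OF that]] by (auto simp: jj_def good_def)
  have jm [measurable]: "jj \<in> measurable BP (count_space UNIV)"
    unfolding jj_def good_def by measurable
  have kc: "(\<lambda>\<sigma>. k (component \<sigma>)) \<in> borel_measurable \<mu>"
    by (rule measurable_compose[OF component_measurable'[OF \<mu>] k])
  have pm: "(\<lambda>\<sigma>. indicator S (jj (component \<sigma>)) * (k (component \<sigma>) - e)) \<in> borel_measurable \<mu>" for S
  proof -
    have "(indicator S :: nat \<Rightarrow> real) \<in> borel_measurable (count_space UNIV)" by simp
    then have "(\<lambda>\<sigma>. indicator S (jj (component \<sigma>)) :: real) \<in> borel_measurable \<mu>"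
      by (rule measurable_compose[OF measurable_compose[OF component_measurable'[OF \<mu>] jm]])
    then show ?thesis using kc by (intro borel_measurable_times borel_measurable_diff borel_measurable_const)
  qed
  have key: "Defs.entropy m \<mu> \<le> ereal (- (\<integral>\<sigma>. indicator {..<N} (jj (component \<sigma>)) * (k (component \<sigma>) - e) \<partial>\<mu>))" for N
  proof -
    \<comment> \<open>Cutting off at \<open>N\<close> leaves finitely many functions, so
      \<open>f\<close> is bounded and bounded away from 0. Where the selected index is too large,
      \<open>f\<close> and \<open>transfer f\<close> are both 1 and contribute nothing to
      \<open>Jfun\<close>.\<close>
    define f where "f \<sigma> = (if jj (component \<sigma>) < N then F (jj (component \<sigma>)) \<sigma> else 1)" for \<sigma>
    have ind: "(\<Sum>j<N. indicator {j} (jj \<nu>) * h j) = (if jj \<nu> < N then h (jj \<nu>) else 0 :: real)" for h \<nu>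
      by (simp add: indicator_def if_distrib[of "\<lambda>x. x * _"] cong: if_cong)
    have f_alt: "f \<sigma> = 1 + (\<Sum>j<N. indicator {j} (jj (component \<sigma>)) * (F j \<sigma> - 1))" for \<sigma>
      unfolding ind by (simp add: f_def)
    have fm: "f \<in> borel_measurable borel"
    proof -
      have 1: "F j \<in> borel_measurable borel" for j by (rule borel_measurable_continuous_onI[OF Fc])
      have "(indicator {j} :: nat \<Rightarrow> real) \<in> borel_measurable (count_space UNIV)" for j by simp
      then have 2: "(\<lambda>\<sigma>. indicator {j} (jj (component \<sigma>)) :: real) \<in> borel_measurable borel" for j
        by (rule measurable_compose[OF measurable_compose[OF cb jm]])
      show ?thesis unfolding f_alt[abs_def]
        by (intro borel_measurable_add borel_measurable_sum borel_measurable_times borel_measurable_diff 1 2 borel_measurable_const)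
    qed
    have "\<exists>a>0. \<forall>j<N. pos j \<longrightarrow> (\<forall>\<sigma>. a \<le> F j \<sigma>)" for N
    proof (induction N)
      case 0 show ?case by (auto intro: exI[of _ 1])
    next
      case (Suc N)
      then obtain a where a: "a > 0" "\<forall>j<N. pos j \<longrightarrow> (\<forall>\<sigma>. a \<le> F j \<sigma>)" by auto
      show ?case
      proof (cases "pos N")
        case True
        then obtain c b where c: "c > 0" "\<And>\<sigma>. c \<le> F N \<sigma>" "\<And>\<sigma>. F N \<sigma> \<le> b"
          using continuous_bounded_pos[OF Fc] unfolding pos_def by metis
        show ?thesis using a c by (intro exI[of _ "min a c"]) (auto simp: less_Suc_eq min_le_iff_disj)
      next
        case False then show ?thesis using a by (intro exI[of _ a]) (auto simp: less_Suc_eq)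
      qed
    qed
    then obtain a where a: "a > 0" "\<forall>j<N. pos j \<longrightarrow> (\<forall>\<sigma>. a \<le> F j \<sigma>)" by blast
    define b where "b = 1 + (\<Sum>j<N. norm (dense_seq j))"
    have fa: "min a 1 \<le> f \<sigma>" for \<sigma>
      using a(2) jj(1)[OF inv[of \<sigma>]] by (auto simp: f_def min_le_iff_disj)
    have fb: "f \<sigma> \<le> b" for \<sigma>
    proof -
      have "F j \<sigma> \<le> (\<Sum>j<N. norm (dense_seq j))" if "j < N" for j
      proof -
        have "F j \<sigma> \<le> norm (dense_seq j)" using bcontfun_bound[of "dense_seq j" \<sigma>] by (simp add: F_def abs_le_iff)
        also have "\<dots> \<le> (\<Sum>j<N. norm (dense_seq j))" using that by (intro member_le_sum) auto
        finally show ?thesis .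
      qed
      moreover have "0 \<le> (\<Sum>j<N. norm (dense_seq j))" by (intro sum_nonneg) auto
      ultimately show ?thesis unfolding f_def b_def by (force simp: add_increasing)
    qed
    have e1: "Defs.entropy m \<mu> \<le> ereal (- Jfun f \<mu>)"
      by (rule entropy_le_Jfun_measurable[OF \<mu>b fm _ fa fb]) (use a(1) in simp)
    have e2: "Jfun f \<mu> \<ge> (\<integral>\<sigma>. indicator {..<N} (jj (component \<sigma>)) * (k (component \<sigma>) - e) \<partial>\<mu>)"
    proof -
      have tf: "transfer f \<sigma> = (if jj (component \<sigma>) < N then transfer (F (jj (component \<sigma>))) \<sigma> else 1)" for \<sigma>
        unfolding transfer_def f_def comp_cons by (auto simp: m.prob_space)
      have "ln (f \<sigma>) - ln (transfer f \<sigma>) = (\<Sum>j<N. indicator {j} (jj (component \<sigma>)) * apply_bcontfun (lam j) \<sigma>)" for \<sigma>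
        unfolding ind using jj(1)[OF inv[of \<sigma>]] by (simp add: f_def tf lam)
      then have "Jfun f \<mu> = (\<integral>\<sigma>. (\<Sum>j<N. indicator {j} (jj (component \<sigma>)) * apply_bcontfun (lam j) \<sigma>) \<partial>\<mu>)"
        by (simp add: Jfun_def)
      also have "\<dots> = (\<Sum>j<N. \<integral>\<sigma>. indicator {j} (jj (component \<sigma>)) * apply_bcontfun (lam j) \<sigma> \<partial>\<mu>)"
      proof (rule Bochner_Integration.integral_sum)
        fix j
        have [measurable]: "apply_bcontfun (lam j) \<in> borel_measurable \<mu>" by (rule measurable_prob_borel[OF \<mu>b]) simp
        show "integrable \<mu> (\<lambda>\<sigma>. indicator {j} (jj (component \<sigma>)) * apply_bcontfun (lam j) \<sigma>)"
          using bcontfun_bound[of "lam j"]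
          by (intro integrable_const_bound[of _ "norm (lam j)"]) (auto simp: indicator_def)
      qed
      \<comment> \<open>Selection of the index \<open>j\<close> depends on the component only, so on
        the set where it occurs \<open>lam j\<close> may be replaced by its integral under the
        component.\<close>
      also have "\<dots> = (\<Sum>j<N. \<integral>\<sigma>. indicator {j} (jj (component \<sigma>)) * ev (component \<sigma>) (lam j) \<partial>\<mu>)"
        by (intro sum.cong refl integral_component[OF \<mu>, of "\<lambda>\<nu>. indicator {_} (jj \<nu>)" 1, symmetric])
          (auto simp: indicator_def)
      also have "\<dots> = (\<integral>\<sigma>. (\<Sum>j<N. indicator {j} (jj (component \<sigma>)) * ev (component \<sigma>) (lam j)) \<partial>\<mu>)"
      proof (rule Bochner_Integration.integral_sum[symmetric])
        fix j
        have [measurable]: "(\<lambda>\<sigma>. ev (component \<sigma>) (lam j)) \<in> borel_measurable \<mu>"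
          by (rule measurable_compose[OF component_measurable'[OF \<mu>] ev_measurable])
        show "integrable \<mu> (\<lambda>\<sigma>. indicator {j} (jj (component \<sigma>)) * ev (component \<sigma>) (lam j))"
          using ev_bound[OF inv_prob_borel[OF inv], of _ "lam j"]
          by (intro integrable_const_bound[of _ "norm (lam j)"]) (auto simp: indicator_def)
      qed
      also have "\<dots> \<ge> (\<integral>\<sigma>. indicator {..<N} (jj (component \<sigma>)) * (k (component \<sigma>) - e) \<partial>\<mu>)"
      proof (rule integral_mono)
        have "\<bar>indicator {..<N} (jj (component \<sigma>)) * (k (component \<sigma>) - e)\<bar> \<le> K + e" for \<sigma>
          using K[OF inv[of \<sigma>]] e by (auto simp: indicator_def)
        then show "integrable \<mu> (\<lambda>\<sigma>. indicator {..<N} (jj (component \<sigma>)) * (k (component \<sigma>) - e))"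
          by (intro integrable_const_bound[of _ "K + e"] pm) simp
        show "integrable \<mu> (\<lambda>\<sigma>. \<Sum>j<N. indicator {j} (jj (component \<sigma>)) * ev (component \<sigma>) (lam j))"
        proof (rule Bochner_Integration.integrable_sum)
          fix j
          have [measurable]: "(\<lambda>\<sigma>. ev (component \<sigma>) (lam j)) \<in> borel_measurable \<mu>"
            by (rule measurable_compose[OF component_measurable'[OF \<mu>] ev_measurable])
          show "integrable \<mu> (\<lambda>\<sigma>. indicator {j} (jj (component \<sigma>)) * ev (component \<sigma>) (lam j))"
            using ev_bound[OF inv_prob_borel[OF inv], of _ "lam j"]
            by (intro integrable_const_bound[of _ "norm (lam j)"]) (auto simp: indicator_def)
        qed
        show "indicator {..<N} (jj (component \<sigma>)) * (k (component \<sigma>) - e) \<le>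
            (\<Sum>j<N. indicator {j} (jj (component \<sigma>)) * ev (component \<sigma>) (lam j))" for \<sigma>
          unfolding ind using jj(2)[OF inv[of \<sigma>]] by (simp add: indicator_def)
      qed
      finally show ?thesis .
    qed
    show ?thesis using e1 e2 by (meson ereal_less_eq(3) neg_le_iff_le order_trans)
  qed
  have "(\<lambda>N. \<integral>\<sigma>. indicator {..<N} (jj (component \<sigma>)) * (k (component \<sigma>) - e) \<partial>\<mu>) \<longlonglongrightarrow> (\<integral>\<sigma>. k (component \<sigma>) - e \<partial>\<mu>)"
  proof (rule integral_dominated_convergence[where w="\<lambda>_. K + e"])
    have "eventually (\<lambda>N. indicator {..<N} (jj (component \<sigma>)) * (k (component \<sigma>) - e) = k (component \<sigma>) - e) sequentially" for \<sigma>
      using eventually_gt_at_top[of "jj (component \<sigma>)"] by eventually_elim simp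
    then show "AE \<sigma> in \<mu>. (\<lambda>N. indicator {..<N} (jj (component \<sigma>)) * (k (component \<sigma>) - e)) \<longlonglongrightarrow> k (component \<sigma>) - e"
      by (intro AE_I2 tendsto_eventually)
    have "\<bar>indicator {..<N} (jj (component \<sigma>)) * (k (component \<sigma>) - e)\<bar> \<le> K + e" for \<sigma> N
      using K[OF inv[of \<sigma>]] e by (auto simp: indicator_def)
    then show "AE \<sigma> in \<mu>. norm (indicator {..<N} (jj (component \<sigma>)) * (k (component \<sigma>) - e)) \<le> K + e" for N
      by simp
    show "(\<lambda>\<sigma>. k (component \<sigma>) - e) \<in> borel_measurable \<mu>"
      using kc by (intro borel_measurable_diff borel_measurable_const)
  qed (rule pm, simp)
  then have "(\<lambda>N. ereal (- (\<integral>\<sigma>. indicator {..<N} (jj (component \<sigma>)) * (k (component \<sigma>) - e) \<partial>\<mu>))) \<longlonglongrightarrow>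
      ereal (- (\<integral>\<sigma>. k (component \<sigma>) - e \<partial>\<mu>))" by (intro tendsto_intros)
  then have "Defs.entropy m \<mu> \<le> ereal (- (\<integral>\<sigma>. k (component \<sigma>) - e \<partial>\<mu>))"
    by (rule LIMSEQ_le_const) (use key in auto)
  also have "(\<integral>\<sigma>. k (component \<sigma>) - e \<partial>\<mu>) = (\<integral>\<sigma>. k (component \<sigma>) \<partial>\<mu>) - e"
  proof -
    have "integrable \<mu> (\<lambda>\<sigma>. k (component \<sigma>))"
      using K[OF inv] by (intro integrable_const_bound[of _ K]) auto
    then show ?thesis by (simp add: prob_space)
  qed
  finally show "Defs.entropy m \<mu> \<le> ereal (- (\<integral>\<sigma>. k (component \<sigma>) \<partial>\<mu>)) + ereal e" by simp
qed

end

section \<open>Approximation by ergodic measures\<close>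

text \<open>Otherwise there would be pairs of points agreeing on more and more coordinates with
  values of \<open>f\<close> more than \<open>e\<close> apart; by compactness both sequences would
  have a common subsequential limit.\<close>

lemma uniform_finite_coordinates:
  fixes f :: "(nat \<Rightarrow> 'w::metric_space) \<Rightarrow> real"
  assumes K: "compact (UNIV :: (nat \<Rightarrow> 'w) set)" and f: "continuous_on UNIV f" and e: "e > 0"
  shows "\<exists>N. \<forall>x y. (\<forall>i<N. x i = y i) \<longrightarrow> \<bar>f x - f y\<bar> \<le> e"
proof (rule ccontr)
  assume "\<not> ?thesis"
  then have "\<forall>N. \<exists>x y. (\<forall>i<N. x i = y i) \<and> \<bar>f x - f y\<bar> > e" by (meson not_le)
  then obtain x y where xy: "\<And>N i. i < N \<Longrightarrow> x N i = y N i" "\<And>N. \<bar>f (x N) - f (y N)\<bar> > e" by metis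
  obtain l r where r: "strict_mono (r :: nat \<Rightarrow> nat)" "(x \<circ> r) \<longlonglongrightarrow> l"
    using K unfolding compact_def by (metis UNIV_I)
  have "(\<lambda>n. y (r n)) \<longlonglongrightarrow> l"
    unfolding tendsto_fun_iff
  proof
    fix i
    have "(\<lambda>n. x (r n) i) \<longlonglongrightarrow> l i" using r(2) unfolding tendsto_fun_iff by (simp add: comp_def)
    moreover have "eventually (\<lambda>n. x (r n) i = y (r n) i) sequentially"
      using eventually_gt_at_top[of i]
    proof eventually_elim
      case (elim n)
      then show ?case using seq_suble[OF r(1), of n] by (intro xy(1)) simp
    qed
    ultimately show "(\<lambda>n. y (r n) i) \<longlonglongrightarrow> l i" by (rule Lim_transform_eventually)
  qed
  moreover have c: "isCont f l" using f by (simp add: continuous_on_eq_continuous_at)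
  ultimately have "(\<lambda>n. f (x (r n)) - f (y (r n))) \<longlonglongrightarrow> f l - f l"
    using r(2) by (intro tendsto_diff isCont_tendsto_compose[OF c]) (simp_all add: comp_def)
  then have "(\<lambda>n. f (x (r n)) - f (y (r n))) \<longlonglongrightarrow> 0" by simp
  from LIMSEQ_D[OF this e] show False using xy(2) by (metis diff_zero le_refl less_asym real_norm_def)
qed

lemma comb_seq_measurable:
  "(\<lambda>p. comb_seq n (fst p) (snd p)) \<in> measurable (borel \<Otimes>\<^sub>M borel) (borel :: (nat \<Rightarrow> 'w::second_countable_topology) measure)"
proof (rule measurable_coordinatewise_then_product)
  fix i
  show "(\<lambda>p :: (nat \<Rightarrow> 'w) \<times> (nat \<Rightarrow> 'w). comb_seq n (fst p) (snd p) i) \<in> borel_measurable (borel \<Otimes>\<^sub>M borel)"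
    using measurable_compose[OF measurable_fst measurable_product_coordinates[of i]]
      measurable_compose[OF measurable_snd measurable_product_coordinates[of "i - n"]]
    by (cases "i < n") (simp_all add: comb_seq_def)
qed

lemma shift_comb_seq: "(shift ^^ n) (comb_seq n a b) = b"
  by (simp add: shift_funpow comb_seq_add)

context compact_alphabet
begin

section \<open>Independent concatenation of blocks\<close>

definition concat_blocks :: "nat \<Rightarrow> (nat \<Rightarrow> nat \<Rightarrow> 'w) \<Rightarrow> nat \<Rightarrow> 'w"
  where "concat_blocks n s i = s (i div n) (i mod n)"

text \<open>Of each independent copy of \<kappa> only the leading \<open>n\<close> coordinates
  survive. The result is invariant under \<open>shift ^^ n\<close>, but in general not under the
  shift.\<close>

definition block_product :: "nat \<Rightarrow> (nat \<Rightarrow> 'w) measure \<Rightarrow> (nat \<Rightarrow> 'w) measure"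
  where "block_product n \<kappa> = distr (Pi\<^sub>M UNIV (\<lambda>_::nat. \<kappa>)) borel (concat_blocks n)"

text \<open>Averaging over one period of length \<open>n\<close> turns invariance under
  \<open>shift ^^ n\<close> into shift invariance.\<close>

definition block_measure :: "nat \<Rightarrow> (nat \<Rightarrow> 'w) measure \<Rightarrow> (nat \<Rightarrow> 'w) measure"
  where "block_measure n \<kappa> = mixture (pmf_of_set {..<n}) (\<lambda>k. distr (block_product n \<kappa>) borel (shift ^^ k))"

lemma concat_blocks_comb_seq:
  assumes "n > 0"
  shows "concat_blocks n (comb_seq r s t) = comb_seq (n * r) (concat_blocks n s) (concat_blocks n t)"
proof
  fix i
  show "concat_blocks n (comb_seq r s t) i = comb_seq (n * r) (concat_blocks n s) (concat_blocks n t) i"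
  proof (cases "i < n * r")
    case True
    then have "i div n < r" using assms by (simp add: less_mult_imp_div_less mult.commute)
    then show ?thesis using True by (simp add: concat_blocks_def comb_seq_def)
  next
    case False
    then have "i = n * r + (i - n * r)" by simp
    then obtain j where j: "i = n * r + j" by blast
    have "i div n = r + j div n" "i mod n = j mod n" using assms by (simp_all add: j)
    then show ?thesis using False by (simp add: concat_blocks_def comb_seq_def j)
  qed
qed

lemma concat_blocks_measurable:
  assumes "sets \<kappa> = sets borel"
  shows "concat_blocks n \<in> measurable (Pi\<^sub>M UNIV (\<lambda>_::nat. \<kappa>)) borel"
proof (rule measurable_coordinatewise_then_product)
  fix i
  have "(\<lambda>s. s (i div n)) \<in> measurable (Pi\<^sub>M UNIV (\<lambda>_::nat. \<kappa>)) \<kappa>" by measurable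
  moreover have "(\<lambda>x. x (i mod n)) \<in> borel_measurable \<kappa>"
    unfolding measurable_cong_sets[OF assms refl] by measurable
  ultimately show "(\<lambda>s. concat_blocks n s i) \<in> borel_measurable (Pi\<^sub>M UNIV (\<lambda>_::nat. \<kappa>))"
    unfolding concat_blocks_def by (rule measurable_compose)
qed

context
  fixes n :: nat and \<kappa> :: "(nat \<Rightarrow> 'w) measure"
  assumes n: "n > 0" and \<kappa>: "\<kappa> \<in> prob_borel"
begin

interpretation \<kappa>: prob_space \<kappa> using prob_borelD[OF \<kappa>] by simp
interpretation W: sequence_space \<kappa> by unfold_locales

lemma block_product_prob_borel: "block_product n \<kappa> \<in> prob_borel"
  unfolding block_product_def prob_borel_def
  using W.P.prob_space_distr[OF concat_blocks_measurable[OF prob_borelD(2)[OF \<kappa>]]] by simp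

text \<open>The leading \<open>r\<close> blocks are independent of the remaining ones, which again
  have the law of the block product. Of \<open>a\<close> only the leading \<open>n * r\<close>
  coordinates are used, so it may run over full sequences.\<close>

lemma integral_block_product_split:
  fixes F :: "(nat \<Rightarrow> 'w) \<Rightarrow> real"
  assumes F: "F \<in> borel_measurable borel" and B: "\<And>x. \<bar>F x\<bar> \<le> B"
  shows "(\<integral>x. F x \<partial>block_product n \<kappa>) = (\<integral>b. (\<integral>a. F (comb_seq (n * r) a b) \<partial>block_product n \<kappa>) \<partial>block_product n \<kappa>)"
proof -
  let ?\<rho> = "block_product n \<kappa>"
  interpret \<rho>: prob_space ?\<rho> using prob_borelD[OF block_product_prob_borel] by simp
  interpret PP: pair_prob_space W.S W.S ..
  note cm = concat_blocks_measurable[OF prob_borelD(2)[OF \<kappa>], of n]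
  have Fc: "(\<lambda>p. F (comb_seq (n * r) (fst p) (snd p))) \<in> borel_measurable (borel \<Otimes>\<^sub>M borel)"
    by (rule measurable_compose[OF comb_seq_measurable F])
  have cm2: "(\<lambda>p. (concat_blocks n (fst p), concat_blocks n (snd p))) \<in> measurable (W.S \<Otimes>\<^sub>M W.S) (borel \<Otimes>\<^sub>M borel)"
    using cm by measurable
  have inner: "(\<lambda>b. \<integral>a. F (comb_seq (n * r) a b) \<partial>?\<rho>) \<in> borel_measurable borel"
  proof -
    have "(\<lambda>(b, a). F (comb_seq (n * r) a b)) \<in> borel_measurable (borel \<Otimes>\<^sub>M borel)"
      using measurable_compose[OF measurable_pair_swap' Fc] by (simp add: case_prod_beta')
    then have "(\<lambda>(b, a). F (comb_seq (n * r) a b)) \<in> borel_measurable (borel \<Otimes>\<^sub>M ?\<rho>)"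
      unfolding measurable_cong_sets[OF sets_pair_measure_cong[OF refl prob_borelD(2)[OF block_product_prob_borel]] refl] .
    then show ?thesis by (rule \<rho>.borel_measurable_lebesgue_integral)
  qed
  have sect: "(\<lambda>a. F (comb_seq (n * r) a b)) \<in> borel_measurable borel" for b
    using measurable_compose[OF measurable_Pair[OF measurable_ident measurable_const] Fc, of b] by simp
  have "(\<integral>x. F x \<partial>?\<rho>) = (\<integral>s. F (concat_blocks n s) \<partial>W.S)"
    unfolding block_product_def by (rule integral_distr[OF cm F])
  also have "\<dots> = (\<integral>s. F (concat_blocks n s) \<partial>distr (W.S \<Otimes>\<^sub>M W.S) W.S (\<lambda>(\<omega>, \<omega>'). comb_seq r \<omega> \<omega>'))"
    by (simp only: W.PiM_comb_seq)
  also have "\<dots> = (\<integral>p. F (concat_blocks n (case p of (\<omega>, \<omega>') \<Rightarrow> comb_seq r \<omega> \<omega>')) \<partial>(W.S \<Otimes>\<^sub>M W.S))"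
    by (rule integral_distr[OF measurable_comb_seq measurable_compose[OF cm F]])
  also have "\<dots> = (\<integral>p. (case p of (s, t) \<Rightarrow> F (comb_seq (n * r) (concat_blocks n s) (concat_blocks n t))) \<partial>(W.S \<Otimes>\<^sub>M W.S))"
    by (simp add: case_prod_beta' concat_blocks_comb_seq[OF n])
  also have "\<dots> = (\<integral>t. (\<integral>s. F (comb_seq (n * r) (concat_blocks n s) (concat_blocks n t)) \<partial>W.S) \<partial>W.S)"
  proof (rule PP.integral_snd[symmetric])
    show "integrable (W.S \<Otimes>\<^sub>M W.S) (\<lambda>(s, t). F (comb_seq (n * r) (concat_blocks n s) (concat_blocks n t)))"
      using measurable_compose[OF cm2 Fc] B
      by (intro PP.integrable_const_bound[of _ B]) (auto simp: case_prod_beta')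
  qed
  also have "\<dots> = (\<integral>t. (\<integral>a. F (comb_seq (n * r) a (concat_blocks n t)) \<partial>?\<rho>) \<partial>W.S)"
    unfolding block_product_def by (simp only: integral_distr[OF cm sect])
  also have "\<dots> = (\<integral>b. (\<integral>a. F (comb_seq (n * r) a b) \<partial>?\<rho>) \<partial>?\<rho>)"
    by (subst (2) block_product_def, rule integral_distr[OF cm inner, symmetric])
  finally show ?thesis .
qed

lemma integral_block_product_first:
  fixes F :: "(nat \<Rightarrow> 'w) \<Rightarrow> real"
  assumes F: "F \<in> borel_measurable borel" and dep: "\<And>x y. (\<forall>i<n. x i = y i) \<Longrightarrow> F x = F y"
  shows "(\<integral>x. F x \<partial>block_product n \<kappa>) = (\<integral>x. F x \<partial>\<kappa>)"
proof -
  have "F (concat_blocks n s) = F (s 0)" for s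
    by (rule dep) (simp add: concat_blocks_def)
  then have "(\<integral>x. F x \<partial>block_product n \<kappa>) = (\<integral>s. F (s 0) \<partial>W.S)"
    unfolding block_product_def
    by (subst integral_distr[OF concat_blocks_measurable[OF prob_borelD(2)[OF \<kappa>]] F]) simp
  also have "\<dots> = (\<integral>x. F x \<partial>distr W.S \<kappa> (\<lambda>s. s 0))"
    by (rule integral_distr[symmetric]) (auto intro: measurable_prob_borel[OF \<kappa> F])
  also have "distr W.S \<kappa> (\<lambda>s. s 0) = \<kappa>"
    by (rule distr_PiM_component) (auto simp: \<kappa>.prob_space_axioms)
  finally show ?thesis .
qed

lemma integral_block_product_shift:
  fixes F :: "(nat \<Rightarrow> 'w) \<Rightarrow> real"
  assumes F: "F \<in> borel_measurable borel" and B: "\<And>x. \<bar>F x\<bar> \<le> B"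
  shows "(\<integral>x. F ((shift ^^ n) x) \<partial>block_product n \<kappa>) = (\<integral>x. F x \<partial>block_product n \<kappa>)"
proof -
  interpret \<rho>: prob_space "block_product n \<kappa>" using prob_borelD[OF block_product_prob_borel] by simp
  have "(\<lambda>x. F ((shift ^^ n) x)) \<in> borel_measurable borel"
    by (rule measurable_compose[OF borel_measurable_continuous_onI[OF continuous_shift_funpow] F])
  from integral_block_product_split[OF this B, of 1]
  show ?thesis by (simp add: shift_comb_seq \<rho>.prob_space)
qed

text \<open>An invariant set is decided by the coordinates from \<open>n * N\<close> on, whereas
  \<phi> is determined up to \<open>e\<close> by the leading \<open>N\<close> coordinates.
  Independence of the blocks makes the two uncorrelated up to \<open>e\<close>, which is
  arbitrary.\<close>

lemma block_product_zero_one: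
  assumes A: "A \<in> sets borel" and inv: "shift -` A = A"
  shows "measure (block_product n \<kappa>) A = 0 \<or> measure (block_product n \<kappa>) A = 1"
proof (rule zero_one_of_product[OF block_product_prob_borel A])
  let ?\<rho> = "block_product n \<kappa>"
  note \<rho>b = prob_borelD[OF block_product_prob_borel]
  interpret \<rho>: prob_space ?\<rho> by (rule \<rho>b)
  fix \<phi> :: "(nat \<Rightarrow> 'w) \<Rightarrow>\<^sub>C real"
  have An: "(shift ^^ k) \<sigma> \<in> A \<longleftrightarrow> \<sigma> \<in> A" for k \<sigma>
    by (induction k) (use inv in auto)
  then have Ac: "comb_seq k a b \<in> A \<longleftrightarrow> b \<in> A" for k a b
    using An[of k "comb_seq k a b"] by (simp add: shift_comb_seq)
  have "\<bar>(\<integral>\<sigma>. indicator A \<sigma> * apply_bcontfun \<phi> \<sigma> \<partial>?\<rho>) - measure ?\<rho> A * ev ?\<rho> \<phi>\<bar> \<le> e" if e: "e > 0" for e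
  proof -
    obtain N where N: "\<And>x y. (\<forall>i<N. x i = y i) \<Longrightarrow> \<bar>apply_bcontfun \<phi> x - apply_bcontfun \<phi> y\<bar> \<le> e"
      using uniform_finite_coordinates[OF compact_seq continuous_bcontfun e] by blast
    have m: "(\<lambda>\<sigma>. indicator A \<sigma> * apply_bcontfun \<phi> \<sigma>) \<in> borel_measurable borel" using A by measurable
    have bd: "\<bar>indicator A \<sigma> * apply_bcontfun \<phi> \<sigma>\<bar> \<le> norm \<phi>" for \<sigma>
      using bcontfun_bound[of \<phi> \<sigma>] by (auto simp: indicator_def)
    have close: "\<bar>apply_bcontfun \<phi> (comb_seq (n * N) a b) - apply_bcontfun \<phi> a\<bar> \<le> e" for a b
    proof (rule N, intro allI impI)
      fix i assume "i < N"
      then have "i < n * N" using n by (metis less_le_trans mult.commute mult_le_mono2 nat_mult_1_right Suc_leI One_nat_def)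
      then show "comb_seq (n * N) a b i = a i" by (rule comb_seq_less)
    qed
    have mc: "(\<lambda>a. apply_bcontfun \<phi> (comb_seq (n * N) a b)) \<in> borel_measurable ?\<rho>" for b
      using measurable_compose[OF measurable_Pair[OF measurable_ident measurable_const]
          measurable_compose[OF comb_seq_measurable bcontfun_measurable[of \<phi>]], of b "n * N"]
      by (intro measurable_prob_borel[OF block_product_prob_borel]) simp
    have ic: "integrable ?\<rho> (\<lambda>a. apply_bcontfun \<phi> (comb_seq (n * N) a b))" for b
      using bcontfun_bound[of \<phi>] by (intro \<rho>.integrable_const_bound[of _ "norm \<phi>"] mc) auto
    \<comment> \<open>The conditional mean of \<phi> given the tail \<open>b\<close>; it stays
      within \<open>e\<close> of the overall mean.\<close>
    define G where "G b = (\<integral>a. apply_bcontfun \<phi> (comb_seq (n * N) a b) \<partial>?\<rho>)" for b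
    have Gc: "\<bar>G b - ev ?\<rho> \<phi>\<bar> \<le> e" for b
    proof -
      have "\<bar>G b - ev ?\<rho> \<phi>\<bar> = \<bar>\<integral>a. apply_bcontfun \<phi> (comb_seq (n * N) a b) - apply_bcontfun \<phi> a \<partial>?\<rho>\<bar>"
        unfolding G_def using ic integrable_bcontfun[OF \<rho>b(1,2)] by simp
      also have "\<dots> \<le> (\<integral>a. e \<partial>?\<rho>)"
        using close ic integrable_bcontfun[OF \<rho>b(1,2)]
        by (intro integral_abs_bound[THEN order_trans] integral_mono) auto
      finally show ?thesis by (simp add: \<rho>.prob_space)
    qed
    have Gm: "G \<in> borel_measurable borel"
    proof -
      have "(\<lambda>(b, a). apply_bcontfun \<phi> (comb_seq (n * N) a b)) \<in> borel_measurable (borel \<Otimes>\<^sub>M borel)"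
        using measurable_compose[OF measurable_pair_swap' measurable_compose[OF comb_seq_measurable bcontfun_measurable[of \<phi>]]]
        by (simp add: case_prod_beta')
      then have "(\<lambda>(b, a). apply_bcontfun \<phi> (comb_seq (n * N) a b)) \<in> borel_measurable (borel \<Otimes>\<^sub>M ?\<rho>)"
        unfolding measurable_cong_sets[OF sets_pair_measure_cong[OF refl \<rho>b(2)] refl] .
      then show ?thesis unfolding G_def[abs_def] by (rule \<rho>.borel_measurable_lebesgue_integral)
    qed
    have Gb: "\<bar>G b\<bar> \<le> norm \<phi>" for b
    proof -
      have "\<bar>G b\<bar> \<le> (\<integral>a. norm \<phi> \<partial>?\<rho>)" unfolding G_def
        using ic bcontfun_bound[of \<phi>] by (intro integral_abs_bound[THEN order_trans] integral_mono) auto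
      then show ?thesis by (simp add: \<rho>.prob_space)
    qed
    have [measurable]: "A \<in> sets ?\<rho>" using A \<rho>b by simp
    have [measurable]: "G \<in> borel_measurable ?\<rho>" by (rule measurable_prob_borel[OF block_product_prob_borel Gm])
    have iG: "integrable ?\<rho> (\<lambda>b. indicator A b * G b)"
      using Gb by (intro \<rho>.integrable_const_bound[of _ "norm \<phi>"]) (auto simp: indicator_def)
    have "(\<integral>\<sigma>. indicator A \<sigma> * apply_bcontfun \<phi> \<sigma> \<partial>?\<rho>) = (\<integral>b. indicator A b * G b \<partial>?\<rho>)"
      unfolding integral_block_product_split[OF m bd, of N] G_def by (simp add: Ac indicator_def)
    moreover have "measure ?\<rho> A * ev ?\<rho> \<phi> = (\<integral>b. indicator A b * ev ?\<rho> \<phi> \<partial>?\<rho>)" by simp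
    ultimately have "\<bar>(\<integral>\<sigma>. indicator A \<sigma> * apply_bcontfun \<phi> \<sigma> \<partial>?\<rho>) - measure ?\<rho> A * ev ?\<rho> \<phi>\<bar> =
        \<bar>\<integral>b. indicator A b * G b - indicator A b * ev ?\<rho> \<phi> \<partial>?\<rho>\<bar>"
      using iG by (simp add: Bochner_Integration.integral_diff less_top[symmetric])
    also have "\<dots> \<le> (\<integral>b. e \<partial>?\<rho>)"
    proof (rule order_trans[OF integral_abs_bound integral_mono])
      show "integrable ?\<rho> (\<lambda>b. \<bar>indicator A b * G b - indicator A b * ev ?\<rho> \<phi>\<bar>)"
        using iG by (auto simp: less_top[symmetric])
      show "\<bar>indicator A b * G b - indicator A b * ev ?\<rho> \<phi>\<bar> \<le> e" for b
        using Gc[of b] e by (auto simp: indicator_def)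
    qed simp
    finally show ?thesis by (simp add: \<rho>.prob_space)
  qed
  then have "\<bar>(\<integral>\<sigma>. indicator A \<sigma> * apply_bcontfun \<phi> \<sigma> \<partial>?\<rho>) - measure ?\<rho> A * ev ?\<rho> \<phi>\<bar> \<le> 0"
    by (rule field_le_epsilon) simp
  then show "(\<integral>\<sigma>. indicator A \<sigma> * apply_bcontfun \<phi> \<sigma> \<partial>?\<rho>) = measure ?\<rho> A * ev ?\<rho> \<phi>" by simp
qed

lemma block_shift_prob_borel: "distr (block_product n \<kappa>) borel (shift ^^ k) \<in> prob_borel"
proof -
  interpret \<rho>: prob_space "block_product n \<kappa>" using prob_borelD[OF block_product_prob_borel] by simp
  have "(shift ^^ k) \<in> measurable (block_product n \<kappa>) borel"
    by (rule measurable_prob_borel[OF block_product_prob_borel borel_measurable_continuous_onI[OF continuous_shift_funpow]])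
  then show ?thesis by (simp add: prob_borel_def \<rho>.prob_space_distr)
qed

lemma block_measure_prob_borel: "block_measure n \<kappa> \<in> prob_borel"
  unfolding block_measure_def by (rule mixture_prob_borel[OF block_shift_prob_borel])

lemma integral_block_measure:
  fixes F :: "(nat \<Rightarrow> 'w) \<Rightarrow> real"
  assumes F: "F \<in> borel_measurable borel" and B: "\<And>x. \<bar>F x\<bar> \<le> B"
  shows "(\<integral>x. F x \<partial>block_measure n \<kappa>) = (\<Sum>k<n. \<integral>x. F ((shift ^^ k) x) \<partial>block_product n \<kappa>) / real n"
proof -
  have sm: "(shift ^^ k) \<in> measurable (block_product n \<kappa>) borel" for k
    by (rule measurable_prob_borel[OF block_product_prob_borel borel_measurable_continuous_onI[OF continuous_shift_funpow]])
  have "(\<integral>x. F x \<partial>block_measure n \<kappa>) = (\<integral>k. (\<integral>x. F ((shift ^^ k) x) \<partial>block_product n \<kappa>) \<partial>measure_pmf (pmf_of_set {..<n}))"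
    unfolding block_measure_def integral_mixture[OF block_shift_prob_borel F B]
    by (simp only: integral_distr[OF sm F])
  also have "\<dots> = (\<Sum>k<n. \<integral>x. F ((shift ^^ k) x) \<partial>block_product n \<kappa>) / real n"
    using n by (subst integral_pmf_of_set) auto
  finally show ?thesis .
qed

text \<open>Under the shift the sum over a period changes only by its end terms, those for the
  exponents \<open>n\<close> and 0, which agree by invariance under
  \<open>shift ^^ n\<close>.\<close>

lemma block_measure_inv: "block_measure n \<kappa> \<in> inv_measures"
  unfolding inv_iff[OF block_measure_prob_borel]
proof
  fix \<phi> :: "(nat \<Rightarrow> 'w) \<Rightarrow>\<^sub>C real"
  let ?I = "\<lambda>k. \<integral>x. apply_bcontfun \<phi> ((shift ^^ k) x) \<partial>block_product n \<kappa>"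
  have m: "(\<lambda>\<sigma>. apply_bcontfun \<phi> (shift \<sigma>)) \<in> borel_measurable borel"
    by (rule borel_measurable_continuous_onI[OF continuous_bcontfun_shift(2)])
  have "(\<integral>\<sigma>. apply_bcontfun \<phi> (shift \<sigma>) \<partial>block_measure n \<kappa>) = (\<Sum>k<n. ?I (Suc k)) / real n"
    using integral_block_measure[OF m bcontfun_bound[of \<phi>]] by simp
  also have "(\<Sum>k<n. ?I (Suc k)) = (\<Sum>k<n. ?I k) + (?I n - ?I 0)"
    using sum.lessThan_Suc_shift[of ?I n] by simp
  also have "?I n = ?I 0"
    using integral_block_product_shift[OF bcontfun_measurable bcontfun_bound[of \<phi>]] by simp
  also have "((\<Sum>k<n. ?I k) + (?I 0 - ?I 0)) / real n = ev (block_measure n \<kappa>) \<phi>"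
    using integral_block_measure[OF bcontfun_measurable bcontfun_bound[of \<phi>]] by simp
  finally show "(\<integral>\<sigma>. apply_bcontfun \<phi> (shift \<sigma>) \<partial>block_measure n \<kappa>) = ev (block_measure n \<kappa>) \<phi>" .
qed

text \<open>Shifting does not change the mass of an invariant set, so the average over a period
  reduces to the block product and its zero-one law.\<close>

lemma block_measure_ergodic: "block_measure n \<kappa> \<in> ergodic_measures"
  unfolding ergodic_measures_def
proof (intro CollectI conjI block_measure_inv ballI impI)
  fix A :: "(nat \<Rightarrow> 'w) set" assume A: "A \<in> sets borel" "shift -` A = A"
  have An: "indicator A ((shift ^^ k) \<sigma>) = (indicator A \<sigma> :: real)" for k \<sigma>
    by (induction k) (use A(2) in \<open>auto simp: indicator_def\<close>)
  have AI: "A \<in> sets (block_measure n \<kappa>)" "A \<in> sets (block_product n \<kappa>)"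
    using A prob_borelD(2)[OF block_measure_prob_borel] prob_borelD(2)[OF block_product_prob_borel] by auto
  have "measure (block_measure n \<kappa>) A = (\<integral>x. indicator A x \<partial>block_measure n \<kappa>)" using AI by simp
  also have "\<dots> = (\<Sum>k<n. \<integral>x. indicator A ((shift ^^ k) x) \<partial>block_product n \<kappa>) / real n"
    by (rule integral_block_measure[where B=1]) (use A in auto)
  also have "\<dots> = measure (block_product n \<kappa>) A" using n AI by (simp add: An)
  finally show "measure (block_measure n \<kappa>) A = 0 \<or> measure (block_measure n \<kappa>) A = 1"
    using block_product_zero_one[OF A] by simp
qed

text \<open>The tail \<open>b\<close> is independent of the leading block, whose coordinates have
  law \<kappa>, so the sum of log-densities over the block can be estimated for each fixed
  \<open>b\<close>; averaging over the period divides by \<open>n\<close>. The bound has to hold for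
  every continuation \<open>b\<close>, because a block is followed by material unrelated to
  it.\<close>

lemma entropy_block_measure:
  assumes D: "\<And>f b. continuous_on UNIV f \<Longrightarrow> (\<And>\<sigma>. f \<sigma> > 0) \<Longrightarrow>
    (\<integral>a. (\<Sum>k<n. ln (f ((shift ^^ k) (comb_seq n a b))) - ln (transfer f ((shift ^^ Suc k) (comb_seq n a b)))) \<partial>\<kappa>) \<le> real n * D"
  shows "ereal (- D) \<le> entropy m (block_measure n \<kappa>)"
proof (rule entropy_geI)
  fix f :: "(nat \<Rightarrow> 'w) \<Rightarrow> real" assume f: "continuous_on UNIV f" "\<And>\<sigma>. f \<sigma> > 0"
  let ?\<rho> = "block_product n \<kappa>" and ?\<nu> = "block_measure n \<kappa>"
  interpret \<rho>: prob_space ?\<rho> using prob_borelD[OF block_product_prob_borel] by simp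
  interpret \<nu>: measure_preserving ?\<nu> shift by (rule inv_measure_preserving[OF block_measure_inv])
  define l where "l \<sigma> = ln (f \<sigma>) - ln (transfer f (shift \<sigma>))" for \<sigma>
  have lnf: "continuous_on UNIV (\<lambda>\<sigma>. ln (f \<sigma>))"
    using f less_imp_neq by (intro continuous_intros) fastforce+
  have lnt: "continuous_on UNIV (\<lambda>\<sigma>. ln (transfer f \<sigma>))"
    using transfer_pos[OF f] less_imp_neq by (intro continuous_intros continuous_transfer f) fastforce+
  have lnts: "continuous_on UNIV (\<lambda>\<sigma>. ln (transfer f (shift \<sigma>)))"
    by (rule continuous_on_compose2[OF lnt continuous_shift]) simp
  have lc: "continuous_on UNIV l" unfolding l_def by (intro continuous_intros lnf lnts)
  have int: "integrable M h" if "M \<in> prob_borel" "continuous_on UNIV h" for M and h :: "(nat \<Rightarrow> 'w) \<Rightarrow> real"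
    using integrable_bcontfun[OF prob_borelD(1,2)[OF that(1)], of "Bcontfun h"] by (simp add: apply_Bcontfun[OF that(2)])
  note nb = block_measure_prob_borel and rb = block_product_prob_borel
  have "Jfun f ?\<nu> = (\<integral>\<sigma>. ln (f \<sigma>) \<partial>?\<nu>) - (\<integral>\<sigma>. ln (transfer f \<sigma>) \<partial>?\<nu>)"
    unfolding Jfun_def using int[OF nb lnf] int[OF nb lnt] by simp
  \<comment> \<open>Invariance moves the argument of \<open>transfer f\<close> by one step, so that
    the integrand \<open>l\<close> is the logarithm of a conditional density.\<close>
  also have "(\<integral>\<sigma>. ln (transfer f \<sigma>) \<partial>?\<nu>) = (\<integral>\<sigma>. ln (transfer f (shift \<sigma>)) \<partial>?\<nu>)"
    by (rule \<nu>.integral_T[symmetric])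
      (rule measurable_prob_borel[OF nb borel_measurable_continuous_onI[OF lnt]])
  also have "(\<integral>\<sigma>. ln (f \<sigma>) \<partial>?\<nu>) - \<dots> = (\<integral>\<sigma>. l \<sigma> \<partial>?\<nu>)"
    unfolding l_def using int[OF nb lnf] int[OF nb lnts] by simp
  also have "\<dots> = (\<Sum>k<n. \<integral>x. l ((shift ^^ k) x) \<partial>?\<rho>) / real n"
  proof -
    obtain B where "\<And>\<sigma>. \<bar>l \<sigma>\<bar> \<le> B" using continuous_bounded[OF lc] by blast
    then show ?thesis by (rule integral_block_measure[OF borel_measurable_continuous_onI[OF lc]])
  qed
  also have "(\<Sum>k<n. \<integral>x. l ((shift ^^ k) x) \<partial>?\<rho>) \<le> real n * D"
  proof -
    define G where "G x = (\<Sum>k<n. l ((shift ^^ k) x))" for x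
    have lk: "continuous_on UNIV (\<lambda>x. l ((shift ^^ k) x))" for k
      by (rule continuous_on_compose2[OF lc continuous_shift_funpow]) simp
    have Gc: "continuous_on UNIV G" unfolding G_def by (intro continuous_intros lk)
    obtain B where B: "\<And>\<sigma>. \<bar>G \<sigma>\<bar> \<le> B" using continuous_bounded[OF Gc] by blast
    have Gm: "G \<in> borel_measurable borel" by (rule borel_measurable_continuous_onI[OF Gc])
    have Gs: "(\<lambda>a. G (comb_seq n a b)) \<in> borel_measurable borel" for b
      using measurable_compose[OF measurable_Pair[OF measurable_ident measurable_const]
          measurable_compose[OF comb_seq_measurable Gm], of b n] by simp
    have "(\<Sum>k<n. \<integral>x. l ((shift ^^ k) x) \<partial>?\<rho>) = (\<integral>x. G x \<partial>?\<rho>)"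
      unfolding G_def using int[OF rb lk] by (simp add: Bochner_Integration.integral_sum)
    also have "\<dots> = (\<integral>b. (\<integral>a. G (comb_seq n a b) \<partial>?\<rho>) \<partial>?\<rho>)"
      using integral_block_product_split[OF Gm B, of 1] by simp
    also have "\<dots> = (\<integral>b. (\<integral>a. G (comb_seq n a b) \<partial>\<kappa>) \<partial>?\<rho>)"
    proof -
      have "(\<integral>a. G (comb_seq n a b) \<partial>?\<rho>) = (\<integral>a. G (comb_seq n a b) \<partial>\<kappa>)" for b
      proof (rule integral_block_product_first[OF Gs])
        fix x y assume "\<forall>i<n. x i = (y i :: 'w)"
        then have "comb_seq n x b = comb_seq n y b" by (auto simp: comb_seq_def)
        then show "G (comb_seq n x b) = G (comb_seq n y b)" by simp
      qed
      then show ?thesis by simp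
    qed
    also have "\<dots> \<le> (\<integral>b. real n * D \<partial>?\<rho>)"
    proof (rule integral_mono)
      show "(\<integral>a. G (comb_seq n a b) \<partial>\<kappa>) \<le> real n * D" for b
        using D[OF f, of b] by (simp add: G_def l_def)
      show "integrable ?\<rho> (\<lambda>b. \<integral>a. G (comb_seq n a b) \<partial>\<kappa>)"
      proof (rule \<rho>.integrable_const_bound[of _ B])
        have "(\<lambda>(b, a). G (comb_seq n a b)) \<in> borel_measurable (borel \<Otimes>\<^sub>M borel)"
          using measurable_compose[OF measurable_pair_swap' measurable_compose[OF comb_seq_measurable Gm]]
          by (simp add: case_prod_beta')
        then have "(\<lambda>(b, a). G (comb_seq n a b)) \<in> borel_measurable (borel \<Otimes>\<^sub>M \<kappa>)"
          unfolding measurable_cong_sets[OF sets_pair_measure_cong[OF refl prob_borelD(2)[OF \<kappa>]] refl] .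
        then have "(\<lambda>b. \<integral>a. G (comb_seq n a b) \<partial>\<kappa>) \<in> borel_measurable borel"
          by (rule \<kappa>.borel_measurable_lebesgue_integral)
        then show "(\<lambda>b. \<integral>a. G (comb_seq n a b) \<partial>\<kappa>) \<in> borel_measurable ?\<rho>" by (rule measurable_prob_borel[OF rb])
        have "\<bar>\<integral>a. G (comb_seq n a b) \<partial>\<kappa>\<bar> \<le> (\<integral>a. B \<partial>\<kappa>)" for b
          using B measurable_prob_borel[OF \<kappa> Gs]
          by (intro integral_abs_bound[THEN order_trans] integral_mono)
            (auto intro!: \<kappa>.integrable_const_bound[of _ B])
        then show "AE b in ?\<rho>. norm (\<integral>a. G (comb_seq n a b) \<partial>\<kappa>) \<le> B" by (simp add: \<kappa>.prob_space)
      qed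
    qed simp
    finally show ?thesis by (simp add: \<rho>.prob_space)
  qed
  finally show "Jfun f ?\<nu> \<le> D" using n by (simp add: field_simps)
qed

end

text \<open>For \<open>k + N \<le> n\<close> the relevant window of coordinates lies inside the
  leading block, whose law is that of \<mu>. Padding with a fixed sequence \<open>c\<close> makes
  the function depend on the block only; this replacement costs \<open>e\<close> under each of the
  two measures.\<close>

lemma block_measure_close:
  assumes n: "n > 0" and \<mu>: "\<mu> \<in> inv_measures" and e: "e > 0" and k: "k + N \<le> n"
    and N: "\<And>x y. (\<forall>i<N. x i = y i) \<Longrightarrow> \<bar>apply_bcontfun \<phi> x - apply_bcontfun \<phi> y\<bar> \<le> e"
  shows "\<bar>(\<integral>x. apply_bcontfun \<phi> ((shift ^^ k) x) \<partial>block_product n \<mu>) - ev \<mu> \<phi>\<bar> \<le> 2 * e"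
proof -
  note \<mu>b = inv_prob_borel[OF \<mu>]
  let ?\<rho> = "block_product n \<mu>"
  note \<rho>b = block_product_prob_borel[OF n \<mu>b]
  define c :: "nat \<Rightarrow> 'w" where "c = undefined"
  define F where "F x = apply_bcontfun \<phi> ((shift ^^ k) (comb_seq n x c))" for x
  define G where "G x = apply_bcontfun \<phi> ((shift ^^ k) x)" for x
  have Gm: "G \<in> borel_measurable borel" unfolding G_def
    by (rule borel_measurable_continuous_onI[OF continuous_bcontfun_shift(1)])
  have Fm: "F \<in> borel_measurable borel"
    using measurable_compose[OF measurable_Pair[OF measurable_ident measurable_const]
        measurable_compose[OF comb_seq_measurable Gm], of c n] by (simp add: F_def[abs_def] G_def)
  have int: "integrable M h" if "M \<in> prob_borel" "h \<in> borel_measurable borel" "\<And>x. \<bar>h x\<bar> \<le> norm \<phi>" for M and h :: "(nat \<Rightarrow> 'w) \<Rightarrow> real"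
  proof -
    interpret M: prob_space M using prob_borelD[OF that(1)] by simp
    show ?thesis using that(3) by (intro M.integrable_const_bound[of _ "norm \<phi>"] measurable_prob_borel[OF that(1,2)]) simp
  qed
  have bd: "\<bar>F x\<bar> \<le> norm \<phi>" "\<bar>G x\<bar> \<le> norm \<phi>" for x by (simp_all add: F_def G_def bcontfun_bound)
  have FG: "\<bar>F x - G x\<bar> \<le> e" for x
    unfolding F_def G_def using k by (intro N) (auto simp: shift_funpow comb_seq_def)
  have close: "\<bar>(\<integral>x. F x \<partial>M) - (\<integral>x. G x \<partial>M)\<bar> \<le> e" if M: "M \<in> prob_borel" for M
  proof -
    interpret M: prob_space M using prob_borelD[OF M] by simp
    have "\<bar>\<integral>x. F x - G x \<partial>M\<bar> \<le> (\<integral>x. e \<partial>M)"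
      using FG int[OF M Fm bd(1)] int[OF M Gm bd(2)]
      by (intro integral_abs_bound[THEN order_trans] integral_mono) auto
    then show ?thesis using int[OF M Fm bd(1)] int[OF M Gm bd(2)] by (simp add: M.prob_space)
  qed
  have "(\<integral>x. F x \<partial>?\<rho>) = (\<integral>x. F x \<partial>\<mu>)"
  proof (rule integral_block_product_first[OF n \<mu>b Fm])
    fix x y assume "\<forall>i<n. x i = (y i :: 'w)"
    then have "comb_seq n x c = comb_seq n y c" by (auto simp: comb_seq_def)
    then show "F x = F y" by (simp add: F_def)
  qed
  moreover have "(\<integral>x. G x \<partial>\<mu>) = ev \<mu> \<phi>"
  proof -
    interpret measure_preserving \<mu> shift by (rule inv_measure_preserving[OF \<mu>])
    show ?thesis unfolding G_def by (rule integral_funpow) (rule measurable_prob_borel[OF \<mu>b bcontfun_measurable])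
  qed
  ultimately show ?thesis using close[OF \<rho>b] close[OF \<mu>b] by (simp add: G_def)
qed

text \<open>At most \<open>N\<close> offsets in a period see beyond the leading block, and each of
  them deviates by at most \<open>2 * norm \<phi>\<close>; their share vanishes as the block length
  grows.\<close>

lemma weakly_block_measure:
  assumes \<mu>: "\<mu> \<in> inv_measures"
  shows "weakly (\<lambda>n. block_measure (Suc n) \<mu>) \<mu>"
  unfolding weakly_def
proof (intro allI LIMSEQ_I)
  fix \<phi> :: "(nat \<Rightarrow> 'w) \<Rightarrow>\<^sub>C real" and e :: real assume e: "e > 0"
  note \<mu>b = inv_prob_borel[OF \<mu>]
  obtain N where N: "\<And>x y. (\<forall>i<N. x i = y i) \<Longrightarrow> \<bar>apply_bcontfun \<phi> x - apply_bcontfun \<phi> y\<bar> \<le> e / 4"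
    using uniform_finite_coordinates[OF compact_seq continuous_bcontfun, of "e/4" \<phi>] e by auto
  \<comment> \<open>From this length on, the offsets near the end of the block contribute less than
    \<open>e / 2\<close> to the average.\<close>
  obtain n0 :: nat where n0: "2 * norm \<phi> * real N / (e / 2) < real n0" using reals_Archimedean2 by blast
  have "norm (ev (block_measure (Suc n) \<mu>) \<phi> - ev \<mu> \<phi>) < e" if nn: "n \<ge> n0" for n
  proof -
    let ?n = "Suc n"
    define I where "I k = (\<integral>x. apply_bcontfun \<phi> ((shift ^^ k) x) \<partial>block_product ?n \<mu>)" for k
    have n: "?n > 0" by simp
    note \<rho>b = block_product_prob_borel[OF n \<mu>b]
    have Ib: "\<bar>I k - ev \<mu> \<phi>\<bar> \<le> e/2 + (if k + N \<le> ?n then 0 else 2 * norm \<phi>)" for k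
    proof (cases "k + N \<le> ?n")
      case True
      then show ?thesis using block_measure_close[OF n \<mu> _ True N] e by (simp add: I_def)
    next
      case False
      have "\<bar>I k\<bar> \<le> norm \<phi>"
      proof -
        interpret \<rho>: prob_space "block_product ?n \<mu>" using prob_borelD[OF \<rho>b] by simp
        have "\<bar>I k\<bar> \<le> (\<integral>x. norm \<phi> \<partial>block_product ?n \<mu>)"
          unfolding I_def using bcontfun_bound[of \<phi>]
            measurable_prob_borel[OF \<rho>b borel_measurable_continuous_onI[OF continuous_bcontfun_shift(1)[of \<phi> k]]]
          by (intro integral_abs_bound[THEN order_trans] integral_mono)
            (auto intro!: \<rho>.integrable_const_bound[of _ "norm \<phi>"])
        then show ?thesis by (simp add: \<rho>.prob_space)
      qed
      then show ?thesis using False ev_bound[OF \<mu>b, of \<phi>] e by simp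
    qed
    have card: "(\<Sum>k<?n. if k + N \<le> ?n then 0 else 2 * norm \<phi>) \<le> 2 * norm \<phi> * real N"
    proof -
      have "(\<Sum>k<?n. if k + N \<le> ?n then 0 else 2 * norm \<phi>) = (\<Sum>k\<in>{k. k < ?n \<and> \<not> k + N \<le> ?n}. 2 * norm \<phi>)"
        by (rule sum.mono_neutral_cong_right) auto
      also have "\<dots> = real (card {k. k < ?n \<and> \<not> k + N \<le> ?n}) * (2 * norm \<phi>)" by simp
      also have "card {k. k < ?n \<and> \<not> k + N \<le> ?n} \<le> card {?n - N..<?n}"
        by (intro card_mono) auto
      then have "real (card {k. k < ?n \<and> \<not> k + N \<le> ?n}) * (2 * norm \<phi>) \<le> real N * (2 * norm \<phi>)"
        by (intro mult_right_mono) auto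
      finally show ?thesis by (simp add: mult_ac)
    qed
    have "ev (block_measure ?n \<mu>) \<phi> = (\<Sum>k<?n. I k) / real ?n"
      unfolding I_def by (rule integral_block_measure[OF n \<mu>b bcontfun_measurable bcontfun_bound])
    then have "ev (block_measure ?n \<mu>) \<phi> - ev \<mu> \<phi> = (\<Sum>k<?n. I k - ev \<mu> \<phi>) / real ?n"
      by (simp add: sum_subtractf field_simps del: of_nat_Suc sum.lessThan_Suc)
    then have "\<bar>ev (block_measure ?n \<mu>) \<phi> - ev \<mu> \<phi>\<bar> \<le> (\<Sum>k<?n. \<bar>I k - ev \<mu> \<phi>\<bar>) / real ?n"
      by (simp only: abs_divide abs_of_nat) (intro divide_right_mono sum_abs of_nat_0_le_iff)
    also have "\<dots> \<le> (\<Sum>k<?n. e/2 + (if k + N \<le> ?n then 0 else 2 * norm \<phi>)) / real ?n"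
      by (intro divide_right_mono sum_mono Ib of_nat_0_le_iff)
    also have "\<dots> \<le> (real ?n * (e/2) + 2 * norm \<phi> * real N) / real ?n"
      using card by (intro divide_right_mono) (simp_all only: sum.distrib sum_constant card_lessThan add_left_mono of_nat_0_le_iff)
    also have "\<dots> = e/2 + 2 * norm \<phi> * real N / real ?n" by (simp add: add_divide_distrib del: of_nat_Suc)
    also have "\<dots> < e"
    proof -
      have "2 * norm \<phi> * real N < real ?n * (e/2)"
      proof -
        have "2 * norm \<phi> * real N < real n0 * (e/2)" using n0 e by (simp add: field_simps)
        also have "\<dots> \<le> real ?n * (e/2)" using nn e by (intro mult_right_mono) auto
        finally show ?thesis .
      qed
      then show ?thesis by (simp add: field_simps del: of_nat_Suc)
    qed
    finally show ?thesis by simp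
  qed
  then show "\<exists>no. \<forall>n\<ge>no. norm (ev (block_measure (Suc n) \<mu>) \<phi> - ev \<mu> \<phi>) < e" by blast
qed

text \<open>Reading off one coordinate at a time: applying the transfer operator to the product of the
  first $j + 1$ conditional densities leaves the product of the first $j$.\<close>

lemma integral_conditional_densities:
  fixes f :: "(nat \<Rightarrow> 'w) \<Rightarrow> real"
  assumes ent: "ereal (- D) \<le> entropy m \<mu>" and \<mu>: "\<mu> \<in> prob_borel"
    and f: "continuous_on UNIV f" "\<And>\<sigma>. f \<sigma> > 0"
  shows "(\<integral>a. (\<Sum>k<j. ln (f ((shift ^^ k) (comb_seq j a b))) - ln (transfer f ((shift ^^ Suc k) (comb_seq j a b)))) \<partial>\<mu>) \<le> real j * D"
proof -
  define l where "l \<sigma> = ln (f \<sigma>) - ln (transfer f (shift \<sigma>))" for \<sigma>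
  have lnf: "continuous_on UNIV (\<lambda>\<sigma>. ln (f \<sigma>))"
    using f less_imp_neq by (intro continuous_intros) fastforce+
  have lnt: "continuous_on UNIV (\<lambda>\<sigma>. ln (transfer f \<sigma>))"
    using transfer_pos[OF f] less_imp_neq by (intro continuous_intros continuous_transfer f) fastforce+
  have lc: "continuous_on UNIV l" unfolding l_def
    by (intro continuous_intros lnf continuous_on_compose2[OF lnt continuous_shift]) simp
  \<comment> \<open>The logarithm of the joint density of the leading \<open>j\<close> coordinates,
    a product of the conditional densities given by \<open>f\<close>, when the fixed sequence
    \<open>b\<close> follows them.\<close>
  define G where "G j a = (\<Sum>k<j. l ((shift ^^ k) (comb_seq j a b)))" for j a
  have cs: "continuous_on UNIV (\<lambda>a. (shift ^^ k) (comb_seq j a b))" for k j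
  proof -
    have "continuous_on UNIV (\<lambda>a. comb_seq j a b)"
    proof (rule continuous_on_coordinatewise_then_product)
      show "continuous_on UNIV (\<lambda>a. comb_seq j a b i)" for i
        by (cases "i < j") (auto simp: comb_seq_def intro: continuous_on_product_coordinates continuous_on_subset)
    qed
    then show ?thesis by (rule continuous_on_compose2[OF continuous_shift_funpow]) simp
  qed
  have Gc: "continuous_on UNIV (G j)" for j unfolding G_def
    by (intro continuous_intros continuous_on_compose2[OF lc cs]) simp
  have int: "integrable \<mu> (G j)" for j
    using integrable_bcontfun[OF prob_borelD(1,2)[OF \<mu>], of "Bcontfun (G j)"] by (simp add: apply_Bcontfun[OF Gc])
  have "(\<integral>a. G j a \<partial>\<mu>) \<le> real j * D" for j
  proof (induction j)
    case 0 then show ?case by (simp add: G_def)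
  next
    case (Suc j)
    have Gcons: "G (Suc j) (case_nat \<omega> a) = l (case_nat \<omega> (comb_seq j a b)) + G j a" for \<omega> a
    proof -
      have e: "comb_seq (Suc j) (case_nat \<omega> a) b = case_nat \<omega> (comb_seq j a b)"
        by (rule case_nat_comb_seq'[symmetric])
      have "G (Suc j) (case_nat \<omega> a) = (\<Sum>k<Suc j. l ((shift ^^ k) (case_nat \<omega> (comb_seq j a b))))"
        by (simp only: G_def e)
      also have "\<dots> = l (case_nat \<omega> (comb_seq j a b)) + (\<Sum>k<j. l ((shift ^^ Suc k) (case_nat \<omega> (comb_seq j a b))))"
        by (subst sum.lessThan_Suc_shift) simp
      also have "(\<Sum>k<j. l ((shift ^^ Suc k) (case_nat \<omega> (comb_seq j a b)))) = G j a"
        by (simp add: G_def funpow_swap1)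
      finally show ?thesis .
    qed
    have tr: "transfer (\<lambda>a. exp (G (Suc j) a)) a = exp (G j a)" for a
    proof -
      define \<tau> where "\<tau> = comb_seq j a b"
      have tp: "transfer f \<tau> > 0" by (rule transfer_pos[OF f])
      have "exp (l (case_nat \<omega> \<tau>)) = f (case_nat \<omega> \<tau>) / transfer f \<tau>" for \<omega>
        using f(2)[of "case_nat \<omega> \<tau>"] tp by (simp add: l_def exp_diff)
      then have "transfer (\<lambda>a. exp (G (Suc j) a)) a = (\<integral>\<omega>. f (case_nat \<omega> \<tau>) / transfer f \<tau> * exp (G j a) \<partial>m)"
        unfolding transfer_def[of _ a] Gcons by (simp add: exp_add \<tau>_def)
      also have "\<dots> = transfer f \<tau> / transfer f \<tau> * exp (G j a)" by (simp add: transfer_def)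
      finally show ?thesis using tp by simp
    qed
    \<comment> \<open>With the joint density as test function, \<open>Jfun\<close> is the difference
      of two consecutive integrals; each coordinate thus costs at most \<open>D\<close>.\<close>
    have "entropy m \<mu> \<le> ereal (- Jfun (\<lambda>a. exp (G (Suc j) a)) \<mu>)"
      by (rule entropy_le_Jfun) (auto intro!: continuous_intros Gc)
    then have "Jfun (\<lambda>a. exp (G (Suc j) a)) \<mu> \<le> D"
      using ent by (meson ereal_less_eq(3) neg_le_iff_le order_trans)
    then have "(\<integral>a. G (Suc j) a \<partial>\<mu>) - (\<integral>a. G j a \<partial>\<mu>) \<le> D"
      using int by (simp add: Jfun_def tr)
    then show ?case using Suc by (simp add: algebra_simps)
  qed
  from this[of j] show ?thesis by (simp add: G_def l_def)
qed

text \<open>The two preceding estimates with \<open>D\<close> equal to minus the entropy of \<mu>,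
  if that is finite; otherwise the inequality is trivial.\<close>

lemma entropy_block_measure_ge:
  assumes \<mu>: "\<mu> \<in> inv_measures" and n: "n > 0"
  shows "entropy m \<mu> \<le> entropy m (block_measure n \<mu>)"
proof (cases "entropy m \<mu>")
  case (real r)
  then have "ereal (- (- r)) \<le> entropy m \<mu>" by simp
  note bound = integral_conditional_densities[OF this inv_prob_borel[OF \<mu>]]
  have "ereal (- (- r)) \<le> entropy m (block_measure n \<mu>)"
    by (rule entropy_block_measure[OF n inv_prob_borel[OF \<mu>]]) (rule bound)
  then show ?thesis using real by simp
next
  case PInf
  then show ?thesis using entropy_nonpos[of \<mu>] by simp
qed simp

text \<open>Blocks of length 1 give the product measure of \<open>m\<close>; of the constant
  sequences under \<kappa> only the leading coordinate is used. By \<open>ln x \<le> x - 1\<close>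
  the mean log-density under \<open>m\<close> is at most 0, so the entropy attains its upper bound
  0. The measure shows that invariant measures exist and bounds suprema of pressures from
  below.\<close>

lemma ergodic_entropy_zero: "\<exists>\<nu>\<in>ergodic_measures. entropy m \<nu> = 0"
proof -
  define \<kappa> where "\<kappa> = distr m borel (\<lambda>\<omega> (_ :: nat). \<omega>)"
  have cm: "(\<lambda>\<omega> (_ :: nat). \<omega>) \<in> measurable m (borel :: (nat \<Rightarrow> 'w) measure)"
    by (rule measurable_coordinatewise_then_product) (rule measurable_ident_sets[OF m_borel])
  have \<kappa>: "\<kappa> \<in> prob_borel" using m.prob_space_distr[OF cm] by (simp add: prob_borel_def \<kappa>_def)
  have one: "(1::nat) > 0" by simp
  have "ereal (- 0) \<le> entropy m (block_measure 1 \<kappa>)"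
  proof (rule entropy_block_measure[OF one \<kappa>])
    fix f :: "(nat \<Rightarrow> 'w) \<Rightarrow> real" and b assume f: "continuous_on UNIV f" "\<And>\<sigma>. f \<sigma> > 0"
    define h where "h \<omega> = ln (f (case_nat \<omega> b)) - ln (transfer f b)" for \<omega>
    have fm: "f \<in> borel_measurable borel" by (rule borel_measurable_continuous_onI[OF f(1)])
    obtain B where B: "\<And>\<sigma>. \<bar>f \<sigma>\<bar> \<le> B" using continuous_bounded[OF f(1)] by blast
    have lnf: "continuous_on UNIV (\<lambda>\<sigma>. ln (f \<sigma>))"
      using f less_imp_neq by (intro continuous_intros) fastforce+
    obtain C where C: "\<And>\<sigma>. \<bar>ln (f \<sigma>)\<bar> \<le> C" using continuous_bounded[OF lnf] by blast
    have tp: "transfer f b > 0" by (rule transfer_pos[OF f])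
    note i1 = integrable_section[OF fm B, of b]
    note i2 = integrable_section[OF borel_measurable_continuous_onI[OF lnf] C, of b]
    let ?H = "\<lambda>a. \<Sum>k<1. ln (f ((shift ^^ k) (comb_seq 1 a b))) - ln (transfer f ((shift ^^ Suc k) (comb_seq 1 a b)))"
    have H: "?H a = h (a 0)" for a
      by (simp add: h_def)
    have "(\<integral>a. ?H a \<partial>\<kappa>) = (\<integral>\<omega>. h \<omega> \<partial>m)"
    proof -
      have "(\<lambda>a :: nat \<Rightarrow> 'w. h (a 0)) \<in> borel_measurable borel"
      proof -
        have "(\<lambda>a. ln (f (case_nat (a 0) b))) \<in> borel_measurable borel"
          using measurable_compose[OF measurable_Pair[OF measurable_product_coordinates[of 0] measurable_const]
            measurable_compose[OF case_nat_measurable borel_measurable_continuous_onI[OF lnf]], of b] by simp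
        then show ?thesis unfolding h_def by measurable
      qed
      then show ?thesis unfolding H \<kappa>_def by (subst integral_distr[OF cm]) simp_all
    qed
    also have "\<dots> \<le> (\<integral>\<omega>. f (case_nat \<omega> b) / transfer f b - 1 \<partial>m)"
    proof (rule integral_mono)
      show "integrable m h" unfolding h_def using i2 by simp
      show "integrable m (\<lambda>\<omega>. f (case_nat \<omega> b) / transfer f b - 1)" using i1 by simp
      show "h \<omega> \<le> f (case_nat \<omega> b) / transfer f b - 1" for \<omega>
        using ln_diff_le[OF f(2)[of "case_nat \<omega> b"] tp] tp by (simp add: h_def diff_divide_distrib)
    qed
    also have "\<dots> = transfer f b / transfer f b - 1" using i1 by (simp add: transfer_def m.prob_space)
    finally show "(\<integral>a. ?H a \<partial>\<kappa>) \<le> real 1 * 0" using tp by simp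
  qed
  then have "entropy m (block_measure 1 \<kappa>) = 0"
    using entropy_nonpos[of "block_measure 1 \<kappa>"] by (simp add: zero_ereal_def antisym)
  then show ?thesis using block_measure_ergodic[OF one \<kappa>] by blast
qed

theorem ergodic_approximation:
  assumes \<mu>: "\<mu> \<in> inv_measures"
  obtains M where "\<And>n. M n \<in> ergodic_measures" "weakly M \<mu>" "\<And>n. entropy m \<mu> \<le> entropy m (M n)"
  by (rule that[of "\<lambda>n. block_measure (Suc n) \<mu>"])
    (auto intro: block_measure_ergodic inv_prob_borel[OF \<mu>] weakly_block_measure[OF \<mu>] entropy_block_measure_ge[OF \<mu>])

end

section \<open>Maximizers of the pressure\<close>

context compact_alphabet
begin

lemma inv_nonempty: "\<exists>\<nu> :: (nat \<Rightarrow> 'w) measure. \<nu> \<in> inv_measures \<and> entropy m \<nu> = 0"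
  using ergodic_entropy_zero ergodic_sub_inv by blast

text \<open>Only an asymptotic upper bound on \<open>d\<close> is assumed, since \<open>d\<close>
  will also be a mean over components, which is upper semicontinuous at best. The slack below
  \<open>c\<close> is divided between the entropy and \<open>d\<close>.\<close>

lemma entropy_add_usc:
  assumes w: "weakly M \<mu>" and d: "\<And>e. e > 0 \<Longrightarrow> eventually (\<lambda>n. d n < d0 + e) sequentially"
    and c: "entropy m \<mu> + ereal d0 < ereal c"
  shows "eventually (\<lambda>n. entropy m (M n) + ereal (d n) < ereal c) sequentially"
proof -
  obtain e where e: "e > 0" "entropy m \<mu> < ereal (c - d0 - e)"
  proof (cases "entropy m \<mu>")
    case (real r)
    then have "r + d0 < c" using c by simp
    then show ?thesis using real by (intro that[of "(c - d0 - r) / 2"]) (auto simp: field_simps)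
  next
    case PInf then show ?thesis using entropy_nonpos[of \<mu>] by simp
  next
    case MInf then show ?thesis by (intro that[of 1]) auto
  qed
  from entropy_usc[OF w e(2)] d[OF e(1)] show ?thesis
  proof eventually_elim
    case (elim n)
    then show ?case by (cases "entropy m (M n)") auto
  qed
qed

lemma entropy_add_limit_le:
  assumes w: "weakly M \<mu>" and d: "\<And>e. e > 0 \<Longrightarrow> eventually (\<lambda>n. d n < d0 + e) sequentially"
    and lim: "(\<lambda>n. entropy m (M n) + ereal (d n)) \<longlonglongrightarrow> ereal p"
  shows "ereal p \<le> entropy m \<mu> + ereal d0"
proof (rule ccontr)
  assume "\<not> ?thesis"
  then obtain c where c: "entropy m \<mu> + ereal d0 < ereal c" "ereal c < ereal p"
    using ereal_dense2[of "entropy m \<mu> + ereal d0" "ereal p"] by (auto simp: not_le)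
  have "eventually (\<lambda>n. ereal c < entropy m (M n) + ereal (d n)) sequentially"
    by (rule order_tendstoD(1)[OF lim c(2)])
  moreover have "eventually (\<lambda>n. entropy m (M n) + ereal (d n) < ereal c) sequentially"
    by (rule entropy_add_usc[where ?d0.0=d0, OF w _ c(1)]) (rule d)
  ultimately have "eventually (\<lambda>n. False) sequentially" by eventually_elim auto
  then show False by simp
qed

lemma tendsto_upper:
  fixes d :: "nat \<Rightarrow> real"
  assumes "d \<longlonglongrightarrow> d0" "e > 0"
  shows "eventually (\<lambda>n. d n < d0 + e) sequentially"
  using assms by (intro order_tendstoD(2)[OF assms(1)]) simp

text \<open>Sequences suffice here, because the weak* topology on invariant measures is
  metrizable.\<close>

definition weak_continuous :: "((nat \<Rightarrow> 'w) measure \<Rightarrow> real) \<Rightarrow> bool"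
  where "weak_continuous f \<longleftrightarrow> (\<forall>M \<mu>. range M \<subseteq> inv_measures \<longrightarrow> \<mu> \<in> inv_measures \<longrightarrow> weakly M \<mu> \<longrightarrow>
    (\<lambda>n. f (M n)) \<longlonglongrightarrow> f \<mu>)"

lemma weak_continuousD:
  "weak_continuous f \<Longrightarrow> (\<And>n. M n \<in> inv_measures) \<Longrightarrow> \<mu> \<in> inv_measures \<Longrightarrow> weakly M \<mu> \<Longrightarrow> (\<lambda>n. f (M n)) \<longlonglongrightarrow> f \<mu>"
  unfolding weak_continuous_def by blast

lemma weak_continuous_measurable: "weak_continuous f \<Longrightarrow> f \<in> borel_measurable BP"
  by (rule measurable_BP_seq_continuous) (auto simp: weak_continuous_def)

lemma weak_continuous_bounded:
  assumes "weak_continuous f"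
  obtains B where "\<And>\<mu>. \<mu> \<in> inv_measures \<Longrightarrow> \<bar>f \<mu>\<bar> \<le> B"
  using bounded_seq_continuous[of f] assms unfolding weak_continuous_def by metis

lemma integrable_component:
  assumes f: "weak_continuous f" and \<mu>: "\<mu> \<in> inv_measures"
  shows "integrable \<mu> (\<lambda>\<sigma>. f (component \<sigma>))"
proof -
  interpret prob_space \<mu> using prob_borelD[OF inv_prob_borel[OF \<mu>]] by simp
  obtain B where B: "\<And>\<mu>. \<mu> \<in> inv_measures \<Longrightarrow> \<bar>f \<mu>\<bar> \<le> B" using weak_continuous_bounded[OF f] by blast
  show ?thesis
    using B[OF component_inv[OF \<mu>]] measurable_compose[OF component_measurable'[OF \<mu>] weak_continuous_measurable[OF f]]
    by (intro integrable_const_bound[of _ B]) auto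
qed

text \<open>The analogue of \<open>Delta\<close> for arbitrary weak* continuous functionals. It is
  needed for the difference of the two convex functionals of the game, which in general is not
  convex itself.\<close>

definition mean :: "((nat \<Rightarrow> 'w) measure \<Rightarrow> real) \<Rightarrow> (nat \<Rightarrow> 'w) measure \<Rightarrow> real"
  where "mean f \<mu> = (\<integral>\<sigma>. f (component \<sigma>) \<partial>\<mu>)"

lemma mean_ergodic:
  assumes f: "weak_continuous f" and \<mu>: "\<mu> \<in> ergodic_measures"
  shows "mean f \<mu> = f \<mu>"
proof -
  have i: "\<mu> \<in> inv_measures" using \<mu> ergodic_sub_inv by auto
  interpret prob_space \<mu> using prob_borelD[OF inv_prob_borel[OF i]] by simp
  have "AE \<sigma> in \<mu>. component \<sigma> = \<mu>" using ergodic_iff_component[OF i] \<mu> by simp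
  then have "mean f \<mu> = (\<integral>\<sigma>. f \<mu> \<partial>\<mu>)"
    unfolding mean_def using integrable_component[OF f i] by (intro integral_cong_AE) auto
  then show ?thesis by (simp add: prob_space)
qed

lemma mean_mix:
  assumes f: "weak_continuous f" and \<mu>: "\<mu> \<in> inv_measures" and \<nu>: "\<nu> \<in> inv_measures" and t: "0 \<le> t" "t \<le> 1"
  shows "mean f (mix t \<mu> \<nu>) = (1 - t) * mean f \<mu> + t * mean f \<nu>"
proof -
  obtain B where B: "\<And>\<mu>. \<mu> \<in> inv_measures \<Longrightarrow> \<bar>f \<mu>\<bar> \<le> B" using weak_continuous_bounded[OF f] by blast
  have "component \<in> measurable borel BP" using component_measurable \<mu> by auto
  from measurable_compose[OF this weak_continuous_measurable[OF f]] show ?thesis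
    unfolding mean_def
    by (rule integral_mix[OF inv_prob_borel[OF \<mu>] inv_prob_borel[OF \<nu>] _ B[OF component_inv[OF \<mu>]] t])
qed

text \<open>By hypothesis the entropy of each component is at most \<open>s - f\<close>, and the
  entropy of \<mu> is at most the mean of these bounds.\<close>

lemma entropy_add_mean_le:
  assumes f: "weak_continuous f" and s: "\<And>\<nu>. \<nu> \<in> inv_measures \<Longrightarrow> entropy m \<nu> + ereal (f \<nu>) \<le> ereal s"
    and \<mu>: "\<mu> \<in> inv_measures"
  shows "entropy m \<mu> + ereal (mean f \<mu>) \<le> ereal s"
proof -
  obtain B where B: "\<And>\<mu>. \<mu> \<in> inv_measures \<Longrightarrow> \<bar>f \<mu>\<bar> \<le> B" using weak_continuous_bounded[OF f] by blast
  have "entropy m \<mu> \<le> ereal (- (\<integral>\<sigma>. f (component \<sigma>) - s \<partial>\<mu>))"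
  proof (rule entropy_le_integral_component[OF \<mu>])
    show "(\<lambda>\<nu>. f \<nu> - s) \<in> borel_measurable BP" using weak_continuous_measurable[OF f] by measurable
    show "\<bar>f \<nu> - s\<bar> \<le> B + \<bar>s\<bar>" if "\<nu> \<in> inv_measures" for \<nu> using B[OF that] by linarith
    show "entropy m \<nu> \<le> ereal (- (f \<nu> - s))" if "\<nu> \<in> inv_measures" for \<nu>
      using s[OF that] by (cases "entropy m \<nu>") auto
  qed
  also have "(\<integral>\<sigma>. f (component \<sigma>) - s \<partial>\<mu>) = mean f \<mu> - s"
  proof -
    interpret prob_space \<mu> using prob_borelD[OF inv_prob_borel[OF \<mu>]] by simp
    show ?thesis unfolding mean_def using integrable_component[OF f \<mu>] by (simp add: prob_space)
  qed
  finally show ?thesis by (cases "entropy m \<mu>") auto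
qed

lemma entropy_add_sup_finite:
  assumes f: "\<And>\<nu>. \<nu> \<in> inv_measures \<Longrightarrow> \<bar>f \<nu>\<bar> \<le> B"
  obtains p where "(SUP \<nu>\<in>inv_measures. entropy m \<nu> + ereal (f \<nu>)) = ereal p"
proof -
  obtain \<nu>0 :: "(nat \<Rightarrow> 'w) measure" where \<nu>0: "\<nu>0 \<in> inv_measures" "entropy m \<nu>0 = 0" using inv_nonempty by auto
  let ?S = "SUP \<nu>\<in>inv_measures. entropy m \<nu> + ereal (f \<nu>)"
  have "?S \<le> ereal B"
  proof (rule SUP_least)
    fix \<nu> :: "(nat \<Rightarrow> 'w) measure" assume "\<nu> \<in> inv_measures"
    then show "entropy m \<nu> + ereal (f \<nu>) \<le> ereal B"
      using f[of \<nu>] entropy_nonpos[of \<nu>] by (cases "entropy m \<nu>") auto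
  qed
  moreover have "ereal (f \<nu>0) \<le> ?S" by (rule SUP_upper2[OF \<nu>0(1)]) (simp add: \<nu>0(2))
  ultimately show ?thesis using that by (cases ?S) auto
qed

text \<open>On ergodic approximants \<open>mean f\<close> and \<open>f\<close> agree, and the error
  \<open>e n\<close> is the difference between the values of \<open>f\<close> at the limit and at
  the approximant.\<close>

lemma approximation_ge:
  assumes f: "weak_continuous f" and \<mu>: "\<mu> \<in> inv_measures" and p: "ereal p \<le> entropy m \<mu> + ereal (f \<mu>)"
  obtains M e where "\<And>n. M n \<in> inv_measures" "weakly M \<mu>" "e \<longlonglongrightarrow> (0::real)"
    "\<And>n. ereal (p - e n) \<le> entropy m (M n) + ereal (mean f (M n))"
proof -
  obtain M where M: "\<And>n. M n \<in> ergodic_measures" "weakly M \<mu>" "\<And>n. entropy m \<mu> \<le> entropy m (M n)"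
    using ergodic_approximation[OF \<mu>] by blast
  have Mi: "M n \<in> inv_measures" for n using M(1) ergodic_sub_inv by auto
  show ?thesis
  proof (rule that[of M "\<lambda>n. f \<mu> - f (M n)"])
    have "(\<lambda>n. f \<mu> - f (M n)) \<longlonglongrightarrow> f \<mu> - f \<mu>"
      by (intro tendsto_intros weak_continuousD[OF f Mi \<mu> M(2)])
    then show "(\<lambda>n. f \<mu> - f (M n)) \<longlonglongrightarrow> 0" by simp
    show "ereal (p - (f \<mu> - f (M n))) \<le> entropy m (M n) + ereal (mean f (M n))" for n
      using p M(3)[of n] entropy_nonpos[of \<mu>] entropy_nonpos[of "M n"]
      unfolding mean_ergodic[OF f M(1)]
      by (cases "entropy m \<mu>"; cases "entropy m (M n)") auto
  qed (use Mi M(2) in auto)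
qed

lemma sup_entropy_add_mean:
  assumes f: "weak_continuous f"
  shows "(SUP \<nu>\<in>inv_measures. entropy m \<nu> + ereal (mean f \<nu>)) = (SUP \<nu>\<in>inv_measures. entropy m \<nu> + ereal (f \<nu>))"
proof -
  obtain B where B: "\<And>\<mu>. \<mu> \<in> inv_measures \<Longrightarrow> \<bar>f \<mu>\<bar> \<le> B" using weak_continuous_bounded[OF f] by blast
  obtain p where p: "(SUP \<nu>\<in>inv_measures. entropy m \<nu> + ereal (f \<nu>)) = ereal p"
    using entropy_add_sup_finite[of f B] B by metis
  have up: "entropy m \<nu> + ereal (f \<nu>) \<le> ereal p" if "\<nu> \<in> inv_measures" for \<nu>
    unfolding p[symmetric] by (rule SUP_upper[OF that])
  show ?thesis
  proof (rule antisym)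
    show "(SUP \<nu>\<in>inv_measures. entropy m \<nu> + ereal (mean f \<nu>)) \<le> (SUP \<nu>\<in>inv_measures. entropy m \<nu> + ereal (f \<nu>))"
      unfolding p by (intro SUP_least entropy_add_mean_le[OF f up])
    show "(SUP \<nu>\<in>inv_measures. entropy m \<nu> + ereal (f \<nu>)) \<le> (SUP \<nu>\<in>inv_measures. entropy m \<nu> + ereal (mean f \<nu>))" (is "_ \<le> ?S")
    proof (rule SUP_least)
      fix \<mu> :: "(nat \<Rightarrow> 'w) measure" assume \<mu>: "\<mu> \<in> inv_measures"
      show "entropy m \<mu> + ereal (f \<mu>) \<le> ?S"
      proof (cases "entropy m \<mu>")
        case (real r)
        then have "ereal (r + f \<mu>) \<le> entropy m \<mu> + ereal (f \<mu>)" by simp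
        then obtain M e where M: "\<And>n. M n \<in> inv_measures" "e \<longlonglongrightarrow> (0::real)"
          "\<And>n. ereal (r + f \<mu> - e n) \<le> entropy m (M n) + ereal (mean f (M n))"
          using approximation_ge[OF f \<mu>] by metis
        have "(\<lambda>n. ereal (r + f \<mu> - e n)) \<longlonglongrightarrow> ereal (r + f \<mu> - 0)" by (intro tendsto_intros M(2))
        then have "ereal (r + f \<mu> - 0) \<le> ?S"
        proof (rule LIMSEQ_le_const2)
          have "ereal (r + f \<mu> - e n) \<le> ?S" for n
            by (rule order_trans[OF M(3)], rule SUP_upper2[OF M(1)], rule order_refl)
          then show "\<exists>N. \<forall>n\<ge>N. ereal (r + f \<mu> - e n) \<le> ?S" by blast
        qed
        then show ?thesis using real by simp
      next
        case PInf then show ?thesis using entropy_nonpos[of \<mu>] by simp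
      qed simp
    qed
  qed
qed

section \<open>Maximizers and their closed convex hulls\<close>

lemma compact_code_image:
  assumes A: "A \<subseteq> inv_measures" and cl: "seq_closed A"
  shows "compact (code ` A)"
  unfolding compact_def
proof (intro allI impI)
  fix x :: "nat \<Rightarrow> nat \<Rightarrow> real" assume x: "\<forall>n. x n \<in> code ` A"
  then obtain M where M: "\<And>n. M n \<in> A" "\<And>n. x n = code (M n)" unfolding image_iff by metis
  then obtain r N where r: "strict_mono (r :: nat \<Rightarrow> nat)" "N \<in> inv_measures" "weakly (\<lambda>n. M (r n)) N"
    using inv_seq_compact[of M] A by (metis subsetD)
  have "N \<in> A"
    by (rule cl[rule_format, of "\<lambda>n. M (r n)" N]) (use r M(1) in auto)
  moreover have "(\<lambda>n. code (M (r n))) \<longlonglongrightarrow> code N"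
    using r M(1) A inv_prob_borel by (subst weakly_iff_code[symmetric]) auto
  ultimately show "\<exists>l\<in>code ` A. \<exists>r. strict_mono r \<and> (x \<circ> r) \<longlonglongrightarrow> l"
    using r(1) M(2) by (intro bexI[of _ "code N"] exI[of _ r]) (auto simp: comp_def)
qed

lemma open_code_box: "open {x :: nat \<Rightarrow> real. \<forall>j<N. \<bar>x j - c j\<bar> < e}"
proof -
  have "{x :: nat \<Rightarrow> real. \<forall>j<N. \<bar>x j - c j\<bar> < e} = (\<Inter>j\<in>{..<N}. {x. \<bar>x j - c j\<bar> < e})" by auto
  also have "open \<dots>"
    by (intro open_INT finite_lessThan ballI open_Collect_less continuous_intros continuous_on_product_coordinates)
  finally show ?thesis .
qed

lemma functional_eq_ev: "\<mu> \<in> inv_measures \<Longrightarrow> blinfun_apply (measure_functional \<mu>) \<phi> = ev \<mu> \<phi>"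
  using prob_borelD[OF inv_prob_borel] by (intro apply_measure_functional) blast+

lemma weakly_code_approx:
  fixes M :: "nat \<Rightarrow> (nat \<Rightarrow> 'w) measure"
  assumes M: "\<And>n. M n \<in> inv_measures" "\<mu> \<in> inv_measures"
    "\<And>n j. j < n \<Longrightarrow> \<bar>code (M n) j - code \<mu> j\<bar> < 1 / real (Suc n)"
  shows "weakly M \<mu>"
proof -
  have "(\<lambda>n. code (M n)) \<longlonglongrightarrow> code \<mu>"
    unfolding tendsto_fun_iff
  proof
    fix j
    have "(\<lambda>n. code (M n) j - code \<mu> j) \<longlonglongrightarrow> 0"
    proof (rule Lim_null_comparison)
      show "eventually (\<lambda>n. norm (code (M n) j - code \<mu> j) \<le> 1 / real (Suc n)) sequentially"
        using eventually_gt_at_top[of j] by eventually_elim (use M(3) in \<open>force intro: less_imp_le\<close>)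
      show "(\<lambda>n. 1 / real (Suc n)) \<longlonglongrightarrow> 0" by (rule LIMSEQ_Suc[OF lim_const_over_n])
    qed
    then show "(\<lambda>n. code (M n) j) \<longlonglongrightarrow> code \<mu> j" by (simp add: LIM_zero_iff)
  qed
  then show ?thesis using M(1,2) inv_prob_borel by (subst weakly_iff_code) auto
qed

text \<open>The image of \<open>A\<close> in the dual is convex by \<open>mix\<close>. A measure in
  its weak* closure is approximated by elements of \<open>A\<close> on any finite part of
  \<open>dense_seq\<close>, which yields a sequence in \<open>A\<close> converging weakly to
  it.\<close>

lemma closed_hull_subset:
  assumes A: "A \<subseteq> inv_measures" and cl: "seq_closed A" and E: "E \<subseteq> A"
    and mix: "\<And>\<mu> \<nu> t. \<mu> \<in> A \<Longrightarrow> \<nu> \<in> A \<Longrightarrow> 0 \<le> t \<Longrightarrow> t \<le> 1 \<Longrightarrow> mix t \<mu> \<nu> \<in> A"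
  shows "closed_hull E \<subseteq> A"
proof
  fix \<mu> assume "\<mu> \<in> closed_hull E"
  then have \<mu>: "\<mu> \<in> inv_measures" and clos: "measure_functional \<mu> \<in> weak_star closure_of (convex hull (measure_functional ` E))"
    by (auto simp: closed_hull_def)
  have "convex hull (measure_functional ` E) \<subseteq> measure_functional ` A"
  proof (rule hull_minimal)
    show "convex (measure_functional ` A)"
      unfolding convex_alt
    proof (intro ballI allI impI, elim conjE)
      fix x y and u :: real assume xy: "x \<in> measure_functional ` A" "y \<in> measure_functional ` A" and u: "0 \<le> u" "u \<le> 1"
      then obtain \<mu> \<nu> where mn: "\<mu> \<in> A" "\<nu> \<in> A" "x = measure_functional \<mu>" "y = measure_functional \<nu>" by auto
      note M = mix[OF mn(1,2) u]
      have "(1 - u) *\<^sub>R x + u *\<^sub>R y = measure_functional (mix u \<mu> \<nu>)"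
        by (rule blinfun_eqI)
          (use mn A M u in \<open>simp add: functional_eq_ev subset_iff ev_mix inv_prob_borel blinfun.add_left blinfun.scaleR_left\<close>)
      then show "(1 - u) *\<^sub>R x + u *\<^sub>R y \<in> measure_functional ` A" using M by simp
    qed
  qed (use E in auto)
  then have clos: "measure_functional \<mu> \<in> weak_star closure_of (measure_functional ` A)"
    using closure_of_mono clos by blast
  have "\<exists>\<nu>\<in>A. \<forall>j<n. \<bar>code \<nu> j - code \<mu> j\<bar> < 1 / real (Suc n)" for n
  proof -
    define V where "V = {x :: nat \<Rightarrow> real. \<forall>j<n. \<bar>x j - code \<mu> j\<bar> < 1 / real (Suc n)}"
    have "open V" unfolding V_def by (rule open_code_box)
    define W where "W = {L. (\<lambda>j. blinfun_apply L (dense_seq j)) \<in> V}"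
    have "continuous_map weak_star euclidean (\<lambda>L j. blinfun_apply L (dense_seq j))"
      unfolding euclidean_product_topology[symmetric] continuous_map_componentwise_UNIV
      by (auto intro: strong_operator_topology_continuous_evaluation)
    then have "openin weak_star W"
      using openin_continuous_map_preimage[of weak_star euclidean _ V] \<open>open V\<close>
      by (simp add: W_def strong_operator_topology_topspace)
    moreover have "measure_functional \<mu> \<in> W" by (simp add: W_def V_def functional_eq_ev[OF \<mu>] code_def)
    ultimately obtain \<nu> where \<nu>: "\<nu> \<in> A" "measure_functional \<nu> \<in> W"
      using clos unfolding in_closure_of by blast
    then show ?thesis using A by (auto simp: W_def V_def functional_eq_ev code_def subset_iff)
  qed
  then obtain M where M: "\<And>n. M n \<in> A" "\<And>n j. j < n \<Longrightarrow> \<bar>code (M n) j - code \<mu> j\<bar> < 1 / real (Suc n)" by metis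
  have "weakly M \<mu>" by (rule weakly_code_approx[OF _ \<mu> M(2)]) (use M(1) A in auto)
  then show "\<mu> \<in> A" using cl M(1) \<mu> by blast
qed

lemma argmax_seq_closed:
  assumes f: "weak_continuous f"
    and s: "\<And>\<nu>. \<nu> \<in> inv_measures \<Longrightarrow> entropy m \<nu> + ereal (f \<nu>) \<le> ereal s"
  shows "seq_closed {\<nu> \<in> inv_measures. entropy m \<nu> + ereal (f \<nu>) = ereal s}"
proof (intro allI impI)
  fix M \<mu> assume M: "range M \<subseteq> {\<nu> \<in> inv_measures. entropy m \<nu> + ereal (f \<nu>) = ereal s}" "weakly M \<mu>" "\<mu> \<in> inv_measures"
  then have Mi: "\<And>n. M n \<in> inv_measures" and eq: "\<And>n. entropy m (M n) + ereal (f (M n)) = ereal s" by auto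
  have "ereal s \<le> entropy m \<mu> + ereal (f \<mu>)"
    by (rule entropy_add_limit_le[OF M(2) tendsto_upper[OF weak_continuousD[OF f Mi M(3,2)]]]) (simp_all add: eq)
  then show "\<mu> \<in> {\<nu> \<in> inv_measures. entropy m \<nu> + ereal (f \<nu>) = ereal s}"
    using s[OF M(3)] M(3) by auto
qed

text \<open>Almost maximality of the mean forces almost all ergodic components to be close to maximizers.\<close>

lemma component_close_to_argmax:
  assumes f: "weak_continuous f"
    and s: "\<And>\<nu>. \<nu> \<in> inv_measures \<Longrightarrow> entropy m \<nu> + ereal (f \<nu>) \<le> ereal s"
    and M: "\<And>n. M n \<in> inv_measures" and lim: "(\<lambda>n. entropy m (M n) + ereal (mean f (M n))) \<longlonglongrightarrow> ereal s"
    and V: "open V" "\<And>\<nu>. \<nu> \<in> inv_measures \<Longrightarrow> entropy m \<nu> + ereal (f \<nu>) = ereal s \<Longrightarrow> code \<nu> \<in> V"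
  shows "(\<lambda>n. measure (M n) {\<sigma>. code (component \<sigma>) \<notin> V}) \<longlonglongrightarrow> 0"
proof -
  \<comment> \<open>By compactness and upper semicontinuity there is a gap: measures with code
    outside the open set \<open>V\<close> stay below the maximum by a fixed amount \<delta>.\<close>
  have "\<exists>\<delta>>0. \<forall>\<nu>\<in>inv_measures. code \<nu> \<notin> V \<longrightarrow> entropy m \<nu> + ereal (f \<nu>) \<le> ereal (s - \<delta>)"
  proof (rule ccontr)
    assume "\<not> ?thesis"
    then have "\<forall>n. \<exists>\<nu>\<in>inv_measures. code \<nu> \<notin> V \<and> ereal (s - 1 / real (Suc n)) < entropy m \<nu> + ereal (f \<nu>)"
      by (metis not_le zero_less_divide_1_iff of_nat_0_less_iff zero_less_Suc)
    then obtain N where N: "\<And>n. N n \<in> inv_measures" "\<And>n. code (N n) \<notin> V"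
      "\<And>n. ereal (s - 1 / real (Suc n)) < entropy m (N n) + ereal (f (N n))" by metis
    obtain r \<nu> where r: "strict_mono (r :: nat \<Rightarrow> nat)" "\<nu> \<in> inv_measures" "weakly (\<lambda>n. N (r n)) \<nu>"
      using inv_seq_compact[of N] N(1) by metis
    have lim': "(\<lambda>n. entropy m (N (r n)) + ereal (f (N (r n)))) \<longlonglongrightarrow> ereal s"
    proof (rule tendsto_sandwich)
      have "(\<lambda>n. s - 1 / real (Suc n)) \<longlonglongrightarrow> s - 0"
        by (intro tendsto_intros LIMSEQ_Suc[OF lim_const_over_n])
      from LIMSEQ_subseq_LIMSEQ[OF this r(1)]
      show "(\<lambda>n. ereal (s - 1 / real (Suc (r n)))) \<longlonglongrightarrow> ereal s" by (simp add: comp_def lim_ereal)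
      show "eventually (\<lambda>n. ereal (s - 1 / real (Suc (r n))) \<le> entropy m (N (r n)) + ereal (f (N (r n)))) sequentially"
        using N(3) less_imp_le by (intro always_eventually) blast
      show "eventually (\<lambda>n. entropy m (N (r n)) + ereal (f (N (r n))) \<le> ereal s) sequentially"
        using s[OF N(1)] by simp
    qed simp
    have "(\<lambda>n. f (N (r n))) \<longlonglongrightarrow> f \<nu>" by (rule weak_continuousD[OF f _ r(2,3)]) (rule N(1))
    then have "ereal s \<le> entropy m \<nu> + ereal (f \<nu>)"
      by (intro entropy_add_limit_le[OF r(3) _ lim'] tendsto_upper)
    then have "code \<nu> \<in> V" using V(2)[OF r(2)] s[OF r(2)] by (simp add: antisym)
    moreover have "(\<lambda>n. code (N (r n))) \<longlonglongrightarrow> code \<nu>"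
      using r N(1) inv_prob_borel by (subst weakly_iff_code[symmetric]) auto
    ultimately have "eventually (\<lambda>n. code (N (r n)) \<in> V) sequentially" using V(1) topological_tendstoD by blast
    then show False using N(2) by simp
  qed
  then obtain \<delta> where \<delta>: "\<delta> > 0" "\<And>\<nu>. \<nu> \<in> inv_measures \<Longrightarrow> code \<nu> \<notin> V \<Longrightarrow> entropy m \<nu> + ereal (f \<nu>) \<le> ereal (s - \<delta>)" by blast
  obtain B where B: "\<And>\<mu>. \<mu> \<in> inv_measures \<Longrightarrow> \<bar>f \<mu>\<bar> \<le> B" using weak_continuous_bounded[OF f] by blast
  define q where "q n = measure (M n) {\<sigma>. code (component \<sigma>) \<notin> V}" for n
  \<comment> \<open>The entropy is at most \<open>s - f\<close>, and at most
    \<open>s - f - \<delta>\<close> outside \<open>V\<close>. Integrated over components, a fraction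
    \<open>q n\<close> of components outside \<open>V\<close> costs
    \<open>\<delta> * q n\<close>.\<close>
  have key: "entropy m (M n) + ereal (mean f (M n)) \<le> ereal (s - \<delta> * q n)" for n
  proof -
    note Mb = prob_borelD[OF inv_prob_borel[OF M[of n]]]
    interpret prob_space "M n" by (rule Mb)
    have bm: "(\<lambda>\<nu>. indicator (- V) (code \<nu>) :: real) \<in> borel_measurable BP"
      using V(1) by (intro measurable_compose[OF code_measurable]) auto
    have cm: "(\<lambda>\<sigma>. indicator (- V) (code (component \<sigma>)) :: real) \<in> borel_measurable (M n)"
      by (rule measurable_compose[OF component_measurable'[OF M] bm])
    have qi: "q n = (\<integral>\<sigma>. indicator (- V) (code (component \<sigma>)) \<partial>M n)"
    proof -
      have "{\<sigma>. code (component \<sigma>) \<notin> V} = (\<lambda>\<sigma>. code (component \<sigma>)) -` (- V) \<inter> space (M n)" using Mb(3) by auto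
      moreover have "\<dots> \<in> sets (M n)"
        using V(1) by (intro measurable_sets[OF measurable_compose[OF component_measurable'[OF M] code_measurable]]) auto
      ultimately have "{\<sigma>. code (component \<sigma>) \<notin> V} \<in> sets (M n)" by simp
      moreover have "indicator (- V) (code (component \<sigma>)) = (indicator {\<sigma>. code (component \<sigma>) \<notin> V} \<sigma> :: real)" for \<sigma>
        by (simp add: indicator_def)
      ultimately show ?thesis by (simp add: q_def)
    qed
    have ii: "integrable (M n) (\<lambda>\<sigma>. indicator (- V) (code (component \<sigma>)) :: real)"
      using cm by (intro integrable_const_bound[of _ 1]) (auto simp: indicator_def)
    have "Defs.entropy m (M n) \<le> ereal (- (\<integral>\<sigma>. f (component \<sigma>) - s + \<delta> * indicator (- V) (code (component \<sigma>)) \<partial>M n))"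
    proof (rule entropy_le_integral_component[OF M])
      show "(\<lambda>\<nu>. f \<nu> - s + \<delta> * indicator (- V) (code \<nu>)) \<in> borel_measurable BP"
        using weak_continuous_measurable[OF f] bm by measurable
      show "\<bar>f \<nu> - s + \<delta> * indicator (- V) (code \<nu>)\<bar> \<le> B + \<bar>s\<bar> + \<delta>" if "\<nu> \<in> inv_measures" for \<nu>
        using B[OF that] \<delta>(1) by (auto simp: indicator_def)
      show "Defs.entropy m \<nu> \<le> ereal (- (f \<nu> - s + \<delta> * indicator (- V) (code \<nu>)))" if "\<nu> \<in> inv_measures" for \<nu>
        using s[OF that] \<delta>(2)[OF that] by (cases "Defs.entropy m \<nu>") (auto simp: indicator_def)
    qed
    also have "(\<integral>\<sigma>. f (component \<sigma>) - s + \<delta> * indicator (- V) (code (component \<sigma>)) \<partial>M n) = mean f (M n) - s + \<delta> * q n"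
      unfolding mean_def qi using integrable_component[OF f M] ii by (simp add: prob_space)
    finally show ?thesis by (cases "Defs.entropy m (M n)") auto
  qed
  have "q \<longlonglongrightarrow> 0"
  proof (rule LIMSEQ_I)
    fix e :: real assume e: "e > 0"
    have "eventually (\<lambda>n. ereal (s - \<delta> * e) < entropy m (M n) + ereal (mean f (M n))) sequentially"
      by (rule order_tendstoD(1)[OF lim]) (use e \<delta>(1) in simp)
    then have "eventually (\<lambda>n. norm (q n - 0) < e) sequentially"
    proof eventually_elim
      case (elim n)
      then have "ereal (s - \<delta> * e) < ereal (s - \<delta> * q n)" using key[of n] by (rule less_le_trans)
      then have "q n < e" using \<delta>(1) by simp
      then show ?case by (simp add: q_def)
    qed
    then show "\<exists>no. \<forall>n\<ge>no. norm (q n - 0) < e" by (simp add: eventually_sequentially)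
  qed
  then show ?thesis by (simp add: q_def[abs_def])
qed

text \<open>Most components of \<open>M n\<close> lie near maximizers, and finitely many of these
  suffice up to \<open>e / 4\<close>. Assigning a nearby maximizer to each component turns the
  decomposition of \<open>M n\<close> into a finite convex combination of maximizers that is close
  to \<mu> on the leading \<open>N\<close> test functions.\<close>

theorem limit_in_closed_hull:
  assumes f: "weak_continuous f"
    and s: "\<And>\<nu>. \<nu> \<in> inv_measures \<Longrightarrow> entropy m \<nu> + ereal (f \<nu>) \<le> ereal s"
    and M: "\<And>n. M n \<in> inv_measures" and \<mu>: "\<mu> \<in> inv_measures" and w: "weakly M \<mu>"
    and lim: "(\<lambda>n. entropy m (M n) + ereal (mean f (M n))) \<longlonglongrightarrow> ereal s"
  shows "\<mu> \<in> closed_hull {\<nu> \<in> inv_measures. entropy m \<nu> + ereal (f \<nu>) = ereal s}" (is "_ \<in> closed_hull ?E")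
proof -
  have Ec: "compact (code ` ?E)" by (rule compact_code_image[OF _ argmax_seq_closed[OF f s]]) auto
  have step: "\<exists>x\<in>convex hull (measure_functional ` ?E). \<forall>j<N. \<bar>blinfun_apply x (dense_seq j) - code \<mu> j\<bar> < e"
    if e: "e > 0" for N e
  proof -
    define V where "V \<kappa> = {x :: nat \<Rightarrow> real. \<forall>j<N. \<bar>x j - code \<kappa> j\<bar> < e / 4}" for \<kappa>
    have Vo: "open (V \<kappa>)" for \<kappa> unfolding V_def by (rule open_code_box)
    have "code ` ?E \<subseteq> (\<Union>\<kappa>\<in>?E. V \<kappa>)"
    proof
      fix x assume "x \<in> code ` ?E"
      then obtain \<kappa> where "\<kappa> \<in> ?E" "x = code \<kappa>" by (rule imageE)
      then show "x \<in> (\<Union>\<kappa>\<in>?E. V \<kappa>)" using e by (intro UN_I[of \<kappa>]) (simp_all add: V_def)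
    qed
    from compactE_image[OF Ec Vo this]
    obtain F where F: "F \<subseteq> ?E" "finite F" "code ` ?E \<subseteq> (\<Union>\<kappa>\<in>F. V \<kappa>)" .
    define W where "W = (\<Union>\<kappa>\<in>F. V \<kappa>)"
    have Wo: "open W" unfolding W_def using Vo by auto
    have q0: "(\<lambda>n. measure (M n) {\<sigma>. code (component \<sigma>) \<notin> W}) \<longlonglongrightarrow> 0"
    proof (rule component_close_to_argmax[OF f s M lim Wo])
      show "code \<nu> \<in> W" if "\<nu> \<in> inv_measures" "entropy m \<nu> + ereal (f \<nu>) = ereal s" for \<nu>
        unfolding W_def by (rule subsetD[OF F(3) imageI]) (simp add: that)
    qed
    \<comment> \<open>A common bound for the coordinates, with 1 added to make it positive. A
      component outside \<open>W\<close> deviates by at most \<open>2 * b\<close>, so mass below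
      \<open>e / (8 * b)\<close> costs less than \<open>e / 4\<close>; mass below 1 ensures that
      \<open>F\<close> is nonempty.\<close>
    define b where "b = (\<Sum>j<N. norm (dense_seq j)) + 1"
    have b: "norm (dense_seq j) \<le> b" if "j < N" for j
      using member_le_sum[of j "{..<N}" "\<lambda>j. norm (dense_seq j)"] that by (simp add: b_def)
    have b0: "b > 0" unfolding b_def by (intro add_nonneg_pos sum_nonneg) simp_all
    have "min 1 (e / (8 * b)) > 0" using e b0 by simp
    then have "eventually (\<lambda>n. measure (M n) {\<sigma>. code (component \<sigma>) \<notin> W} < min 1 (e / (8 * b))) sequentially"
      by (rule order_tendstoD(2)[OF q0])
    moreover have "eventually (\<lambda>n. \<forall>j\<in>{..<N}. \<bar>code (M n) j - code \<mu> j\<bar> < e / 4) sequentially"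
    proof (rule eventually_ball_finite[OF finite_lessThan], rule ballI)
      fix j
      have "(\<lambda>n. code (M n) j) \<longlonglongrightarrow> code \<mu> j" unfolding code_def by (rule weakly_ev[OF w])
      from tendstoD[OF this, of "e/4"] e show "eventually (\<lambda>n. \<bar>code (M n) j - code \<mu> j\<bar> < e / 4) sequentially"
        by (simp add: dist_real_def)
    qed
    ultimately have "eventually (\<lambda>n. measure (M n) {\<sigma>. code (component \<sigma>) \<notin> W} < min 1 (e / (8 * b)) \<and>
        (\<forall>j\<in>{..<N}. \<bar>code (M n) j - code \<mu> j\<bar> < e / 4)) sequentially" by (rule eventually_conj)
    then obtain n where n: "measure (M n) {\<sigma>. code (component \<sigma>) \<notin> W} < min 1 (e / (8 * b))"
      "\<And>j. j < N \<Longrightarrow> \<bar>code (M n) j - code \<mu> j\<bar> < e / 4"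
      by (auto simp: eventually_sequentially)
    note Mb = prob_borelD[OF inv_prob_borel[OF M[of n]]]
    interpret prob_space "M n" by (rule Mb)
    have inv: "component \<sigma> \<in> inv_measures" for \<sigma> by (rule component_inv[OF M])
    have cm: "(\<lambda>\<sigma>. code (component \<sigma>)) \<in> borel_measurable (M n)"
      by (rule measurable_compose[OF component_measurable'[OF M] code_measurable])
    have "F \<noteq> {}" using n(1) Mb(3) prob_space by (auto simp: W_def)
    obtain \<kappa>s where \<kappa>s: "set \<kappa>s = F" using finite_list[OF F(2)] by blast
    define p where "p = length \<kappa>s"
    have p0: "p > 0" using \<open>F \<noteq> {}\<close> \<kappa>s by (auto simp: p_def)
    \<comment> \<open>Position in the list of the maximizer replacing a component with code
      \<open>x\<close>; taking the least admissible one makes the choice measurable. Outside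
      \<open>W\<close> the index 0 is arbitrary but valid, as the list is nonempty.\<close>
    define idx where "idx x = (if x \<in> W then LEAST i. i < p \<and> x \<in> V (\<kappa>s ! i) else 0)" for x
    have idxW: "idx x < p" "x \<in> V (\<kappa>s ! idx x)" if "x \<in> W" for x
    proof -
      have "\<exists>i. i < p \<and> x \<in> V (\<kappa>s ! i)"
        using that \<kappa>s unfolding W_def p_def by (metis UN_E in_set_conv_nth)
      from LeastI_ex[OF this] show "idx x < p" "x \<in> V (\<kappa>s ! idx x)" using that by (auto simp: idx_def)
    qed
    have idxp: "idx x < p" for x using idxW(1)[of x] p0 by (cases "x \<in> W") (auto simp: idx_def)
    have im: "idx \<in> measurable borel (count_space UNIV)"
    proof -
      have [measurable]: "W \<in> sets borel" "V \<kappa> \<in> sets borel" for \<kappa> using Wo Vo by auto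
      show ?thesis unfolding idx_def by measurable
    qed
    have idm: "(\<lambda>\<sigma>. idx (code (component \<sigma>))) \<in> measurable (M n) (count_space UNIV)"
      by (rule measurable_compose[OF cm im])
    have hm: "(\<lambda>\<sigma>. h (idx (code (component \<sigma>)))) \<in> borel_measurable (M n)" for h :: "nat \<Rightarrow> real"
      by (rule measurable_compose[OF idm]) simp
    \<comment> \<open>The weight of a maximizer is the mass of the components assigned to
      it.\<close>
    define wt where "wt i = (\<integral>\<sigma>. (indicator {i} (idx (code (component \<sigma>))) :: real) \<partial>M n)" for i
    have wti: "integrable (M n) (\<lambda>\<sigma>. indicator {i} (idx (code (component \<sigma>))) :: real)" for i
      using hm[of "indicator {i}"] by (intro integrable_const_bound[of _ 1]) (auto simp: indicator_def)
    have wsum: "(\<Sum>i<p. h i * wt i) = (\<integral>\<sigma>. h (idx (code (component \<sigma>))) \<partial>M n)" for h :: "nat \<Rightarrow> real"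
    proof -
      have "(\<Sum>i<p. h i * wt i) = (\<Sum>i<p. \<integral>\<sigma>. h i * indicator {i} (idx (code (component \<sigma>))) \<partial>M n)"
        by (simp add: wt_def)
      also have "\<dots> = (\<integral>\<sigma>. (\<Sum>i<p. h i * indicator {i} (idx (code (component \<sigma>)))) \<partial>M n)"
        using wti by (intro Bochner_Integration.integral_sum[symmetric]) auto
      also have "\<dots> = (\<integral>\<sigma>. h (idx (code (component \<sigma>))) \<partial>M n)"
      proof (intro Bochner_Integration.integral_cong refl)
        fix \<sigma>
        have "(\<Sum>i<p. h i * indicator {i} (idx (code (component \<sigma>)))) = (\<Sum>i<p. if i = idx (code (component \<sigma>)) then h i else 0)"
          by (intro sum.cong refl) (auto simp: indicator_def)
        then show "(\<Sum>i<p. h i * indicator {i} (idx (code (component \<sigma>)))) = h (idx (code (component \<sigma>)))"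
          using idxp[of "code (component \<sigma>)"] by simp
      qed
      finally show ?thesis .
    qed
    define x where "x = (\<Sum>i<p. wt i *\<^sub>R measure_functional (\<kappa>s ! i))"
    have \<kappa>E: "\<kappa>s ! i \<in> ?E" if "i < p" for i using that F(1) \<kappa>s nth_mem[of i \<kappa>s] by (auto simp: p_def)
    have "x \<in> convex hull (measure_functional ` ?E)"
      unfolding x_def
    proof (rule convex_sum[OF finite_lessThan convex_convex_hull])
      show "sum wt {..<p} = 1" using wsum[of "\<lambda>_. 1"] by (simp add: prob_space)
      show "0 \<le> wt i" for i by (simp add: wt_def)
      show "measure_functional (\<kappa>s ! i) \<in> convex hull measure_functional ` ?E" if "i \<in> {..<p}" for i
        using \<kappa>E[of i] that by (intro hull_inc imageI) auto
    qed
    moreover have "\<bar>blinfun_apply x (dense_seq j) - code \<mu> j\<bar> < e" if j: "j < N" for j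
    proof -
      define h where "h i = code (\<kappa>s ! i) j" for i
      have \<kappa>b: "\<bar>h (idx c)\<bar> \<le> norm (dense_seq j)" for c
        unfolding h_def using \<kappa>E[OF idxp] by (intro code_bound) auto
      have cb: "\<bar>code (component \<sigma>) j\<bar> \<le> norm (dense_seq j)" for \<sigma> by (rule code_bound[OF inv])
      have cmj: "(\<lambda>\<sigma>. code (component \<sigma>) j) \<in> borel_measurable (M n)"
        by (rule component_code_measurable[OF M])
      have "blinfun_apply x (dense_seq j) = (\<Sum>i<p. h i * wt i)"
        unfolding x_def blinfun.sum_left using \<kappa>E
        by (intro sum.cong refl) (simp add: blinfun.scaleR_left functional_eq_ev code_def h_def mult.commute)
      also have "\<dots> = (\<integral>\<sigma>. h (idx (code (component \<sigma>))) \<partial>M n)" by (rule wsum)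
      finally have xe: "blinfun_apply x (dense_seq j) = (\<integral>\<sigma>. h (idx (code (component \<sigma>))) \<partial>M n)" .
      have ce: "code (M n) j = (\<integral>\<sigma>. code (component \<sigma>) j \<partial>M n)"
        unfolding code_def by (rule integral_component_ev[OF M, symmetric])
      have i1: "integrable (M n) (\<lambda>\<sigma>. h (idx (code (component \<sigma>))))"
        using hm[of h] \<kappa>b by (intro integrable_const_bound[of _ "norm (dense_seq j)"]) auto
      have i2: "integrable (M n) (\<lambda>\<sigma>. code (component \<sigma>) j)"
        using cmj cb by (intro integrable_const_bound[of _ "norm (dense_seq j)"]) auto
      have Ws: "{\<sigma>. code (component \<sigma>) \<notin> W} \<in> sets (M n)"
      proof -
        have "(\<lambda>\<sigma>. code (component \<sigma>)) -` (- W) \<inter> space (M n) \<in> sets (M n)"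
          using Wo by (intro measurable_sets[OF cm]) auto
        then show ?thesis using Mb(3) by (simp add: vimage_def)
      qed
      have "\<bar>blinfun_apply x (dense_seq j) - code (M n) j\<bar> = \<bar>\<integral>\<sigma>. h (idx (code (component \<sigma>))) - code (component \<sigma>) j \<partial>M n\<bar>"
        unfolding xe ce using i1 i2 by simp
      also have "\<dots> \<le> (\<integral>\<sigma>. e/4 + 2 * b * indicator {\<sigma>. code (component \<sigma>) \<notin> W} \<sigma> \<partial>M n)"
      proof (rule order_trans[OF integral_abs_bound integral_mono])
        show "integrable (M n) (\<lambda>\<sigma>. \<bar>h (idx (code (component \<sigma>))) - code (component \<sigma>) j\<bar>)" using i1 i2 by auto
        show "integrable (M n) (\<lambda>\<sigma>. e/4 + 2 * b * indicator {\<sigma>. code (component \<sigma>) \<notin> W} \<sigma>)"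
          using Ws by (auto simp: less_top[symmetric])
        fix \<sigma>
        show "\<bar>h (idx (code (component \<sigma>))) - code (component \<sigma>) j\<bar> \<le> e/4 + 2 * b * indicator {\<sigma>. code (component \<sigma>) \<notin> W} \<sigma>"
        proof (cases "code (component \<sigma>) \<in> W")
          case True
          then show ?thesis using idxW(2)[OF True] j by (auto simp: V_def h_def abs_minus_commute)
        next
          case False
          have "\<bar>h (idx (code (component \<sigma>))) - code (component \<sigma>) j\<bar> \<le> 2 * b"
            using \<kappa>b[of "code (component \<sigma>)"] cb[of \<sigma>] b[OF j] by linarith
          then show ?thesis using False e by simp
        qed
      qed
      also have "\<dots> = e/4 + 2 * b * measure (M n) {\<sigma>. code (component \<sigma>) \<notin> W}"
        using Ws by (simp add: prob_space less_top[symmetric])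
      also have "\<dots> < e/4 + 2 * b * (e / (8 * b))"
        using n(1) b0 by (intro add_strict_left_mono mult_strict_left_mono) auto
      also have "\<dots> = e/2" using b0 by simp
      finally show ?thesis using n(2)[OF j] by linarith
    qed
    ultimately show ?thesis by blast
  qed
  define near where "near N x \<longleftrightarrow> x \<in> convex hull (measure_functional ` ?E) \<and>
    (\<forall>j<N. \<bar>blinfun_apply x (dense_seq j) - code \<mu> j\<bar> < 1 / real (Suc N))" for N x
  have "\<exists>x. near N x" for N using step[of "1 / real (Suc N)" N] unfolding near_def Bex_def by simp
  then have "\<exists>X. \<forall>N. near N (X N)" by (intro choice) blast
  then obtain X where "\<forall>N. near N (X N)" ..
  then have X: "X N \<in> convex hull (measure_functional ` ?E)"
    "j < N \<Longrightarrow> \<bar>blinfun_apply (X N) (dense_seq j) - code \<mu> j\<bar> < 1 / real (Suc N)" for N j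
    by (simp_all add: near_def)
  \<comment> \<open>Convex combinations of the functionals have norm at most 1. This uniform bound
    extends the convergence from \<open>dense_seq\<close> to all continuous functions.\<close>
  have bound: "\<bar>blinfun_apply x \<phi>\<bar> \<le> norm \<phi>" if "x \<in> convex hull (measure_functional ` ?E)" for x \<phi>
  proof -
    have "convex hull (measure_functional ` ?E) \<subseteq> cball 0 1"
    proof (rule hull_minimal)
      have "norm (measure_functional \<nu>) \<le> 1" if "\<nu> \<in> ?E" for \<nu>
        using that ev_bound[OF inv_prob_borel] by (intro norm_blinfun_bound) (auto simp: functional_eq_ev)
      then show "measure_functional ` ?E \<subseteq> cball 0 1" by auto
      show "convex (cball 0 1 :: (((nat \<Rightarrow> 'w) \<Rightarrow>\<^sub>C real) \<Rightarrow>\<^sub>L real) set)" by (rule convex_cball)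
    qed
    then have "norm x \<le> 1" using that by auto
    then show ?thesis using norm_blinfun[of x \<phi>] mult_right_mono[of "norm x" 1 "norm \<phi>"] by simp
  qed
  have "limitin weak_star X (measure_functional \<mu>) sequentially"
    unfolding limitin_weak_star
  proof (intro allI LIMSEQ_I)
    fix \<phi> and e :: real assume e: "e > 0"
    obtain j where j: "dist \<phi> (dense_seq j) < e/3" using dense_seq[of "e/3" \<phi>] e by auto
    obtain n0 where n0: "1 / real (Suc n0) < e/3" using nat_approx_posE[of "e/3"] e by auto
    have "norm (blinfun_apply (X n) \<phi> - blinfun_apply (measure_functional \<mu>) \<phi>) < e" if n: "n \<ge> max n0 (Suc j)" for n
    proof -
      have "1 / real (Suc n) \<le> 1 / real (Suc n0)" using n by (intro divide_left_mono) auto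
      then have "\<bar>blinfun_apply (X n) (dense_seq j) - code \<mu> j\<bar> < e/3" using X(2)[of j n] n n0 by simp
      moreover have "\<bar>blinfun_apply (X n) \<phi> - blinfun_apply (X n) (dense_seq j)\<bar> < e/3"
        using bound[OF X(1), of n "\<phi> - dense_seq j"] j by (simp add: blinfun.diff_right dist_norm)
      moreover have "\<bar>ev \<mu> \<phi> - code \<mu> j\<bar> < e/3"
        using ev_dist[OF inv_prob_borel[OF \<mu>], of \<phi> "dense_seq j"] j by (simp add: code_def)
      ultimately show ?thesis unfolding functional_eq_ev[OF \<mu>] real_norm_def by linarith
    qed
    then show "\<exists>no. \<forall>n\<ge>no. norm (blinfun_apply (X n) \<phi> - blinfun_apply (measure_functional \<mu>) \<phi>) < e" by blast
  qed
  then have "measure_functional \<mu> \<in> weak_star closure_of (convex hull (measure_functional ` ?E))"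
    using X(1) unfolding in_closure_of limitin_sequentially by blast
  then show ?thesis using \<mu> by (simp add: closed_hull_def)
qed

abbreviation pres :: "((nat \<Rightarrow> 'w) measure \<Rightarrow> real) \<Rightarrow> ereal"
  where "pres f \<equiv> (SUP \<nu>\<in>inv_measures. entropy m \<nu> + ereal (f \<nu>))"

lemma pres_upper: "\<nu> \<in> inv_measures \<Longrightarrow> entropy m \<nu> + ereal (f \<nu>) \<le> pres f"
  by (rule SUP_upper)

lemma pres_real:
  assumes "weak_continuous f"
  obtains q where "pres f = ereal q"
proof -
  obtain B where "\<And>\<mu>. \<mu> \<in> inv_measures \<Longrightarrow> \<bar>f \<mu>\<bar> \<le> B" using weak_continuous_bounded[OF assms] by blast
  then show ?thesis using entropy_add_sup_finite[of f B] that by blast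
qed

lemma weak_continuous_diff:
  assumes "weak_continuous f" "weak_continuous k"
  shows "weak_continuous (\<lambda>\<nu>. f \<nu> - k \<nu>)"
  using assms unfolding weak_continuous_def by (auto intro: tendsto_diff)

lemma mean_diff:
  assumes "weak_continuous f" "weak_continuous k" "\<mu> \<in> inv_measures"
  shows "mean (\<lambda>\<nu>. f \<nu> - k \<nu>) \<mu> = mean f \<mu> - mean k \<mu>"
  unfolding mean_def by (rule Bochner_Integration.integral_diff) (rule integrable_component; fact)+

lemma entropy_add_mix:
  fixes \<mu> \<nu> :: "(nat \<Rightarrow> 'w) measure"
  assumes \<mu>: "\<mu> \<in> inv_measures" and \<nu>: "\<nu> \<in> inv_measures" and t: "0 \<le> t" "t \<le> 1"
    and b: "b (mix t \<mu> \<nu>) = (1 - t) * b \<mu> + t * b \<nu>"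
  shows "ereal (1 - t) * (entropy m \<mu> + ereal (b \<mu>)) + ereal t * (entropy m \<nu> + ereal (b \<nu>))
    \<le> entropy m (mix t \<mu> \<nu>) + ereal (b (mix t \<mu> \<nu>))"
proof -
  have "ereal (1 - t) * (entropy m \<mu> + ereal (b \<mu>)) + ereal t * (entropy m \<nu> + ereal (b \<nu>))
      = (ereal (1 - t) * entropy m \<mu> + ereal t * entropy m \<nu>) + ereal (b (mix t \<mu> \<nu>))"
    unfolding b using entropy_nonpos[of \<mu>] entropy_nonpos[of \<nu>] t
    by (cases "entropy m \<mu>"; cases "entropy m \<nu>") (auto simp: algebra_simps)
  also have "\<dots> \<le> entropy m (mix t \<mu> \<nu>) + ereal (b (mix t \<mu> \<nu>))"
    by (intro add_right_mono entropy_mix inv_prob_borel \<mu> \<nu> t)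
  finally show ?thesis .
qed

lemma convex_ereal_le:
  assumes "0 \<le> t" "t \<le> 1" "ereal c \<le> x" "ereal c \<le> y"
  shows "ereal c \<le> ereal (1 - t) * x + ereal t * y"
proof -
  have "ereal c = ereal (1 - t) * ereal c + ereal t * ereal c" by (simp add: algebra_simps)
  also have "\<dots> \<le> ereal (1 - t) * x + ereal t * y"
    using assms by (intro add_mono ereal_mult_left_mono) auto
  finally show ?thesis .
qed

section \<open>Generalized equilibria\<close>

lemma generalized_equilibria_cong:
  assumes "\<And>\<nu>. \<nu> \<in> inv_measures \<Longrightarrow> \<Phi> \<nu> = \<Psi> \<nu>"
  shows "generalized_equilibria \<Phi> = generalized_equilibria \<Psi>"
proof -
  have "(SUP \<nu>\<in>inv_measures. \<Phi> \<nu>) = (SUP \<nu>\<in>inv_measures. \<Psi> \<nu>)" by (intro SUP_cong refl assms)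
  moreover have "(\<lambda>n. \<Phi> (M n)) = (\<lambda>n. \<Psi> (M n))" if "range M \<subseteq> inv_measures" for M :: "nat \<Rightarrow> _"
    using that by (intro ext assms) auto
  ultimately show ?thesis unfolding generalized_equilibria_def by (auto; metis)
qed

text \<open>With continuous \<open>f\<close> the functional is upper semicontinuous, so limits of
  maximizing sequences are maximizers; conversely a maximizer is the limit of a constant
  sequence.\<close>

lemma generalized_equilibria_weak_continuous:
  assumes f: "weak_continuous f" and p: "pres f = ereal p"
  shows "generalized_equilibria (\<lambda>\<mu>. entropy m \<mu> + ereal (f \<mu>))
    = {\<mu> \<in> inv_measures. entropy m \<mu> + ereal (f \<mu>) = ereal p}" (is "?G = ?E")
proof
  show "?G \<subseteq> ?E"
  proof
    fix \<mu> assume "\<mu> \<in> ?G"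
    then obtain M where M: "\<And>n. M n \<in> inv_measures" "limitin inv_topology M \<mu> sequentially"
      "(\<lambda>n. entropy m (M n) + ereal (f (M n))) \<longlonglongrightarrow> ereal p" and \<mu>: "\<mu> \<in> inv_measures"
      unfolding generalized_equilibria_def p by blast
    have w: "weakly M \<mu>" using M(2) limitin_inv_topology[OF \<mu>, of M] M(1) by simp
    have "(\<lambda>n. f (M n)) \<longlonglongrightarrow> f \<mu>" by (rule weak_continuousD[OF f _ \<mu> w]) (rule M(1))
    then have "ereal p \<le> entropy m \<mu> + ereal (f \<mu>)"
      by (intro entropy_add_limit_le[OF w _ M(3)] tendsto_upper)
    then show "\<mu> \<in> ?E" using pres_upper[OF \<mu>, of f] \<mu> by (simp add: p antisym)
  qed
  show "?E \<subseteq> ?G"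
  proof
    fix \<mu> assume "\<mu> \<in> ?E"
    then show "\<mu> \<in> ?G"
      unfolding generalized_equilibria_def p
      using limitin_inv_topology[of \<mu> "\<lambda>_. \<mu>"]
      by (auto simp: weakly_def intro!: exI[of _ "\<lambda>_. \<mu>"])
  qed
qed

text \<open>Accuracy in position and in value is governed by one parameter \<open>N\<close>. In this
  form, without sequences, closedness and convexity of the set of generalized equilibria can be
  checked directly.\<close>

lemma generalized_equilibria_iff:
  assumes p: "(SUP \<nu>\<in>inv_measures. \<Phi> \<nu>) = ereal p" and \<mu>: "\<mu> \<in> inv_measures"
  shows "\<mu> \<in> generalized_equilibria \<Phi> \<longleftrightarrow> (\<forall>N. \<exists>\<nu>\<in>inv_measures.
    (\<forall>j<N. \<bar>code \<nu> j - code \<mu> j\<bar> < 1 / real (Suc N)) \<and> ereal (p - 1 / real (Suc N)) < \<Phi> \<nu>)"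
proof
  assume "\<mu> \<in> generalized_equilibria \<Phi>"
  then obtain M where M: "\<And>n. M n \<in> inv_measures" "limitin inv_topology M \<mu> sequentially"
    "(\<lambda>n. \<Phi> (M n)) \<longlonglongrightarrow> ereal p"
    unfolding generalized_equilibria_def p by blast
  have w: "weakly M \<mu>" using M(2) limitin_inv_topology[OF \<mu>, of M] M(1) by simp
  show "\<forall>N. \<exists>\<nu>\<in>inv_measures. (\<forall>j<N. \<bar>code \<nu> j - code \<mu> j\<bar> < 1 / real (Suc N)) \<and> ereal (p - 1 / real (Suc N)) < \<Phi> \<nu>"
  proof
    fix N
    have "eventually (\<lambda>n. \<forall>j\<in>{..<N}. \<bar>code (M n) j - code \<mu> j\<bar> < 1 / real (Suc N)) sequentially"
    proof (rule eventually_ball_finite[OF finite_lessThan], rule ballI)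
      fix j
      have "(\<lambda>n. code (M n) j) \<longlonglongrightarrow> code \<mu> j" unfolding code_def by (rule weakly_ev[OF w])
      from tendstoD[OF this, of "1 / real (Suc N)"]
      show "eventually (\<lambda>n. \<bar>code (M n) j - code \<mu> j\<bar> < 1 / real (Suc N)) sequentially"
        by (simp add: dist_real_def)
    qed
    moreover have "eventually (\<lambda>n. ereal (p - 1 / real (Suc N)) < \<Phi> (M n)) sequentially"
      by (rule order_tendstoD(1)[OF M(3)]) simp
    ultimately have "eventually (\<lambda>n. (\<forall>j\<in>{..<N}. \<bar>code (M n) j - code \<mu> j\<bar> < 1 / real (Suc N)) \<and>
        ereal (p - 1 / real (Suc N)) < \<Phi> (M n)) sequentially" by (rule eventually_conj)
    then obtain n where "\<forall>j\<in>{..<N}. \<bar>code (M n) j - code \<mu> j\<bar> < 1 / real (Suc N)"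
      "ereal (p - 1 / real (Suc N)) < \<Phi> (M n)"
      unfolding eventually_sequentially by blast
    then show "\<exists>\<nu>\<in>inv_measures. (\<forall>j<N. \<bar>code \<nu> j - code \<mu> j\<bar> < 1 / real (Suc N)) \<and> ereal (p - 1 / real (Suc N)) < \<Phi> \<nu>"
      using M(1)[of n] by (intro bexI[of _ "M n"] conjI) auto
  qed
next
  assume "\<forall>N. \<exists>\<nu>\<in>inv_measures. (\<forall>j<N. \<bar>code \<nu> j - code \<mu> j\<bar> < 1 / real (Suc N)) \<and> ereal (p - 1 / real (Suc N)) < \<Phi> \<nu>"
  then have "\<exists>M. \<forall>N. M N \<in> inv_measures \<and> (\<forall>j<N. \<bar>code (M N) j - code \<mu> j\<bar> < 1 / real (Suc N)) \<and> ereal (p - 1 / real (Suc N)) < \<Phi> (M N)"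
    unfolding Bex_def by (rule choice)
  then obtain M where M: "\<And>N. M N \<in> inv_measures" "\<And>N j. j < N \<Longrightarrow> \<bar>code (M N) j - code \<mu> j\<bar> < 1 / real (Suc N)"
    "\<And>N. ereal (p - 1 / real (Suc N)) < \<Phi> (M N)" by blast
  have w: "weakly M \<mu>" by (rule weakly_code_approx[OF M(1) \<mu> M(2)])
  have "(\<lambda>n. \<Phi> (M n)) \<longlonglongrightarrow> ereal p"
  proof (rule tendsto_sandwich)
    have "(\<lambda>n. ereal (p - 1 / real (Suc n))) \<longlonglongrightarrow> ereal (p - 0)"
      by (intro tendsto_intros LIMSEQ_Suc[OF lim_const_over_n])
    then show "(\<lambda>n. ereal (p - 1 / real (Suc n))) \<longlonglongrightarrow> ereal p" by simp
    show "eventually (\<lambda>n. ereal (p - 1 / real (Suc n)) \<le> \<Phi> (M n)) sequentially"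
      using M(3) less_imp_le by (intro always_eventually) blast
    show "eventually (\<lambda>n. \<Phi> (M n) \<le> ereal p) sequentially"
      unfolding p[symmetric] by (intro always_eventually allI SUP_upper M(1))
  qed simp
  moreover have "limitin inv_topology M \<mu> sequentially" using limitin_inv_topology[OF \<mu>, of M] M(1) w by simp
  ultimately show "\<mu> \<in> generalized_equilibria \<Phi>"
    unfolding generalized_equilibria_def p using \<mu> M(1) by auto
qed

lemma code_mix:
  fixes \<mu> \<nu> :: "(nat \<Rightarrow> 'w) measure"
  assumes "\<mu> \<in> inv_measures" "\<nu> \<in> inv_measures" "0 \<le> t" "t \<le> 1"
  shows "code (mix t \<mu> \<nu>) j = (1 - t) * code \<mu> j + t * code \<nu> j"
  unfolding code_def using assms by (intro ev_mix inv_prob_borel)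

lemma code_mix_close:
  fixes \<mu> \<nu> \<mu>' \<nu>' :: "(nat \<Rightarrow> 'w) measure"
  assumes "\<mu> \<in> inv_measures" "\<nu> \<in> inv_measures" "\<mu>' \<in> inv_measures" "\<nu>' \<in> inv_measures" "0 \<le> t" "t \<le> 1"
    "\<bar>code \<mu>' j - code \<mu> j\<bar> < e" "\<bar>code \<nu>' j - code \<nu> j\<bar> < e"
  shows "\<bar>code (mix t \<mu>' \<nu>') j - code (mix t \<mu> \<nu>) j\<bar> < e"
proof -
  have "\<bar>code (mix t \<mu>' \<nu>') j - code (mix t \<mu> \<nu>) j\<bar> = \<bar>(1 - t) * (code \<mu>' j - code \<mu> j) + t * (code \<nu>' j - code \<nu> j)\<bar>"
    using assms(1-6) by (simp add: code_mix algebra_simps)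
  also have "\<dots> \<le> (1 - t) * \<bar>code \<mu>' j - code \<mu> j\<bar> + t * \<bar>code \<nu>' j - code \<nu> j\<bar>"
    using assms(5,6) by (intro order_trans[OF abs_triangle_ineq]) (simp add: abs_mult)
  also have "\<dots> < e" using assms(5-8) by (intro convex_bound_lt) auto
  finally show ?thesis .
qed

lemma argmax_approximation:
  assumes f: "weak_continuous f" and p: "pres f = ereal p"
    and \<mu>: "\<mu> \<in> inv_measures" and eq: "entropy m \<mu> + ereal (f \<mu>) = ereal p"
  obtains M where "\<And>n. M n \<in> inv_measures" "weakly M \<mu>"
    "(\<lambda>n. entropy m (M n) + ereal (mean f (M n))) \<longlonglongrightarrow> ereal p"
proof -
  have p': "pres (mean f) = ereal p" unfolding sup_entropy_add_mean[OF f] by (rule p)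
  obtain M e where M: "\<And>n. M n \<in> inv_measures" "weakly M \<mu>" "e \<longlonglongrightarrow> (0::real)"
    "\<And>n. ereal (p - e n) \<le> entropy m (M n) + ereal (mean f (M n))"
    using approximation_ge[OF f \<mu> eq_refl[OF eq[symmetric]]] by blast
  have "(\<lambda>n. entropy m (M n) + ereal (mean f (M n))) \<longlonglongrightarrow> ereal p"
  proof (rule tendsto_sandwich)
    have "(\<lambda>n. ereal (p - e n)) \<longlonglongrightarrow> ereal (p - 0)" by (intro tendsto_intros M(3))
    then show "(\<lambda>n. ereal (p - e n)) \<longlonglongrightarrow> ereal p" by simp
    show "eventually (\<lambda>n. ereal (p - e n) \<le> entropy m (M n) + ereal (mean f (M n))) sequentially"
      using M(4) by (intro always_eventually) blast
    show "eventually (\<lambda>n. entropy m (M n) + ereal (mean f (M n)) \<le> ereal p) sequentially"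
      unfolding p'[symmetric] by (intro always_eventually allI pres_upper M(1))
  qed simp
  with M(1,2) show ?thesis by (rule that)
qed

text \<open>Since \<open>mean f\<close> need not be semicontinuous, limits of its maximizing
  sequences need not be maximizers. Instead the generalized equilibria are shown to form a closed
  convex set containing the maximizers for \<open>f\<close>; the opposite inclusion is
  \<open>limit_in_closed_hull\<close>.\<close>

theorem generalized_equilibria_mean:
  assumes f: "weak_continuous f"
  shows "generalized_equilibria (\<lambda>\<mu>. entropy m \<mu> + ereal (mean f \<mu>))
    = closed_hull (generalized_equilibria (\<lambda>\<mu>. entropy m \<mu> + ereal (f \<mu>)))" (is "?A = closed_hull ?G")
proof -
  obtain p where p: "pres f = ereal p" using pres_real[OF f] .
  have p': "pres (mean f) = ereal p" unfolding sup_entropy_add_mean[OF f] by (rule p)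
  have G: "?G = {\<mu> \<in> inv_measures. entropy m \<mu> + ereal (f \<mu>) = ereal p}"
    by (rule generalized_equilibria_weak_continuous[OF f p])
  note iff = generalized_equilibria_iff[of "\<lambda>\<mu>. entropy m \<mu> + ereal (mean f \<mu>)", OF p']
  have sub: "?A \<subseteq> inv_measures" unfolding generalized_equilibria_def by blast
  show ?thesis
  proof
    show "?A \<subseteq> closed_hull ?G"
    proof
      fix \<mu> assume "\<mu> \<in> ?A"
      then obtain M where M: "\<And>n. M n \<in> inv_measures" "limitin inv_topology M \<mu> sequentially"
        "(\<lambda>n. entropy m (M n) + ereal (mean f (M n))) \<longlonglongrightarrow> ereal p" and \<mu>: "\<mu> \<in> inv_measures"
        unfolding generalized_equilibria_def p' by blast
      have w: "weakly M \<mu>" using M(2) limitin_inv_topology[OF \<mu>, of M] M(1) by simp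
      show "\<mu> \<in> closed_hull ?G"
        unfolding G by (rule limit_in_closed_hull[OF f pres_upper[where f=f, unfolded p] M(1) \<mu> w M(3)])
    qed
    show "closed_hull ?G \<subseteq> ?A"
    proof (rule closed_hull_subset[OF sub])
      show "seq_closed ?A"
      proof (intro allI impI)
        fix M \<mu> assume M: "range M \<subseteq> ?A" "weakly M \<mu>" and \<mu>: "\<mu> \<in> inv_measures"
        have Mi: "M n \<in> inv_measures" for n using M(1) sub by auto
        have cl: "(\<lambda>n. code (M n) j) \<longlonglongrightarrow> code \<mu> j" for j unfolding code_def by (rule weakly_ev[OF M(2)])
        show "\<mu> \<in> ?A"
          unfolding iff[OF \<mu>]
        proof
          fix N
          \<comment> \<open>Accuracy \<open>1 / (N + 2)\<close> relative to \<open>M n\<close> has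
            to become \<open>1 / (N + 1)\<close> relative to \<mu>, which leaves \<open>d\<close>
            for the distance between these two measures.\<close>
          define d where "d = 1 / real (Suc N) - 1 / real (Suc (Suc N))"
          have d: "d > 0" unfolding d_def by (auto intro: divide_strict_left_mono)
          have "eventually (\<lambda>n. \<forall>j\<in>{..<N}. \<bar>code (M n) j - code \<mu> j\<bar> < d) sequentially"
          proof (rule eventually_ball_finite[OF finite_lessThan], rule ballI)
            fix j
            from tendstoD[OF cl d, of j] show "eventually (\<lambda>n. \<bar>code (M n) j - code \<mu> j\<bar> < d) sequentially"
              by (simp add: dist_real_def)
          qed
          then obtain n where n: "\<And>j. j < N \<Longrightarrow> \<bar>code (M n) j - code \<mu> j\<bar> < d"
            unfolding eventually_sequentially by blast
          have "M n \<in> ?A" using M(1) by blast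
          then obtain \<nu> where \<nu>: "\<nu> \<in> inv_measures"
            "\<And>j. j < Suc N \<Longrightarrow> \<bar>code \<nu> j - code (M n) j\<bar> < 1 / real (Suc (Suc N))"
            "ereal (p - 1 / real (Suc (Suc N))) < entropy m \<nu> + ereal (mean f \<nu>)"
            unfolding iff[OF Mi] by blast
          show "\<exists>\<nu>\<in>inv_measures. (\<forall>j<N. \<bar>code \<nu> j - code \<mu> j\<bar> < 1 / real (Suc N)) \<and>
              ereal (p - 1 / real (Suc N)) < entropy m \<nu> + ereal (mean f \<nu>)"
          proof (intro bexI[OF _ \<nu>(1)] conjI allI impI)
            fix j assume "j < N"
            then show "\<bar>code \<nu> j - code \<mu> j\<bar> < 1 / real (Suc N)"
              using n[of j] \<nu>(2)[of j] unfolding d_def by linarith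
          next
            have "ereal (p - 1 / real (Suc N)) \<le> ereal (p - 1 / real (Suc (Suc N)))" using d unfolding d_def by simp
            then show "ereal (p - 1 / real (Suc N)) < entropy m \<nu> + ereal (mean f \<nu>)" using \<nu>(3) by (rule le_less_trans)
          qed
        qed
      qed
      show "?G \<subseteq> ?A"
      proof
        fix \<mu> assume "\<mu> \<in> ?G"
        then have \<mu>: "\<mu> \<in> inv_measures" and eq: "entropy m \<mu> + ereal (f \<mu>) = ereal p" unfolding G by auto
        obtain M where M: "\<And>n. M n \<in> inv_measures" "weakly M \<mu>"
          "(\<lambda>n. entropy m (M n) + ereal (mean f (M n))) \<longlonglongrightarrow> ereal p"
          using argmax_approximation[OF f p \<mu> eq] by blast
        moreover have "limitin inv_topology M \<mu> sequentially" using limitin_inv_topology[OF \<mu>, of M] M(1,2) by simp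
        ultimately show "\<mu> \<in> ?A" unfolding generalized_equilibria_def p' using \<mu> by auto
      qed
      fix \<mu> \<nu> and t :: real assume mn: "\<mu> \<in> ?A" "\<nu> \<in> ?A" and t: "0 \<le> t" "t \<le> 1"
      have \<mu>: "\<mu> \<in> inv_measures" and \<nu>: "\<nu> \<in> inv_measures" using mn sub by auto
      show "mix t \<mu> \<nu> \<in> ?A"
        unfolding iff[OF mix_inv[OF \<mu> \<nu> t]]
      proof
        fix N
        obtain \<mu>' where \<mu>': "\<mu>' \<in> inv_measures" "\<And>j. j < N \<Longrightarrow> \<bar>code \<mu>' j - code \<mu> j\<bar> < 1 / real (Suc N)"
          "ereal (p - 1 / real (Suc N)) < entropy m \<mu>' + ereal (mean f \<mu>')"
          using mn(1) unfolding iff[OF \<mu>] by blast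
        obtain \<nu>' where \<nu>': "\<nu>' \<in> inv_measures" "\<And>j. j < N \<Longrightarrow> \<bar>code \<nu>' j - code \<nu> j\<bar> < 1 / real (Suc N)"
          "ereal (p - 1 / real (Suc N)) < entropy m \<nu>' + ereal (mean f \<nu>')"
          using mn(2) unfolding iff[OF \<nu>] by blast
        \<comment> \<open>A common real lower bound for both values, strictly above the required
          level, so that the convex combination can be bounded in the extended reals.\<close>
        obtain c where c: "p - 1 / real (Suc N) < c" "ereal c \<le> entropy m \<mu>' + ereal (mean f \<mu>')"
          "ereal c \<le> entropy m \<nu>' + ereal (mean f \<nu>')"
        proof -
          have "ereal (p - 1 / real (Suc N)) < min (entropy m \<mu>' + ereal (mean f \<mu>')) (entropy m \<nu>' + ereal (mean f \<nu>'))"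
            using \<mu>'(3) \<nu>'(3) by simp
          then obtain c where "ereal (p - 1 / real (Suc N)) < ereal c"
            "ereal c < min (entropy m \<mu>' + ereal (mean f \<mu>')) (entropy m \<nu>' + ereal (mean f \<nu>'))"
            using ereal_dense2 by blast
          then show ?thesis by (intro that[of c]) auto
        qed
        have "ereal (p - 1 / real (Suc N)) < ereal c" using c(1) by simp
        also have "\<dots> \<le> ereal (1 - t) * (entropy m \<mu>' + ereal (mean f \<mu>')) + ereal t * (entropy m \<nu>' + ereal (mean f \<nu>'))"
          by (rule convex_ereal_le[OF t c(2,3)])
        also have "\<dots> \<le> entropy m (mix t \<mu>' \<nu>') + ereal (mean f (mix t \<mu>' \<nu>'))"
          by (rule entropy_add_mix[OF \<mu>'(1) \<nu>'(1) t mean_mix[OF f \<mu>'(1) \<nu>'(1) t]])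
        finally show "\<exists>\<kappa>\<in>inv_measures. (\<forall>j<N. \<bar>code \<kappa> j - code (mix t \<mu> \<nu>) j\<bar> < 1 / real (Suc N)) \<and>
            ereal (p - 1 / real (Suc N)) < entropy m \<kappa> + ereal (mean f \<kappa>)"
          using code_mix_close[OF \<mu> \<nu> \<mu>'(1) \<nu>'(1) t \<mu>'(2) \<nu>'(2)]
          by (intro bexI[OF _ mix_inv[OF \<mu>'(1) \<nu>'(1) t]]) blast
      qed
    qed
  qed
qed

text \<open>Upper semicontinuity of \<open>mean f\<close> makes its set of maximizers closed; the
  set is convex by concavity of the entropy, and it contains the maximizers for \<open>f\<close> as
  limits of ergodic approximants. This is why the sharp functional has genuine equilibria.\<close>

lemma closed_hull_argmax_subset:
  assumes f: "weak_continuous f" and q: "pres f = ereal q"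
    and usc: "\<And>M \<nu> e. (\<And>n. M n \<in> inv_measures) \<Longrightarrow> \<nu> \<in> inv_measures \<Longrightarrow> weakly M \<nu> \<Longrightarrow> e > 0 \<Longrightarrow>
      eventually (\<lambda>n. mean f (M n) < mean f \<nu> + e) sequentially"
  shows "closed_hull {\<nu> \<in> inv_measures. entropy m \<nu> + ereal (f \<nu>) = ereal q}
    \<subseteq> {\<nu> \<in> inv_measures. entropy m \<nu> + ereal (mean f \<nu>) = ereal q}" (is "closed_hull ?E \<subseteq> ?A")
proof -
  have q': "pres (mean f) = ereal q" unfolding sup_entropy_add_mean[OF f] by (rule q)
  have up: "entropy m \<nu> + ereal (mean f \<nu>) \<le> ereal q" if "\<nu> \<in> inv_measures" for \<nu>
    unfolding q'[symmetric] by (rule pres_upper[OF that])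
  show ?thesis
  proof (rule closed_hull_subset)
    show "?A \<subseteq> inv_measures" by blast
    show "seq_closed ?A"
    proof (intro allI impI)
      fix M \<mu> assume M: "range M \<subseteq> ?A" "weakly M \<mu>" and \<mu>: "\<mu> \<in> inv_measures"
      then have Mi: "\<And>n. M n \<in> inv_measures" and eq: "\<And>n. entropy m (M n) + ereal (mean f (M n)) = ereal q" by auto
      have "ereal q \<le> entropy m \<mu> + ereal (mean f \<mu>)"
        by (rule entropy_add_limit_le[OF M(2) usc[OF Mi \<mu> M(2)]]) (simp_all add: eq)
      then show "\<mu> \<in> ?A" using up[OF \<mu>] \<mu> by (simp add: antisym)
    qed
    show "?E \<subseteq> ?A"
    proof
      fix \<mu> assume "\<mu> \<in> ?E"
      then have \<mu>: "\<mu> \<in> inv_measures" and eq: "entropy m \<mu> + ereal (f \<mu>) = ereal q" by auto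
      obtain M where M: "\<And>n. M n \<in> inv_measures" "weakly M \<mu>"
        "(\<lambda>n. entropy m (M n) + ereal (mean f (M n))) \<longlonglongrightarrow> ereal q"
        using argmax_approximation[OF f q \<mu> eq] by blast
      have "ereal q \<le> entropy m \<mu> + ereal (mean f \<mu>)"
        by (rule entropy_add_limit_le[OF M(2) usc[OF M(1) \<mu> M(2)] M(3)])
      then show "\<mu> \<in> ?A" using up[OF \<mu>] \<mu> by (simp add: antisym)
    qed
    fix \<mu> \<nu> and t :: real assume mn: "\<mu> \<in> ?A" "\<nu> \<in> ?A" and t: "0 \<le> t" "t \<le> 1"
    then have \<mu>: "\<mu> \<in> inv_measures" "entropy m \<mu> + ereal (mean f \<mu>) = ereal q"
      and \<nu>: "\<nu> \<in> inv_measures" "entropy m \<nu> + ereal (mean f \<nu>) = ereal q" by auto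
    have "ereal q \<le> ereal (1 - t) * (entropy m \<mu> + ereal (mean f \<mu>)) + ereal t * (entropy m \<nu> + ereal (mean f \<nu>))"
      by (rule convex_ereal_le[OF t]) (simp_all add: \<mu>(2) \<nu>(2))
    also have "\<dots> \<le> entropy m (mix t \<mu> \<nu>) + ereal (mean f (mix t \<mu> \<nu>))"
      by (rule entropy_add_mix[OF \<mu>(1) \<nu>(1) t mean_mix[OF f \<mu>(1) \<nu>(1) t]])
    finally show "mix t \<mu> \<nu> \<in> ?A"
      using up[OF mix_inv[OF \<mu>(1) \<nu>(1) t]] mix_inv[OF \<mu>(1) \<nu>(1) t] by (simp add: antisym)
  qed
qed

end

section \<open>The thermodynamic game\<close>

context compact_alphabet
begin

lemma observable_linear:
  fixes y :: "'x::real_normed_vector \<Rightarrow>\<^sub>L real"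
  assumes "linear \<theta>" "sigma_normal \<theta>"
  shows "observable m \<theta> (blinfun_apply y)"
proof (intro observable.intro observable_axioms.intro compact_alphabet_axioms)
  show "convex_on UNIV (blinfun_apply y)"
    by (auto simp: convex_on_def blinfun.add_right blinfun.scaleR_right)
  show "continuous_on UNIV (blinfun_apply y)" by (intro continuous_intros)
qed (rule assms)+

end

context observable
begin

lemma weak_continuous_obs: "weak_continuous obs"
  unfolding weak_continuous_def using obs_tendsto_inv by blast

lemma mean_obs: "\<mu> \<in> inv_measures \<Longrightarrow> mean obs \<mu> = Delta \<theta> g \<mu>"
  by (simp add: mean_def Delta_eq)

text \<open>Jensen's inequality for the ergodic decomposition, obtained without integrating
  vector-valued maps: the two sides agree on ergodic approximants of \<mu>, along which the left
  side is continuous and the right side upper semicontinuous.\<close>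

lemma obs_le_Delta:
  assumes \<mu>: "\<mu> \<in> inv_measures"
  shows "obs \<mu> \<le> Delta \<theta> g \<mu>"
proof -
  obtain M where M: "\<And>n. M n \<in> ergodic_measures" "weakly M \<mu>" "\<And>n. entropy m \<mu> \<le> entropy m (M n)"
    using ergodic_approximation[OF \<mu>] by blast
  have Mi: "M n \<in> inv_measures" for n using M(1) ergodic_sub_inv by auto
  have lim: "(\<lambda>n. obs (M n)) \<longlonglongrightarrow> obs \<mu>" by (rule weak_continuousD[OF weak_continuous_obs Mi \<mu> M(2)])
  show ?thesis
  proof (rule field_le_epsilon)
    fix e :: real assume "e > 0"
    then have "eventually (\<lambda>n. obs (M n) < Delta \<theta> g \<mu> + e) sequentially"
      using Delta_usc[OF Mi \<mu> M(2)] unfolding Delta_ergodic[OF M(1)] by blast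
    then show "obs \<mu> \<le> Delta \<theta> g \<mu> + e"
      by (intro tendsto_upperbound[OF lim]) (auto elim: eventually_mono)
  qed
qed

end

context compact_alphabet
begin

text \<open>Jensen's inequality for \<open>y\<close> and for \<open>- y\<close>. This is how
  sigma-normality makes \<theta> compatible with barycenters of ergodic decompositions.\<close>

lemma mean_linear:
  fixes y :: "'x::real_normed_vector \<Rightarrow>\<^sub>L real"
  assumes \<theta>: "linear \<theta>" "sigma_normal \<theta>" and \<mu>: "\<mu> \<in> inv_measures"
  shows "mean (\<lambda>\<nu>. blinfun_apply y (\<theta> (eval_S \<nu>))) \<mu> = blinfun_apply y (\<theta> (eval_S \<mu>))"
proof -
  have le: "blinfun_apply z (\<theta> (eval_S \<mu>)) \<le> mean (\<lambda>\<nu>. blinfun_apply z (\<theta> (eval_S \<nu>))) \<mu>" for z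
  proof -
    interpret Z: observable m \<theta> "blinfun_apply z" by (rule observable_linear[OF \<theta>])
    show ?thesis using Z.obs_le_Delta[OF \<mu>] by (simp only: Z.mean_obs[OF \<mu>])
  qed
  show ?thesis using le[of y] le[of "- y"] by (simp add: blinfun.minus_left mean_def)
qed

end

locale game = compact_alphabet m + P: observable m \<theta>p gp + M: observable m \<theta>m gm
  for m :: "'w::polish_space measure"
    and \<theta>p :: "'w test_fun bborel \<Rightarrow> 'x::real_normed_vector" and gp :: "'x \<Rightarrow> real"
    and \<theta>m :: "'w test_fun bborel \<Rightarrow> 'y::real_normed_vector" and gm :: "'y \<Rightarrow> real" +
  assumes conjugate_real: "range (conjugate gp) \<subseteq> range ereal"
begin

abbreviation tp :: "(nat \<Rightarrow> 'w) measure \<Rightarrow> 'x" where "tp \<nu> \<equiv> \<theta>p (eval_S \<nu>)"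
abbreviation tm :: "(nat \<Rightarrow> 'w) measure \<Rightarrow> 'y" where "tm \<nu> \<equiv> \<theta>m (eval_S \<nu>)"

lemma conjugate_gp: obtains c where "conjugate gp y = ereal c"
proof -
  have "conjugate gp y \<in> range ereal" using conjugate_real by auto
  then show ?thesis by (rule rangeE) (rule that)
qed

lemma weak_continuous_lin:
  "weak_continuous (\<lambda>\<nu>. blinfun_apply xp (tp \<nu>))" "weak_continuous (\<lambda>\<nu>. blinfun_apply ym (tm \<nu>))"
  using observable.weak_continuous_obs[OF observable_linear[OF P.lin P.normal, of xp]]
    observable.weak_continuous_obs[OF observable_linear[OF M.lin M.normal, of ym]] by blast+

lemma F_flat_eq: "\<mu> \<in> inv_measures \<Longrightarrow>
    F_flat m \<theta>p \<theta>m gp gm \<mu> = entropy m \<mu> + ereal (mean (\<lambda>\<nu>. gp (tp \<nu>) - gm (tm \<nu>)) \<mu>)"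
  by (simp add: F_flat_def mean_diff P.weak_continuous_obs M.weak_continuous_obs P.mean_obs M.mean_obs add.commute)

lemma F_sharp_eq: "F_sharp m \<theta>p \<theta>m gp gm \<mu> = entropy m \<mu> + ereal (Delta \<theta>p gp \<mu> - gm (tm \<mu>))"
  by (simp add: F_sharp_def add.commute)

lemma pressure_fun_eq: "pressure_fun m \<theta>p \<theta>m gp gm \<mu> = entropy m \<mu> + ereal (gp (tp \<mu>) - gm (tm \<mu>))"
  by (cases "entropy m \<mu>") (simp_all add: pressure_fun_def)

lemma lin_pressure_fun_eq:
  "lin_pressure_fun m \<theta>p \<theta>m xp ym \<mu> = entropy m \<mu> + ereal (blinfun_apply xp (tp \<mu>) - blinfun_apply ym (tm \<mu>))"
  by (cases "entropy m \<mu>") (simp_all add: lin_pressure_fun_def)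

lemma P_L_eq: "P_L m \<theta>p \<theta>m xp ym = pres (\<lambda>\<nu>. blinfun_apply xp (tp \<nu>) - blinfun_apply ym (tm \<nu>))"
  by (simp add: P_L_def lin_pressure_fun_eq)

lemma pres_conjugate_le:
  assumes c: "conjugate gp xp = ereal c"
  shows "pres (\<lambda>\<nu>. blinfun_apply xp (tp \<nu>) - z \<nu>) - ereal c \<le> pres (\<lambda>\<nu>. gp (tp \<nu>) - z \<nu>)"
proof -
  have "pres (\<lambda>\<nu>. blinfun_apply xp (tp \<nu>) - z \<nu>) \<le> pres (\<lambda>\<nu>. gp (tp \<nu>) - z \<nu>) + ereal c"
  proof (rule SUP_least)
    fix \<nu> :: "(nat \<Rightarrow> 'w) measure" assume \<nu>: "\<nu> \<in> inv_measures"
    have "blinfun_apply xp (tp \<nu>) - gp (tp \<nu>) \<le> c" using conjugate_ge[of xp "tp \<nu>" gp] c by simp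
    then have "entropy m \<nu> + ereal (blinfun_apply xp (tp \<nu>) - z \<nu>) \<le> (entropy m \<nu> + ereal (gp (tp \<nu>) - z \<nu>)) + ereal c"
      by (cases "entropy m \<nu>") auto
    also have "\<dots> \<le> pres (\<lambda>\<nu>. gp (tp \<nu>) - z \<nu>) + ereal c" by (intro add_right_mono pres_upper[OF \<nu>])
    finally show "entropy m \<nu> + ereal (blinfun_apply xp (tp \<nu>) - z \<nu>) \<le> pres (\<lambda>\<nu>. gp (tp \<nu>) - z \<nu>) + ereal c" .
  qed
  then show ?thesis by (simp add: ereal_minus_le)
qed

text \<open>The Fenchel-Young inequality gives one bound; for the other, a subgradient of
  \<open>gp\<close> at \<open>tp \<nu>\<close> gives equality in the term of \<nu>.\<close>

lemma pres_sup_conjugate: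
  "(SUP xp. pres (\<lambda>\<nu>. blinfun_apply xp (tp \<nu>) - z \<nu>) - conjugate gp xp) = pres (\<lambda>\<nu>. gp (tp \<nu>) - z \<nu>)" (is "?L = ?R")
proof (rule antisym)
  show "?L \<le> ?R"
  proof (rule SUP_least)
    fix xp
    obtain c where c: "conjugate gp xp = ereal c" by (rule conjugate_gp)
    show "pres (\<lambda>\<nu>. blinfun_apply xp (tp \<nu>) - z \<nu>) - conjugate gp xp \<le> ?R"
      unfolding c by (rule pres_conjugate_le[OF c])
  qed
  show "?R \<le> ?L"
  proof (rule SUP_least)
    fix \<nu> :: "(nat \<Rightarrow> 'w) measure" assume \<nu>: "\<nu> \<in> inv_measures"
    obtain xp where xp: "conjugate gp xp = ereal (blinfun_apply xp (tp \<nu>) - gp (tp \<nu>))"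
      using subdifferential_nonempty[OF P.cvx P.cont] unfolding subdifferential_iff_conjugate by blast
    have "entropy m \<nu> + ereal (gp (tp \<nu>) - z \<nu>) = (entropy m \<nu> + ereal (blinfun_apply xp (tp \<nu>) - z \<nu>)) - conjugate gp xp"
      unfolding xp by (cases "entropy m \<nu>") auto
    also have "\<dots> \<le> pres (\<lambda>\<nu>. blinfun_apply xp (tp \<nu>) - z \<nu>) - conjugate gp xp"
      by (intro ereal_minus_mono pres_upper[OF \<nu>] order_refl)
    also have "\<dots> \<le> ?L" by (rule SUP_upper) simp
    finally show "entropy m \<nu> + ereal (gp (tp \<nu>) - z \<nu>) \<le> ?L" .
  qed
qed

text \<open>Fenchel duality over the index set \<open>inv_measures\<close>: the entropy is concave,
  so adding an affine \<open>b\<close> preserves the mixing condition. It is used with a linear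
  functional of \<open>tp\<close> and with \<open>Delta \<theta>p gp\<close> in the role of
  \<open>b\<close>.\<close>

lemma pres_duality:
  assumes b: "\<And>\<mu> \<nu> t. \<mu> \<in> inv_measures \<Longrightarrow> \<nu> \<in> inv_measures \<Longrightarrow> 0 \<le> t \<Longrightarrow> t \<le> 1 \<Longrightarrow>
      b (mix t \<mu> \<nu>) = (1 - t) * b \<mu> + t * b \<nu>"
    and s: "pres (\<lambda>\<nu>. b \<nu> - gm (tm \<nu>)) = ereal s"
  shows "\<exists>y. pres (\<lambda>\<nu>. b \<nu> - blinfun_apply y (tm \<nu>)) + conjugate gm y = ereal s"
    and "ereal s \<le> pres (\<lambda>\<nu>. b \<nu> - blinfun_apply y (tm \<nu>)) + conjugate gm y"
proof -
  define a where "a \<nu> = entropy m \<nu> + ereal (b \<nu>)" for \<nu>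
  have a: "a \<nu> - ereal c = entropy m \<nu> + ereal (b \<nu> - c)" for \<nu> c
    unfolding a_def by (cases "entropy m \<nu>") auto
  have "\<exists>y. (SUP \<nu>\<in>inv_measures. a \<nu> - ereal (blinfun_apply y (tm \<nu>))) + conjugate gm y = ereal s"
  proof (rule fenchel_duality_attained[OF M.cvx M.cont])
    fix \<mu> \<nu> :: "(nat \<Rightarrow> 'w) measure" and t :: real
    assume mn: "\<mu> \<in> inv_measures" "\<nu> \<in> inv_measures" and t: "0 < t" "t < 1"
    have t': "0 \<le> t" "t \<le> 1" using t by auto
    show "\<exists>\<kappa>\<in>inv_measures. tm \<kappa> = (1 - t) *\<^sub>R tm \<mu> + t *\<^sub>R tm \<nu> \<and> ereal (1 - t) * a \<mu> + ereal t * a \<nu> \<le> a \<kappa>"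
      unfolding a_def
      by (intro bexI[OF _ mix_inv[OF mn t']] conjI entropy_add_mix[OF mn t' b[OF mn t']]
        tau_mix[OF M.lin inv_prob_borel[OF mn(1)] inv_prob_borel[OF mn(2)] t'])
  qed (use s in \<open>simp add: a\<close>)
  then show "\<exists>y. pres (\<lambda>\<nu>. b \<nu> - blinfun_apply y (tm \<nu>)) + conjugate gm y = ereal s" by (simp add: a)
  show "ereal s \<le> pres (\<lambda>\<nu>. b \<nu> - blinfun_apply y (tm \<nu>)) + conjugate gm y"
    using fenchel_weak_duality[of a gm tm inv_measures y] by (simp add: a s)
qed

section \<open>The values of the two games\<close>

lemma lin_mix:
  assumes "\<mu> \<in> inv_measures" "\<nu> \<in> inv_measures" "0 \<le> t" "t \<le> 1"
  shows "blinfun_apply xp (tp (mix t \<mu> \<nu>)) = (1 - t) * blinfun_apply xp (tp \<mu>) + t * blinfun_apply xp (tp \<nu>)"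
  using tau_mix[OF P.lin inv_prob_borel[OF assms(1)] inv_prob_borel[OF assms(2)] assms(3,4)]
  by (simp add: blinfun.add_right blinfun.scaleR_right)

text \<open>For fixed \<open>xp\<close> the linearized functional is affine in the measure, so
  minimising over \<open>ym\<close> restores \<open>- gm\<close> by duality; the supremum over
  \<open>xp\<close> then restores \<open>gp\<close>. In this order the mean over components does not
  enter.\<close>

lemma P_flat_eq: "P_flat m \<theta>p \<theta>m gp gm = pres (\<lambda>\<nu>. gp (tp \<nu>) - gm (tm \<nu>))"
proof -
  have "(INF ym. P_NL m \<theta>p \<theta>m gp gm xp ym) = pres (\<lambda>\<nu>. blinfun_apply xp (tp \<nu>) - gm (tm \<nu>)) - conjugate gp xp" for xp
  proof -
    obtain c where c: "conjugate gp xp = ereal c" by (rule conjugate_gp)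
    obtain s where s: "pres (\<lambda>\<nu>. blinfun_apply xp (tp \<nu>) - gm (tm \<nu>)) = ereal s"
      using pres_real[OF weak_continuous_diff[OF weak_continuous_lin(1) M.weak_continuous_obs]] .
    note dual = pres_duality[where b="\<lambda>\<nu>. blinfun_apply xp (tp \<nu>)", OF lin_mix s]
    obtain y where "P_L m \<theta>p \<theta>m xp y + conjugate gm y = ereal s" using dual(1) unfolding P_L_eq by blast
    then show ?thesis
      unfolding P_NL_def c s
      by (intro antisym INF_lower2[of y] INF_greatest ereal_minus_mono)
        (auto simp: P_L_eq intro: dual(2))
  qed
  then show ?thesis unfolding P_flat_def by (simp add: pres_sup_conjugate)
qed

lemma P_sharp_at_eq:
  "P_sharp_at m \<theta>p \<theta>m gp gm y = pres (\<lambda>\<nu>. gp (tp \<nu>) - blinfun_apply y (tm \<nu>)) + conjugate gm y"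
proof -
  have "P_NL m \<theta>p \<theta>m gp gm xp y = (P_L m \<theta>p \<theta>m xp y - conjugate gp xp) + conjugate gm y" for xp
  proof -
    obtain c where c: "conjugate gp xp = ereal c" by (rule conjugate_gp)
    \<comment> \<open>\<open>conjugate gm y\<close> may be \<open>\<infinity>\<close> but not
      \<open>- \<infinity>\<close>, and \<open>conjugate gp xp\<close> is real, so the terms can be
      rearranged.\<close>
    show ?thesis unfolding P_NL_def c
      using conjugate_gt_MInf[of gm y] by (cases "P_L m \<theta>p \<theta>m xp y"; cases "conjugate gm y") auto
  qed
  then have "P_sharp_at m \<theta>p \<theta>m gp gm y = (SUP xp. (P_L m \<theta>p \<theta>m xp y - conjugate gp xp) + conjugate gm y)"
    unfolding P_sharp_at_def by simp
  also have "\<dots> = (SUP xp. P_L m \<theta>p \<theta>m xp y - conjugate gp xp) + conjugate gm y"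
    by (rule SUP_ereal_add_left) (use conjugate_gt_MInf[of gm y] in auto)
  finally show ?thesis unfolding P_L_eq pres_sup_conjugate .
qed

lemma weak_continuous_partial: "weak_continuous (\<lambda>\<nu>. gp (tp \<nu>) - blinfun_apply y (tm \<nu>))"
  by (rule weak_continuous_diff[OF P.weak_continuous_obs weak_continuous_lin(2)])

lemma mean_partial:
  "\<mu> \<in> inv_measures \<Longrightarrow> mean (\<lambda>\<nu>. gp (tp \<nu>) - blinfun_apply y (tm \<nu>)) \<mu> = Delta \<theta>p gp \<mu> - blinfun_apply y (tm \<mu>)"
  by (simp add: mean_diff P.weak_continuous_obs weak_continuous_lin P.mean_obs mean_linear[OF M.lin M.normal])

text \<open>Linear functionals equal their own mean over components, so taking the mean affects the
  term with \<open>gp\<close> only; and passing to means leaves the supremum unchanged.\<close>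

lemma pres_partial:
  "pres (\<lambda>\<nu>. Delta \<theta>p gp \<nu> - blinfun_apply y (tm \<nu>)) = pres (\<lambda>\<nu>. gp (tp \<nu>) - blinfun_apply y (tm \<nu>))"
  unfolding sup_entropy_add_mean[OF weak_continuous_partial, symmetric]
  by (intro SUP_cong refl) (simp add: mean_partial)

lemma pres_sharp_real:
  obtains s where "pres (\<lambda>\<nu>. Delta \<theta>p gp \<nu> - gm (tm \<nu>)) = ereal s"
proof -
  obtain B where B: "\<And>\<nu>. \<nu> \<in> prob_borel \<Longrightarrow> \<bar>gp (tp \<nu>)\<bar> \<le> B" using P.obs_bounded by blast
  obtain C where C: "\<And>\<nu>. \<nu> \<in> prob_borel \<Longrightarrow> \<bar>gm (tm \<nu>)\<bar> \<le> C" using M.obs_bounded by blast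
  have "\<bar>Delta \<theta>p gp \<nu> - gm (tm \<nu>)\<bar> \<le> B + C" if \<nu>: "\<nu> \<in> inv_measures" for \<nu>
  proof -
    interpret \<nu>: prob_space \<nu> using prob_borelD[OF inv_prob_borel[OF \<nu>]] by simp
    have "\<bar>Delta \<theta>p gp \<nu>\<bar> \<le> (\<integral>\<sigma>. \<bar>gp (tp (component \<sigma>))\<bar> \<partial>\<nu>)"
      unfolding P.Delta_eq[OF \<nu>] by (rule integral_abs_bound)
    also have "\<dots> \<le> (\<integral>\<sigma>. B \<partial>\<nu>)"
      using integrable_component[OF P.weak_continuous_obs \<nu>]
      by (intro integral_mono B inv_prob_borel component_inv[OF \<nu>]) auto
    finally have "\<bar>Delta \<theta>p gp \<nu>\<bar> \<le> B" by (simp add: \<nu>.prob_space)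
    then show ?thesis using C[OF inv_prob_borel[OF \<nu>]] by linarith
  qed
  then show ?thesis using entropy_add_sup_finite[of "\<lambda>\<nu>. Delta \<theta>p gp \<nu> - gm (tm \<nu>)" "B + C"] that by blast
qed

text \<open>Duality in \<open>y\<close> calls for an affine functional besides the entropy, and
  \<open>gp\<close> composed with \<open>tp\<close> is merely convex. For each fixed
  \<open>y\<close> it can be exchanged for the affine \<open>Delta \<theta>p gp\<close> without
  changing the supremum, and then the separation applies.\<close>

lemma P_sharp_attained:
  assumes s: "pres (\<lambda>\<nu>. Delta \<theta>p gp \<nu> - gm (tm \<nu>)) = ereal s"
  shows "P_sharp m \<theta>p \<theta>m gp gm = ereal s" "\<exists>y. P_sharp_at m \<theta>p \<theta>m gp gm y = ereal s"
proof -
  note dual = pres_duality[where b="Delta \<theta>p gp", OF P.Delta_mix s]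
  show ex: "\<exists>y. P_sharp_at m \<theta>p \<theta>m gp gm y = ereal s"
    unfolding P_sharp_at_eq pres_partial[symmetric] by (rule dual(1))
  then obtain y where y: "P_sharp_at m \<theta>p \<theta>m gp gm y = ereal s" by blast
  show "P_sharp m \<theta>p \<theta>m gp gm = ereal s"
    unfolding P_sharp_def
  proof (rule antisym)
    show "(INF y. P_sharp_at m \<theta>p \<theta>m gp gm y) \<le> ereal s" by (rule INF_lower2[of y]) (simp_all add: y)
    show "ereal s \<le> (INF y. P_sharp_at m \<theta>p \<theta>m gp gm y)"
      unfolding P_sharp_at_eq pres_partial[symmetric] by (intro INF_greatest dual(2))
  qed
qed

text \<open>Given an optimal \<open>xp\<close>, the Fenchel-Young inequality carries optimality of
  \<nu> from the linear problem over to the one with \<open>gp\<close>. Conversely a subgradient of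
  \<open>gp\<close> at \<open>tp \<nu>\<close> is an optimal \<open>xp\<close> for which \<nu> is an
  equilibrium. The finite value \<open>d\<close> can be cancelled in these comparisons.\<close>

lemma E_NL_eq:
  assumes d: "conjugate gm y = ereal d" and q: "pres (\<lambda>\<nu>. gp (tp \<nu>) - blinfun_apply y (tm \<nu>)) = ereal q"
  shows "E_NL m \<theta>p \<theta>m gp gm y = {\<nu> \<in> inv_measures. entropy m \<nu> + ereal (gp (tp \<nu>) - blinfun_apply y (tm \<nu>)) = ereal q}"
    (is "_ = ?E")
proof (intro equalityI subsetI)
  fix \<nu> assume "\<nu> \<in> E_NL m \<theta>p \<theta>m gp gm y"
  then obtain xp where xp: "P_NL m \<theta>p \<theta>m gp gm xp y = ereal q + ereal d" and \<nu>: "\<nu> \<in> inv_measures"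
    and eq: "lin_pressure_fun m \<theta>p \<theta>m xp y \<nu> = P_L m \<theta>p \<theta>m xp y"
    unfolding E_NL_def M_sharp_at_def E_L_def P_sharp_at_eq q d by blast
  obtain c where c: "conjugate gp xp = ereal c" by (rule conjugate_gp)
  have "blinfun_apply xp (tp \<nu>) - gp (tp \<nu>) \<le> c" using conjugate_ge[of xp "tp \<nu>" gp] c by simp
  then have "ereal q \<le> entropy m \<nu> + ereal (gp (tp \<nu>) - blinfun_apply y (tm \<nu>))"
    using xp unfolding P_NL_def c d eq[symmetric] lin_pressure_fun_eq by (cases "entropy m \<nu>") auto
  moreover have "entropy m \<nu> + ereal (gp (tp \<nu>) - blinfun_apply y (tm \<nu>)) \<le> ereal q"
    unfolding q[symmetric] by (rule pres_upper[OF \<nu>])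
  ultimately show "\<nu> \<in> ?E" using \<nu> by (simp add: antisym)
next
  fix \<nu> assume "\<nu> \<in> ?E"
  then have \<nu>: "\<nu> \<in> inv_measures" and eq: "entropy m \<nu> + ereal (gp (tp \<nu>) - blinfun_apply y (tm \<nu>)) = ereal q" by auto
  obtain xp where xp: "conjugate gp xp = ereal (blinfun_apply xp (tp \<nu>) - gp (tp \<nu>))"
    using subdifferential_nonempty[OF P.cvx P.cont] unfolding subdifferential_iff_conjugate by blast
  define c where "c = blinfun_apply xp (tp \<nu>) - gp (tp \<nu>)"
  have lin: "lin_pressure_fun m \<theta>p \<theta>m xp y \<nu> = ereal (q + c)"
    using eq unfolding lin_pressure_fun_eq c_def by (cases "entropy m \<nu>") auto
  have "P_L m \<theta>p \<theta>m xp y - ereal c \<le> ereal q"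
    unfolding P_L_eq q[symmetric] by (rule pres_conjugate_le) (simp add: xp c_def)
  then have "P_L m \<theta>p \<theta>m xp y \<le> ereal (q + c)" by (cases "P_L m \<theta>p \<theta>m xp y") auto
  moreover have "ereal (q + c) \<le> P_L m \<theta>p \<theta>m xp y"
    unfolding P_L_def lin[symmetric] by (rule SUP_upper[OF \<nu>])
  ultimately have PL: "P_L m \<theta>p \<theta>m xp y = ereal (q + c)" by (rule antisym)
  have "xp \<in> M_sharp_at m \<theta>p \<theta>m gp gm y"
    by (simp add: M_sharp_at_def P_sharp_at_eq q d P_NL_def PL) (simp add: xp c_def)
  moreover have "\<nu> \<in> E_L m \<theta>p \<theta>m xp y" unfolding E_L_def PL using lin \<nu> by simp
  ultimately show "\<nu> \<in> E_NL m \<theta>p \<theta>m gp gm y" unfolding E_NL_def by blast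
qed

section \<open>Equilibria of the flat and of the sharp functional\<close>

lemma Delta_partial_usc:
  assumes M: "\<And>n. M n \<in> inv_measures" and \<nu>: "\<nu> \<in> inv_measures" and w: "weakly M \<nu>" and e: "e > 0"
  shows "eventually (\<lambda>n. mean (\<lambda>\<nu>. gp (tp \<nu>) - blinfun_apply y (tm \<nu>)) (M n)
    < mean (\<lambda>\<nu>. gp (tp \<nu>) - blinfun_apply y (tm \<nu>)) \<nu> + e) sequentially"
proof -
  have "(\<lambda>n. blinfun_apply y (tm (M n))) \<longlonglongrightarrow> blinfun_apply y (tm \<nu>)"
    by (rule weak_continuousD[OF weak_continuous_lin(2) M \<nu> w])
  then have "eventually (\<lambda>n. blinfun_apply y (tm \<nu>) - e/2 < blinfun_apply y (tm (M n))) sequentially"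
    using e by (intro order_tendstoD) auto
  moreover have "eventually (\<lambda>n. Delta \<theta>p gp (M n) < Delta \<theta>p gp \<nu> + e/2) sequentially"
    using e by (intro P.Delta_usc[OF M \<nu> w]) simp
  ultimately show ?thesis
    unfolding mean_partial[OF M] mean_partial[OF \<nu>] by eventually_elim linarith
qed

lemma generalized_equilibria_flat:
  "generalized_equilibria (F_flat m \<theta>p \<theta>m gp gm) = closed_hull (generalized_equilibria (pressure_fun m \<theta>p \<theta>m gp gm))"
proof -
  have "generalized_equilibria (F_flat m \<theta>p \<theta>m gp gm) =
      generalized_equilibria (\<lambda>\<mu>. entropy m \<mu> + ereal (mean (\<lambda>\<nu>. gp (tp \<nu>) - gm (tm \<nu>)) \<mu>))"
    by (rule generalized_equilibria_cong) (rule F_flat_eq)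
  also have "\<dots> = closed_hull (generalized_equilibria (\<lambda>\<mu>. entropy m \<mu> + ereal (gp (tp \<mu>) - gm (tm \<mu>))))"
    by (rule generalized_equilibria_mean[OF weak_continuous_diff[OF P.weak_continuous_obs M.weak_continuous_obs]])
  also have "\<dots> = closed_hull (generalized_equilibria (pressure_fun m \<theta>p \<theta>m gp gm))"
    by (simp add: pressure_fun_eq[abs_def])
  finally show ?thesis .
qed

lemma sup_F_flat: "(SUP \<mu>\<in>inv_measures. F_flat m \<theta>p \<theta>m gp gm \<mu>) = P_flat m \<theta>p \<theta>m gp gm"
  unfolding P_flat_eq
    sup_entropy_add_mean[OF weak_continuous_diff[OF P.weak_continuous_obs M.weak_continuous_obs], symmetric]
  by (intro SUP_cong refl F_flat_eq)

lemma sup_F_sharp: "(SUP \<mu>\<in>inv_measures. F_sharp m \<theta>p \<theta>m gp gm \<mu>) = P_sharp m \<theta>p \<theta>m gp gm"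
proof -
  obtain s where s: "pres (\<lambda>\<nu>. Delta \<theta>p gp \<nu> - gm (tm \<nu>)) = ereal s" by (rule pres_sharp_real)
  show ?thesis using P_sharp_attained(1)[OF s] s by (simp add: F_sharp_eq)
qed

lemma equilibria_sharp:
  "equilibria (F_sharp m \<theta>p \<theta>m gp gm) = {\<mu> \<in> inv_measures.
    \<exists>y \<in> M_sharp m \<theta>p \<theta>m gp gm \<inter> subdifferential gm (tm \<mu>). \<mu> \<in> closed_hull (E_NL m \<theta>p \<theta>m gp gm y)}"
  (is "_ = ?R")
proof -
  obtain s where s: "pres (\<lambda>\<nu>. Delta \<theta>p gp \<nu> - gm (tm \<nu>)) = ereal s" by (rule pres_sharp_real)
  have eqs: "equilibria (F_sharp m \<theta>p \<theta>m gp gm) =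
      {\<mu> \<in> inv_measures. entropy m \<mu> + ereal (Delta \<theta>p gp \<mu> - gm (tm \<mu>)) = ereal s}" (is "_ = ?E")
    unfolding equilibria_def F_sharp_eq s ..
  have "?E = ?R"
  proof (intro equalityI subsetI)
    fix \<mu> assume "\<mu> \<in> ?E"
    then have \<mu>: "\<mu> \<in> inv_measures" and eq: "entropy m \<mu> + ereal (Delta \<theta>p gp \<mu> - gm (tm \<mu>)) = ereal s" by auto
    obtain y where y: "P_sharp_at m \<theta>p \<theta>m gp gm y = ereal s" using P_sharp_attained(2)[OF s] by blast
    let ?f = "\<lambda>\<nu>. gp (tp \<nu>) - blinfun_apply y (tm \<nu>)"
    obtain q where q: "pres ?f = ereal q" by (rule pres_real[OF weak_continuous_partial])
    obtain d where d: "conjugate gm y = ereal d" and qd: "q + d = s"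
      using y unfolding P_sharp_at_eq q by (cases "conjugate gm y") auto
    obtain r where r: "entropy m \<mu> = ereal r" "r + (Delta \<theta>p gp \<mu> - gm (tm \<mu>)) = s"
      using eq by (cases "entropy m \<mu>") auto
    have up: "entropy m \<nu> + ereal (?f \<nu>) \<le> ereal q" if "\<nu> \<in> inv_measures" for \<nu>
      unfolding q[symmetric] by (rule pres_upper[OF that])
    \<comment> \<open>Two inequalities whose sum is an equality, because \<open>q + d = s\<close>;
      hence both are equalities. One says that \<open>y\<close> is a subgradient at
      \<open>tm \<mu>\<close>, the other that \<mu> maximizes the mean of the partially linearized
      functional.\<close>
    have "r + (Delta \<theta>p gp \<mu> - blinfun_apply y (tm \<mu>)) \<le> q"
      using entropy_add_mean_le[OF weak_continuous_partial up \<mu>] unfolding mean_partial[OF \<mu>] r(1) by simp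
    moreover have "blinfun_apply y (tm \<mu>) - gm (tm \<mu>) \<le> d" using conjugate_ge[of y "tm \<mu>" gm] d by simp
    ultimately have dq: "d = blinfun_apply y (tm \<mu>) - gm (tm \<mu>)" "r + (Delta \<theta>p gp \<mu> - blinfun_apply y (tm \<mu>)) = q"
      using qd r(2) by linarith+
    \<comment> \<open>The constant sequence at \<mu> is maximizing for the mean, since \<mu> attains
      the maximum.\<close>
    have "\<mu> \<in> closed_hull {\<nu> \<in> inv_measures. entropy m \<nu> + ereal (?f \<nu>) = ereal q}"
    proof (rule limit_in_closed_hull[OF weak_continuous_partial up])
      show "(\<lambda>n::nat. entropy m \<mu> + ereal (mean ?f \<mu>)) \<longlonglongrightarrow> ereal q"
        unfolding mean_partial[OF \<mu>] r(1) using dq(2) by simp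
    qed (use \<mu> in \<open>auto simp: weakly_def\<close>)
    then have "\<mu> \<in> closed_hull (E_NL m \<theta>p \<theta>m gp gm y)" unfolding E_NL_eq[OF d q] .
    moreover have "y \<in> M_sharp m \<theta>p \<theta>m gp gm" unfolding M_sharp_def using y P_sharp_attained(1)[OF s] by simp
    moreover have "y \<in> subdifferential gm (tm \<mu>)" unfolding subdifferential_iff_conjugate d dq(1) ..
    ultimately show "\<mu> \<in> ?R" using \<mu> by blast
  next
    fix \<mu> assume "\<mu> \<in> ?R"
    then obtain y where \<mu>: "\<mu> \<in> inv_measures" and y: "P_sharp_at m \<theta>p \<theta>m gp gm y = ereal s"
      "y \<in> subdifferential gm (tm \<mu>)" "\<mu> \<in> closed_hull (E_NL m \<theta>p \<theta>m gp gm y)"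
      unfolding M_sharp_def P_sharp_attained(1)[OF s] by blast
    let ?f = "\<lambda>\<nu>. gp (tp \<nu>) - blinfun_apply y (tm \<nu>)"
    obtain q where q: "pres ?f = ereal q" by (rule pres_real[OF weak_continuous_partial])
    \<comment> \<open>The subgradient condition gives the value of the conjugate, which converts the
      maximum of the functional linearized at \<open>y\<close> into the value of the sharp
      functional at \<mu>.\<close>
    have d: "conjugate gm y = ereal (blinfun_apply y (tm \<mu>) - gm (tm \<mu>))"
      using y(2) unfolding subdifferential_iff_conjugate .
    have "\<mu> \<in> closed_hull {\<nu> \<in> inv_measures. entropy m \<nu> + ereal (?f \<nu>) = ereal q}"
      using y(3) unfolding E_NL_eq[OF d q] .
    then have "entropy m \<mu> + ereal (mean ?f \<mu>) = ereal q"
      using closed_hull_argmax_subset[OF weak_continuous_partial q Delta_partial_usc] by blast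
    moreover have "ereal q + conjugate gm y = ereal s" using y(1) unfolding P_sharp_at_eq q .
    ultimately have "entropy m \<mu> + ereal (Delta \<theta>p gp \<mu> - gm (tm \<mu>)) = ereal s"
      unfolding mean_partial[OF \<mu>] d by (cases "entropy m \<mu>") auto
    then show "\<mu> \<in> ?E" using \<mu> by blast
  qed
  with eqs show ?thesis by (rule trans)
qed

end

theorem theorem2p21:
  fixes m :: "'w::polish_space measure"
    and \<theta>p :: "'w test_fun bborel \<Rightarrow> 'x::real_normed_vector"
    and \<theta>m :: "'w test_fun bborel \<Rightarrow> 'y::real_normed_vector"
    and gp :: "'x \<Rightarrow> real"
    and gm :: "'y \<Rightarrow> real"
  assumes compact: "compact (UNIV :: 'w set)"
    and diam_le: "\<forall>x y :: 'w. dist x y \<le> 1"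
    and diam_attained: "\<exists>x y :: 'w. dist x y = 1"
    and m_prob: "prob_space m"
    and m_borel: "sets m = sets borel"
    and m_support: "\<forall>U :: 'w set. open U \<and> U \<noteq> {} \<longrightarrow> emeasure m U > 0"
    and \<theta>p_linear: "linear \<theta>p" and \<theta>p_normal: "sigma_normal \<theta>p"
    and \<theta>m_linear: "linear \<theta>m" and \<theta>m_normal: "sigma_normal \<theta>m"
    and gm_cont: "continuous_on UNIV gm"
    and gm_convex: "convex_on UNIV gm"
    and gm_dom: "\<exists>R0>0. \<forall>R\<ge>R0.
          {x. norm x \<le> R \<and> conjugate gm x < \<infinity>} \<noteq> {} \<and>
          closedin weak_star {x. norm x \<le> R \<and> conjugate gm x < \<infinity>}"
    and gm_growth: "minimal_linear_growth gm (onorm \<theta>m)"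
    and gp_cont: "continuous_on UNIV gp"
    and gp_convex: "convex_on UNIV gp"
    and gp_bounded: "\<forall>B. bounded B \<longrightarrow> bounded (gp ` B)"
    and gp_conj_real: "range (conjugate gp) \<subseteq> range ereal"
    and gp_growth: "minimal_linear_growth gp (onorm \<theta>p)"
  shows
    "(SUP \<mu>\<in>inv_measures. F_flat m \<theta>p \<theta>m gp gm \<mu>) = P_flat m \<theta>p \<theta>m gp gm \<and>
     P_flat m \<theta>p \<theta>m gp gm =
       (SUP yp. INF ym. P_L m \<theta>p \<theta>m yp ym + conjugate gm ym - conjugate gp yp) \<and>
     (SUP \<mu>\<in>inv_measures. F_sharp m \<theta>p \<theta>m gp gm \<mu>) = P_sharp m \<theta>p \<theta>m gp gm \<and>
     P_sharp m \<theta>p \<theta>m gp gm =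
       (INF ym. SUP yp. P_L m \<theta>p \<theta>m yp ym + conjugate gm ym - conjugate gp yp) \<and>
     generalized_equilibria (F_flat m \<theta>p \<theta>m gp gm) =
       closed_hull (generalized_equilibria (pressure_fun m \<theta>p \<theta>m gp gm)) \<and>
     equilibria (F_sharp m \<theta>p \<theta>m gp gm) =
       {\<mu> \<in> inv_measures.
          \<exists>xm \<in> M_sharp m \<theta>p \<theta>m gp gm \<inter> subdifferential gm (\<theta>m (eval_S \<mu>)).
            \<mu> \<in> closed_hull (E_NL m \<theta>p \<theta>m gp gm xm)}"
proof -
  interpret game m \<theta>p gp \<theta>m gm
    by (intro game.intro game_axioms.intro observable.intro observable_axioms.intro compact_alphabet.intro; rule assms)
  show ?thesis
    by (intro conjI sup_F_flat sup_F_sharp generalized_equilibria_flat equilibria_sharp)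
      (simp_all only: P_flat_def P_sharp_def P_sharp_at_def P_NL_def)
qed

end
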